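(* Let $A=\Bbbk Q/I$ be a gentle algebra over an algebraically closed field $\Bbbk$. (a) There is a unique (up to isomorphism) maximal almost rigid $A$-module that contains all indecomposable projective $A$-modules as direct summands. (b) There is a unique (up to isomorphism) maximal almost rigid $A$-module that contains all indecomposable injective $A$-modules as direct summands.
   Context: Conventions: $\Bbbk$ is an algebraically closed field, $Q=(Q_0,Q_1)$ is a finite connected quiver, paths are written left to right ($\alpha\beta$ means first $\alpha$, then $\beta$, with $t(\alpha)=s(\beta)$), $I$ is an admissible ideal, and modules are finitely generated right modules, identified with representations of $Q$ satisfying the relations in $I$. Gentle algebra: a finite-dimensional algebra $A=\Bbbk Q/I$ such that (G1) every vertex is the source of at most two arrows and the target of at most two arrows; (G2) for each arrow $\alpha$ there is at most one arrow $\beta$ with $t(\alpha)=s(\beta)$ and $\alpha\beta\notin I$, and at most one arrow $\gamma$ with $t(\gamma)=s(\alpha)$ and $\gamma\alpha\notin I$; (G3) for each arrow $\alpha$ there is at most one arrow $\beta'$ with $t(\alpha)=s(\beta')$ and $\alpha\beta'\in I$, and at most one arrow $\gamma'$ with $t(\gamma')=s(\alpha)$ and $\gamma'\alpha\in I$; (G4) $I$ is generated by paths of length 2. Strings and string modules: for each arrow $\alpha$ let $\alpha^{-1}$ be a formal inverse with source and target exchanged. A string is either a trivial string $1_v$ ($v\in Q_0$) or a walk $w=\alpha_1\cdots\alpha_\ell$ with $\ell\ge1$, $\alpha_i\in Q_1\cup Q_1^{-1}$, $t(\alpha_i)=s(\alpha_{i+1})$, containing no subwalk $\alpha\alpha^{-1}$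 or $\alpha^{-1}\alpha$, and no subwalk $\alpha\beta$ with $\alpha\beta\in I$ or $(\alpha\beta)^{-1}\in I$. The string module $M(w)$ has a basis $b_1,\dots,b_{\ell+1}$, with $b_i$ placed at the $i$-th vertex visited by $w$; if $\alpha_i$ is an arrow it sends $b_i$ to $b_{i+1}$, if $\alpha_i$ is an inverse arrow then the arrow $\alpha_i^{-1}$ sends $b_{i+1}$ to $b_i$, and all other actions are zero. $M(1_v)=S(v)$ is simple. $M(w)$ is indecomposable and $M(w)\cong M(w')$ iff $w'\in\{w,w^{-1}\}$. Maximal almost rigid modules: a basic $A$-module $T$ is almost rigid if (M1) $T$ is a direct sum of string modules and (M2) for each pair $M,N$ of (possibly equal) indecomposable summands of $T$, every short exact sequence $0\to N\to E\to M\to0$ either splits or has indecomposable middle term $E$. $T$ is maximal almost rigid if it is almost rigid and (M3) $T\oplus L$ is not almost rigid for every nonzero string $A$-module $L$. *)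

theory Defs
  imports
    "HOL-Library.Function_Algebras"
    "HOL-Computational_Algebra.Polynomial"
    "HOL-Algebra.Ideal_Product"
    "Graph_Theory.Graph_Theory"
begin

section \<open>The path algebra of a quiver\<close>

text \<open>
  A quiver is a \<^typ>\<open>('v, 'a) pre_digraph\<close> (loops and parallel arrows are allowed), with
  \<^const>\<open>tail\<close> as source and \<^const>\<open>head\<close> as target.  A path is a pair \<open>(u, p)\<close> of its
  starting vertex and its list of arrows, read from left to right, so that \<open>(u, [])\<close> is the trivial
  path at \<open>u\<close>.  Elements of the path algebra are finitely supported functions on paths.
\<close>

type_synonym ('v, 'a) qpath = "'v \<times> 'a list"

definition is_path :: "('v, 'a) pre_digraph \<Rightarrow> ('v, 'a) qpath \<Rightarrow> bool" where
  "is_path Q p \<longleftrightarrow> (\<exists>v. pre_digraph.awalk Q (fst p) (snd p) v)"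

abbreviation path_end :: "('v, 'a) pre_digraph \<Rightarrow> 'v \<Rightarrow> 'a list \<Rightarrow> 'v" where
  "path_end Q u p \<equiv> pre_digraph.awlast Q u p"

text \<open>
  The coefficient of a path in a product is the sum over all ways to cut that path in two.
\<close>

definition path_algebra :: "('v, 'a) pre_digraph \<Rightarrow> (('v, 'a) qpath \<Rightarrow> 'k::field) ring" where
  "path_algebra Q =
    \<lparr> carrier = {f. finite {p. f p \<noteq> 0} \<and> (\<forall>p. f p \<noteq> 0 \<longrightarrow> is_path Q p)},
      mult = (\<lambda>f g (u, p). \<Sum>i\<le>length p. f (u, take i p) * g (path_end Q u (take i p), drop i p)),
      one = (\<lambda>(u, p). if u \<in> verts Q \<and> p = [] then 1 else 0),
      zero = (\<lambda>_. 0),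
      add = (\<lambda>f g p. f p + g p) \<rparr>"

definition path_elt :: "('v, 'a) qpath \<Rightarrow> ('v, 'a) qpath \<Rightarrow> 'k::field" where
  "path_elt p = (\<lambda>q. if q = p then 1 else 0)"

lemma path_end_append:
  "path_end Q u (p @ q) = path_end Q (path_end Q u p) q"
  by (simp add: pre_digraph.awalk_verts_conv)

lemma ring_path_algebra:
  assumes "fin_digraph Q"
  shows "ring (path_algebra Q :: (('v, 'a) qpath \<Rightarrow> 'k::field) ring)"
proof -
  interpret fin_digraph Q by fact
  let ?R = "path_algebra Q :: (('v, 'a) qpath \<Rightarrow> 'k) ring"
  note R = path_algebra_def
  have carrI: "f \<in> carrier ?R"
    if "finite {p. f p \<noteq> 0}" "\<And>u p. f (u, p) \<noteq> 0 \<Longrightarrow> \<exists>v. awalk u p v" for f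
    using that by (auto simp: R is_path_def)
  have fin: "finite {p. f p \<noteq> 0}" if "f \<in> carrier ?R" for f
    using that by (simp add: R)
  have path: "awalk u p (awlast u p)" if "f \<in> carrier ?R" "f (u, p) \<noteq> 0" for f u p
    using that awalk_ends by (fastforce simp: R is_path_def)
  have add_closed: "f \<oplus>\<^bsub>?R\<^esub> g \<in> carrier ?R" if "f \<in> carrier ?R" "g \<in> carrier ?R" for f g
  proof (rule carrI)
    have "{p. (f \<oplus>\<^bsub>?R\<^esub> g) p \<noteq> 0} \<subseteq> {p. f p \<noteq> 0} \<union> {p. g p \<noteq> 0}"
      by (auto simp: R)
    then show "finite {p. (f \<oplus>\<^bsub>?R\<^esub> g) p \<noteq> 0}"
      using that fin by (meson finite_UnI finite_subset)
  next
    fix u p assume "(f \<oplus>\<^bsub>?R\<^esub> g) (u, p) \<noteq> 0"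
    then have "f (u, p) \<noteq> 0 \<or> g (u, p) \<noteq> 0" by (auto simp: R)
    then show "\<exists>v. awalk u p v" using that path by blast
  qed
  have mult: "(f \<otimes>\<^bsub>?R\<^esub> g) (u, p) =
      (\<Sum>i\<le>length p. f (u, take i p) * g (awlast u (take i p), drop i p))" for f g u p
    by (simp add: R)
  have mult_nonzero: "\<exists>q r. p = q @ r \<and> f (u, q) \<noteq> 0 \<and> g (awlast u q, r) \<noteq> 0"
    if nz: "(f \<otimes>\<^bsub>?R\<^esub> g) (u, p) \<noteq> 0" for f g u p
  proof -
    obtain i where "f (u, take i p) * g (awlast u (take i p), drop i p) \<noteq> 0"
      using nz unfolding mult by (rule sum.not_neutral_contains_not_neutral)
    then show ?thesis by (intro exI[of _ "take i p"] exI[of _ "drop i p"]) auto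
  qed
  have mult_closed: "f \<otimes>\<^bsub>?R\<^esub> g \<in> carrier ?R"
    if f: "f \<in> carrier ?R" and g: "g \<in> carrier ?R" for f g
  proof (rule carrI)
    have "{p. (f \<otimes>\<^bsub>?R\<^esub> g) p \<noteq> 0} \<subseteq>
        (\<lambda>(x, y). (fst x, snd x @ snd y)) ` ({p. f p \<noteq> 0} \<times> {p. g p \<noteq> 0})"
      by (force dest: mult_nonzero)
    then show "finite {p. (f \<otimes>\<^bsub>?R\<^esub> g) p \<noteq> 0}"
      using fin[OF f] fin[OF g] by (meson finite_SigmaI finite_imageI finite_subset)
  next
    fix u p assume "(f \<otimes>\<^bsub>?R\<^esub> g) (u, p) \<noteq> 0"
    then obtain q r where "p = q @ r" "f (u, q) \<noteq> 0" "g (awlast u q, r) \<noteq> 0"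
      using mult_nonzero by blast
    then show "\<exists>v. awalk u p v"
      using path[OF f] path[OF g] awalk_appendI by blast
  qed
  have one_closed: "\<one>\<^bsub>?R\<^esub> \<in> carrier ?R"
  proof (rule carrI)
    have "{p. \<one>\<^bsub>?R\<^esub> p \<noteq> 0} \<subseteq> (\<lambda>u. (u, [])) ` verts Q"
      by (auto simp: R split: if_splits)
    then show "finite {p. \<one>\<^bsub>?R\<^esub> p \<noteq> 0}"
      by (meson finite_imageI finite_subset finite_verts)
  next
    fix u p assume "\<one>\<^bsub>?R\<^esub> (u, p) \<noteq> 0"
    then show "\<exists>v. awalk u p v"
      by (auto simp: R awalk_Nil_iff split: if_splits)
  qed
  have assoc: "(f \<otimes>\<^bsub>?R\<^esub> g) \<otimes>\<^bsub>?R\<^esub> h = f \<otimes>\<^bsub>?R\<^esub> (g \<otimes>\<^bsub>?R\<^esub> h)" for f g h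
  proof (rule ext, clarify)
    fix u p
    let ?t = "\<lambda>j i. f (u, take j p) * g (awlast u (take j p), take (i - j) (drop j p))
                * h (awlast u (take i p), drop i p)"
    have "((f \<otimes>\<^bsub>?R\<^esub> g) \<otimes>\<^bsub>?R\<^esub> h) (u, p) = (\<Sum>i\<le>length p. \<Sum>j\<le>i. ?t j i)"
      unfolding mult
      by (auto simp: sum_distrib_right min_def drop_take intro!: sum.cong)
    also have "\<dots> = (\<Sum>(i, j)\<in>(SIGMA i:{..length p}. {..i}). ?t j i)"
      by (simp add: sum.Sigma)
    also have "\<dots> = (\<Sum>(j, m)\<in>(SIGMA j:{..length p}. {..length p - j}). ?t j (j + m))"
      by (rule sum.reindex_bij_witness[where i = "\<lambda>(j, m). (j + m, j)" and j = "\<lambda>(i, j). (j, i - j)"])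
         auto
    also have "\<dots> = (\<Sum>j\<le>length p. \<Sum>m\<le>length p - j. ?t j (j + m))"
      by (simp add: sum.Sigma)
    also have "\<dots> = (f \<otimes>\<^bsub>?R\<^esub> (g \<otimes>\<^bsub>?R\<^esub> h)) (u, p)"
      unfolding mult
      by (auto simp: sum_distrib_left take_add path_end_append mult.assoc add.commute
          intro!: sum.cong)
    finally show "((f \<otimes>\<^bsub>?R\<^esub> g) \<otimes>\<^bsub>?R\<^esub> h) (u, p) = (f \<otimes>\<^bsub>?R\<^esub> (g \<otimes>\<^bsub>?R\<^esub> h)) (u, p)" .
  qed
  have one_left: "\<one>\<^bsub>?R\<^esub> \<otimes>\<^bsub>?R\<^esub> f = f" if f: "f \<in> carrier ?R" for f
  proof (rule ext, clarify)
    fix u p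
    have "(\<one>\<^bsub>?R\<^esub> \<otimes>\<^bsub>?R\<^esub> f) (u, p) =
        (\<Sum>i\<le>length p. if i = 0 then (if u \<in> verts Q then f (u, p) else 0) else 0)"
      unfolding mult by (intro sum.cong) (auto simp: R)
    also have "\<dots> = f (u, p)"
      using path[OF f, of u p] by (cases "f (u, p) = 0") (auto simp: awalk_def)
    finally show "(\<one>\<^bsub>?R\<^esub> \<otimes>\<^bsub>?R\<^esub> f) (u, p) = f (u, p)" .
  qed
  have one_right: "f \<otimes>\<^bsub>?R\<^esub> \<one>\<^bsub>?R\<^esub> = f" if f: "f \<in> carrier ?R" for f
  proof (rule ext, clarify)
    fix u p
    have "(f \<otimes>\<^bsub>?R\<^esub> \<one>\<^bsub>?R\<^esub>) (u, p) =
        (\<Sum>i\<le>length p. if i = length p then (if awlast u p \<in> verts Q then f (u, p) else 0) else 0)"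
      unfolding mult by (intro sum.cong) (auto simp: R)
    also have "\<dots> = f (u, p)"
      using path[OF f, of u p] awalk_last_in_verts by (cases "f (u, p) = 0") auto
    finally show "(f \<otimes>\<^bsub>?R\<^esub> \<one>\<^bsub>?R\<^esub>) (u, p) = f (u, p)" .
  qed
  show ?thesis
  proof (rule ringI)
    show "abelian_group ?R"
    proof (rule abelian_groupI)
      fix f assume f: "f \<in> carrier ?R"
      have "(\<lambda>p. - f p) \<in> carrier ?R" using f by (simp add: R)
      moreover have "(\<lambda>p. - f p) \<oplus>\<^bsub>?R\<^esub> f = \<zero>\<^bsub>?R\<^esub>" by (simp add: R)
      ultimately show "\<exists>g\<in>carrier ?R. g \<oplus>\<^bsub>?R\<^esub> f = \<zero>\<^bsub>?R\<^esub>" by blast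
    next
      show "f \<oplus>\<^bsub>?R\<^esub> g = g \<oplus>\<^bsub>?R\<^esub> f" for f g
        by (simp add: R add.commute)
      show "(f \<oplus>\<^bsub>?R\<^esub> g) \<oplus>\<^bsub>?R\<^esub> h = f \<oplus>\<^bsub>?R\<^esub> (g \<oplus>\<^bsub>?R\<^esub> h)" for f g h
        by (simp add: R add.assoc)
    qed ((rule add_closed; assumption) | simp add: R)+
    show "monoid ?R"
      by (rule monoidI) (use mult_closed one_closed assoc one_left one_right in auto)
    show "(f \<oplus>\<^bsub>?R\<^esub> g) \<otimes>\<^bsub>?R\<^esub> h = f \<otimes>\<^bsub>?R\<^esub> h \<oplus>\<^bsub>?R\<^esub> g \<otimes>\<^bsub>?R\<^esub> h" for f g h
      by (auto simp: R distrib_right sum.distrib)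
    show "h \<otimes>\<^bsub>?R\<^esub> (f \<oplus>\<^bsub>?R\<^esub> g) = h \<otimes>\<^bsub>?R\<^esub> f \<oplus>\<^bsub>?R\<^esub> h \<otimes>\<^bsub>?R\<^esub> g" for f g h
      by (auto simp: R distrib_left sum.distrib)
  qed
qed


section \<open>Gentle algebras\<close>

definition arrow_ideal :: "('v, 'a) pre_digraph \<Rightarrow> (('v, 'a) qpath \<Rightarrow> 'k::field) set" where
  "arrow_ideal Q = Idl\<^bsub>path_algebra Q\<^esub> {path_elt (tail Q a, [a]) | a. a \<in> arcs Q}"

primrec arrow_ideal_power :: "('v, 'a) pre_digraph \<Rightarrow> nat \<Rightarrow> (('v, 'a) qpath \<Rightarrow> 'k::field) set" where
  "arrow_ideal_power Q 0 = carrier (path_algebra Q)"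
| "arrow_ideal_power Q (Suc m) = ideal_prod (path_algebra Q) (arrow_ideal_power Q m) (arrow_ideal Q)"

definition admissible_ideal ::
    "('v, 'a) pre_digraph \<Rightarrow> (('v, 'a) qpath \<Rightarrow> 'k::field) set \<Rightarrow> bool" where
  "admissible_ideal Q I \<longleftrightarrow> ideal I (path_algebra Q) \<and>
     (\<exists>m\<ge>2. arrow_ideal_power Q m \<subseteq> I) \<and> I \<subseteq> arrow_ideal_power Q 2"

text \<open>
  Connectedness of a digraph in the library is that of the underlying undirected graph, and it
  includes being nonempty.  Since the quiver is finite and \<open>I\<close> contains a power of the arrow ideal,
  the quotient of the path algebra by \<open>I\<close> is finite-dimensional.
\<close>

locale bound_quiver = fin_digraph Q
  for Q :: "('v, 'a) pre_digraph" +
  fixes I :: "(('v, 'a) qpath \<Rightarrow> 'k::field) set"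
  assumes connected: "Digraph_Component.connected Q"
    and admissible: "admissible_ideal Q I"

locale gentle_algebra = bound_quiver Q I
  for Q :: "('v, 'a) pre_digraph" and I :: "(('v, 'a) qpath \<Rightarrow> 'k::field) set" +
  assumes G1: "\<And>v. v \<in> verts Q \<Longrightarrow> out_degree Q v \<le> 2 \<and> in_degree Q v \<le> 2"
    and G2: "\<And>a. a \<in> arcs Q \<Longrightarrow>
      (\<exists>\<^sub>\<le>\<^sub>1 b. b \<in> arcs Q \<and> head Q a = tail Q b \<and> path_elt (tail Q a, [a, b]) \<notin> I) \<and>
      (\<exists>\<^sub>\<le>\<^sub>1 c. c \<in> arcs Q \<and> head Q c = tail Q a \<and> path_elt (tail Q c, [c, a]) \<notin> I)"
    and G3: "\<And>a. a \<in> arcs Q \<Longrightarrow>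
      (\<exists>\<^sub>\<le>\<^sub>1 b. b \<in> arcs Q \<and> head Q a = tail Q b \<and> path_elt (tail Q a, [a, b]) \<in> I) \<and>
      (\<exists>\<^sub>\<le>\<^sub>1 c. c \<in> arcs Q \<and> head Q c = tail Q a \<and> path_elt (tail Q c, [c, a]) \<in> I)"
    and G4: "\<exists>S. (\<forall>p\<in>S. is_path Q p \<and> length (snd p) = 2) \<and> I = Idl\<^bsub>path_algebra Q\<^esub> (path_elt ` S)"


section \<open>Finite-dimensional representations\<close>

text \<open>
  The vector spaces of a representation are finite-dimensional subspaces of the space of all
  sequences of scalars.  Up to isomorphism these are all finite-dimensional vector spaces.
  The map of an arrow matters only on the space at the source of that arrow.
\<close>

definition seq_scale :: "'k::field \<Rightarrow> (nat \<Rightarrow> 'k) \<Rightarrow> nat \<Rightarrow> 'k" where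
  "seq_scale c x = (\<lambda>i. c * x i)"

interpretation seq: vector_space seq_scale
  by unfold_locales (auto simp: seq_scale_def algebra_simps)

definition fin_dim_subspace :: "(nat \<Rightarrow> 'k::field) set \<Rightarrow> bool" where
  "fin_dim_subspace V \<longleftrightarrow> seq.subspace V \<and> (\<exists>B. finite B \<and> seq.span B = V)"

definition linear_map ::
    "(nat \<Rightarrow> 'k::field) set \<Rightarrow> (nat \<Rightarrow> 'k) set \<Rightarrow> ((nat \<Rightarrow> 'k) \<Rightarrow> (nat \<Rightarrow> 'k)) \<Rightarrow> bool" where
  "linear_map V W f \<longleftrightarrow> f \<in> V \<rightarrow> W \<and>
     (\<forall>x\<in>V. \<forall>y\<in>V. f (x + y) = f x + f y) \<and>
     (\<forall>c. \<forall>x\<in>V. f (seq_scale c x) = seq_scale c (f x))"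

record ('v, 'a, 'k) rep =
  space :: "'v \<Rightarrow> (nat \<Rightarrow> 'k) set"
  act :: "'a \<Rightarrow> (nat \<Rightarrow> 'k) \<Rightarrow> (nat \<Rightarrow> 'k)"

text \<open>
  The last condition says that every element of \<open>I\<close> acts as zero: the component of \<open>f\<close> in the span
  of the paths from \<open>u\<close> to \<open>v\<close> annihilates the space at \<open>u\<close>.  A path acts (on the right) by its
  arrows from left to right.
\<close>

definition is_rep ::
    "('v, 'a) pre_digraph \<Rightarrow> (('v, 'a) qpath \<Rightarrow> 'k::field) set \<Rightarrow> ('v, 'a, 'k) rep \<Rightarrow> bool" where
  "is_rep Q I M \<longleftrightarrow>
     (\<forall>v\<in>verts Q. fin_dim_subspace (space M v)) \<and>
     (\<forall>a\<in>arcs Q. linear_map (space M (tail Q a)) (space M (head Q a)) (act M a)) \<and>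
     (\<forall>f\<in>I. \<forall>u\<in>verts Q. \<forall>v\<in>verts Q. \<forall>x\<in>space M u.
        (\<Sum>p | f (u, p) \<noteq> 0 \<and> path_end Q u p = v. seq_scale (f (u, p)) (fold (act M) p x)) = 0)"

definition is_hom ::
    "('v, 'a) pre_digraph \<Rightarrow> ('v, 'a, 'k::field) rep \<Rightarrow> ('v, 'a, 'k) rep \<Rightarrow>
     ('v \<Rightarrow> (nat \<Rightarrow> 'k) \<Rightarrow> (nat \<Rightarrow> 'k)) \<Rightarrow> bool" where
  "is_hom Q M N h \<longleftrightarrow>
     (\<forall>v\<in>verts Q. linear_map (space M v) (space N v) (h v)) \<and>
     (\<forall>a\<in>arcs Q. \<forall>x\<in>space M (tail Q a).
        h (head Q a) (act M a x) = act N a (h (tail Q a) x))"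

definition rep_iso :: "('v, 'a) pre_digraph \<Rightarrow> ('v, 'a, 'k::field) rep \<Rightarrow> ('v, 'a, 'k) rep \<Rightarrow> bool" where
  "rep_iso Q M N \<longleftrightarrow>
     (\<exists>h. is_hom Q M N h \<and> (\<forall>v\<in>verts Q. bij_betw (h v) (space M v) (space N v)))"

definition is_zero_rep :: "('v, 'a) pre_digraph \<Rightarrow> ('v, 'a, 'k::field) rep \<Rightarrow> bool" where
  "is_zero_rep Q M \<longleftrightarrow> (\<forall>v\<in>verts Q. space M v = {0})"

text \<open>
  For direct sums, a pair of sequences is encoded as one sequence, with the first component at the
  even and the second component at the odd positions.
\<close>

definition seq_left :: "(nat \<Rightarrow> 'k) \<Rightarrow> nat \<Rightarrow> 'k" where
  "seq_left x = (\<lambda>i. x (2 * i))"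

definition seq_right :: "(nat \<Rightarrow> 'k) \<Rightarrow> nat \<Rightarrow> 'k" where
  "seq_right x = (\<lambda>i. x (2 * i + 1))"

definition seq_pair :: "(nat \<Rightarrow> 'k) \<Rightarrow> (nat \<Rightarrow> 'k) \<Rightarrow> nat \<Rightarrow> 'k" where
  "seq_pair x y = (\<lambda>i. if even i then x (i div 2) else y (i div 2))"

definition rep_sum :: "('v, 'a, 'k::field) rep \<Rightarrow> ('v, 'a, 'k) rep \<Rightarrow> ('v, 'a, 'k) rep" where
  "rep_sum M N =
    \<lparr> space = (\<lambda>v. {seq_pair x y | x y. x \<in> space M v \<and> y \<in> space N v}),
      act = (\<lambda>a z. seq_pair (act M a (seq_left z)) (act N a (seq_right z))) \<rparr>"

definition zero_rep :: "('v, 'a, 'k::field) rep" where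
  "zero_rep = \<lparr> space = (\<lambda>_. {0}), act = (\<lambda>_ _. 0) \<rparr>"

definition rep_sum_list :: "('v, 'a, 'k::field) rep list \<Rightarrow> ('v, 'a, 'k) rep" where
  "rep_sum_list Ms = foldr rep_sum Ms zero_rep"

definition is_summand ::
    "('v, 'a) pre_digraph \<Rightarrow> (('v, 'a) qpath \<Rightarrow> 'k::field) set \<Rightarrow>
     ('v, 'a, 'k) rep \<Rightarrow> ('v, 'a, 'k) rep \<Rightarrow> bool" where
  "is_summand Q I M T \<longleftrightarrow> is_rep Q I M \<and> (\<exists>N. is_rep Q I N \<and> rep_iso Q T (rep_sum M N))"

definition indecomposable ::
    "('v, 'a) pre_digraph \<Rightarrow> (('v, 'a) qpath \<Rightarrow> 'k::field) set \<Rightarrow> ('v, 'a, 'k) rep \<Rightarrow> bool" where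
  "indecomposable Q I M \<longleftrightarrow> is_rep Q I M \<and> \<not> is_zero_rep Q M \<and>
     (\<forall>X Y. is_rep Q I X \<and> is_rep Q I Y \<and> rep_iso Q M (rep_sum X Y) \<longrightarrow>
        is_zero_rep Q X \<or> is_zero_rep Q Y)"

definition basic_rep ::
    "('v, 'a) pre_digraph \<Rightarrow> (('v, 'a) qpath \<Rightarrow> 'k::field) set \<Rightarrow> ('v, 'a, 'k) rep \<Rightarrow> bool" where
  "basic_rep Q I T \<longleftrightarrow> is_rep Q I T \<and>
     (\<exists>Ms. (\<forall>M\<in>set Ms. indecomposable Q I M) \<and>
           (\<forall>i<length Ms. \<forall>j<length Ms. i \<noteq> j \<longrightarrow> \<not> rep_iso Q (Ms ! i) (Ms ! j)) \<and>
           rep_iso Q T (rep_sum_list Ms))"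

definition surj_hom ::
    "('v, 'a) pre_digraph \<Rightarrow> ('v, 'a, 'k::field) rep \<Rightarrow> ('v, 'a, 'k) rep \<Rightarrow>
     ('v \<Rightarrow> (nat \<Rightarrow> 'k) \<Rightarrow> (nat \<Rightarrow> 'k)) \<Rightarrow> bool" where
  "surj_hom Q M N h \<longleftrightarrow> is_hom Q M N h \<and> (\<forall>v\<in>verts Q. h v ` space M v = space N v)"

definition inj_hom ::
    "('v, 'a) pre_digraph \<Rightarrow> ('v, 'a, 'k::field) rep \<Rightarrow> ('v, 'a, 'k) rep \<Rightarrow>
     ('v \<Rightarrow> (nat \<Rightarrow> 'k) \<Rightarrow> (nat \<Rightarrow> 'k)) \<Rightarrow> bool" where
  "inj_hom Q M N h \<longleftrightarrow> is_hom Q M N h \<and> (\<forall>v\<in>verts Q. inj_on (h v) (space M v))"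

definition short_exact ::
    "('v, 'a) pre_digraph \<Rightarrow> ('v, 'a, 'k::field) rep \<Rightarrow> ('v, 'a, 'k) rep \<Rightarrow> ('v, 'a, 'k) rep \<Rightarrow>
     ('v \<Rightarrow> (nat \<Rightarrow> 'k) \<Rightarrow> (nat \<Rightarrow> 'k)) \<Rightarrow> ('v \<Rightarrow> (nat \<Rightarrow> 'k) \<Rightarrow> (nat \<Rightarrow> 'k)) \<Rightarrow> bool" where
  "short_exact Q N E M f g \<longleftrightarrow> inj_hom Q N E f \<and> surj_hom Q E M g \<and>
     (\<forall>v\<in>verts Q. f v ` space N v = {x \<in> space E v. g v x = 0})"

definition split_epi ::
    "('v, 'a) pre_digraph \<Rightarrow> ('v, 'a, 'k::field) rep \<Rightarrow> ('v, 'a, 'k) rep \<Rightarrow>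
     ('v \<Rightarrow> (nat \<Rightarrow> 'k) \<Rightarrow> (nat \<Rightarrow> 'k)) \<Rightarrow> bool" where
  "split_epi Q E M g \<longleftrightarrow>
     (\<exists>s. is_hom Q M E s \<and> (\<forall>v\<in>verts Q. \<forall>x\<in>space M v. g v (s v x) = x))"

definition projective_rep ::
    "('v, 'a) pre_digraph \<Rightarrow> (('v, 'a) qpath \<Rightarrow> 'k::field) set \<Rightarrow> ('v, 'a, 'k) rep \<Rightarrow> bool" where
  "projective_rep Q I P \<longleftrightarrow> is_rep Q I P \<and>
     (\<forall>X Y g h. is_rep Q I X \<and> is_rep Q I Y \<and> surj_hom Q X Y g \<and> is_hom Q P Y h \<longrightarrow>
        (\<exists>l. is_hom Q P X l \<and> (\<forall>v\<in>verts Q. \<forall>x\<in>space P v. g v (l v x) = h v x)))"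

definition injective_rep ::
    "('v, 'a) pre_digraph \<Rightarrow> (('v, 'a) qpath \<Rightarrow> 'k::field) set \<Rightarrow> ('v, 'a, 'k) rep \<Rightarrow> bool" where
  "injective_rep Q I J \<longleftrightarrow> is_rep Q I J \<and>
     (\<forall>X Y g h. is_rep Q I X \<and> is_rep Q I Y \<and> inj_hom Q X Y g \<and> is_hom Q X J h \<longrightarrow>
        (\<exists>e. is_hom Q Y J e \<and> (\<forall>v\<in>verts Q. \<forall>x\<in>space X v. e v (g v x) = h v x)))"


section \<open>Strings and string modules\<close>

datatype 'a letter = Fwd 'a | Inv 'a

fun lsource :: "('v, 'a) pre_digraph \<Rightarrow> 'a letter \<Rightarrow> 'v" where
  "lsource Q (Fwd a) = tail Q a"
| "lsource Q (Inv a) = head Q a"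

fun ltarget :: "('v, 'a) pre_digraph \<Rightarrow> 'a letter \<Rightarrow> 'v" where
  "ltarget Q (Fwd a) = head Q a"
| "ltarget Q (Inv a) = tail Q a"

fun larrow :: "'a letter \<Rightarrow> 'a" where
  "larrow (Fwd a) = a"
| "larrow (Inv a) = a"

text \<open>
  Whether two consecutive letters may occur in a string: no subwalk \<open>\<alpha>\<alpha>\<^sup>-\<^sup>1\<close> or \<open>\<alpha>\<^sup>-\<^sup>1\<alpha>\<close>, and neither
  the subwalk nor its inverse is a path of length two in \<open>I\<close>.
\<close>

fun letters_ok ::
    "('v, 'a) pre_digraph \<Rightarrow> (('v, 'a) qpath \<Rightarrow> 'k::field) set \<Rightarrow> 'a letter \<Rightarrow> 'a letter \<Rightarrow> bool" where
  "letters_ok Q I (Fwd a) (Inv b) \<longleftrightarrow> a \<noteq> b"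
| "letters_ok Q I (Inv a) (Fwd b) \<longleftrightarrow> a \<noteq> b"
| "letters_ok Q I (Fwd a) (Fwd b) \<longleftrightarrow> path_elt (tail Q a, [a, b]) \<notin> I"
| "letters_ok Q I (Inv a) (Inv b) \<longleftrightarrow> path_elt (tail Q b, [b, a]) \<notin> I"

text \<open>
  Like a path, a string is given with its starting vertex; \<open>(v, [])\<close> is the trivial string at \<open>v\<close>.
\<close>

definition string_verts :: "('v, 'a) pre_digraph \<Rightarrow> 'v \<times> 'a letter list \<Rightarrow> 'v list" where
  "string_verts Q w = fst w # map (ltarget Q) (snd w)"

definition is_string ::
    "('v, 'a) pre_digraph \<Rightarrow> (('v, 'a) qpath \<Rightarrow> 'k::field) set \<Rightarrow> 'v \<times> 'a letter list \<Rightarrow> bool" where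
  "is_string Q I w \<longleftrightarrow> fst w \<in> verts Q \<and> (\<forall>l\<in>set (snd w). larrow l \<in> arcs Q) \<and>
     (\<forall>i<length (snd w). lsource Q (snd w ! i) = string_verts Q w ! i) \<and>
     (\<forall>i. Suc i < length (snd w) \<longrightarrow> letters_ok Q I (snd w ! i) (snd w ! Suc i))"

text \<open>
  The basis vector at the \<open>i\<close>-th visited vertex, counted from \<open>0\<close>, is the \<open>i\<close>-th unit sequence.
\<close>

definition string_module :: "('v, 'a) pre_digraph \<Rightarrow> 'v \<times> 'a letter list \<Rightarrow> ('v, 'a, 'k::field) rep" where
  "string_module Q w =
    \<lparr> space = (\<lambda>v. {x. \<forall>i. x i \<noteq> 0 \<longrightarrow> i \<le> length (snd w) \<and> string_verts Q w ! i = v}),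
      act = (\<lambda>a x j.
        (if 0 < j \<and> j \<le> length (snd w) \<and> snd w ! (j - 1) = Fwd a then x (j - 1) else 0) +
        (if j < length (snd w) \<and> snd w ! j = Inv a then x (Suc j) else 0)) \<rparr>"


section \<open>Maximal almost rigid modules\<close>

definition almost_rigid ::
    "('v, 'a) pre_digraph \<Rightarrow> (('v, 'a) qpath \<Rightarrow> 'k::field) set \<Rightarrow> ('v, 'a, 'k) rep \<Rightarrow> bool" where
  "almost_rigid Q I T \<longleftrightarrow> basic_rep Q I T \<and>
     (\<exists>ws. (\<forall>w\<in>set ws. is_string Q I w) \<and> rep_iso Q T (rep_sum_list (map (string_module Q) ws))) \<and>
     (\<forall>M N E f g.
        indecomposable Q I M \<and> is_summand Q I M T \<and>
        indecomposable Q I N \<and> is_summand Q I N T \<and>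
        is_rep Q I E \<and> short_exact Q N E M f g \<longrightarrow>
          split_epi Q E M g \<or> indecomposable Q I E)"

text \<open>
  Almost rigid representations are basic, so a string module that is already a summand of \<open>T\<close> never
  violates maximality.  String modules are never zero.
\<close>

definition maximal_almost_rigid ::
    "('v, 'a) pre_digraph \<Rightarrow> (('v, 'a) qpath \<Rightarrow> 'k::field) set \<Rightarrow> ('v, 'a, 'k) rep \<Rightarrow> bool" where
  "maximal_almost_rigid Q I T \<longleftrightarrow> almost_rigid Q I T \<and>
     (\<forall>w. is_string Q I w \<longrightarrow> \<not> almost_rigid Q I (rep_sum T (string_module Q w)))"

definition contains_indec_projectives ::
    "('v, 'a) pre_digraph \<Rightarrow> (('v, 'a) qpath \<Rightarrow> 'k::field) set \<Rightarrow> ('v, 'a, 'k) rep \<Rightarrow> bool" where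
  "contains_indec_projectives Q I T \<longleftrightarrow>
     (\<forall>P. projective_rep Q I P \<and> indecomposable Q I P \<longrightarrow> is_summand Q I P T)"

definition contains_indec_injectives ::
    "('v, 'a) pre_digraph \<Rightarrow> (('v, 'a) qpath \<Rightarrow> 'k::field) set \<Rightarrow> ('v, 'a, 'k) rep \<Rightarrow> bool" where
  "contains_indec_injectives Q I T \<longleftrightarrow>
     (\<forall>J. injective_rep Q I J \<and> indecomposable Q I J \<longrightarrow> is_summand Q I J T)"

end

theory Submission
  imports Defs
begin

text \<open>
  Since the ideal is spanned by the paths containing a relation, an indecomposable projective
  \<open>P(v)\<close> is the string module of \<open>B\<inverse>A\<close>, where the legs \<open>A\<close> and \<open>B\<close> are the maximal nonzero paths that
  start at \<open>v\<close>.  For an arrow \<open>b\<close> starting at \<open>v\<close>, removing the leg through \<open>b\<close> gives a quotient of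
  \<open>P(v)\<close>.  Call all these modules good.  An extension of a good module \<open>M\<close> by a good
  module \<open>N\<close> splits if \<open>M\<close> is projective.  If \<open>M\<close> is the quotient of \<open>P(v)\<close> by the leg through \<open>b\<close>, the
  extension is determined by the element \<open>xb\<close> of \<open>N\<close>, where \<open>x\<close> lifts the generator of \<open>M\<close>.  Either \<open>x\<close>
  can be corrected so that \<open>xb = 0\<close> and the extension splits, or a suitable basis of \<open>N\<close> ends in \<open>xb\<close>, and the
  middle term is the string module in which \<open>b\<inverse>\<close> joins the two strings.
  A string whose module is not good can be cut as \<open>w = w\<^sub>1w\<^sub>2\<close> at some \<open>v\<close>, in such a way that for suitable
  legs there is a non-split exact sequence
  \<open>0 \<rightarrow> P(v) \<rightarrow> M(w\<^sub>1A) \<oplus> M(B\<inverse>w\<^sub>2) \<rightarrow> M(w) \<rightarrow> 0\<close>.  So an almost rigid module containing the projectives has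
  only good summands, the sum of all good modules is almost rigid, and uniqueness follows from the
  Krull-Schmidt theorem.  Part (b) is part (a) for the opposite quiver, transported by vector space
  duality.
\<close>

section \<open>Linear algebra\<close>

text \<open>The ideal matters only through its relations of length two. The locale
  \<open>monomial_quiver\<close> keeps just the fact that every path in the support of an element of
  \<open>I\<close> contains such a relation, so that the reversed relations can serve for the
  opposite quiver as a bare set. Endomorphisms of a string module are triangular with constant
  diagonal, because two positions of a reduced walk that simulate each other coincide. So one
  nonzero diagonal entry makes an endomorphism invertible. This gives indecomposability, prevents
  the cut sequences from splitting, and certifies the change of basis of \<open>N\<close>. That
  change of basis is the main obstacle: the class of an extension is an arbitrary vector, not a
  basis vector. Modulo the image of \<open>b\<close>, gentleness confines it to the generator and
  the two ends of the legs, and if both ends occur, one leg is a suffix of the other. An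
  automorphism then moves an end of the string to that vector. In a cut, each leg must compose to a
  string with its side. At a valley the conditions on relations provide such a matching.\<close>

interpretation seq_pair: vector_space_pair seq_scale seq_scale
  by unfold_locales

lemma seq_scale_apply [simp]: "seq_scale c x i = c * x i"
  by (simp add: seq_scale_def)

lemma fin_dim_subspaceD: "fin_dim_subspace V \<Longrightarrow> seq.subspace V"
  by (simp add: fin_dim_subspace_def)

lemma fin_dim_subspace_basis:
  assumes "fin_dim_subspace V"
  obtains B where "B \<subseteq> V" "finite B" "seq.independent B" "seq.span B = V"
proof -
  obtain C where C: "finite C" "seq.span C = V" and V: "seq.subspace V"
    using assms unfolding fin_dim_subspace_def by blast
  obtain B where B: "B \<subseteq> V" "seq.independent B" "V \<subseteq> seq.span B"
    using seq.maximal_independent_subset by metis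
  have "finite B"
    using seq.independent_span_bound[OF C(1) B(2)] B(1) C(2) by simp
  moreover have "seq.span B = V"
    using B V by (simp add: seq.span_minimal subset_antisym)
  ultimately show ?thesis using B that by blast
qed

lemma fin_dim_subspace_subset:
  assumes V: "fin_dim_subspace V" and W: "seq.subspace W" and sub: "W \<subseteq> V"
  shows "fin_dim_subspace W"
proof -
  obtain C where C: "finite C" "seq.span C = V"
    using V unfolding fin_dim_subspace_def by blast
  obtain B where B: "B \<subseteq> W" "seq.independent B" "W \<subseteq> seq.span B"
    using seq.maximal_independent_subset by metis
  have "finite B"
    using seq.independent_span_bound[OF C(1) B(2)] B(1) C(2) sub by auto
  moreover have "seq.span B = W"
    using B W by (simp add: seq.span_minimal subset_antisym)
  ultimately show ?thesis using W unfolding fin_dim_subspace_def by blast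
qed

lemma fin_dim_subspace_dim:
  assumes V: "fin_dim_subspace V" and W: "seq.subspace W" and sub: "W \<subseteq> V"
  shows "seq.dim W \<le> seq.dim V" "seq.dim W = seq.dim V \<Longrightarrow> W = V"
proof -
  obtain B where B: "B \<subseteq> W" "finite B" "seq.independent B" "seq.span B = W"
    using fin_dim_subspace_basis[OF fin_dim_subspace_subset[OF V W sub]] .
  obtain C where C: "finite C" "seq.span C = V" "C \<subseteq> V" "seq.independent C"
    using fin_dim_subspace_basis[OF V] by metis
  obtain D where D: "B \<subseteq> D" "D \<subseteq> V" "seq.independent D" "V \<subseteq> seq.span D"
    using seq.maximal_independent_subset_extend[OF _ B(3), of V] B(1) sub by blast
  have finD: "finite D"
    using seq.independent_span_bound[OF C(1) D(3)] D(2) C(2) by simp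
  have dW: "seq.dim W = card B"
    using B seq.dim_span_eq_card_independent by metis
  have dV: "seq.dim V = card D"
    using D seq.basis_card_eq_dim by metis
  show "seq.dim W \<le> seq.dim V"
    unfolding dW dV using D(1) finD by (simp add: card_mono)
  show "W = V" if "seq.dim W = seq.dim V"
  proof -
    have "B = D" using card_subset_eq[OF finD D(1)] that dW dV by simp
    then show ?thesis using B(4) D(4) sub by blast
  qed
qed

text \<open>\<open>linear_map\<close> constrains a map only on its subspace. Extending from a basis
  to all sequences makes the theory of global linear maps available; the set where both maps agree
  is a subspace that contains the basis.\<close>

lemma linear_map_extend:
  assumes V: "seq.subspace V" and f: "linear_map V W f"
  obtains F where "Vector_Spaces.linear seq_scale seq_scale F" "\<And>x. x \<in> V \<Longrightarrow> F x = f x"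
proof -
  obtain B where B: "B \<subseteq> V" "seq.independent B" "V \<subseteq> seq.span B"
    using seq.maximal_independent_subset by metis
  obtain F where F: "Vector_Spaces.linear seq_scale seq_scale F" "\<forall>x\<in>B. F x = f x"
    using seq_pair.linear_independent_extend[OF B(2), of f] by blast
  interpret F: Vector_Spaces.linear seq_scale seq_scale F by fact
  have "F x = f x" if "x \<in> V" for x
  proof -
    let ?S = "{x \<in> V. F x = f x}"
    have fz: "f 0 = 0"
    proof -
      have "f (seq_scale 0 0) = seq_scale 0 (f 0)"
        using f V unfolding linear_map_def by (meson seq.subspace_0)
      then show ?thesis by simp
    qed
    have "seq.subspace ?S"
    proof (rule seq.subspaceI)
      show "0 \<in> ?S" using V fz F.zero by (simp add: seq.subspace_0)
      show "x + y \<in> ?S" if "x \<in> ?S" "y \<in> ?S" for x y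
        using that f V F.add by (auto simp: linear_map_def seq.subspace_add)
      show "seq_scale c x \<in> ?S" if "x \<in> ?S" for c x
        using that f V F.scale by (auto simp: linear_map_def seq.subspace_scale)
    qed
    moreover have "B \<subseteq> ?S" using F(2) B(1) by auto
    ultimately have "seq.span B \<subseteq> ?S" by (rule seq.span_minimal[rotated])
    then show ?thesis using B(3) that by auto
  qed
  then show ?thesis using F(1) that by blast
qed

lemma linear_map_0:
  assumes "linear_map V W f" "seq.subspace V" shows "f 0 = 0"
proof -
  have "f (seq_scale 0 0) = seq_scale 0 (f 0)"
    using assms unfolding linear_map_def by (meson seq.subspace_0)
  then show ?thesis by simp
qed

lemma linear_map_diff:
  assumes f: "linear_map V W f" and V: "seq.subspace V" and "x \<in> V" "y \<in> V"
  shows "f (x - y) = f x - f y"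
proof -
  have "f x = f ((x - y) + y)" by simp
  also have "\<dots> = f (x - y) + f y"
    using assms unfolding linear_map_def by (meson seq.subspace_diff)
  finally show ?thesis by simp
qed

lemma linear_map_sum:
  assumes f: "linear_map V W f" and V: "seq.subspace V"
    and "\<And>i. i \<in> A \<Longrightarrow> g i \<in> V"
  shows "f (sum g A) = (\<Sum>i\<in>A. f (g i))"
  using assms(3)
proof (induction A rule: infinite_finite_induct)
  case (insert x F)
  then have "sum g F \<in> V" using V by (simp add: seq.subspace_sum)
  then have "f (g x + sum g F) = f (g x) + f (sum g F)"
    using f insert.prems unfolding linear_map_def by (meson insertI1)
  then show ?case using insert by (metis insertCI sum.insert)
qed (use linear_map_0[OF f V] in auto)

lemma linear_map_image_subspace:
  assumes f: "linear_map V W f" and V: "seq.subspace V"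
  shows "seq.subspace (f ` V)"
proof (rule seq.subspaceI)
  show "0 \<in> f ` V" using linear_map_0[OF f V] V by (metis image_eqI seq.subspace_0)
next
  fix x y assume "x \<in> f ` V" "y \<in> f ` V"
  then obtain a b where "a \<in> V" "b \<in> V" "x = f a" "y = f b" by auto
  then have "x + y = f (a + b)" "a + b \<in> V"
    using f V by (auto simp: linear_map_def seq.subspace_add)
  then show "x + y \<in> f ` V" by blast
next
  fix c x assume "x \<in> f ` V"
  then obtain a where "a \<in> V" "x = f a" by auto
  then have "seq_scale c x = f (seq_scale c a)" "seq_scale c a \<in> V"
    using f V by (auto simp: linear_map_def seq.subspace_scale)
  then show "seq_scale c x \<in> f ` V" by blast
qed

lemma linear_map_kernel_subspace:
  assumes f: "linear_map V W f" and V: "seq.subspace V"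
  shows "seq.subspace {x \<in> V. f x = 0}"
  using f V linear_map_0[OF f V]
  by (intro seq.subspaceI) (auto simp: linear_map_def seq.subspace_0 seq.subspace_add seq.subspace_scale)

text \<open>By counting: the image of a basis under a surjection spans \<open>V\<close> with no more
  vectors than the basis has, hence is a basis; under an injection it is independent and spans a
  subspace of full dimension.\<close>

lemma linear_map_surj_self:
  assumes V: "fin_dim_subspace V" and f: "linear_map V V f"
  shows "f ` V = V \<longleftrightarrow> inj_on f V"
proof -
  have sV: "seq.subspace V" using V by (rule fin_dim_subspaceD)
  obtain B where B: "B \<subseteq> V" "finite B" "seq.independent B" "seq.span B = V"
    using fin_dim_subspace_basis[OF V] .
  obtain F where F: "Vector_Spaces.linear seq_scale seq_scale F" "\<And>x. x \<in> V \<Longrightarrow> F x = f x"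
    using linear_map_extend[OF sV f] by metis
  have FB: "seq.span (F ` B) = f ` V"
  proof -
    have "seq.span (F ` B) = F ` seq.span B"
      using F(1) seq_pair.linear_span_image by blast
    then show ?thesis using B(4) F(2) by auto
  qed
  have inj_iff: "inj_on f V \<longleftrightarrow> inj_on F V" using F(2) by (simp cong: inj_on_cong)
  show ?thesis
  proof
    assume "f ` V = V"
    then have sp: "seq.span (F ` B) = V" using FB by simp
    have FBV: "F ` B \<subseteq> V" using sp seq.span_superset by blast
    have card: "card (F ` B) = card B"
    proof (rule antisym)
      show "card (F ` B) \<le> card B" using B(2) by (rule card_image_le)
      show "card B \<le> card (F ` B)"
        using seq.independent_span_bound[of "F ` B" B] B sp by simp
    qed
    have injB: "inj_on F B" using card B(2) by (simp add: eq_card_imp_inj_on)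
    \<comment> \<open>A maximal independent subset of the image still spans \<open>V\<close>, so it
      cannot be smaller than the basis \<open>B\<close>.\<close>
    have ind: "seq.independent (F ` B)"
    proof -
      obtain C where C: "C \<subseteq> F ` B" "seq.independent C" "F ` B \<subseteq> seq.span C"
        using seq.maximal_independent_subset by metis
      have "B \<subseteq> seq.span C"
        using C(3) sp B(1) by (metis seq.span_minimal seq.subspace_span subset_trans)
      then have "card B \<le> card C"
        using seq.independent_span_bound[of C B] C(1) B finite_subset by blast
      then have "C = F ` B"
        using card card_subset_eq[OF finite_imageI[OF B(2)] C(1)] card_mono[OF finite_imageI[OF B(2)] C(1)]
        by linarith
      then show ?thesis using C(2) by simp
    qed
    have "inj_on F (seq.span B)"
      using seq_pair.linear_inj_on_span_independent_image[OF F(1) ind injB] .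
    then show "inj_on f V" using B(4) inj_iff by simp
  next
    assume "inj_on f V"
    then have inj: "inj_on F (seq.span B)" using B(4) inj_iff by simp
    have "seq.independent (F ` B)"
      using seq_pair.linear_independent_injective_image[OF F(1) B(3) inj] .
    then have "seq.dim (f ` V) = card B"
      using FB seq.dim_span_eq_card_independent[of "F ` B"] inj seq.span_superset[of B]
      by (metis card_image inj_on_subset)
    moreover have "seq.dim V = card B" using B seq.dim_span_eq_card_independent by metis
    moreover have "f ` V \<subseteq> V" using f by (auto simp: linear_map_def)
    ultimately show "f ` V = V"
      using fin_dim_subspace_dim(2)[OF V linear_map_image_subspace[OF f sV]] by simp
  qed
qed

section \<open>Representations of a quiver with monomial relations\<close>

lemma seq_left_pair [simp]: "seq_left (seq_pair x y) = x"
  and seq_right_pair [simp]: "seq_right (seq_pair x y) = y"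
  by (auto simp: seq_left_def seq_right_def seq_pair_def)

lemma seq_pair_left_right [simp]: "seq_pair (seq_left z) (seq_right z) = z"
  by (auto simp: seq_left_def seq_right_def seq_pair_def elim!: evenE oddE)

lemma seq_left_linear [simp]:
  "seq_left (x + y) = seq_left x + seq_left y" "seq_left (x - y) = seq_left x - seq_left y"
  "seq_left (seq_scale c x) = seq_scale c (seq_left x)" "seq_left 0 = 0"
  by (auto simp: seq_left_def fun_eq_iff)

lemma seq_right_linear [simp]:
  "seq_right (x + y) = seq_right x + seq_right y" "seq_right (x - y) = seq_right x - seq_right y"
  "seq_right (seq_scale c x) = seq_scale c (seq_right x)" "seq_right 0 = 0"
  by (auto simp: seq_right_def fun_eq_iff)

lemma seq_pair_linear:
  "seq_pair (x + y) (x' + y') = seq_pair x x' + seq_pair y y'"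
  "seq_pair (seq_scale c x) (seq_scale c x') = seq_scale c (seq_pair x x')"
  "seq_pair 0 0 = 0"
  by (auto simp: seq_pair_def fun_eq_iff)

lemma seq_pair_eq_iff [simp]: "seq_pair x y = seq_pair x' y' \<longleftrightarrow> x = x' \<and> y = y'"
  by (metis seq_left_pair seq_right_pair)

lemma seq_pair_eq_0_iff [simp]: "seq_pair x y = 0 \<longleftrightarrow> x = 0 \<and> y = 0"
  by (metis seq_pair_eq_iff seq_pair_linear(3))

lemma fin_dim_subspace_pair:
  assumes "fin_dim_subspace V" "fin_dim_subspace W"
  shows "fin_dim_subspace {seq_pair x y | x y. x \<in> V \<and> y \<in> W}"
proof -
  obtain B where B: "finite B" "seq.span B = V"
    using assms(1) unfolding fin_dim_subspace_def by blast
  obtain C where C: "finite C" "seq.span C = W"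
    using assms(2) unfolding fin_dim_subspace_def by blast
  let ?L = "\<lambda>x. seq_pair x (0 :: nat \<Rightarrow> 'a)" and ?R = "seq_pair (0 :: nat \<Rightarrow> 'a)"
  have L: "Vector_Spaces.linear seq_scale seq_scale ?L" and R: "Vector_Spaces.linear seq_scale seq_scale ?R"
    by (auto simp: Vector_Spaces.linear_iff seq_pair_def fun_eq_iff seq.vector_space_axioms)
  have "seq.span (?L ` B \<union> ?R ` C) = {seq_pair x y | x y. x \<in> V \<and> y \<in> W}"
  proof -
    have sum: "?L x + ?R y = seq_pair x y" for x y
      by (auto simp: seq_pair_def fun_eq_iff)
    have "seq.span (?L ` B \<union> ?R ` C) = {x + y | x y. x \<in> ?L ` V \<and> y \<in> ?R ` W}"
      unfolding seq.span_Un using seq_pair.linear_span_image[OF L, of B] seq_pair.linear_span_image[OF R, of C] B C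
      by auto
    also have "\<dots> = {seq_pair x y | x y. x \<in> V \<and> y \<in> W}"
      using sum by (auto; metis imageI)
    finally show ?thesis .
  qed
  then show ?thesis
    unfolding fin_dim_subspace_def using B(1) C(1)
    by (intro conjI exI[of _ "?L ` B \<union> ?R ` C"]) (metis seq.subspace_span, simp_all)
qed

text \<open>No ideal is required here, only that all supports run through relations of length two.
  This lets \<open>op_relations\<close>, which is a mere set of paths, be an instance.\<close>

locale monomial_quiver = fin_digraph Q
  for Q :: "('v, 'a) pre_digraph" +
  fixes I :: "(('v, 'a) qpath \<Rightarrow> 'k::field) set"
  assumes support: "f \<in> I \<Longrightarrow> f (u, p) \<noteq> 0 \<Longrightarrow>
    \<exists>v xs a b ys. awalk u p v \<and> p = xs @ a # b # ys \<and> path_elt (tail Q a, [a, b]) \<in> I"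
begin

definition zero_rel :: "'a \<Rightarrow> 'a \<Rightarrow> bool" where
  "zero_rel a b \<longleftrightarrow> path_elt (tail Q a, [a, b]) \<in> I"

abbreviation "rep \<equiv> is_rep Q I"
abbreviation rhom ::
    "('v, 'a, 'k) rep \<Rightarrow> ('v, 'a, 'k) rep \<Rightarrow> ('v \<Rightarrow> (nat \<Rightarrow> 'k) \<Rightarrow> nat \<Rightarrow> 'k) \<Rightarrow> bool" where
  "rhom \<equiv> is_hom Q"
abbreviation riso :: "('v, 'a, 'k) rep \<Rightarrow> ('v, 'a, 'k) rep \<Rightarrow> bool" where
  "riso \<equiv> rep_iso Q"
abbreviation "indec \<equiv> indecomposable Q I"

text \<open>Assumes only the linear half of \<open>is_rep\<close>, because it is used to establish
  the other half.\<close>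

lemma fold_act_linear:
  assumes a: "\<forall>a\<in>arcs Q. linear_map (space M (tail Q a)) (space M (head Q a)) (act M a)"
    and s: "\<forall>v\<in>verts Q. fin_dim_subspace (space M v)"
  shows "awalk u p v \<Longrightarrow> x \<in> space M u \<Longrightarrow> fold (act M) p x \<in> space M v"
    and "awalk u p v \<Longrightarrow> fold (act M) p 0 = 0"
proof -
  show "awalk u p v \<Longrightarrow> x \<in> space M u \<Longrightarrow> fold (act M) p x \<in> space M v"
  proof (induction p arbitrary: u x)
    case Nil
    then show ?case by (simp add: awalk_Nil_iff)
  next
    case (Cons b p)
    then have b: "b \<in> arcs Q" "tail Q b = u" "awalk (head Q b) p v" by (auto simp: awalk_Cons_iff)
    then have "act M b x \<in> space M (head Q b)" using a Cons.prems by (auto simp: linear_map_def)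
    then show ?case using Cons.IH b by simp
  qed
  show "awalk u p v \<Longrightarrow> fold (act M) p 0 = 0"
  proof (induction p arbitrary: u)
    case (Cons b p)
    then have b: "b \<in> arcs Q" "tail Q b = u" "awalk (head Q b) p v" by (auto simp: awalk_Cons_iff)
    then have "act M b 0 = 0" using a s linear_map_0 fin_dim_subspaceD by (metis tail_in_verts)
    moreover have "fold (act M) p 0 = 0" using Cons.IH b by blast
    ultimately show ?case by (metis fold_simps(2))
  qed simp
qed

text \<open>A path in the support of an element of \<open>I\<close> contains a relation of length
  two, so it acts as zero as soon as these relations do. Conversely each relation is itself an
  element of \<open>I\<close> with a single path in its support.\<close>

lemma rep_iff:
  "rep M \<longleftrightarrow> (\<forall>v\<in>verts Q. fin_dim_subspace (space M v)) \<and>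
     (\<forall>a\<in>arcs Q. linear_map (space M (tail Q a)) (space M (head Q a)) (act M a)) \<and>
     (\<forall>a\<in>arcs Q. \<forall>b\<in>arcs Q. head Q a = tail Q b \<longrightarrow> zero_rel a b \<longrightarrow>
        (\<forall>x\<in>space M (tail Q a). act M b (act M a x) = 0))"
  (is "_ \<longleftrightarrow> ?S \<and> ?L \<and> ?Z")
proof
  assume M: "rep M"
  have "act M b (act M a x) = 0"
    if a: "a \<in> arcs Q" "b \<in> arcs Q" "head Q a = tail Q b" "zero_rel a b" "x \<in> space M (tail Q a)" for a b x
  proof -
    let ?f = "path_elt (tail Q a, [a, b]) :: _ \<Rightarrow> 'k"
    have "{p. ?f (tail Q a, p) \<noteq> 0 \<and> awlast (tail Q a) p = head Q b} = {[a, b]}"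
      by (auto simp: path_elt_def)
    moreover have "(\<Sum>p | ?f (tail Q a, p) \<noteq> 0 \<and> awlast (tail Q a) p = head Q b.
        seq_scale (?f (tail Q a, p)) (fold (act M) p x)) = 0"
      using M a unfolding is_rep_def zero_rel_def by (meson head_in_verts tail_in_verts)
    ultimately show ?thesis by (simp add: path_elt_def)
  qed
  then show "?S \<and> ?L \<and> ?Z" using M unfolding is_rep_def by blast
next
  assume R: "?S \<and> ?L \<and> ?Z"
  have "(\<Sum>p | f (u, p) \<noteq> 0 \<and> awlast u p = v. seq_scale (f (u, p)) (fold (act M) p x)) = 0"
    if f: "f \<in> I" "x \<in> space M u" for f u v x
  proof (rule sum.neutral, clarify)
    fix p assume "f (u, p) \<noteq> 0"
    then obtain w xs a b ys where p: "awalk u p w" "p = xs @ a # b # ys" "zero_rel a b"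
      using support[OF f(1)] unfolding zero_rel_def by blast
    then have w: "awalk u xs (tail Q a)" "a \<in> arcs Q" "head Q a = tail Q b" "b \<in> arcs Q" "awalk (head Q b) ys w"
      by (auto simp: awalk_Cons_iff)
    then have "fold (act M) xs x \<in> space M (tail Q a)" using fold_act_linear(1) R f(2) by blast
    then have "act M b (act M a (fold (act M) xs x)) = 0" using R w p(3) by blast
    moreover have "fold (act M) ys 0 = 0" using fold_act_linear(2) R w(5) by blast
    ultimately have "fold (act M) p x = 0" using p(2) by (simp only: fold_append fold_simps comp_apply)
    then show "seq_scale (f (u, p)) (fold (act M) p x) = 0" by simp
  qed
  then show "rep M" using R unfolding is_rep_def by blast
qed

lemma rep_subspace: "rep M \<Longrightarrow> v \<in> verts Q \<Longrightarrow> seq.subspace (space M v)"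
  by (simp add: rep_iff fin_dim_subspaceD)

lemma
  assumes "rep M" "v \<in> verts Q"
  shows rep_0: "0 \<in> space M v"
    and rep_add: "x \<in> space M v \<Longrightarrow> y \<in> space M v \<Longrightarrow> x + y \<in> space M v"
    and rep_diff: "x \<in> space M v \<Longrightarrow> y \<in> space M v \<Longrightarrow> x - y \<in> space M v"
    and rep_scale: "x \<in> space M v \<Longrightarrow> seq_scale c x \<in> space M v"
    and rep_sum_mem: "(\<And>i. i \<in> A \<Longrightarrow> g i \<in> space M v) \<Longrightarrow> sum g A \<in> space M v"
  using rep_subspace[OF assms]
  by (simp_all add: seq.subspace_0 seq.subspace_add seq.subspace_diff seq.subspace_scale seq.subspace_sum)

lemma rep_act_linear: "rep M \<Longrightarrow> a \<in> arcs Q \<Longrightarrow> linear_map (space M (tail Q a)) (space M (head Q a)) (act M a)"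
  by (simp add: rep_iff)

lemma
  assumes "rep M" "a \<in> arcs Q"
  shows act_mem: "x \<in> space M (tail Q a) \<Longrightarrow> act M a x \<in> space M (head Q a)"
    and act_0: "act M a 0 = 0"
    and act_add: "x \<in> space M (tail Q a) \<Longrightarrow> y \<in> space M (tail Q a) \<Longrightarrow> act M a (x + y) = act M a x + act M a y"
    and act_diff: "x \<in> space M (tail Q a) \<Longrightarrow> y \<in> space M (tail Q a) \<Longrightarrow> act M a (x - y) = act M a x - act M a y"
    and act_scale: "x \<in> space M (tail Q a) \<Longrightarrow> act M a (seq_scale c x) = seq_scale c (act M a x)"
    and act_sum: "(\<And>i. i \<in> A \<Longrightarrow> g i \<in> space M (tail Q a)) \<Longrightarrow> act M a (sum g A) = (\<Sum>i\<in>A. act M a (g i))"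
proof -
  note l = rep_act_linear[OF assms] and s = rep_subspace[OF assms(1) tail_in_verts[OF assms(2)]]
  show "x \<in> space M (tail Q a) \<Longrightarrow> act M a x \<in> space M (head Q a)"
    and "x \<in> space M (tail Q a) \<Longrightarrow> y \<in> space M (tail Q a) \<Longrightarrow> act M a (x + y) = act M a x + act M a y"
    and "x \<in> space M (tail Q a) \<Longrightarrow> act M a (seq_scale c x) = seq_scale c (act M a x)"
    using l unfolding linear_map_def by blast+
  show "act M a 0 = 0"
    and "x \<in> space M (tail Q a) \<Longrightarrow> y \<in> space M (tail Q a) \<Longrightarrow> act M a (x - y) = act M a x - act M a y"
    and "(\<And>i. i \<in> A \<Longrightarrow> g i \<in> space M (tail Q a)) \<Longrightarrow> act M a (sum g A) = (\<Sum>i\<in>A. act M a (g i))"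
    by (rule linear_map_0[OF l s] linear_map_diff[OF l s] linear_map_sum[OF l s]; assumption)+
qed

lemma act_act: "rep M \<Longrightarrow> a \<in> arcs Q \<Longrightarrow> b \<in> arcs Q \<Longrightarrow> head Q a = tail Q b \<Longrightarrow> zero_rel a b \<Longrightarrow>
    x \<in> space M (tail Q a) \<Longrightarrow> act M b (act M a x) = 0"
  by (simp add: rep_iff)

lemma homI:
  assumes "\<And>v x. v \<in> verts Q \<Longrightarrow> x \<in> space M v \<Longrightarrow> h v x \<in> space N v"
    and "\<And>v x y. v \<in> verts Q \<Longrightarrow> x \<in> space M v \<Longrightarrow> y \<in> space M v \<Longrightarrow> h v (x + y) = h v x + h v y"
    and "\<And>v c x. v \<in> verts Q \<Longrightarrow> x \<in> space M v \<Longrightarrow> h v (seq_scale c x) = seq_scale c (h v x)"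
    and "\<And>a x. a \<in> arcs Q \<Longrightarrow> x \<in> space M (tail Q a) \<Longrightarrow> h (head Q a) (act M a x) = act N a (h (tail Q a) x)"
  shows "rhom M N h"
  using assms unfolding is_hom_def linear_map_def by blast

lemma hom_linear: "rhom M N h \<Longrightarrow> v \<in> verts Q \<Longrightarrow> linear_map (space M v) (space N v) (h v)"
  by (simp add: is_hom_def)

lemma
  assumes "rhom M N h" "v \<in> verts Q"
  shows hom_mem: "x \<in> space M v \<Longrightarrow> h v x \<in> space N v"
    and hom_add: "x \<in> space M v \<Longrightarrow> y \<in> space M v \<Longrightarrow> h v (x + y) = h v x + h v y"
    and hom_scale: "x \<in> space M v \<Longrightarrow> h v (seq_scale c x) = seq_scale c (h v x)"
  using hom_linear[OF assms] by (auto simp: linear_map_def)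

lemma
  assumes "rhom M N h" "rep M" "v \<in> verts Q"
  shows hom_0: "h v 0 = 0"
    and hom_diff: "x \<in> space M v \<Longrightarrow> y \<in> space M v \<Longrightarrow> h v (x - y) = h v x - h v y"
    and hom_sum: "(\<And>i. i \<in> A \<Longrightarrow> g i \<in> space M v) \<Longrightarrow> h v (sum g A) = (\<Sum>i\<in>A. h v (g i))"
  using hom_linear[OF assms(1,3)] rep_subspace[OF assms(2,3)]
  by - (rule linear_map_0 linear_map_diff linear_map_sum; assumption)+

lemma hom_act: "rhom M N h \<Longrightarrow> a \<in> arcs Q \<Longrightarrow> x \<in> space M (tail Q a) \<Longrightarrow>
    h (head Q a) (act M a x) = act N a (h (tail Q a) x)"
  by (simp add: is_hom_def)

lemmas hom_simps = hom_mem hom_add hom_scale hom_act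

lemma hom_comp:
  assumes "rhom L M f" "rhom M N g" shows "rhom L N (\<lambda>v x. g v (f v x))"
  by (intro homI) (simp_all add: hom_simps[OF assms(1)] hom_simps[OF assms(2)])

lemma hom_id: "rhom M M (\<lambda>v x. x)"
  by (intro homI) auto

lemma hom_plus:
  assumes "rep N" "rhom M N f" "rhom M N g" shows "rhom M N (\<lambda>v x. f v x + g v x)"
  using assms
  by (intro homI) (simp_all add: hom_simps[OF assms(2)] hom_simps[OF assms(3)] act_add rep_add seq.scale_right_distrib)

lemma hom_smult:
  assumes "rep N" "rhom M N f" shows "rhom M N (\<lambda>v x. seq_scale c (f v x))"
  using assms
  by (intro homI) (simp_all add: hom_simps[OF assms(2)] act_scale rep_scale seq.scale_right_distrib mult.commute)

lemma hom_minus: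
  assumes "rep N" "rhom M N f" "rhom M N g" shows "rhom M N (\<lambda>v x. f v x - g v x)"
  using assms
  by (intro homI) (simp_all add: hom_simps[OF assms(2)] hom_simps[OF assms(3)] act_diff rep_diff seq.scale_right_diff_distrib)

lemma hom_zero: "rep N \<Longrightarrow> rhom M N (\<lambda>v x. 0)"
  by (intro homI) (simp_all add: rep_0 act_0)

subsection \<open>Isomorphisms\<close>

definition inverse_homs ::
    "('v, 'a, 'k) rep \<Rightarrow> ('v, 'a, 'k) rep \<Rightarrow> ('v \<Rightarrow> (nat \<Rightarrow> 'k) \<Rightarrow> nat \<Rightarrow> 'k) \<Rightarrow>
     ('v \<Rightarrow> (nat \<Rightarrow> 'k) \<Rightarrow> nat \<Rightarrow> 'k) \<Rightarrow> bool" where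
  "inverse_homs M N f g \<longleftrightarrow> rhom M N f \<and> rhom N M g \<and>
     (\<forall>v\<in>verts Q. \<forall>x\<in>space M v. g v (f v x) = x) \<and> (\<forall>v\<in>verts Q. \<forall>y\<in>space N v. f v (g v y) = y)"

lemma inverse_homs_exists:
  assumes M: "rep M" and h: "rhom M N h" and bij: "\<And>v. v \<in> verts Q \<Longrightarrow> bij_betw (h v) (space M v) (space N v)"
  shows "\<exists>g. inverse_homs M N h g"
proof -
  define g where "g = (\<lambda>v. the_inv_into (space M v) (h v))"
  have g1: "g v (h v x) = x" if "v \<in> verts Q" "x \<in> space M v" for v x
    using that bij_betw_imp_inj_on[OF bij[OF that(1)]] unfolding g_def by (simp add: the_inv_into_f_f)
  have g2: "\<exists>x\<in>space M v. y = h v x" if "v \<in> verts Q" "y \<in> space N v" for v y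
    using that bij unfolding bij_betw_def by blast
  have g3: "h v (g v y) = y" "g v y \<in> space M v" if "v \<in> verts Q" "y \<in> space N v" for v y
    using g2[OF that] g1 that(1) by auto
  have "rhom N M g"
  proof (rule homI)
    fix v x y assume v: "v \<in> verts Q" "x \<in> space N v" "y \<in> space N v"
    then have "h v (g v x + g v y) = x + y" using M g3 by (simp add: hom_add[OF h])
    then show "g v (x + y) = g v x + g v y" using g1 g3 v M by (metis rep_add)
  next
    fix v c x assume v: "v \<in> verts Q" "x \<in> space N v"
    then have "h v (seq_scale c (g v x)) = seq_scale c x" using M g3 by (simp add: hom_scale[OF h])
    then show "g v (seq_scale c x) = seq_scale c (g v x)" using g1 g3 v M by (metis rep_scale)
  next
    fix a x assume a: "a \<in> arcs Q" "x \<in> space N (tail Q a)"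
    then have "h (head Q a) (act M a (g (tail Q a) x)) = act N a x" using g3 by (simp add: hom_act[OF h])
    then show "g (head Q a) (act N a x) = act M a (g (tail Q a) x)"
      using g1 g3 a M by (metis act_mem head_in_verts tail_in_verts)
  qed (use g3 in auto)
  then show ?thesis using h g1 g3 unfolding inverse_homs_def by blast
qed

lemma inverse_homs_bij: "inverse_homs M N f g \<Longrightarrow> v \<in> verts Q \<Longrightarrow> bij_betw (f v) (space M v) (space N v)"
  unfolding inverse_homs_def by (intro bij_betw_byWitness[where f' = "g v"]) (auto simp: hom_mem)

lemma isoI: "inverse_homs M N f g \<Longrightarrow> riso M N"
  unfolding rep_iso_def using inverse_homs_bij[of M N f g] by (auto simp: inverse_homs_def)

lemma iso_iff:
  assumes "rep M" shows "riso M N \<longleftrightarrow> (\<exists>f g. inverse_homs M N f g)"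
proof
  assume "riso M N"
  then show "\<exists>f g. inverse_homs M N f g"
    unfolding rep_iso_def using inverse_homs_exists[OF assms] by blast
qed (use isoI in blast)

lemma iso_refl: "riso M M"
  by (rule isoI[of _ _ "\<lambda>v x. x" "\<lambda>v x. x"]) (simp add: inverse_homs_def hom_id)

lemma inverse_homs_sym: "inverse_homs M N f g \<Longrightarrow> inverse_homs N M g f"
  by (auto simp: inverse_homs_def)

lemma iso_sym: "rep M \<Longrightarrow> riso M N \<Longrightarrow> riso N M"
  using iso_iff inverse_homs_sym isoI by blast

lemma inverse_homs_trans:
  "inverse_homs L M f g \<Longrightarrow> inverse_homs M N f' g' \<Longrightarrow> inverse_homs L N (\<lambda>v x. f' v (f v x)) (\<lambda>v x. g v (g' v x))"
  using hom_comp[of L M f N f'] hom_comp[of N M g' L g] by (auto simp: inverse_homs_def hom_mem)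

lemma iso_trans: "riso L M \<Longrightarrow> riso M N \<Longrightarrow> riso L N"
proof -
  assume "riso L M" "riso M N"
  then obtain f g where "rhom L M f" "\<forall>v\<in>verts Q. bij_betw (f v) (space L v) (space M v)"
     "rhom M N g" "\<forall>v\<in>verts Q. bij_betw (g v) (space M v) (space N v)"
    unfolding rep_iso_def by blast
  then have "rhom L N (\<lambda>v x. g v (f v x))" "\<forall>v\<in>verts Q. bij_betw (\<lambda>x. g v (f v x)) (space L v) (space N v)"
    using hom_comp bij_betw_trans by (fastforce simp: comp_def)+
  then show ?thesis unfolding rep_iso_def by blast
qed

subsection \<open>Direct sums, summands and retracts\<close>

lemma mem_rep_sum [simp]: "z \<in> space (rep_sum A B) v \<longleftrightarrow> seq_left z \<in> space A v \<and> seq_right z \<in> space B v"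
  by (auto simp: rep_sum_def) (metis seq_pair_left_right)

lemma act_rep_sum [simp]: "act (rep_sum A B) a z = seq_pair (act A a (seq_left z)) (act B a (seq_right z))"
  by (simp add: rep_sum_def)

lemma rep_rep_sum:
  assumes "rep A" "rep B" shows "rep (rep_sum A B)"
  unfolding rep_iff
proof (intro conjI ballI impI)
  fix v assume "v \<in> verts Q"
  then show "fin_dim_subspace (space (rep_sum A B) v)"
    using assms fin_dim_subspace_pair[of "space A v" "space B v"] unfolding rep_iff by (simp add: rep_sum_def)
next
  fix a assume "a \<in> arcs Q"
  then show "linear_map (space (rep_sum A B) (tail Q a)) (space (rep_sum A B) (head Q a)) (act (rep_sum A B) a)"
    using assms by (auto simp: linear_map_def act_mem act_add act_scale seq_pair_linear)
next
  fix a b x assume "a \<in> arcs Q" "b \<in> arcs Q" "head Q a = tail Q b" "zero_rel a b" "x \<in> space (rep_sum A B) (tail Q a)"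
  then show "act (rep_sum A B) b (act (rep_sum A B) a x) = 0"
    using assms by (simp add: act_act)
qed

lemma rep_zero_rep: "rep zero_rep"
  unfolding rep_iff
  by (auto simp: zero_rep_def fin_dim_subspace_def linear_map_def seq.subspace_single_0 intro!: exI[of _ "{}"])

lemma hom_pair:
  assumes "rhom M A f" "rhom M B g"
  shows "rhom M (rep_sum A B) (\<lambda>v x. seq_pair (f v x) (g v x))"
  by (intro homI) (simp_all add: hom_simps[OF assms(1)] hom_simps[OF assms(2)] seq_pair_linear)

lemma hom_left: "rhom (rep_sum A B) A (\<lambda>v. seq_left)" and hom_right: "rhom (rep_sum A B) B (\<lambda>v. seq_right)"
  by (intro homI; simp)+

lemma hom_inl: "rep B \<Longrightarrow> rhom A (rep_sum A B) (\<lambda>v x. seq_pair x 0)"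
  and hom_inr: "rep A \<Longrightarrow> rhom B (rep_sum A B) (\<lambda>v x. seq_pair 0 x)"
  by (simp_all add: hom_pair hom_id hom_zero)

lemma hom_copair:
  assumes "rep M" "rhom A M f" "rhom B M g"
  shows "rhom (rep_sum A B) M (\<lambda>v z. f v (seq_left z) + g v (seq_right z))"
  using hom_plus[OF assms(1) hom_comp[OF hom_left assms(2)] hom_comp[OF hom_right assms(3)]] .

text \<open>A summand without a named complement: transitivity and the passage to direct sums are
  then mere compositions of maps. \<open>summand_iff_retract\<close> recovers the complement as a
  kernel.\<close>

definition retract :: "('v, 'a, 'k) rep \<Rightarrow> ('v, 'a, 'k) rep \<Rightarrow> bool" where
  "retract M T \<longleftrightarrow> (\<exists>i p. rhom M T i \<and> rhom T M p \<and> (\<forall>v\<in>verts Q. \<forall>x\<in>space M v. p v (i v x) = x))"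

lemma retract_trans: "retract L M \<Longrightarrow> retract M N \<Longrightarrow> retract L N"
proof -
  assume "retract L M" "retract M N"
  then obtain i p j q where "rhom L M i" "rhom M L p" "\<And>v x. v \<in> verts Q \<Longrightarrow> x \<in> space L v \<Longrightarrow> p v (i v x) = x"
     "rhom M N j" "rhom N M q" "\<And>v x. v \<in> verts Q \<Longrightarrow> x \<in> space M v \<Longrightarrow> q v (j v x) = x"
    unfolding retract_def by blast
  then show ?thesis
    using hom_comp[of L M i N j] hom_comp[of N M q L p] unfolding retract_def
    by (intro exI[of _ "\<lambda>v x. j v (i v x)"] exI[of _ "\<lambda>v x. p v (q v x)"]) (simp add: hom_mem)
qed

lemma inverse_homs_retract: "inverse_homs M N f g \<Longrightarrow> retract M N"
  unfolding inverse_homs_def retract_def by blast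

lemma retract_iso: "rep M \<Longrightarrow> riso M N \<Longrightarrow> retract M N"
  using iso_iff inverse_homs_retract by blast

lemma retract_iso': "rep M \<Longrightarrow> riso M N \<Longrightarrow> retract N M"
  using iso_iff inverse_homs_retract inverse_homs_sym by blast

lemma retract_left: "rep B \<Longrightarrow> retract A (rep_sum A B)" and retract_right: "rep A \<Longrightarrow> retract B (rep_sum A B)"
  unfolding retract_def using hom_inl hom_inr hom_left hom_right seq_left_pair seq_right_pair by metis+

lemma retract_sum_mono:
  assumes "retract A A'" "retract B B'" shows "retract (rep_sum A B) (rep_sum A' B')"
proof -
  obtain i p j q where h: "rhom A A' i" "rhom A' A p" "\<And>v x. v \<in> verts Q \<Longrightarrow> x \<in> space A v \<Longrightarrow> p v (i v x) = x"
     "rhom B B' j" "rhom B' B q" "\<And>v x. v \<in> verts Q \<Longrightarrow> x \<in> space B v \<Longrightarrow> q v (j v x) = x"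
    using assms unfolding retract_def by metis
  show ?thesis unfolding retract_def
    using hom_pair[OF hom_comp[OF hom_left h(1)] hom_comp[OF hom_right h(4)]]
       hom_pair[OF hom_comp[OF hom_left h(2)] hom_comp[OF hom_right h(5)]] h(3,6)
    by (intro exI[of _ "\<lambda>v z. seq_pair (i v (seq_left z)) (j v (seq_right z))"]
         exI[of _ "\<lambda>v z. seq_pair (p v (seq_left z)) (q v (seq_right z))"]) simp
qed

lemma rep_subrep:
  assumes M: "rep M" and S: "\<And>v. v \<in> verts Q \<Longrightarrow> seq.subspace (S v)" "\<And>v. v \<in> verts Q \<Longrightarrow> S v \<subseteq> space M v"
    and a: "\<And>a x. a \<in> arcs Q \<Longrightarrow> x \<in> S (tail Q a) \<Longrightarrow> act M a x \<in> S (head Q a)"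
  shows "rep \<lparr>space = S, act = act M\<rparr>"
  unfolding rep_iff
proof (intro conjI ballI impI)
  fix v assume "v \<in> verts Q"
  then show "fin_dim_subspace (space \<lparr>space = S, act = act M\<rparr> v)"
    using fin_dim_subspace_subset[OF _ S] M by (simp add: rep_iff)
next
  fix b assume b: "b \<in> arcs Q"
  then have "S (tail Q b) \<subseteq> space M (tail Q b)" using S by simp
  then show "linear_map (space \<lparr>space = S, act = act M\<rparr> (tail Q b)) (space \<lparr>space = S, act = act M\<rparr> (head Q b))
      (act \<lparr>space = S, act = act M\<rparr> b)"
    using b a act_add[OF M b] act_scale[OF M b] by (auto simp: linear_map_def subset_iff)
next
  fix b c x assume "b \<in> arcs Q" "c \<in> arcs Q" "head Q b = tail Q c" "zero_rel b c" "x \<in> space \<lparr>space = S, act = act M\<rparr> (tail Q b)"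
  then show "act \<lparr>space = S, act = act M\<rparr> c (act \<lparr>space = S, act = act M\<rparr> b x) = 0"
    using act_act[OF M] S(2) by (simp add: subset_iff)
qed

definition hom_kernel ::
    "('v, 'a, 'k) rep \<Rightarrow> ('v \<Rightarrow> (nat \<Rightarrow> 'k) \<Rightarrow> nat \<Rightarrow> 'k) \<Rightarrow> ('v, 'a, 'k) rep" where
  "hom_kernel M h = \<lparr>space = (\<lambda>v. {x \<in> space M v. h v x = 0}), act = act M\<rparr>"

lemma rep_hom_kernel:
  assumes "rep M" "rep N" "rhom M N h" shows "rep (hom_kernel M h)"
  unfolding hom_kernel_def
proof (rule rep_subrep[OF assms(1)])
  fix v assume v: "v \<in> verts Q"
  show "seq.subspace {x \<in> space M v. h v x = 0}"
    by (rule linear_map_kernel_subspace[OF hom_linear[OF assms(3) v] rep_subspace[OF assms(1) v]])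
next
  fix a x assume "a \<in> arcs Q" "x \<in> {x \<in> space M (tail Q a). h (tail Q a) x = 0}"
  then show "act M a x \<in> {x \<in> space M (head Q a). h (head Q a) x = 0}"
    using assms(1,2) by (simp add: act_mem hom_act[OF assms(3)] act_0)
qed auto

text \<open>The idempotent \<open>i p\<close> splits \<open>x\<close> into \<open>i (p x)\<close>
  and \<open>x - i (p x)\<close>, and the second part lies in the kernel of
  \<open>p\<close>.\<close>

lemma retract_complement:
  assumes T: "rep T" and M: "rep M" and i: "rhom M T i" and p: "rhom T M p"
    and pi: "\<And>v x. v \<in> verts Q \<Longrightarrow> x \<in> space M v \<Longrightarrow> p v (i v x) = x"
  shows "riso T (rep_sum M (hom_kernel T p))"
proof (rule isoI)
  let ?K = "hom_kernel T p"
  have K: "rep ?K" using rep_hom_kernel T M p by blast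
  have ip: "rhom T T (\<lambda>v x. i v (p v x))" using hom_comp[OF p i] .
  have "rhom T ?K (\<lambda>v x. x - i v (p v x))"
  proof (rule homI)
    fix v x assume "v \<in> verts Q" "x \<in> space T v"
    then show "x - i v (p v x) \<in> space ?K v"
      using T pi by (simp add: hom_kernel_def hom_simps[OF i] hom_simps[OF p] rep_diff hom_diff[OF p T])
  next
    fix a x assume "a \<in> arcs Q" "x \<in> space T (tail Q a)"
    then show "act T a x - i (head Q a) (p (head Q a) (act T a x)) = act ?K a (x - i (tail Q a) (p (tail Q a) x))"
      using T by (simp add: hom_kernel_def hom_simps[OF i] hom_simps[OF p] act_diff)
  next
    fix v x y assume "v \<in> verts Q" "x \<in> space T v" "y \<in> space T v"
    then show "x + y - i v (p v (x + y)) = x - i v (p v x) + (y - i v (p v y))"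
      by (simp add: hom_simps[OF i] hom_simps[OF p])
  next
    fix v c x assume "v \<in> verts Q" "x \<in> space T v"
    then show "seq_scale c x - i v (p v (seq_scale c x)) = seq_scale c (x - i v (p v x))"
      by (simp add: hom_simps[OF i] hom_simps[OF p] seq.scale_right_diff_distrib)
  qed
  then have f: "rhom T (rep_sum M ?K) (\<lambda>v x. seq_pair (p v x) (x - i v (p v x)))"
    using hom_pair p by blast
  have "rhom ?K T (\<lambda>v x. x)"
    by (intro homI) (auto simp: hom_kernel_def)
  then have g: "rhom (rep_sum M ?K) T (\<lambda>v z. i v (seq_left z) + seq_right z)"
    using hom_copair[OF T i] by blast
  show "inverse_homs T (rep_sum M ?K) (\<lambda>v x. seq_pair (p v x) (x - i v (p v x)))
     (\<lambda>v z. i v (seq_left z) + seq_right z)"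
    unfolding inverse_homs_def
  proof (intro conjI ballI f g)
    fix v z assume v: "v \<in> verts Q" "z \<in> space (rep_sum M ?K) v"
    have "p v (i v (seq_left z) + seq_right z) = seq_left z"
      using v hom_add[OF p v(1), of "i v (seq_left z)" "seq_right z"] i pi
      by (simp add: hom_kernel_def hom_mem)
    then show "seq_pair (p v (i v (seq_left z) + seq_right z))
         (i v (seq_left z) + seq_right z - i v (p v (i v (seq_left z) + seq_right z))) = z"
      by simp
  qed simp
qed

lemma summand_iff_retract:
  assumes T: "rep T" shows "is_summand Q I M T \<longleftrightarrow> rep M \<and> retract M T"
proof
  assume "is_summand Q I M T"
  then obtain N where N: "rep M" "rep N" "riso T (rep_sum M N)" unfolding is_summand_def by blast
  then have "retract (rep_sum M N) T" using retract_iso' T by blast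
  then show "rep M \<and> retract M T" using N retract_left retract_trans by blast
next
  assume M: "rep M \<and> retract M T"
  then obtain i p where "rhom M T i" "rhom T M p" "\<And>v x. v \<in> verts Q \<Longrightarrow> x \<in> space M v \<Longrightarrow> p v (i v x) = x"
    unfolding retract_def by blast
  then show "is_summand Q I M T"
    using retract_complement[OF T] rep_hom_kernel[OF T] M unfolding is_summand_def by blast
qed

end

section \<open>Indecomposable representations and the Krull-Schmidt property\<close>

context monomial_quiver
begin

lemma indec_rep: "indec M \<Longrightarrow> rep M"
  by (simp add: indecomposable_def)

lemma indec_nonzero: "indec M \<Longrightarrow> \<exists>v\<in>verts Q. \<exists>x\<in>space M v. x \<noteq> 0"
  unfolding indecomposable_def is_zero_rep_def using rep_0 by blast

lemma is_zero_rep_iff: "rep M \<Longrightarrow> is_zero_rep Q M \<longleftrightarrow> (\<forall>v\<in>verts Q. \<forall>x\<in>space M v. x = 0)"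
  unfolding is_zero_rep_def using rep_0 by blast

text \<open>An idempotent splits \<open>M\<close> into its image and its kernel; a decomposition
  yields the projection onto one summand. The idempotent form avoids quantifying over pairs of
  representations.\<close>

lemma indec_iff:
  "indec M \<longleftrightarrow> rep M \<and> \<not> is_zero_rep Q M \<and>
     (\<forall>e. rhom M M e \<longrightarrow> (\<forall>v\<in>verts Q. \<forall>x\<in>space M v. e v (e v x) = e v x) \<longrightarrow>
        (\<forall>v\<in>verts Q. \<forall>x\<in>space M v. e v x = 0) \<or> (\<forall>v\<in>verts Q. \<forall>x\<in>space M v. e v x = x))"
  (is "?L \<longleftrightarrow> ?R")
proof
  assume L: ?L
  then have M: "rep M" by (rule indec_rep)
  have "(\<forall>v\<in>verts Q. \<forall>x\<in>space M v. e v x = 0) \<or> (\<forall>v\<in>verts Q. \<forall>x\<in>space M v. e v x = x)"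
    if e: "rhom M M e" and ee: "\<forall>v\<in>verts Q. \<forall>x\<in>space M v. e v (e v x) = e v x" for e
  proof -
    \<comment> \<open>The image of \<open>e\<close> is written as the kernel of
      \<open>e - 1\<close>, so that \<open>hom_kernel\<close> covers both summands.\<close>
    let ?X = "hom_kernel M (\<lambda>v x. e v x - x)" and ?Y = "hom_kernel M e"
    have X: "rep ?X" and Y: "rep ?Y"
      using rep_hom_kernel[OF M M hom_minus[OF M e hom_id]] rep_hom_kernel[OF M M e] .
    have i: "rhom ?X M (\<lambda>v x. x)" by (intro homI) (auto simp: hom_kernel_def)
    have p: "rhom M ?X e"
      using ee by (intro homI) (auto simp: hom_kernel_def hom_simps[OF e])
    have "riso M (rep_sum ?X ?Y)"
      by (rule retract_complement[OF M X i p]) (simp add: hom_kernel_def)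
    then have "is_zero_rep Q ?X \<or> is_zero_rep Q ?Y"
      using L X Y unfolding indecomposable_def by blast
    then show ?thesis
    proof
      assume "is_zero_rep Q ?X"
      then have "e v x = 0" if "v \<in> verts Q" "x \<in> space M v" for v x
        using hom_mem[OF p that] that is_zero_rep_iff[OF X] by blast
      then show ?thesis by blast
    next
      assume Z: "is_zero_rep Q ?Y"
      have "e v x = x" if v: "v \<in> verts Q" "x \<in> space M v" for v x
      proof -
        have "x - e v x \<in> space ?Y v"
          using v ee by (simp add: hom_kernel_def hom_simps[OF e] hom_diff[OF e M] rep_diff[OF M])
        then have "x - e v x = 0" using Z is_zero_rep_iff[OF Y] v(1) by blast
        then show ?thesis by (metis right_minus_eq)
      qed
      then show ?thesis by blast
    qed
  qed
  then show ?R using L unfolding indecomposable_def by blast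
next
  assume R: ?R
  then have M: "rep M" by blast
  have "is_zero_rep Q X \<or> is_zero_rep Q Y" if X: "rep X" and Y: "rep Y" and iso: "riso M (rep_sum X Y)" for X Y
  proof -
    obtain f g where fg: "inverse_homs M (rep_sum X Y) f g" using iso iso_iff[OF M] by blast
    then have f: "rhom M (rep_sum X Y) f" and g: "rhom (rep_sum X Y) M g"
      and gf: "\<And>v x. v \<in> verts Q \<Longrightarrow> x \<in> space M v \<Longrightarrow> g v (f v x) = x"
      and fg: "\<And>v x. v \<in> verts Q \<Longrightarrow> x \<in> space (rep_sum X Y) v \<Longrightarrow> f v (g v x) = x"
      by (auto simp only: inverse_homs_def)
    \<comment> \<open>The projection onto the first summand, transported back to
      \<open>M\<close>.\<close>
    define e where "e = (\<lambda>v x. g v (seq_pair (seq_left (f v x)) 0))"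
    have e: "rhom M M e"
      unfolding e_def using hom_comp[OF hom_comp[OF hom_comp[OF f hom_left] hom_inl[OF Y]] g] .
    have fe: "f v (e v x) = seq_pair (seq_left (f v x)) 0" if "v \<in> verts Q" "x \<in> space M v" for v x
      unfolding e_def using hom_mem[OF f that] rep_0[OF Y that(1)] by (intro fg[OF that(1)]) simp
    have "e v (e v x) = e v x" if "v \<in> verts Q" "x \<in> space M v" for v x
      using fe[OF that] by (simp add: e_def)
    then consider "\<forall>v\<in>verts Q. \<forall>x\<in>space M v. e v x = 0" | "\<forall>v\<in>verts Q. \<forall>x\<in>space M v. e v x = x"
      using R e by blast
    then show ?thesis
    proof cases
      case 1
      have "x = 0" if v: "v \<in> verts Q" "x \<in> space X v" for v x
      proof -
        have m: "seq_pair x 0 \<in> space (rep_sum X Y) v" using v rep_0[OF Y] by simp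
        have "f v (e v (g v (seq_pair x 0))) = seq_pair x 0"
          using fe[OF v(1) hom_mem[OF g v(1) m]] fg[OF v(1) m] by simp
        moreover have "e v (g v (seq_pair x 0)) = 0" using 1 v hom_mem[OF g v(1) m] by blast
        ultimately show ?thesis using hom_0[OF f M v(1)] by (metis seq_pair_eq_0_iff)
      qed
      then show ?thesis using is_zero_rep_iff[OF X] by blast
    next
      case 2
      have "y = 0" if v: "v \<in> verts Q" "y \<in> space Y v" for v y
      proof -
        have m: "seq_pair 0 y \<in> space (rep_sum X Y) v" using v rep_0[OF X] by simp
        have "f v (e v (g v (seq_pair 0 y))) = 0"
          using fe[OF v(1) hom_mem[OF g v(1) m]] fg[OF v(1) m] by simp
        moreover have "e v (g v (seq_pair 0 y)) = g v (seq_pair 0 y)" using 2 v hom_mem[OF g v(1) m] by blast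
        ultimately show ?thesis using fg[OF v(1) m] by (metis seq_pair_eq_0_iff)
      qed
      then show ?thesis using is_zero_rep_iff[OF Y] by blast
    qed
  qed
  then show ?L using R unfolding indecomposable_def by blast
qed

lemma iso_is_zero_rep:
  assumes "riso M N" "rep M" "rep N" "is_zero_rep Q N" shows "is_zero_rep Q M"
proof -
  obtain f g where "inverse_homs M N f g" using assms iso_iff by blast
  then show ?thesis
    using assms is_zero_rep_iff[OF assms(2)] is_zero_rep_iff[OF assms(3)] hom_0
    unfolding inverse_homs_def by (metis hom_mem)
qed

lemma indec_iso:
  assumes "indec M" "riso M N" "rep N" shows "indec N"
proof -
  have "is_zero_rep Q X \<or> is_zero_rep Q Y" if "rep X" "rep Y" "riso N (rep_sum X Y)" for X Y
    using assms that iso_trans unfolding indecomposable_def by blast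
  then show ?thesis using assms iso_is_zero_rep unfolding indecomposable_def by blast
qed

section \<open>Fitting's lemma and local endomorphism rings\<close>

lemma hom_funpow: "rhom M M f \<Longrightarrow> rhom M M (\<lambda>v. f v ^^ n)"
proof (induction n)
  case 0
  then show ?case using hom_id by (simp add: id_def)
next
  case (Suc n)
  then show ?case using hom_comp[OF Suc.IH[OF Suc.prems] Suc.prems] by (simp add: comp_def)
qed

text \<open>Fitting's lemma. Once the rank of the powers of \<open>f\<close> is minimal,
  \<open>F = f ^^ n\<close> permutes its image \<open>W\<close>. Sending \<open>x\<close> to the
  point of \<open>W\<close> with the same value under \<open>F\<close> is an idempotent
  endomorphism, hence zero or the identity.\<close>

lemma indec_bij_or_nilpotent:
  assumes M: "indec M" and f: "rhom M M f"
  shows "(\<forall>v\<in>verts Q. bij_betw (f v) (space M v) (space M v)) \<or>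
         (\<exists>n. \<forall>v\<in>verts Q. \<forall>x\<in>space M v. (f v ^^ n) x = 0)"
proof -
  have rM: "rep M" using M by (rule indec_rep)
  have fd: "fin_dim_subspace (space M v)" if "v \<in> verts Q" for v using rM that by (simp add: rep_iff)
  let ?d = "\<lambda>n v. seq.dim ((f v ^^ n) ` space M v)"
  let ?D = "\<lambda>n. \<Sum>v\<in>verts Q. ?d n v"
  \<comment> \<open>The ranks are summed over the vertices so that one exponent serves all of them.
    It is positive because the bijective case splits off one factor \<open>f\<close>.\<close>
  obtain n where n: "0 < n" "\<And>m. 0 < m \<Longrightarrow> ?D n \<le> ?D m"
    using ex_has_least_nat[of "\<lambda>n. 0 < n" 1 ?D] by auto
  define F where "F = (\<lambda>v. f v ^^ n)"
  have F: "rhom M M F" unfolding F_def by (rule hom_funpow[OF f])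
  define W where "W = (\<lambda>v. F v ` space M v)"
  have WM: "W v \<subseteq> space M v" if "v \<in> verts Q" for v
    unfolding W_def using hom_mem[OF F that] by blast
  have sW: "seq.subspace (W v)" if "v \<in> verts Q" for v
    unfolding W_def by (rule linear_map_image_subspace[OF hom_linear[OF F that] rep_subspace[OF rM that]])
  have fW: "fin_dim_subspace (W v)" if "v \<in> verts Q" for v
    using fin_dim_subspace_subset[OF fd sW WM] that by blast
  have lW: "linear_map (W v) (W v) (F v)" if v: "v \<in> verts Q" for v
    using hom_linear[OF F v] WM[OF v] unfolding linear_map_def W_def by blast
  have FW: "F v ` W v = W v" if v: "v \<in> verts Q" for v
  proof -
    have sub: "F v ` W v \<subseteq> W v" if "v \<in> verts Q" for v
      using WM[OF that] unfolding W_def by blast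
    have d2: "(f v ^^ (n + n)) ` space M v = F v ` W v" for v
      unfolding W_def F_def by (simp add: funpow_add image_comp)
    have sFW: "seq.subspace (F v ` W v)" if "v \<in> verts Q" for v
      using linear_map_image_subspace[OF lW sW] that by blast
    have le: "?d (n + n) v \<le> ?d n v" if "v \<in> verts Q" for v
      using fin_dim_subspace_dim(1)[OF fW sFW sub] that d2 unfolding W_def F_def by simp
    have "?D (n + n) \<le> ?D n" using le by (rule sum_mono)
    then have "?D (n + n) = ?D n" using n(2)[of "n + n"] n(1) by simp
    then have "?d (n + n) v = ?d n v"
      using sum_mono_inv[of "?d (n + n)" "verts Q" "?d n" v] le v finite_verts by blast
    then have "seq.dim (F v ` W v) = seq.dim (W v)" using d2 unfolding W_def F_def by simp
    then show ?thesis using fin_dim_subspace_dim(2)[OF fW sFW sub] v by blast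
  qed
  have inj: "inj_on (F v) (W v)" if "v \<in> verts Q" for v
    using linear_map_surj_self[OF fW lW] FW that by blast
  have ex1: "\<exists>!u. u \<in> W v \<and> F v u = F v x" if v: "v \<in> verts Q" "x \<in> space M v" for v x
  proof -
    have "F v x \<in> F v ` W v" using FW[OF v(1)] v(2) unfolding W_def by blast
    then show ?thesis using inj[OF v(1)] by (auto simp: inj_on_def)
  qed
  \<comment> \<open>The projection onto the image of \<open>F\<close> along its kernel.\<close>
  define e where "e = (\<lambda>v x. THE u. u \<in> W v \<and> F v u = F v x)"
  have eW: "e v x \<in> W v" and eF: "F v (e v x) = F v x" if "v \<in> verts Q" "x \<in> space M v" for v x
    using theI'[OF ex1[OF that]] unfolding e_def by blast+
  have eI: "e v x = u" if "v \<in> verts Q" "x \<in> space M v" "u \<in> W v" "F v u = F v x" for v x u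
    using ex1[OF that(1,2)] eW eF that by blast
  have eM: "e v x \<in> space M v" if "v \<in> verts Q" "x \<in> space M v" for v x
    using eW WM that by blast
  have e: "rhom M M e"
  proof (rule homI)
    fix v x y assume v: "v \<in> verts Q" "x \<in> space M v" "y \<in> space M v"
    then show "e v (x + y) = e v x + e v y"
      using eW eF eM by (intro eI) (simp_all add: hom_add[OF F] rep_add[OF rM] seq.subspace_add[OF sW])
  next
    fix v c x assume "v \<in> verts Q" "x \<in> space M v"
    then show "e v (seq_scale c x) = seq_scale c (e v x)"
      using eW eF eM by (intro eI) (simp_all add: hom_scale[OF F] rep_scale[OF rM] seq.subspace_scale[OF sW])
  next
    fix a x assume a: "a \<in> arcs Q" "x \<in> space M (tail Q a)"
    have "act M a (e (tail Q a) x) \<in> W (head Q a)"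
    proof -
      obtain z where z: "z \<in> space M (tail Q a)" "e (tail Q a) x = F (tail Q a) z"
        using eW[of "tail Q a" x] a unfolding W_def by auto
      then have "act M a (e (tail Q a) x) = F (head Q a) (act M a z)" by (simp add: hom_act[OF F a(1)])
      then show ?thesis using act_mem[OF rM a(1) z(1)] unfolding W_def by blast
    qed
    then show "e (head Q a) (act M a x) = act M a (e (tail Q a) x)"
      using a eF eM act_mem[OF rM a(1)] by (intro eI) (simp_all add: hom_act[OF F a(1)])
  qed (rule eM)
  have "e v (e v x) = e v x" if "v \<in> verts Q" "x \<in> space M v" for v x
    using eI eM eW that by blast
  then consider "\<forall>v\<in>verts Q. \<forall>x\<in>space M v. e v x = 0" | "\<forall>v\<in>verts Q. \<forall>x\<in>space M v. e v x = x"
    using M e unfolding indec_iff by blast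
  then show ?thesis
  proof cases
    case 1
    then have "F v x = 0" if "v \<in> verts Q" "x \<in> space M v" for v x
      using eF[OF that] that hom_0[OF F rM that(1)] by (metis)
    then show ?thesis unfolding F_def by blast
  next
    case 2
    have "bij_betw (f v) (space M v) (space M v)" if v: "v \<in> verts Q" for v
    proof -
      have "space M v \<subseteq> f v ` space M v"
      proof
        fix x assume x: "x \<in> space M v"
        then have "x \<in> W v" using eW[OF v x] 2 v by simp
        then obtain z where z: "z \<in> space M v" "x = F v z" unfolding W_def by blast
        obtain m where m: "n = Suc m" using n(1) by (cases n) auto
        have "x = f v ((f v ^^ m) z)" using z(2) unfolding F_def m by simp
        moreover have "(f v ^^ m) z \<in> space M v" using hom_mem[OF hom_funpow[OF f] v z(1)] .
        ultimately show "x \<in> f v ` space M v" by blast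
      qed
      then have s: "f v ` space M v = space M v" using hom_mem[OF f v] by blast
      then have "inj_on (f v) (space M v)" using linear_map_surj_self[OF fd[OF v] hom_linear[OF f v]] by blast
      then show ?thesis using s by (simp add: bij_betw_def)
    qed
    then show ?thesis by blast
  qed
qed

definition hom_bij :: "('v, 'a, 'k) rep \<Rightarrow> ('v, 'a, 'k) rep \<Rightarrow> ('v \<Rightarrow> (nat \<Rightarrow> 'k) \<Rightarrow> nat \<Rightarrow> 'k) \<Rightarrow> bool" where
  "hom_bij M N f \<longleftrightarrow> (\<forall>v\<in>verts Q. bij_betw (f v) (space M v) (space N v))"

lemma hom_bijD: "hom_bij M N f \<Longrightarrow> v \<in> verts Q \<Longrightarrow> bij_betw (f v) (space M v) (space N v)"
  by (simp add: hom_bij_def)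

text \<open>If both maps were nilpotent, let \<open>y\<close> be the last nonzero vector among the
  iterates of \<open>f\<close> on some \<open>x\<close>. Then \<open>f y = 0\<close> and so
  \<open>g y = y\<close>, which contradicts the nilpotency of \<open>g\<close>.\<close>

lemma indec_local:
  assumes M: "indec M" and f: "rhom M M f" and g: "rhom M M g"
    and fg: "\<And>v x. v \<in> verts Q \<Longrightarrow> x \<in> space M v \<Longrightarrow> f v x + g v x = x"
  shows "hom_bij M M f \<or> hom_bij M M g"
proof (rule ccontr)
  assume "\<not> ?thesis"
  then obtain n m where n: "\<forall>v\<in>verts Q. \<forall>x\<in>space M v. (f v ^^ n) x = 0"
     and m: "\<forall>v\<in>verts Q. \<forall>x\<in>space M v. (g v ^^ m) x = 0"
    using indec_bij_or_nilpotent[OF M] f g unfolding hom_bij_def by metis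
  obtain v x where v: "v \<in> verts Q" "x \<in> space M v" "x \<noteq> 0" using indec_nonzero[OF M] by blast
  obtain k where k: "(f v ^^ k) x \<noteq> 0" "(f v ^^ Suc k) x = 0"
  proof -
    have ex: "\<exists>j. (f v ^^ j) x = 0" using n v by blast
    define j where "j = (LEAST j. (f v ^^ j) x = 0)"
    have j: "(f v ^^ j) x = 0" unfolding j_def using LeastI_ex[OF ex] .
    then obtain k where k: "j = Suc k" using v(3) by (cases j) auto
    then have "(f v ^^ k) x \<noteq> 0" using not_less_Least[of k "\<lambda>j. (f v ^^ j) x = 0"] unfolding j_def by simp
    then show ?thesis using that j k by blast
  qed
  let ?y = "(f v ^^ k) x"
  have y: "?y \<in> space M v" using hom_mem[OF hom_funpow[OF f] v(1,2)] .
  have "f v ?y = 0" using k(2) by simp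
  then have gy: "g v ?y = ?y" using fg[OF v(1) y] by simp
  have "(g v ^^ i) ?y = ?y" for i by (induction i) (simp_all add: gy)
  then show False using m v(1) y k(1) by metis
qed

lemma hom_bij_inverse:
  assumes "rep M" "rhom M N f" "hom_bij M N f" obtains g where "inverse_homs M N f g"
  using inverse_homs_exists[OF assms(1,2)] assms(3) unfolding hom_bij_def by blast

lemma inverse_homs_hom_bij: "inverse_homs M N f g \<Longrightarrow> hom_bij M N f"
  using inverse_homs_bij unfolding hom_bij_def by blast

lemma retract_if_comp_bij:
  assumes M: "rep M" and i: "rhom M A i" and p: "rhom A M p" and b: "hom_bij M M (\<lambda>v x. p v (i v x))"
  shows "retract M A"
proof -
  obtain k where "inverse_homs M M (\<lambda>v x. p v (i v x)) k"
    using hom_bij_inverse[OF M hom_comp[OF i p] b] .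
  then have "rhom M M k" "\<forall>v\<in>verts Q. \<forall>x\<in>space M v. k v (p v (i v x)) = x"
    by (auto simp: inverse_homs_def)
  then show ?thesis unfolding retract_def using i hom_comp[OF p] by blast
qed

text \<open>The identity of \<open>M\<close> is the sum of the composites through \<open>A\<close>
  and through \<open>B\<close>; by locality one of them is invertible.\<close>

lemma indec_retract_sum:
  assumes M: "indec M" and A: "rep A" and B: "rep B" and r: "retract M (rep_sum A B)"
  shows "retract M A \<or> retract M B"
proof -
  obtain i p where i: "rhom M (rep_sum A B) i" and p: "rhom (rep_sum A B) M p"
    and pi: "\<And>v x. v \<in> verts Q \<Longrightarrow> x \<in> space M v \<Longrightarrow> p v (i v x) = x"
    using r unfolding retract_def by blast
  have rM: "rep M" using M by (rule indec_rep)
  have iA: "rhom M A (\<lambda>v x. seq_left (i v x))" and iB: "rhom M B (\<lambda>v x. seq_right (i v x))"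
    using hom_comp[OF i hom_left] hom_comp[OF i hom_right] .
  have pA: "rhom A M (\<lambda>v x. p v (seq_pair x 0))" and pB: "rhom B M (\<lambda>v x. p v (seq_pair 0 x))"
    using hom_comp[OF hom_inl[OF B] p] hom_comp[OF hom_inr[OF A] p] .
  have "p v (seq_pair (seq_left (i v x)) 0) + p v (seq_pair 0 (seq_right (i v x))) = x"
    if v: "v \<in> verts Q" "x \<in> space M v" for v x
  proof -
    have "seq_pair (seq_left (i v x)) 0 + seq_pair 0 (seq_right (i v x)) = i v x"
      by (simp flip: seq_pair_linear(1))
    then show ?thesis
      using pi[OF v] hom_mem[OF i v] hom_add[OF p v(1), of "seq_pair (seq_left (i v x)) 0" "seq_pair 0 (seq_right (i v x))"]
      by (simp add: rep_0 A B v)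
  qed
  then show ?thesis
    using indec_local[OF M hom_comp[OF iA pA] hom_comp[OF iB pB]]
      retract_if_comp_bij[OF rM iA pA] retract_if_comp_bij[OF rM iB pB] by blast
qed

text \<open>With \<open>k\<close> the inverse of \<open>p i\<close>, the map \<open>i k p\<close> is
  a nonzero idempotent of the indecomposable \<open>N\<close>, hence the identity.\<close>

lemma indec_comp_bij:
  assumes M: "indec M" and N: "indec N" and i: "rhom M N i" and p: "rhom N M p"
    and b: "hom_bij M M (\<lambda>v x. p v (i v x))"
  shows "hom_bij M N i" "hom_bij N M p"
proof -
  have rM: "rep M" and rN: "rep N" using M N by (simp_all add: indec_rep)
  obtain k where k: "inverse_homs M M (\<lambda>v x. p v (i v x)) k"
    using hom_bij_inverse[OF rM hom_comp[OF i p] b] .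
  then have k1: "rhom M M k" and k2: "\<And>v x. v \<in> verts Q \<Longrightarrow> x \<in> space M v \<Longrightarrow> k v (p v (i v x)) = x"
    and k3: "\<And>v x. v \<in> verts Q \<Longrightarrow> x \<in> space M v \<Longrightarrow> p v (i v (k v x)) = x"
    by (auto simp: inverse_homs_def)
  define e where "e = (\<lambda>v x. i v (k v (p v x)))"
  have e: "rhom N N e" unfolding e_def using hom_comp[OF hom_comp[OF p k1] i] .
  have "e v (e v x) = e v x" if "v \<in> verts Q" "x \<in> space N v" for v x
    unfolding e_def using that by (simp add: k2 hom_mem[OF i] hom_mem[OF k1] hom_mem[OF p])
  then consider "\<forall>v\<in>verts Q. \<forall>x\<in>space N v. e v x = 0" | "\<forall>v\<in>verts Q. \<forall>x\<in>space N v. e v x = x"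
    using N e unfolding indec_iff by blast
  then have e2: "\<And>v x. v \<in> verts Q \<Longrightarrow> x \<in> space N v \<Longrightarrow> e v x = x"
  proof cases
    case 1
    obtain v x where v: "v \<in> verts Q" "x \<in> space M v" "x \<noteq> 0" using indec_nonzero[OF M] by blast
    have "i v x = 0" using 1 v k2 hom_mem[OF i v(1,2)] unfolding e_def by fastforce
    then have "x = 0" using k2[OF v(1,2)] hom_0[OF p rN v(1)] hom_0[OF k1 rM v(1)] by simp
    then show "\<And>v x. v \<in> verts Q \<Longrightarrow> x \<in> space N v \<Longrightarrow> e v x = x" using v(3) by blast
  qed blast
  have "inverse_homs M N i (\<lambda>v x. k v (p v x))"
    unfolding inverse_homs_def using i hom_comp[OF p k1] k2 e2 unfolding e_def by blast
  then show "hom_bij M N i" by (rule inverse_homs_hom_bij)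
  have "inverse_homs N M p (\<lambda>v x. i v (k v x))"
    unfolding inverse_homs_def using p hom_comp[OF k1 i] k3 e2 unfolding e_def by blast
  then show "hom_bij N M p" by (rule inverse_homs_hom_bij)
qed

lemma indec_retract_iso:
  assumes M: "indec M" and N: "indec N" and r: "retract M N" shows "riso M N"
proof -
  obtain i p where i: "rhom M N i" and p: "rhom N M p"
    and pi: "\<And>v x. v \<in> verts Q \<Longrightarrow> x \<in> space M v \<Longrightarrow> p v (i v x) = x"
    using r unfolding retract_def by blast
  have "hom_bij M M (\<lambda>v x. p v (i v x))"
    unfolding hom_bij_def using pi by (intro ballI bij_betw_byWitness[where f' = "\<lambda>x. x"]) auto
  then show ?thesis using indec_comp_bij[OF M N i p] i unfolding rep_iso_def hom_bij_def by blast
qed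

text \<open>
  If \<open>M\<close> were no summand of \<open>B\<close>, then all four maps between the two copies of \<open>M\<close> that factor
  through \<open>N\<close> would be invertible, in particular the off-diagonal ones; but an off-diagonal one is the
  negative of a map that factors through \<open>B\<close>.
\<close>

lemma indec_double_retract_sum:
  assumes M: "indec M" and N: "indec N" and B: "rep B" and r: "retract (rep_sum M M) (rep_sum N B)"
  shows "retract M B"
proof (rule ccontr)
  assume nr: "\<not> retract M B"
  have rM: "rep M" and rN: "rep N" using M N by (simp_all add: indec_rep)
  obtain i p where i: "rhom (rep_sum M M) (rep_sum N B) i" and p: "rhom (rep_sum N B) (rep_sum M M) p"
    and pi: "\<And>v x. v \<in> verts Q \<Longrightarrow> x \<in> space (rep_sum M M) v \<Longrightarrow> p v (i v x) = x"
    using r unfolding retract_def by blast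
  define i1 i2 where "i1 = (\<lambda>v x. i v (seq_pair x 0))" and "i2 = (\<lambda>v x. i v (seq_pair 0 x))"
  define p1 p2 where "p1 = (\<lambda>v x. seq_left (p v x))" and "p2 = (\<lambda>v x. seq_right (p v x))"
  have i12: "rhom M (rep_sum N B) i1" "rhom M (rep_sum N B) i2"
    unfolding i1_def i2_def using hom_comp[OF hom_inl[OF rM] i] hom_comp[OF hom_inr[OF rM] i] .
  have p12: "rhom (rep_sum N B) M p1" "rhom (rep_sum N B) M p2"
    unfolding p1_def p2_def using hom_comp[OF p hom_left] hom_comp[OF p hom_right] .
  have pi11: "p1 v (i1 v x) = x" and pi22: "p2 v (i2 v x) = x" and pi12: "p1 v (i2 v x) = 0"
    if "v \<in> verts Q" "x \<in> space M v" for v x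
    using that rep_0[OF rM] by (simp_all add: pi i1_def i2_def p1_def p2_def)
  let ?L = "\<lambda>j v x. seq_left (j v x)" and ?R = "\<lambda>j v x. seq_right (j v x)"
  let ?l = "\<lambda>q v x. q v (seq_pair x 0)" and ?r = "\<lambda>q v x. q v (seq_pair 0 x)"
  have LR: "rhom M N (?L j)" "rhom M B (?R j)" if "rhom M (rep_sum N B) j" for j
    using hom_comp[OF that hom_left] hom_comp[OF that hom_right] .
  have lr: "rhom N M (?l q)" "rhom B M (?r q)" if "rhom (rep_sum N B) M q" for q
    using hom_comp[OF hom_inl[OF B] that] hom_comp[OF hom_inr[OF rN] that] .
  have split: "?l q v (?L j v x) + ?r q v (?R j v x) = q v (j v x)"
    if j: "rhom M (rep_sum N B) j" and q: "rhom (rep_sum N B) M q" and v: "v \<in> verts Q" "x \<in> space M v" for j q v x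
  proof -
    have "seq_pair (seq_left (j v x)) 0 + seq_pair 0 (seq_right (j v x)) = j v x"
      by (simp flip: seq_pair_linear(1))
    then show ?thesis
      using hom_mem[OF j v] hom_add[OF q v(1), of "seq_pair (seq_left (j v x)) 0" "seq_pair 0 (seq_right (j v x))"]
      by (simp add: rep_0 rN B v)
  qed
  have nb: "\<not> hom_bij M M (\<lambda>v x. ?r q v (?R j v x))"
    if "rhom M (rep_sum N B) j" "rhom (rep_sum N B) M q" for j q
    using retract_if_comp_bij[OF rM LR(2)[OF that(1)] lr(2)[OF that(2)]] nr by blast
  have b: "hom_bij M M (\<lambda>v x. ?l q v (?L j v x))"
    if j: "rhom M (rep_sum N B) j" and q: "rhom (rep_sum N B) M q"
      and qj: "\<And>v x. v \<in> verts Q \<Longrightarrow> x \<in> space M v \<Longrightarrow> q v (j v x) = x" for j q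
    using indec_local[OF M hom_comp[OF LR(1)[OF j] lr(1)[OF q]] hom_comp[OF LR(2)[OF j] lr(2)[OF q]]]
      split[OF j q] qj nb[OF j q] by simp
  have b1: "hom_bij N M (?l p1)"
    using indec_comp_bij(2)[OF M N LR(1)[OF i12(1)] lr(1)[OF p12(1)] b[OF i12(1) p12(1) pi11]] .
  have b2: "hom_bij M N (?L i2)"
    using indec_comp_bij(1)[OF M N LR(1)[OF i12(2)] lr(1)[OF p12(2)] b[OF i12(2) p12(2) pi22]] .
  have "hom_bij M M (\<lambda>v x. ?r p1 v (?R i2 v x))"
    unfolding hom_bij_def
  proof
    fix v assume v: "v \<in> verts Q"
    have "bij_betw (\<lambda>x. ?l p1 v (?L i2 v x)) (space M v) (space M v)"
      using bij_betw_trans[OF hom_bijD[OF b2 v] hom_bijD[OF b1 v]] by (simp add: comp_def)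
    moreover have "bij_betw uminus (space M v) (space M v)"
      using seq.subspace_neg[OF rep_subspace[OF rM v]] by (intro bij_betw_byWitness[where f' = uminus]) auto
    ultimately have "bij_betw (\<lambda>x. - ?l p1 v (?L i2 v x)) (space M v) (space M v)"
      using bij_betw_trans[of _ "space M v" "space M v" uminus "space M v"] by (simp add: comp_def)
    moreover have "- ?l p1 v (?L i2 v x) = ?r p1 v (?R i2 v x)" if "x \<in> space M v" for x
    proof -
      have "?l p1 v (?L i2 v x) + ?r p1 v (?R i2 v x) = 0"
        using split[OF i12(2) p12(1) v that] pi12[OF v that] by simp
      then show ?thesis by (rule minus_unique)
    qed
    ultimately show "bij_betw (\<lambda>x. ?r p1 v (?R i2 v x)) (space M v) (space M v)"
      by (metis (no_types, lifting) bij_betw_cong)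
  qed
  then show False using nb[OF i12(2) p12(1)] by blast
qed

subsection \<open>Direct sums of lists\<close>

lemma inverse_homs_sum:
  assumes "inverse_homs A A' f f'" "inverse_homs B B' g g'"
  shows "inverse_homs (rep_sum A B) (rep_sum A' B')
     (\<lambda>v z. seq_pair (f v (seq_left z)) (g v (seq_right z)))
     (\<lambda>v z. seq_pair (f' v (seq_left z)) (g' v (seq_right z)))"
  using assms hom_pair[OF hom_comp[OF hom_left] hom_comp[OF hom_right]]
  unfolding inverse_homs_def by simp

lemma iso_sum_cong:
  "rep A \<Longrightarrow> rep B \<Longrightarrow> riso A A' \<Longrightarrow> riso B B' \<Longrightarrow> riso (rep_sum A B) (rep_sum A' B')"
proof -
  assume "rep A" "rep B" "riso A A'" "riso B B'"
  then obtain f f' g g' where "inverse_homs A A' f f'" "inverse_homs B B' g g'" using iso_iff by metis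
  then show ?thesis using isoI[OF inverse_homs_sum] by blast
qed

lemma iso_sum_swap: "riso (rep_sum A (rep_sum B C)) (rep_sum B (rep_sum A C))"
proof -
  let ?f = "\<lambda>(v :: 'v) z. seq_pair (seq_left (seq_right z)) (seq_pair (seq_left z) (seq_right (seq_right z)))"
  have f: "rhom (rep_sum A (rep_sum B C)) (rep_sum B (rep_sum A C)) ?f" for A B C :: "('v, 'a, 'k) rep"
    using hom_pair[OF hom_comp[OF hom_right hom_left] hom_pair[OF hom_left hom_comp[OF hom_right hom_right]]] .
  show ?thesis
    by (rule isoI[where f = ?f and g = ?f]) (use f in \<open>simp add: inverse_homs_def\<close>)
qed

lemma rep_sum_list_simps [simp]:
  "rep_sum_list [] = zero_rep" "rep_sum_list (M # Ms) = rep_sum M (rep_sum_list Ms)"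
  by (simp_all add: rep_sum_list_def)

lemma rep_rep_sum_list: "\<forall>M\<in>set Ms. rep M \<Longrightarrow> rep (rep_sum_list Ms)"
  by (induction Ms) (simp_all add: rep_zero_rep rep_rep_sum)

lemma retract_rep_sum_list: "M \<in> set Ms \<Longrightarrow> \<forall>M\<in>set Ms. rep M \<Longrightarrow> retract M (rep_sum_list Ms)"
proof (induction Ms)
  case (Cons N Ms)
  then have r: "rep N" "rep (rep_sum_list Ms)" using rep_rep_sum_list by auto
  show ?case
  proof (cases "M = N")
    case True
    then show ?thesis using retract_left[OF r(2)] by simp
  next
    case False
    then show ?thesis using Cons retract_trans[OF _ retract_right[OF r(1)]] by simp
  qed
qed simp

lemma indec_retract_rep_sum_list:
  assumes M: "indec M" and r: "retract M (rep_sum_list Ms)" and Ms: "\<forall>M\<in>set Ms. rep M"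
  shows "\<exists>N\<in>set Ms. retract M N"
  using r Ms
proof (induction Ms)
  case Nil
  then obtain i p where i: "rhom M zero_rep i" and p: "rhom zero_rep M p"
    and pi: "\<And>v x. v \<in> verts Q \<Longrightarrow> x \<in> space M v \<Longrightarrow> p v (i v x) = x"
    unfolding retract_def by auto
  obtain v x where v: "v \<in> verts Q" "x \<in> space M v" "x \<noteq> 0" using indec_nonzero[OF M] by blast
  have "i v x = 0" using hom_mem[OF i v(1,2)] by (simp add: zero_rep_def)
  then have "x = 0" using pi[OF v(1,2)] hom_0[OF p rep_zero_rep v(1)] by simp
  then show ?case using v(3) by simp
next
  case (Cons N Ms)
  then show ?case using indec_retract_sum[OF M, of N "rep_sum_list Ms"] rep_rep_sum_list[of Ms] by auto
qed

lemma rep_sum_list_remove: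
  assumes "\<forall>M\<in>set (xs @ y # ys). rep M"
  shows "riso (rep_sum_list (xs @ y # ys)) (rep_sum y (rep_sum_list (xs @ ys)))"
  using assms
proof (induction xs)
  case (Cons x xs)
  have "riso (rep_sum x (rep_sum_list (xs @ y # ys))) (rep_sum x (rep_sum y (rep_sum_list (xs @ ys))))"
    using Cons rep_rep_sum_list[of "xs @ y # ys"] by (intro iso_sum_cong) (auto simp: iso_refl)
  then show ?case using iso_sum_swap iso_trans by (metis append_Cons rep_sum_list_simps(2))
qed (simp add: iso_refl)

text \<open>Each module is compared only with later ones, which suits induction over the list;
  \<open>nonisos_iff\<close> restores the symmetric form of \<open>basic_rep\<close>.\<close>

abbreviation nonisos :: "('v, 'a, 'k) rep list \<Rightarrow> bool" where
  "nonisos \<equiv> sorted_wrt (\<lambda>M N. \<not> riso M N)"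

lemma nonisos_iff:
  assumes "\<forall>M\<in>set Ms. rep M"
  shows "nonisos Ms \<longleftrightarrow> (\<forall>i<length Ms. \<forall>j<length Ms. i \<noteq> j \<longrightarrow> \<not> riso (Ms ! i) (Ms ! j))"
proof
  assume "nonisos Ms"
  then have *: "\<not> riso (Ms ! i) (Ms ! j)" if "i < j" "j < length Ms" for i j
    using that by (simp add: sorted_wrt_iff_nth_less)
  show "\<forall>i<length Ms. \<forall>j<length Ms. i \<noteq> j \<longrightarrow> \<not> riso (Ms ! i) (Ms ! j)"
  proof (intro allI impI)
    fix i j assume ij: "i < length Ms" "j < length Ms" "i \<noteq> j"
    have "rep (Ms ! i)" using assms ij(1) by simp
    then have "riso (Ms ! i) (Ms ! j) \<Longrightarrow> riso (Ms ! j) (Ms ! i)" by (rule iso_sym)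
    then show "\<not> riso (Ms ! i) (Ms ! j)" using *[of i j] *[of j i] ij by linarith
  qed
qed (simp add: sorted_wrt_iff_nth_less)

lemma basic_rep_iff:
  "basic_rep Q I T \<longleftrightarrow> rep T \<and>
     (\<exists>Ms. (\<forall>M\<in>set Ms. indec M) \<and> nonisos Ms \<and> riso T (rep_sum_list Ms))"
  unfolding basic_rep_def using nonisos_iff indec_rep by blast

text \<open>One copy of \<open>M\<close> accounts for a listed module \<open>N\<close>. After
  removing \<open>N\<close> the other copy is still a retract of the rest, and so is isomorphic to a
  second listed module.\<close>

lemma basic_rep_no_double:
  assumes T: "basic_rep Q I T" and M: "indec M" shows "\<not> retract (rep_sum M M) T"
proof
  assume r: "retract (rep_sum M M) T"
  obtain Ms where Ms: "\<forall>M\<in>set Ms. indec M" "nonisos Ms" "riso T (rep_sum_list Ms)" and rT: "rep T"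
    using T unfolding basic_rep_iff by blast
  have rMs: "\<forall>M\<in>set Ms. rep M" and rM: "rep M" using Ms(1) M indec_rep by blast+
  have r': "retract (rep_sum M M) (rep_sum_list Ms)"
    using retract_trans[OF r retract_iso[OF rT Ms(3)]] .
  then have "retract M (rep_sum_list Ms)" using retract_trans[OF retract_left[OF rM]] by blast
  then obtain N where N: "N \<in> set Ms" "retract M N"
    using indec_retract_rep_sum_list[OF M] rMs by blast
  obtain xs ys where xs: "Ms = xs @ N # ys" using N(1) split_list by metis
  have rr: "rep (rep_sum_list (xs @ ys))" using rMs xs by (intro rep_rep_sum_list) auto
  have "retract (rep_sum M M) (rep_sum N (rep_sum_list (xs @ ys)))"
    using retract_trans[OF r'] retract_iso[OF _ rep_sum_list_remove] rMs rep_rep_sum_list unfolding xs by blast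
  then have "retract M (rep_sum_list (xs @ ys))"
    using indec_double_retract_sum[OF M _ rr] N(1) Ms(1) by blast
  then obtain N' where N': "N' \<in> set (xs @ ys)" "retract M N'"
    using indec_retract_rep_sum_list[OF M, of "xs @ ys"] rMs xs by auto
  have iN': "indec N'" and iN: "indec N" using N' N(1) Ms(1) xs by auto
  have M1: "riso M N" "riso M N'" using indec_retract_iso[OF M] iN iN' N N' by blast+
  then have "riso N N'" "riso N' N" using iso_sym[OF rM] iso_trans by blast+
  then show False using Ms(2) N'(1) unfolding xs by (auto simp: sorted_wrt_append)
qed

text \<open>The first module is matched with its partner, which is then moved to the front and
  removed. Since neither list repeats a module up to isomorphism, no other module needs that
  partner.\<close>

lemma rep_sum_list_iso:
  assumes "\<forall>M\<in>set Ms. rep M" "\<forall>N\<in>set Ns. rep N" "nonisos Ms" "nonisos Ns"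
    and "\<forall>M\<in>set Ms. \<exists>N\<in>set Ns. riso M N" "\<forall>N\<in>set Ns. \<exists>M\<in>set Ms. riso M N"
  shows "riso (rep_sum_list Ms) (rep_sum_list Ns)"
  using assms
proof (induction Ms arbitrary: Ns)
  case Nil
  then have "Ns = []" by (cases Ns) auto
  then show ?case by (simp add: iso_refl)
next
  case (Cons M Ms)
  then obtain N where N: "N \<in> set Ns" "riso M N" by auto
  obtain xs ys where xs: "Ns = xs @ N # ys" using N(1) split_list by metis
  have rM: "rep M" and rN: "rep N" using Cons.prems N by auto
  have "riso (rep_sum_list Ms) (rep_sum_list (xs @ ys))"
  proof (rule Cons.IH)
    show "\<forall>M'\<in>set Ms. \<exists>N\<in>set (xs @ ys). riso M' N"
    proof
      fix M' assume M': "M' \<in> set Ms"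
      then obtain N' where N': "N' \<in> set Ns" "riso M' N'" using Cons.prems(5) by auto
      have "N' \<noteq> N"
      proof
        assume "N' = N"
        then have "riso N M'" using N'(2) iso_sym[of M' N] M' Cons.prems(1) by simp
        then have "riso M M'" by (rule iso_trans[OF N(2)])
        then show False using Cons.prems(3) M' by simp
      qed
      then show "\<exists>N\<in>set (xs @ ys). riso M' N" using N' xs by auto
    qed
    show "\<forall>N\<in>set (xs @ ys). \<exists>M\<in>set Ms. riso M N"
    proof
      fix N' assume N': "N' \<in> set (xs @ ys)"
      then obtain M' where M': "M' \<in> set (M # Ms)" "riso M' N'" using Cons.prems(6) xs by auto
      have "M' \<noteq> M"
      proof
        assume "M' = M"
        then have "riso N N'" "riso N' N" using N(2) M'(2) iso_sym[OF rM] iso_trans by blast+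
        then show False using Cons.prems(4) N' xs by (auto simp: sorted_wrt_append)
      qed
      then show "\<exists>M\<in>set Ms. riso M N'" using M' by auto
    qed
  qed (use Cons.prems xs in \<open>auto simp: sorted_wrt_append\<close>)
  then have "riso (rep_sum M (rep_sum_list Ms)) (rep_sum N (rep_sum_list (xs @ ys)))"
    using N(2) Cons.prems(1) rep_rep_sum_list by (intro iso_sum_cong) auto
  moreover have "riso (rep_sum N (rep_sum_list (xs @ ys))) (rep_sum_list Ns)"
    using iso_sym[OF rep_rep_sum_list[OF Cons.prems(2)]] rep_sum_list_remove[of xs N ys] Cons.prems(2)
    unfolding xs by simp
  ultimately show ?case using iso_trans by (metis rep_sum_list_simps(2))
qed

end

section \<open>String modules are indecomposable\<close>

fun linv :: "'a letter \<Rightarrow> 'a letter" where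
  "linv (Fwd a) = Inv a"
| "linv (Inv a) = Fwd a"

lemma linv_linv [simp]: "linv (linv l) = l"
  by (cases l) auto

lemma linv_neq [simp]: "linv l \<noteq> l" "l \<noteq> linv l"
  by (cases l; simp)+

lemma linv_eq_iff: "linv l = k \<longleftrightarrow> l = linv k"
  by auto

definition reduced :: "'a letter list \<Rightarrow> bool" where
  "reduced ls \<longleftrightarrow> (\<forall>i. Suc i < length ls \<longrightarrow> ls ! Suc i \<noteq> linv (ls ! i))"

text \<open>The walk is seen as a graph on the positions \<open>0\<close> to
  \<open>length ls\<close>, traversable in both directions. An edge labelled \<open>Fwd a\<close>
  from \<open>i\<close> to \<open>i'\<close> means that the arrow \<open>a\<close> sends the
  \<open>i\<close>-th basis vector to the \<open>i'\<close>-th.\<close>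

definition edge :: "'a letter list \<Rightarrow> nat \<Rightarrow> 'a letter \<Rightarrow> nat \<Rightarrow> bool" where
  "edge ls i l i' \<longleftrightarrow> i' = Suc i \<and> i < length ls \<and> ls ! i = l \<or> i = Suc i' \<and> i' < length ls \<and> ls ! i' = linv l"

lemma edge_linv: "edge ls i' (linv l) i \<longleftrightarrow> edge ls i l i'"
  by (auto simp: edge_def)

lemma edge_le: "edge ls i l i' \<Longrightarrow> i \<le> length ls \<and> i' \<le> length ls"
  by (auto simp: edge_def)

lemma edge_unique: "reduced ls \<Longrightarrow> edge ls i l i' \<Longrightarrow> edge ls i l i'' \<Longrightarrow> i' = i''"
  unfolding edge_def reduced_def by (metis Suc_inject linv_linv)

text \<open>
  A nonzero \<open>(i, j)\<close> entry of an endomorphism of a string module forces \<open>simulates ls i j\<close>, which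
  is a partial order.  Hence endomorphisms are triangular.
\<close>

definition simulation :: "'a letter list \<Rightarrow> (nat \<Rightarrow> nat \<Rightarrow> bool) \<Rightarrow> bool" where
  "simulation ls S \<longleftrightarrow> (\<forall>i j. S i j \<longrightarrow> i \<le> length ls \<and> j \<le> length ls \<and>
     (\<forall>a j'. edge ls j (Fwd a) j' \<longrightarrow> (\<exists>i'. edge ls i (Fwd a) i' \<and> S i' j')) \<and>
     (\<forall>a i'. edge ls i (Inv a) i' \<longrightarrow> (\<exists>j'. edge ls j (Inv a) j' \<and> S i' j')))"

text \<open>The union of all simulations; the next lemmas say that it is a simulation
  itself.\<close>

definition simulates :: "'a letter list \<Rightarrow> nat \<Rightarrow> nat \<Rightarrow> bool" where
  "simulates ls i j \<longleftrightarrow> (\<exists>S. simulation ls S \<and> S i j)"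

lemma simulates_le: "simulates ls i j \<Longrightarrow> i \<le> length ls \<and> j \<le> length ls"
  unfolding simulates_def simulation_def by blast

lemma simulates_Fwd:
  assumes "simulates ls i j" "edge ls j (Fwd a) j'" shows "\<exists>i'. edge ls i (Fwd a) i' \<and> simulates ls i' j'"
proof -
  obtain S where S: "simulation ls S" "S i j" using assms(1) unfolding simulates_def by blast
  obtain k where k: "edge ls i (Fwd a) k" "S k j'"
    using S(2) assms(2) S(1)[unfolded simulation_def, rule_format] by meson
  have "simulates ls k j'" unfolding simulates_def using S(1) k(2) by (intro exI[of _ S] conjI)
  then show ?thesis using k(1) by (intro exI[of _ k] conjI)
qed

lemma simulates_Inv:
  assumes "simulates ls i j" "edge ls i (Inv a) i'" shows "\<exists>j'. edge ls j (Inv a) j' \<and> simulates ls i' j'"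
proof -
  obtain S where S: "simulation ls S" "S i j" using assms(1) unfolding simulates_def by blast
  obtain k where k: "edge ls j (Inv a) k" "S i' k"
    using S(2) assms(2) S(1)[unfolded simulation_def, rule_format] by meson
  have "simulates ls i' k" unfolding simulates_def using S(1) k(2) by (intro exI[of _ S] conjI)
  then show ?thesis using k(1) by (intro exI[of _ k] conjI)
qed

lemma simulates_trans:
  assumes "simulates ls i j" "simulates ls j k" shows "simulates ls i k"
proof -
  have "simulation ls (\<lambda>i k. \<exists>j. simulates ls i j \<and> simulates ls j k)"
    unfolding simulation_def
  proof (intro allI impI conjI; elim exE conjE)
    fix i j k assume ij: "simulates ls i j" and jk: "simulates ls j k"
    show "i \<le> length ls" "k \<le> length ls" using simulates_le[OF ij] simulates_le[OF jk] by auto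
    fix a k' assume "edge ls k (Fwd a) k'"
    then obtain j' where j': "edge ls j (Fwd a) j'" "simulates ls j' k'" using simulates_Fwd[OF jk] by metis
    then obtain i' where "edge ls i (Fwd a) i'" "simulates ls i' j'" using simulates_Fwd[OF ij] by metis
    then show "\<exists>i'. edge ls i (Fwd a) i' \<and> (\<exists>j. simulates ls i' j \<and> simulates ls j k')" using j'(2) by metis
  next
    fix i j k a i' assume ij: "simulates ls i j" and jk: "simulates ls j k" and "edge ls i (Inv a) i'"
    then obtain j' where j': "edge ls j (Inv a) j'" "simulates ls i' j'" using simulates_Inv by metis
    then obtain k' where "edge ls k (Inv a) k'" "simulates ls j' k'" using simulates_Inv[OF jk] by metis
    then show "\<exists>k'. edge ls k (Inv a) k' \<and> (\<exists>j. simulates ls i' j \<and> simulates ls j k')" using j'(2) by metis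
  qed
  then show ?thesis using assms unfolding simulates_def[of ls i k] by blast
qed

text \<open>Positions that simulate each other see the same letters and can be moved in parallel.
  Two different ones lead to position \<open>0\<close> paired with the last position, and from there
  to the conclusion that the walk equals its own inverse. No reduced walk of positive length
  does.\<close>

lemma simulates_antisym:
  assumes red: "reduced ls" and ij: "simulates ls i j" "simulates ls j i"
  shows "i = j"
proof (rule ccontr)
  assume "i \<noteq> j"
  define S where "S = (\<lambda>i j. simulates ls i j \<and> simulates ls j i)"
  let ?n = "length ls"
  have S_sym: "S i j \<Longrightarrow> S j i" for i j by (auto simp: S_def)
  have S_le: "S i j \<Longrightarrow> i \<le> ?n \<and> j \<le> ?n" for i j using simulates_le unfolding S_def by blast
  have S_edge: "\<exists>j'. edge ls j l j' \<and> S i' j'" if "S i j" "edge ls i l i'" for i j l i'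
  proof (cases l)
    case (Fwd a)
    then show ?thesis
      using that simulates_Fwd[of ls j i a i'] simulates_Fwd[of ls i j a] edge_unique[OF red] unfolding S_def by metis
  next
    case (Inv a)
    then show ?thesis
      using that simulates_Inv[of ls i j a i'] simulates_Inv[of ls j i a] edge_unique[OF red] unfolding S_def by metis
  qed
  \<comment> \<open>Both positions follow the letter that leads the smaller one to the left. The
    larger one may move either way but stays ahead.\<close>
  have "\<exists>j>0. S 0 j" if "S i j" "i < j" for i j
    using that
  proof (induction i arbitrary: j)
    case (Suc i)
    have "edge ls (Suc i) (linv (ls ! i)) i" using S_le[OF Suc.prems(1)] by (simp add: edge_def)
    then obtain j' where j': "edge ls j (linv (ls ! i)) j'" "S i j'" using S_edge Suc.prems(1) by blast
    then have "i < j'" using Suc.prems(2) by (auto simp: edge_def)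
    then show ?case using Suc.IH j'(2) by blast
  qed blast
  then obtain j where j: "j > 0" "S 0 j"
    using ij \<open>i \<noteq> j\<close> by (metis S_def linorder_neqE_nat)
  \<comment> \<open>An inner position has two neighbours, but position \<open>0\<close> offers only
    one edge to match both. The two letters at \<open>j\<close> would then be inverse to each
    other.\<close>
  have jn: "j = ?n"
  proof (rule ccontr)
    assume "j \<noteq> ?n"
    then have jl: "j < ?n" using S_le[OF j(2)] by simp
    have "edge ls j (ls ! j) (Suc j)" "edge ls j (linv (ls ! (j - 1))) (j - 1)"
      using jl j(1) by (auto simp: edge_def)
    then have "edge ls 0 (ls ! j) 1" "edge ls 0 (linv (ls ! (j - 1))) 1"
      using S_edge[OF S_sym[OF j(2)]] unfolding edge_def by (metis One_nat_def nat.distinct(1))+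
    then have "ls ! j = ls ! 0" "linv (ls ! (j - 1)) = ls ! 0" by (auto simp: edge_def)
    moreover have "ls ! Suc (j - 1) \<noteq> linv (ls ! (j - 1))"
      using red jl j(1) unfolding reduced_def by (metis Suc_diff_1)
    ultimately show False using j(1) by simp
  qed
  \<comment> \<open>The positions \<open>k\<close> and \<open>?n - k\<close> are moved towards each
    other. Turning back instead would again meet a letter next to its inverse.\<close>
  have *: "k \<le> ?n \<Longrightarrow> S k (?n - k) \<and> (k > 0 \<longrightarrow> ls ! (k - 1) = linv (ls ! (?n - k)))" for k
  proof (induction k)
    case 0
    then show ?case using j jn by simp
  next
    case (Suc k)
    have "edge ls k (ls ! k) (Suc k)" using Suc.prems by (simp add: edge_def)
    then obtain j' where j': "edge ls (?n - k) (ls ! k) j'" "S (Suc k) j'" using S_edge Suc by fastforce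
    show ?case
    proof (cases "j' = Suc (?n - k)")
      case True
      then have k: "k > 0" "ls ! (?n - k) = ls ! k" using j'(1) Suc.prems by (auto simp: edge_def)
      then have "ls ! (k - 1) = linv (ls ! k)" using Suc by simp
      then have "ls ! Suc (k - 1) = linv (ls ! (k - 1))" using k by simp
      then show ?thesis using red k Suc.prems unfolding reduced_def by (metis Suc_diff_1 Suc_le_lessD)
    next
      case False
      then have "?n - k = Suc j'" "ls ! j' = linv (ls ! k)" using j'(1) by (auto simp: edge_def)
      then have "j' = ?n - Suc k" "ls ! k = linv (ls ! j')" by auto
      then show ?thesis using j'(2) by (metis diff_Suc_1)
    qed
  qed
  \<comment> \<open>In even length the two middle letters would be inverse neighbours; in odd length
    the middle letter would be its own inverse.\<close>
  obtain m where "?n = 2 * m \<or> ?n = 2 * m + 1" by (meson evenE oddE)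
  then show False
  proof
    assume m: "?n = 2 * m"
    then have "ls ! (m - 1) = linv (ls ! m)" "m > 0" using *[of m] j(1) jn by auto
    then have "ls ! Suc (m - 1) = linv (ls ! (m - 1))" by simp
    moreover have "Suc (m - 1) < length ls" using m \<open>m > 0\<close> by simp
    ultimately show False using red unfolding reduced_def by blast
  next
    assume "?n = 2 * m + 1"
    then have "ls ! m = linv (ls ! m)" using *[of "Suc m"] by simp
    then show False by simp
  qed
qed

lemma simulates_finite: "finite {k. simulates ls i k}"
  using simulates_le by (metis (no_types, lifting) finite_nat_set_iff_bounded_le mem_Collect_eq)

definition unit_seq :: "nat \<Rightarrow> nat \<Rightarrow> 'k::field" where
  "unit_seq k = (\<lambda>j. if j = k then 1 else 0)"

lemma unit_seq_apply [simp]: "unit_seq k j = (if j = k then 1 else 0)"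
  by (simp add: unit_seq_def)

lemma sum_seq_apply: "(\<Sum>k\<in>A. f k) j = (\<Sum>k\<in>A. f k j :: 'k::field)"
  by (induction A rule: infinite_finite_induct) auto

lemma seq_expand:
  assumes "finite A" "\<And>i. x i \<noteq> 0 \<Longrightarrow> i \<in> A"
  shows "x = (\<Sum>k\<in>A. seq_scale (x k) (unit_seq k))"
proof
  fix j
  have "(\<Sum>k\<in>A. seq_scale (x k) (unit_seq k)) j = (\<Sum>k\<in>A. if j = k then x k else 0)"
    unfolding sum_seq_apply by (intro sum.cong) auto
  then show "x j = (\<Sum>k\<in>A. seq_scale (x k) (unit_seq k)) j" using assms by auto
qed

lemma fin_dim_subspace_support:
  assumes "finite A" shows "fin_dim_subspace {x :: nat \<Rightarrow> 'k::field. \<forall>i. x i \<noteq> 0 \<longrightarrow> i \<in> A}" (is "fin_dim_subspace ?V")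
proof -
  have V: "seq.subspace ?V" by (rule seq.subspaceI) (auto, metis add.right_neutral)
  have "seq.span (unit_seq ` A) = ?V"
  proof
    show "seq.span (unit_seq ` A) \<subseteq> ?V" using V by (intro seq.span_minimal) (auto split: if_splits)
    show "?V \<subseteq> seq.span (unit_seq ` A)"
    proof
      fix x :: "nat \<Rightarrow> 'k" assume "x \<in> ?V"
      then have "x = (\<Sum>k\<in>A. seq_scale (x k) (unit_seq k))" using seq_expand[OF assms, of x] by blast
      also have "\<dots> \<in> seq.span (unit_seq ` A)"
        by (intro seq.span_sum seq.span_scale seq.span_base) auto
      finally show "x \<in> seq.span (unit_seq ` A)" .
    qed
  qed
  then show ?thesis unfolding fin_dim_subspace_def using V assms by blast
qed

context monomial_quiver
begin

abbreviation "string \<equiv> is_string Q I"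
abbreviation SM :: "'v \<times> 'a letter list \<Rightarrow> ('v, 'a, 'k) rep" where "SM \<equiv> string_module Q"
abbreviation "sv w i \<equiv> string_verts Q w ! i"
abbreviation slen :: "'v \<times> 'a letter list \<Rightarrow> nat" where "slen w \<equiv> length (snd w)"

lemma mem_SM [simp]: "x \<in> space (SM w) v \<longleftrightarrow> (\<forall>i. x i \<noteq> 0 \<longrightarrow> i \<le> slen w \<and> sv w i = v)"
  by (simp add: string_module_def)

lemma act_SM: "act (SM w) a x j =
    (if 0 < j \<and> j \<le> slen w \<and> snd w ! (j - 1) = Fwd a then x (j - 1) else 0) +
    (if j < slen w \<and> snd w ! j = Inv a then x (Suc j) else 0)"
  by (simp add: string_module_def)

lemma letters_ok_linv [simp]: "\<not> letters_ok Q I l (linv l)"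
  by (cases l) auto

lemma string_reduced: "string w \<Longrightarrow> reduced (snd w)"
  unfolding is_string_def reduced_def using letters_ok_linv by metis

lemma
  assumes "string w" "i < slen w"
  shows string_arc: "larrow (snd w ! i) \<in> arcs Q"
    and string_source: "lsource Q (snd w ! i) = sv w i"
    and string_target: "ltarget Q (snd w ! i) = sv w (Suc i)"
  using assms by (auto simp: is_string_def string_verts_def)

lemma sv_0 [simp]: "sv w 0 = fst w"
  by (simp add: string_verts_def)

lemma string_sv_verts: "string w \<Longrightarrow> i \<le> slen w \<Longrightarrow> sv w i \<in> verts Q"
proof (cases i)
  case (Suc j)
  assume w: "string w" "i \<le> slen w"
  then have j: "j < slen w" using Suc by simp
  show ?thesis
    using string_arc[OF w(1) j] string_target[OF w(1) j] head_in_verts tail_in_verts unfolding Suc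
    by (cases "snd w ! j") (metis larrow.simps ltarget.simps)+
qed (simp add: is_string_def string_verts_def)

lemma string_edge:
  assumes "string w" "edge (snd w) i (Fwd a) j"
  shows "a \<in> arcs Q" "tail Q a = sv w i" "head Q a = sv w j"
  using assms string_arc[OF assms(1)] string_source[OF assms(1)] string_target[OF assms(1)]
  unfolding edge_def by (fastforce)+

lemma act_SM_edge:
  assumes w: "string w" and e: "edge (snd w) i (Fwd a) j"
  shows "act (SM w) a x j = x i"
proof -
  \<comment> \<open>Both summands of \<open>act_SM\<close> can be present at \<open>j\<close> only
    if the letters around \<open>j\<close> are \<open>a\<close> and its inverse.\<close>
  have "\<not> (snd w ! (j - 1) = Fwd a \<and> snd w ! j = Inv a)" if "0 < j" "j < slen w"
    using string_reduced[OF w] that unfolding reduced_def by (metis Suc_diff_1 linv.simps(1))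
  then show ?thesis using e unfolding act_SM edge_def by auto
qed

lemma act_SM_no_edge:
  assumes "\<And>i. \<not> edge (snd w) i (Fwd a) j"
  shows "act (SM w) a x j = 0"
  using assms[of "j - 1"] assms[of "Suc j"] unfolding act_SM edge_def by auto

lemma act_SM_unit:
  assumes w: "string w" and e: "edge (snd w) i (Fwd a) j"
  shows "act (SM w) a (unit_seq i) = unit_seq j"
proof
  fix k
  show "act (SM w) a (unit_seq i) k = unit_seq j k"
  proof (cases "\<exists>i'. edge (snd w) i' (Fwd a) k")
    case True
    then obtain i' where i': "edge (snd w) i' (Fwd a) k" by blast
    have "i' = i \<longleftrightarrow> k = j"
      using edge_unique[OF string_reduced[OF w]] e i' edge_linv[of "snd w" k "Fwd a" i'] edge_linv[of "snd w" j "Fwd a" i]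
      by metis
    then show ?thesis using act_SM_edge[OF w i'] by auto
  next
    case False
    then show ?thesis using act_SM_no_edge e by auto
  qed
qed

lemma act_SM_unit_0:
  assumes w: "string w" and e: "\<And>j. \<not> edge (snd w) i (Fwd a) j"
  shows "act (SM w) a (unit_seq i) = 0"
proof
  fix k
  show "act (SM w) a (unit_seq i) k = 0 k"
  proof (cases "\<exists>i'. edge (snd w) i' (Fwd a) k")
    case True
    then show ?thesis using act_SM_edge[OF w] e by fastforce
  next
    case False
    then show ?thesis using act_SM_no_edge by auto
  qed
qed

lemma unit_seq_mem: "i \<le> slen w \<Longrightarrow> sv w i = v \<Longrightarrow> unit_seq i \<in> space (SM w) v"
  by simp

lemma SM_expand: "x \<in> space (SM w) v \<Longrightarrow> x = (\<Sum>k\<le>slen w. seq_scale (x k) (unit_seq k))"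
  by (rule seq_expand) auto

lemma rep_SM:
  assumes w: "string w" shows "rep (SM w)"
  unfolding rep_iff
proof (intro conjI ballI impI)
  fix v assume "v \<in> verts Q"
  show "fin_dim_subspace (space (SM w) v)"
    using fin_dim_subspace_support[of "{i. i \<le> slen w \<and> sv w i = v}"] by (simp add: string_module_def)
next
  fix a assume a: "a \<in> arcs Q"
  show "linear_map (space (SM w) (tail Q a)) (space (SM w) (head Q a)) (act (SM w) a)"
    unfolding linear_map_def
  proof (intro conjI ballI allI Pi_I)
    fix x assume x: "x \<in> space (SM w) (tail Q a)"
    have "j \<le> slen w \<and> sv w j = head Q a" if j: "act (SM w) a x j \<noteq> 0" for j
    proof -
      obtain i where "edge (snd w) i (Fwd a) j" using j act_SM_no_edge by metis
      then show ?thesis using string_edge(3)[OF w] edge_le by metis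
    qed
    then show "act (SM w) a x \<in> space (SM w) (head Q a)" by simp
  qed (auto simp: act_SM fun_eq_iff algebra_simps)
next
  fix a b x assume ab: "a \<in> arcs Q" "b \<in> arcs Q" "head Q a = tail Q b" "zero_rel a b" "x \<in> space (SM w) (tail Q a)"
  show "act (SM w) b (act (SM w) a x) = 0"
  proof (rule ext, rule ccontr)
    fix k assume k: "act (SM w) b (act (SM w) a x) k \<noteq> 0 k"
    then obtain j where j: "edge (snd w) j (Fwd b) k" using act_SM_no_edge by fastforce
    then have "act (SM w) a x j \<noteq> 0" using k act_SM_edge[OF w j] by simp
    then obtain i where i: "edge (snd w) i (Fwd a) j" using act_SM_no_edge by fastforce
    have ok: "letters_ok Q I (snd w ! m) (snd w ! Suc m)" if "Suc m < slen w" for m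
      using w that by (simp add: is_string_def)
    \<comment> \<open>Two consecutive edges labelled \<open>Fwd a\<close> and \<open>Fwd b\<close>
      cannot turn back at \<open>j\<close>, since one letter would have to be both direct and
      inverse. Running straight on, they spell \<open>a b\<close> or its inverse, which no string
      contains when \<open>a b\<close> is a relation.\<close>
    show False
    proof (cases "j = Suc i")
      case True
      then have "snd w ! i = Fwd a" "k = Suc j \<Longrightarrow> snd w ! j = Fwd b \<and> j < slen w" "k \<noteq> Suc j \<Longrightarrow> snd w ! i = Inv b"
        using i j by (auto simp: edge_def)
      then show False using ok[of i] ab(4) True by (cases "k = Suc j") (auto simp: zero_rel_def)
    next
      case False
      then have "i = Suc j" "snd w ! j = Inv a" "i \<le> slen w" using i by (auto simp: edge_def)
      moreover have "k \<noteq> Suc j \<Longrightarrow> j = Suc k \<and> snd w ! k = Inv b" "k = Suc j \<Longrightarrow> snd w ! j = Fwd b"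
        using j by (auto simp: edge_def)
      ultimately show False using ok[of k] ab(4) by (cases "k = Suc j") (auto simp: zero_rel_def)
    qed
  qed
qed

subsection \<open>Homomorphisms out of string modules\<close>

text \<open>The conditions on the images of the basis vectors of \<open>SM w\<close>: sufficient by
  \<open>hom_family_hom\<close>, necessary by \<open>string_family_of_hom\<close>. At a peak both
  summands concern the position \<open>k\<close>, but for different arrows \<open>a\<close>.\<close>

definition string_family where
  "string_family X w e \<longleftrightarrow> (\<forall>k\<le>slen w. e k \<in> space X (sv w k)) \<and>
     (\<forall>k\<le>slen w. \<forall>a\<in>arcs Q. tail Q a = sv w k \<longrightarrow> act X a (e k) =
        (if k < slen w \<and> snd w ! k = Fwd a then e (Suc k) else 0) +
        (if 0 < k \<and> snd w ! (k - 1) = Inv a then e (k - 1) else 0))"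

definition family_hom :: "'v \<times> 'a letter list \<Rightarrow> (nat \<Rightarrow> nat \<Rightarrow> 'k) \<Rightarrow> 'v \<Rightarrow> (nat \<Rightarrow> 'k) \<Rightarrow> nat \<Rightarrow> 'k" where
  "family_hom w e = (\<lambda>v x. \<Sum>k\<le>slen w. seq_scale (x k) (e k))"

lemma family_hom_unit: "k \<le> slen w \<Longrightarrow> family_hom w e v (unit_seq k) = e k"
proof -
  assume k: "k \<le> slen w"
  have "family_hom w e v (unit_seq k) = (\<Sum>j\<le>slen w. if k = j then e j else 0)"
    unfolding family_hom_def by (intro sum.cong) (auto simp: fun_eq_iff)
  then show ?thesis using k by simp
qed

lemma hom_family_hom:
  assumes X: "rep X" and w: "string w" and f: "string_family X w e"
  shows "rhom (SM w) X (family_hom w e)"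
proof (rule homI)
  have m: "seq_scale (x k) (e k) \<in> space X v" if "x \<in> space (SM w) v" "v \<in> verts Q" "k \<le> slen w" for x v k
  proof (cases "x k = 0")
    case True
    then show ?thesis using rep_0[OF X that(2)] by simp
  next
    case False
    then have "e k \<in> space X v" using f that(1,3) unfolding string_family_def mem_SM by metis
    then show ?thesis by (rule rep_scale[OF X that(2)])
  qed
  show "family_hom w e v x \<in> space X v" if "v \<in> verts Q" "x \<in> space (SM w) v" for v x
    unfolding family_hom_def using m[OF that(2,1)] by (intro rep_sum_mem[OF X that(1)]) simp
  show "family_hom w e v (x + y) = family_hom w e v x + family_hom w e v y" for v x y
    by (simp add: family_hom_def seq.scale_left_distrib sum.distrib)
  show "family_hom w e v (seq_scale c x) = seq_scale c (family_hom w e v x)" for v c x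
    by (simp add: family_hom_def seq.scale_sum_right)
  fix a x assume a: "a \<in> arcs Q" and x: "x \<in> space (SM w) (tail Q a)"
  let ?n = "slen w" and ?ls = "snd w"
  have "act X a (family_hom w e (tail Q a) x) = (\<Sum>k\<le>?n. act X a (seq_scale (x k) (e k)))"
    unfolding family_hom_def using m[OF x] a by (intro act_sum[OF X a]) simp
  also have "\<dots> = (\<Sum>k\<le>?n. (if k < ?n \<and> ?ls ! k = Fwd a then seq_scale (x k) (e (Suc k)) else 0)
       + (if 0 < k \<and> ?ls ! (k - 1) = Inv a then seq_scale (x k) (e (k - 1)) else 0))"
  proof (rule sum.cong)
    fix k assume k: "k \<in> {..?n}"
    show "act X a (seq_scale (x k) (e k)) = (if k < ?n \<and> ?ls ! k = Fwd a then seq_scale (x k) (e (Suc k)) else 0)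
       + (if 0 < k \<and> ?ls ! (k - 1) = Inv a then seq_scale (x k) (e (k - 1)) else 0)"
    proof (cases "x k = 0")
      case True
      have "act X a (seq_scale (x k) (e k)) = 0" unfolding True seq.scale_zero_left by (rule act_0[OF X a])
      then show ?thesis unfolding True seq.scale_zero_left by (simp only: if_cancel add_0)
    next
      case False
      then have "tail Q a = sv w k" using x by auto
      then show ?thesis using f k a act_scale[OF X a, of "e k" "x k"] unfolding string_family_def
        by (auto simp: seq.scale_right_distrib)
    qed
  qed simp
  \<comment> \<open>The terms are indexed by the letters of the walk, and afterwards by the position
    where a letter arrives; there the coefficient of \<open>e k\<close> is the entry
    \<open>k\<close> of the action on \<open>x\<close>.\<close>
  also have "\<dots> = (\<Sum>k<?n. if ?ls ! k = Fwd a then seq_scale (x k) (e (Suc k)) else 0)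
       + (\<Sum>k<?n. if ?ls ! k = Inv a then seq_scale (x (Suc k)) (e k) else 0)"
  proof -
    have "(\<Sum>k\<le>?n. if k < ?n \<and> ?ls ! k = Fwd a then seq_scale (x k) (e (Suc k)) else 0) =
        (\<Sum>k<?n. if ?ls ! k = Fwd a then seq_scale (x k) (e (Suc k)) else 0)"
      unfolding lessThan_Suc_atMost[symmetric] sum.lessThan_Suc by simp
    moreover have "(\<Sum>k\<le>?n. if 0 < k \<and> ?ls ! (k - 1) = Inv a then seq_scale (x k) (e (k - 1)) else 0) =
        (\<Sum>k<?n. if ?ls ! k = Inv a then seq_scale (x (Suc k)) (e k) else 0)"
      unfolding sum.atMost_shift diff_Suc_1 by simp
    ultimately show ?thesis by (simp only: sum.distrib)
  qed
  also have "\<dots> = (\<Sum>k\<le>?n. if 0 < k \<and> ?ls ! (k - 1) = Fwd a then seq_scale (x (k - 1)) (e k) else 0)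
       + (\<Sum>k\<le>?n. if k < ?n \<and> ?ls ! k = Inv a then seq_scale (x (Suc k)) (e k) else 0)"
  proof -
    have "(\<Sum>k\<le>?n. if k < ?n \<and> ?ls ! k = Inv a then seq_scale (x (Suc k)) (e k) else 0) =
        (\<Sum>k<?n. if ?ls ! k = Inv a then seq_scale (x (Suc k)) (e k) else 0)"
      unfolding lessThan_Suc_atMost[symmetric] sum.lessThan_Suc by simp
    moreover have "(\<Sum>k\<le>?n. if 0 < k \<and> ?ls ! (k - 1) = Fwd a then seq_scale (x (k - 1)) (e k) else 0) =
        (\<Sum>k<?n. if ?ls ! k = Fwd a then seq_scale (x k) (e (Suc k)) else 0)"
      unfolding sum.atMost_shift diff_Suc_1 by simp
    ultimately show ?thesis by (simp only:)
  qed
  also have "\<dots> = family_hom w e (head Q a) (act (SM w) a x)"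
    unfolding family_hom_def sum.distrib[symmetric]
    by (intro sum.cong) (auto simp: act_SM seq.scale_left_distrib)
  finally show "family_hom w e (head Q a) (act (SM w) a x) = act X a (family_hom w e (tail Q a) x)" by simp
qed

lemma hom_SM_expand:
  assumes h: "rhom (SM w) X h" and w: "string w" and v: "v \<in> verts Q" and x: "x \<in> space (SM w) v"
  shows "h v x = (\<Sum>k\<le>slen w. seq_scale (x k) (h (sv w k) (unit_seq k)))"
proof -
  note l = hom_linear[OF h v] and s = rep_subspace[OF rep_SM[OF w] v]
  have m: "seq_scale (x k) (unit_seq k) \<in> space (SM w) v" for k using x by simp
  have "h v x = h v (\<Sum>k\<le>slen w. seq_scale (x k) (unit_seq k))" using SM_expand[OF x] by simp
  also have "\<dots> = (\<Sum>k\<le>slen w. h v (seq_scale (x k) (unit_seq k)))"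
    by (rule linear_map_sum[OF l s m])
  also have "\<dots> = (\<Sum>k\<le>slen w. seq_scale (x k) (h (sv w k) (unit_seq k)))"
  proof (rule sum.cong)
    fix k assume "k \<in> {..slen w}"
    show "h v (seq_scale (x k) (unit_seq k)) = seq_scale (x k) (h (sv w k) (unit_seq k))"
    proof (cases "x k = 0")
      case True
      then show ?thesis using linear_map_0[OF l s] by simp
    next
      case False
      then have "sv w k = v" "k \<le> slen w" using x by auto
      then show ?thesis using hom_scale[OF h v, of "unit_seq k"] by simp
    qed
  qed simp
  finally show ?thesis .
qed

subsection \<open>Matrix coefficients of endomorphisms\<close>

text \<open>The first index is that of the argument, so composition multiplies these matrices in the
  order in which the maps are applied.\<close>

definition coef :: "'v \<times> 'a letter list \<Rightarrow> ('v \<Rightarrow> (nat \<Rightarrow> 'k) \<Rightarrow> nat \<Rightarrow> 'k) \<Rightarrow> nat \<Rightarrow> nat \<Rightarrow> 'k" where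
  "coef w h i j = h (sv w i) (unit_seq i) j"

context
  fixes w assumes w: "string w"
begin

lemma coef_nonzero:
  assumes h: "rhom (SM w) (SM w) h" and i: "i \<le> slen w" and c: "coef w h i j \<noteq> 0"
  shows "j \<le> slen w \<and> sv w j = sv w i"
  using hom_mem[OF h string_sv_verts[OF w i] unit_seq_mem[OF i refl]] c unfolding coef_def by simp

lemma coef_act:
  assumes h: "rhom (SM w) (SM w) h" and e: "edge (snd w) i (Fwd a) i'"
  shows "coef w h i' k = act (SM w) a (h (sv w i) (unit_seq i)) k"
proof -
  note a = string_edge[OF w e]
  have i: "i \<le> slen w" using edge_le[OF e] by blast
  have "act (SM w) a (unit_seq i) = unit_seq i'" by (rule act_SM_unit[OF w e])
  moreover have "unit_seq i \<in> space (SM w) (tail Q a)" using a(2) i by (intro unit_seq_mem) simp_all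
  ultimately have "h (head Q a) (unit_seq i') = act (SM w) a (h (tail Q a) (unit_seq i))"
    using hom_act[OF h a(1)] by metis
  then show ?thesis unfolding coef_def a(2) a(3) by (rule fun_cong)
qed

lemma coef_edge:
  assumes h: "rhom (SM w) (SM w) h" and e: "edge (snd w) i (Fwd a) i'" "edge (snd w) j (Fwd a) j'"
  shows "coef w h i' j' = coef w h i j"
  unfolding coef_act[OF h e(1)] act_SM_edge[OF w e(2)] by (simp only: coef_def)

text \<open>Let the entry be nonzero. If \<open>a\<close> leaves \<open>j\<close>, it does not kill
  the image of the \<open>i\<close>-th vector, so it leaves \<open>i\<close> too. If
  \<open>a\<close> arrives at \<open>i\<close>, the image of the \<open>i\<close>-th vector lies in
  the image of \<open>a\<close>, so \<open>a\<close> also arrives at \<open>j\<close>. Nonzero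
  entries therefore form a simulation.\<close>

lemma coef_simulates:
  assumes h: "rhom (SM w) (SM w) h"
    and i: "i \<le> slen w" and c: "coef w h i j \<noteq> 0"
  shows "simulates (snd w) i j"
proof -
  have "i \<le> slen w \<and> j \<le> slen w \<and>
     (\<forall>a j'. edge (snd w) j (Fwd a) j' \<longrightarrow> (\<exists>i'. edge (snd w) i (Fwd a) i' \<and> i' \<le> slen w \<and> coef w h i' j' \<noteq> 0)) \<and>
     (\<forall>a i'. edge (snd w) i (Inv a) i' \<longrightarrow> (\<exists>j'. edge (snd w) j (Inv a) j' \<and> i' \<le> slen w \<and> coef w h i' j' \<noteq> 0))"
    if simulates: "i \<le> slen w" "coef w h i j \<noteq> 0" for i j
  proof -
  have j: "j \<le> slen w" "sv w j = sv w i" using coef_nonzero[OF h simulates] by auto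
  have "\<exists>i'. edge (snd w) i (Fwd a) i' \<and> i' \<le> slen w \<and> coef w h i' j' \<noteq> 0" if e: "edge (snd w) j (Fwd a) j'" for a j'
  proof -
    note a = string_edge[OF w e]
    have "\<exists>i'. edge (snd w) i (Fwd a) i'"
    proof (rule ccontr)
      assume "\<nexists>i'. edge (snd w) i (Fwd a) i'"
      then have "act (SM w) a (unit_seq i) = 0" using act_SM_unit_0[OF w] by blast
      moreover have "unit_seq i \<in> space (SM w) (tail Q a)" using simulates j a by (simp add: unit_seq_mem)
      ultimately have "act (SM w) a (h (tail Q a) (unit_seq i)) = 0"
        using hom_act[OF h a(1)] hom_0[OF h rep_SM[OF w]] a(1) by (metis head_in_verts)
      then have "coef w h i j = 0" using act_SM_edge[OF w e] a j unfolding coef_def by (metis zero_fun_apply)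
      then show False using simulates by simp
    qed
    then obtain i' where i': "edge (snd w) i (Fwd a) i'" by blast
    then show ?thesis using coef_edge[OF h i' e] simulates edge_le by metis
  qed
  moreover have "\<exists>j'. edge (snd w) j (Inv a) j' \<and> i' \<le> slen w \<and> coef w h i' j' \<noteq> 0" if "edge (snd w) i (Inv a) i'" for a i'
  proof -
    have e: "edge (snd w) i' (Fwd a) i" using that edge_linv[of "snd w" i' "Inv a"] by simp
    have "act (SM w) a (h (sv w i') (unit_seq i')) j \<noteq> 0" using coef_act[OF h e, of j] simulates by simp
    then obtain j' where j': "edge (snd w) j' (Fwd a) j" using act_SM_no_edge by metis
    then have "edge (snd w) j (Inv a) j'" using edge_linv[of "snd w" j "Fwd a"] by simp
    then show ?thesis using coef_edge[OF h e j'] simulates edge_le that by metis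
  qed
  ultimately show ?thesis using simulates j by blast
  qed
  then have "simulation (snd w) (\<lambda>i j. i \<le> slen w \<and> coef w h i j \<noteq> 0)"
    unfolding simulation_def by blast
  then show ?thesis using i c unfolding simulates_def by blast
qed

text \<open>Neighbouring positions are joined by an edge, and \<open>coef_edge\<close> carries the
  diagonal entry along it.\<close>

lemma coef_diag:
  assumes h: "rhom (SM w) (SM w) h" shows "i \<le> slen w \<Longrightarrow> coef w h i i = coef w h 0 0"
proof (induction i)
  case (Suc i)
  have "coef w h (Suc i) (Suc i) = coef w h i i"
  proof (cases "snd w ! i")
    case (Fwd a)
    then have "edge (snd w) i (Fwd a) (Suc i)" using Suc.prems by (simp add: edge_def)
    then show ?thesis using coef_edge[OF h] by blast
  next
    case (Inv a)
    then have "edge (snd w) (Suc i) (Fwd a) i" using Suc.prems by (simp add: edge_def)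
    then show ?thesis using coef_edge[OF h] by metis
  qed
  then show ?case using Suc by simp
qed simp

lemma coef_comp:
  assumes h: "rhom (SM w) (SM w) h" and g: "rhom (SM w) (SM w) g" and i: "i \<le> slen w"
  shows "coef w (\<lambda>v x. g v (h v x)) i k = (\<Sum>j\<le>slen w. coef w h i j * coef w g j k)"
proof -
  have "h (sv w i) (unit_seq i) \<in> space (SM w) (sv w i)"
    using hom_mem[OF h string_sv_verts[OF w i] unit_seq_mem[OF i refl]] .
  then show ?thesis
    using hom_SM_expand[OF g w string_sv_verts[OF w i]] by (simp add: coef_def sum_seq_apply)
qed

lemma coef_comp_diag:
  assumes h: "rhom (SM w) (SM w) h" and g: "rhom (SM w) (SM w) g"
  shows "coef w (\<lambda>v x. g v (h v x)) 0 0 = coef w h 0 0 * coef w g 0 0"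
proof -
  have "coef w h 0 j * coef w g j 0 = 0" if "j \<le> slen w" "j \<noteq> 0" for j
    using coef_simulates[OF h, of 0 j] coef_simulates[OF g, of j 0] simulates_antisym[OF string_reduced[OF w], of 0 j] that
    by auto
  then have "(\<Sum>j\<le>slen w. coef w h 0 j * coef w g j 0) = (\<Sum>j\<in>{0}. coef w h 0 j * coef w g j 0)"
    by (intro sum.mono_neutral_right) auto
  then show ?thesis using coef_comp[OF h g, of 0 0] by simp
qed

lemma coef_0_imp_0:
  assumes h: "rhom (SM w) (SM w) h" and c: "\<And>i j. i \<le> slen w \<Longrightarrow> coef w h i j = 0"
    and v: "v \<in> verts Q" "x \<in> space (SM w) v"
  shows "h v x = 0"
proof -
  have "seq_scale (x k) (h (sv w k) (unit_seq k)) = 0" if "k \<le> slen w" for k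
    using c[OF that] unfolding coef_def by (auto simp: fun_eq_iff)
  then have "(\<Sum>k\<le>slen w. seq_scale (x k) (h (sv w k) (unit_seq k))) = 0" by (intro sum.neutral) simp
  then show ?thesis using hom_SM_expand[OF h w v] by simp
qed

text \<open>A triangular idempotent with zero diagonal vanishes. In \<open>e = e e\<close> a nonzero
  factor at \<open>(i, k)\<close> has \<open>k\<close> strictly beyond \<open>i\<close> in the
  order, where fewer positions are simulated, and there the induction hypothesis kills the second
  factor.\<close>

lemma idem_diag_0:
  assumes e: "rhom (SM w) (SM w) e" and ee: "\<And>v x. v \<in> verts Q \<Longrightarrow> x \<in> space (SM w) v \<Longrightarrow> e v (e v x) = e v x"
    and d: "coef w e 0 0 = 0" and v: "v \<in> verts Q" "x \<in> space (SM w) v"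
  shows "e v x = 0"
proof -
  have "coef w e i j = 0" if "i \<le> slen w" for i j
    using that
  proof (induction "card {k. simulates (snd w) i k}" arbitrary: i j rule: less_induct)
    case less
    have ceq: "coef w e i j = coef w (\<lambda>v x. e v (e v x)) i j"
      using ee[OF string_sv_verts[OF w less.prems] unit_seq_mem[OF less.prems refl]] by (simp add: coef_def)
    have "coef w e i k * coef w e k j = 0" if k: "k \<le> slen w" for k
    proof (rule ccontr)
      assume nz: "\<not> ?thesis"
      then have ik: "simulates (snd w) i k" using coef_simulates[OF e less.prems] by auto
      have "k \<noteq> i" using nz coef_diag[OF e less.prems] d by auto
      then have "\<not> simulates (snd w) k i" using simulates_antisym[OF string_reduced[OF w] ik] by blast
      moreover have "simulates (snd w) i i"
        using coef_simulates[OF hom_id less.prems, of i] by (simp add: coef_def)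
      ultimately have "{m. simulates (snd w) k m} \<subset> {m. simulates (snd w) i m}"
        using ik simulates_trans by blast
      then have "card {m. simulates (snd w) k m} < card {m. simulates (snd w) i m}"
        by (rule psubset_card_mono[OF simulates_finite])
      then show False using less.hyps k nz by auto
    qed
    then show ?case unfolding ceq coef_comp[OF e e less.prems] by (intro sum.neutral) simp
  qed
  then show ?thesis using coef_0_imp_0[OF e _ v] by blast
qed

text \<open>The diagonal entry of an idempotent \<open>e\<close> is idempotent in the field, hence
  \<open>0\<close> or \<open>1\<close>; \<open>idem_diag_0\<close> then applies to \<open>e\<close>
  or to \<open>1 - e\<close>.\<close>

lemma indec_SM: "indec (SM w)"
  unfolding indec_iff
proof (intro conjI allI impI)
  show r: "rep (SM w)" by (rule rep_SM[OF w])
  have "unit_seq 0 \<in> space (SM w) (fst w)" by simp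
  moreover have "unit_seq 0 \<noteq> (0 :: nat \<Rightarrow> 'k)" by (metis unit_seq_apply zero_fun_apply zero_neq_one)
  ultimately show "\<not> is_zero_rep Q (SM w)"
    using string_sv_verts[OF w, of 0] is_zero_rep_iff[OF r] by fastforce
  fix e assume e: "rhom (SM w) (SM w) e" and ee: "\<forall>v\<in>verts Q. \<forall>x\<in>space (SM w) v. e v (e v x) = e v x"
  have "coef w (\<lambda>v x. e v (e v x)) 0 0 = coef w e 0 0"
    using ee string_sv_verts[OF w, of 0] by (simp add: coef_def)
  then have "coef w e 0 0 = coef w e 0 0 * coef w e 0 0" using coef_comp_diag[OF e e] by simp
  then consider "coef w e 0 0 = 0" | "coef w e 0 0 = 1" by (metis mult_cancel_right2)
  then show "(\<forall>v\<in>verts Q. \<forall>x\<in>space (SM w) v. e v x = 0) \<or> (\<forall>v\<in>verts Q. \<forall>x\<in>space (SM w) v. e v x = x)"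
  proof cases
    case 1
    then show ?thesis using idem_diag_0[OF e] ee by blast
  next
    case 2
    let ?d = "\<lambda>v x. x - e v x"
    have d: "rhom (SM w) (SM w) ?d" by (rule hom_minus[OF r hom_id e])
    have "?d v (?d v x) = ?d v x" if v: "v \<in> verts Q" "x \<in> space (SM w) v" for v x
      using hom_diff[OF e r v(1) v(2) hom_mem[OF e v]] ee v by (simp)
    moreover have "coef w ?d 0 0 = 0" using 2 by (simp add: coef_def)
    ultimately have "x - e v x = 0" if "v \<in> verts Q" "x \<in> space (SM w) v" for v x
      using idem_diag_0[OF d] that by blast
    then show ?thesis by (metis right_minus_eq)
  qed
qed

text \<open>The diagonal entries of the powers of \<open>h\<close> are the powers of its diagonal
  entry, so \<open>h\<close> is not nilpotent and Fitting's lemma makes it bijective.\<close>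

lemma endo_bij_if_diag:
  assumes h: "rhom (SM w) (SM w) h" and i: "i \<le> slen w" and c: "coef w h i i \<noteq> 0"
  shows "hom_bij (SM w) (SM w) h"
proof (rule ccontr)
  assume "\<not> ?thesis"
  then obtain n where n: "\<forall>v\<in>verts Q. \<forall>x\<in>space (SM w) v. (h v ^^ n) x = 0"
    using indec_bij_or_nilpotent[OF indec_SM h] unfolding hom_bij_def by blast
  have c0: "coef w h 0 0 \<noteq> 0" using coef_diag[OF h i] c by simp
  have "coef w (\<lambda>v. h v ^^ m) 0 0 = coef w h 0 0 ^ m" for m
  proof (induction m)
    case 0
    then show ?case by (simp add: coef_def)
  next
    case (Suc m)
    then show ?case using coef_comp_diag[OF hom_funpow[OF h, of m] h] by (simp add: coef_def mult.commute)
  qed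
  moreover have "coef w (\<lambda>v. h v ^^ n) 0 0 = 0"
    using n string_sv_verts[OF w, of 0] by (simp add: coef_def)
  ultimately show False using c0 by simp
qed

end

end

section \<open>Legs and indecomposable projectives\<close>

context monomial_quiver
begin

text \<open>\<open>is_string\<close> in recursive form, where concatenating and reversing are proved
  by induction instead of by index arithmetic.\<close>

primrec swalk :: "'v \<Rightarrow> 'a letter list \<Rightarrow> bool" where
  "swalk u [] \<longleftrightarrow> u \<in> verts Q"
| "swalk u (l # ls) \<longleftrightarrow> larrow l \<in> arcs Q \<and> lsource Q l = u \<and>
     (ls = [] \<or> letters_ok Q I l (hd ls)) \<and> swalk (ltarget Q l) ls"

definition wend :: "'v \<Rightarrow> 'a letter list \<Rightarrow> 'v" where
  "wend u ls = last (u # map (ltarget Q) ls)"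

lemma wend_simps [simp]: "wend u [] = u" "wend u (l # ls) = wend (ltarget Q l) ls"
  by (simp_all add: wend_def)

lemma wend_append [simp]: "wend u (xs @ ys) = wend (wend u xs) ys"
  by (induction xs arbitrary: u) auto

lemma lsource_in_verts: "larrow l \<in> arcs Q \<Longrightarrow> lsource Q l \<in> verts Q"
  and ltarget_in_verts: "larrow l \<in> arcs Q \<Longrightarrow> ltarget Q l \<in> verts Q"
  by (cases l; simp)+

lemma swalk_verts: "swalk u ls \<Longrightarrow> u \<in> verts Q"
  by (cases ls) (auto simp: lsource_in_verts)

lemma string_iff: "string (u, ls) \<longleftrightarrow> swalk u ls"
proof (induction ls arbitrary: u)
  case Nil
  then show ?case by (simp add: is_string_def)
next
  case (Cons l ls)
  have "string (u, l # ls) \<longleftrightarrow> larrow l \<in> arcs Q \<and> lsource Q l = u \<and>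
      (ls = [] \<or> letters_ok Q I l (hd ls)) \<and> string (ltarget Q l, ls)"
  proof -
    have "(\<forall>i. Suc i < length (l # ls) \<longrightarrow> letters_ok Q I ((l # ls) ! i) ((l # ls) ! Suc i)) \<longleftrightarrow>
        (ls = [] \<or> letters_ok Q I l (hd ls)) \<and> (\<forall>i. Suc i < length ls \<longrightarrow> letters_ok Q I (ls ! i) (ls ! Suc i))"
      (is "?L \<longleftrightarrow> ?R")
    proof
      assume L: ?L
      have "letters_ok Q I l (hd ls)" if "ls \<noteq> []"
        using L[rule_format, of 0] that by (simp add: hd_conv_nth)
      moreover have "letters_ok Q I (ls ! i) (ls ! Suc i)" if "Suc i < length ls" for i
        using L[rule_format, of "Suc i"] that by simp
      ultimately show ?R by blast
    next
      assume R: ?R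
      show ?L
      proof (intro allI impI)
        fix i assume "Suc i < length (l # ls)"
        then show "letters_ok Q I ((l # ls) ! i) ((l # ls) ! Suc i)"
          using R by (cases i) (auto simp: hd_conv_nth)
      qed
    qed
    moreover have "(\<forall>i<length (l # ls). lsource Q ((l # ls) ! i) = sv (u, l # ls) i) \<longleftrightarrow>
        lsource Q l = u \<and> (\<forall>i<length ls. lsource Q (ls ! i) = sv (ltarget Q l, ls) i)"
      by (auto simp: string_verts_def All_less_Suc2)
    ultimately show ?thesis
      unfolding is_string_def using lsource_in_verts ltarget_in_verts by auto
  qed
  then show ?case using Cons.IH by simp
qed

lemma swalk_append: "swalk u (xs @ ys) \<longleftrightarrow> swalk u xs \<and> swalk (wend u xs) ys \<and>
    (xs \<noteq> [] \<longrightarrow> ys \<noteq> [] \<longrightarrow> letters_ok Q I (last xs) (hd ys))"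
proof (induction xs arbitrary: u)
  case Nil
  then show ?case using swalk_verts by auto
next
  case (Cons l xs)
  then show ?case
    by (cases xs) (auto simp: ltarget_in_verts dest: swalk_verts)
qed

lemma letters_ok_rev: "letters_ok Q I (linv b) (linv a) = letters_ok Q I a b"
  by (cases a; cases b) auto

lemma linv_letter [simp]: "larrow (linv l) = larrow l" "lsource Q (linv l) = ltarget Q l" "ltarget Q (linv l) = lsource Q l"
  by (cases l; simp)+

lemma swalk_rev: "swalk u ls \<Longrightarrow> swalk (wend u ls) (map linv (rev ls)) \<and> wend (wend u ls) (map linv (rev ls)) = u"
proof (induction ls arbitrary: u)
  case (Cons l ls)
  then have s: "swalk (ltarget Q l) ls" and l: "larrow l \<in> arcs Q" "lsource Q l = u" and
    ok: "ls \<noteq> [] \<longrightarrow> letters_ok Q I l (hd ls)" by auto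
  have "ls \<noteq> [] \<longrightarrow> letters_ok Q I (last (map linv (rev ls))) (linv l)"
    using ok by (simp add: last_map last_rev letters_ok_rev)
  then show ?case using Cons.IH[OF s] l lsource_in_verts[OF l(1)] by (auto simp: swalk_append)
qed simp

lemma wend_nth: "wend u ls = sv (u, ls) (length ls)"
  unfolding wend_def string_verts_def by (metis fst_conv last_conv_nth length_Cons length_map list.distinct(1) diff_Suc_1 snd_conv)

lemma sv_take: "i \<le> length ls \<Longrightarrow> sv (u, ls) i = wend u (take i ls)"
proof -
  assume i: "i \<le> length ls"
  have "wend u (take i ls) = sv (u, take i ls) i" using wend_nth[of u "take i ls"] i by simp
  also have "\<dots> = sv (u, ls) i"
    using i by (cases i) (auto simp: string_verts_def)
  finally show ?thesis by simp
qed

section \<open>Inverse strings\<close>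

definition rev_string :: "'v \<times> 'a letter list \<Rightarrow> 'v \<times> 'a letter list" where
  "rev_string w = (wend (fst w) (snd w), map linv (rev (snd w)))"

lemma string_rev_string: "string w \<Longrightarrow> string (rev_string w)"
  using swalk_rev by (cases w) (simp add: rev_string_def string_iff)

lemma slen_rev_string [simp]: "slen (rev_string w) = slen w"
  by (simp add: rev_string_def)

lemma rev_string_rev_string: "string w \<Longrightarrow> rev_string (rev_string w) = w"
  using swalk_rev by (cases w) (simp add: rev_string_def string_iff rev_map comp_def)

lemma rev_string_letter: "i < slen w \<Longrightarrow> snd (rev_string w) ! i = linv (snd w ! (slen w - Suc i))"
  by (simp add: rev_string_def rev_nth)

lemma sv_rev_string:
  assumes w: "string w" and i: "i \<le> slen w"
  shows "sv (rev_string w) i = sv w (slen w - i)"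
proof (cases i)
  case 0
  then show ?thesis using wend_nth[of "fst w" "snd w"] by (simp add: rev_string_def)
next
  case (Suc j)
  have "sv (rev_string w) (Suc j) = ltarget Q (snd (rev_string w) ! j)"
    using Suc i string_target[OF string_rev_string[OF w], of j] by simp
  then show ?thesis
    using Suc i string_source[OF w, of "slen w - Suc j"] by (simp add: rev_string_letter)
qed

definition rev_hom :: "'v \<times> 'a letter list \<Rightarrow> 'v \<Rightarrow> (nat \<Rightarrow> 'k) \<Rightarrow> nat \<Rightarrow> 'k" where
  "rev_hom w v x = (\<lambda>j. if j \<le> slen w then x (slen w - j) else 0)"

lemma hom_rev_hom:
  assumes w: "string w" shows "rhom (SM w) (SM (rev_string w)) (rev_hom w)"
proof (rule homI)
  show "rev_hom w v x \<in> space (SM (rev_string w)) v" if "x \<in> space (SM w) v" for v x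
    using that by (auto simp: rev_hom_def sv_rev_string[OF w])
  show "rev_hom w v (x + y) = rev_hom w v x + rev_hom w v y" for v x y
    by (auto simp: rev_hom_def)
  show "rev_hom w v (seq_scale c x) = seq_scale c (rev_hom w v x)" for v c x
    by (auto simp: rev_hom_def fun_eq_iff)
  fix a x assume x: "x \<in> space (SM w) (tail Q a)"
  show "rev_hom w (head Q a) (act (SM w) a x) = act (SM (rev_string w)) a (rev_hom w (tail Q a) x)"
  proof
    fix j
    let ?n = "slen w"
    have 1: "0 < j \<and> j \<le> ?n \<and> snd (rev_string w) ! (j - 1) = Fwd a \<longleftrightarrow> j \<le> ?n \<and> ?n - j < ?n \<and> snd w ! (?n - j) = Inv a"
      using rev_string_letter[of "j - 1" w] by (cases j; cases "snd w ! (?n - j)") auto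
    have 2: "j < ?n \<and> snd (rev_string w) ! j = Inv a \<longleftrightarrow> j \<le> ?n \<and> 0 < ?n - j \<and> snd w ! (?n - j - 1) = Fwd a"
      using rev_string_letter[of j w] by (cases "snd w ! (?n - Suc j)") auto
    have 3: "snd w \<noteq> [] \<Longrightarrow> ?n - (?n - Suc 0) = Suc 0" by (cases "snd w") auto
    show "rev_hom w (head Q a) (act (SM w) a x) j = act (SM (rev_string w)) a (rev_hom w (tail Q a) x) j"
      unfolding act_SM slen_rev_string 1 2 unfolding rev_hom_def act_SM
      by (auto simp: Suc_diff_le add.commute 3)
  qed
qed

lemma inverse_homs_rev:
  assumes w: "string w" shows "inverse_homs (SM w) (SM (rev_string w)) (rev_hom w) (rev_hom (rev_string w))"
proof -
  have "rhom (SM (rev_string w)) (SM w) (rev_hom (rev_string w))"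
    using hom_rev_hom[OF string_rev_string[OF w]] by (simp add: rev_string_rev_string[OF w])
  moreover have "rev_hom w' v (rev_hom w'' v x) = x"
    if "slen w' = slen w''" "x \<in> space (SM u) v" "slen u = slen w'" for w' w'' u v x
    using that by (auto simp: rev_hom_def fun_eq_iff)
  ultimately show ?thesis using hom_rev_hom[OF w] slen_rev_string[of w] unfolding inverse_homs_def by metis
qed

end

text \<open>(G1) to (G3) as statements on two or three arrows, in pairs that are exchanged when all
  arrows are reversed. \<open>bounded\<close> is the form in which admissibility is used: it makes
  maximal nonzero paths exist.\<close>

locale gentle_quiver = monomial_quiver Q I
  for Q :: "('v, 'a) pre_digraph" and I :: "(('v, 'a) qpath \<Rightarrow> 'k::field) set" +
  assumes out2: "\<lbrakk>a \<in> arcs Q; b \<in> arcs Q; c \<in> arcs Q; tail Q a = tail Q c; tail Q b = tail Q c\<rbrakk> \<Longrightarrow> a = b \<or> a = c \<or> b = c"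
    and in2: "\<lbrakk>a \<in> arcs Q; b \<in> arcs Q; c \<in> arcs Q; head Q a = head Q c; head Q b = head Q c\<rbrakk> \<Longrightarrow> a = b \<or> a = c \<or> b = c"
    and nonzero_right: "\<lbrakk>a \<in> arcs Q; b \<in> arcs Q; b' \<in> arcs Q; head Q a = tail Q b; head Q a = tail Q b';
        \<not> zero_rel a b; \<not> zero_rel a b'\<rbrakk> \<Longrightarrow> b = b'"
    and nonzero_left: "\<lbrakk>a \<in> arcs Q; a' \<in> arcs Q; b \<in> arcs Q; head Q a = tail Q b; head Q a' = tail Q b;
        \<not> zero_rel a b; \<not> zero_rel a' b\<rbrakk> \<Longrightarrow> a = a'"
    and zero_right: "\<lbrakk>a \<in> arcs Q; b \<in> arcs Q; b' \<in> arcs Q; head Q a = tail Q b; head Q a = tail Q b';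
        zero_rel a b; zero_rel a b'\<rbrakk> \<Longrightarrow> b = b'"
    and zero_left: "\<lbrakk>a \<in> arcs Q; a' \<in> arcs Q; b \<in> arcs Q; head Q a = tail Q b; head Q a' = tail Q b;
        zero_rel a b; zero_rel a' b\<rbrakk> \<Longrightarrow> a = a'"
    and bounded: "\<exists>m. \<forall>u p v. awalk u p v \<longrightarrow> m \<le> length p \<longrightarrow> (\<exists>xs a b ys. p = xs @ a # b # ys \<and> zero_rel a b)"
begin

section \<open>Nonzero paths and legs\<close>

definition nzpath :: "'v \<Rightarrow> 'a list \<Rightarrow> bool" where
  "nzpath v p \<longleftrightarrow> swalk v (map Fwd p)"

definition pv :: "'v \<Rightarrow> 'a list \<Rightarrow> nat \<Rightarrow> 'v" where
  "pv v p s = (if s = 0 then v else head Q (p ! (s - 1)))"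

text \<open>A nontrivial leg is a nonzero path that cannot be prolonged. The empty path counts as a
  leg even if arrows start at \<open>v\<close>; whether a leg is missing is recorded by
  \<open>covers\<close>.\<close>

definition leg :: "'v \<Rightarrow> 'a list \<Rightarrow> bool" where
  "leg v p \<longleftrightarrow> nzpath v p \<and> (p \<noteq> [] \<longrightarrow> (\<forall>b\<in>arcs Q. head Q (last p) = tail Q b \<longrightarrow> zero_rel (last p) b))"

lemma nzpath_nth:
  assumes "nzpath v p" "s < length p"
  shows "p ! s \<in> arcs Q" "tail Q (p ! s) = pv v p s" "Suc s < length p \<Longrightarrow> \<not> zero_rel (p ! s) (p ! Suc s)"
proof -
  have s: "string (v, map Fwd p)" using assms by (simp add: nzpath_def string_iff)
  show "p ! s \<in> arcs Q" using string_arc[OF s, of s] assms(2) by simp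
  show "tail Q (p ! s) = pv v p s"
    using string_source[OF s, of s] string_target[OF s, of "s - 1"] assms(2) by (cases s) (auto simp: pv_def)
  have "letters_ok Q I (snd (v, map Fwd p) ! s) (snd (v, map Fwd p) ! Suc s)" if "Suc s < length p"
    using s that unfolding is_string_def by auto
  then show "Suc s < length p \<Longrightarrow> \<not> zero_rel (p ! s) (p ! Suc s)"
    using assms(2) by (simp add: zero_rel_def)
qed

lemma nzpath_next:
  assumes p: "nzpath v p" and s: "0 < s" "s < length p" and b: "b \<in> arcs Q" "tail Q b = pv v p s" "b \<noteq> p ! s"
  shows "zero_rel (p ! (s - 1)) b"
  using nonzero_right[of "p ! (s - 1)" b "p ! s"] nzpath_nth[OF p, of "s - 1"] nzpath_nth[OF p, of s] s b
  by (auto simp: pv_def)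

text \<open>Inside the leg its next arrow is the only one with a nonzero product; at its end there
  is none by maximality. So a vector moved along a leg is killed by every arrow that leaves the
  leg.\<close>

lemma leg_next:
  assumes p: "leg v p" and s: "0 < s" "s \<le> length p" and b: "b \<in> arcs Q" "tail Q b = pv v p s" "s < length p \<Longrightarrow> b \<noteq> p ! s"
  shows "zero_rel (p ! (s - 1)) b"
proof (cases "s = length p")
  case True
  then have "p \<noteq> []" "p ! (s - 1) = last p" using s by (auto simp: last_conv_nth)
  then show ?thesis using p b s unfolding leg_def pv_def by auto
next
  case False
  then have "s < length p" using s by simp
  then show ?thesis using nzpath_next[OF _ s(1) _ b(1,2)] p b(3) unfolding leg_def by blast
qed

lemma leg_Nil: "v \<in> verts Q \<Longrightarrow> leg v []"
  by (simp add: leg_def nzpath_def)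

lemma nzpath_awalk: "nzpath v p \<Longrightarrow> awalk v p (wend v (map Fwd p))"
  unfolding nzpath_def by (induction p arbitrary: v) (auto simp: awalk_Nil_iff awalk_Cons_iff)

lemma nzpath_no_zero: "nzpath v (xs @ a # b # ys) \<Longrightarrow> \<not> zero_rel a b"
  by (auto simp: nzpath_def swalk_append zero_rel_def)

lemma nzpath_bounded: "\<exists>m. \<forall>v p. nzpath v p \<longrightarrow> length p < m"
proof -
  obtain m where m: "\<And>u p v. awalk u p v \<Longrightarrow> m \<le> length p \<Longrightarrow> \<exists>xs a b ys. p = xs @ a # b # ys \<and> zero_rel a b"
    using bounded by blast
  have "length p < m" if "nzpath v p" for v p
    using m[OF nzpath_awalk[OF that]] nzpath_no_zero that by (metis not_le)
  then show ?thesis by blast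
qed

text \<open>Nonzero paths have bounded length, so a longest one that begins with \<open>a\<close>
  exists; an arrow with nonzero product at its end would prolong it.\<close>

lemma leg_exists:
  assumes a: "a \<in> arcs Q" shows "\<exists>p. leg (tail Q a) (a # p)"
proof -
  obtain m where m: "\<And>v p. nzpath v p \<Longrightarrow> length p < m" using nzpath_bounded by blast
  have "nzpath (tail Q a) [a]" using a by (simp add: nzpath_def)
  then have "\<exists>p. nzpath (tail Q a) (a # p) \<and> (\<forall>q. nzpath (tail Q a) (a # q) \<longrightarrow> length q \<le> length p)"
    using ex_has_greatest_nat[of "\<lambda>p. nzpath (tail Q a) (a # p)" "[]" length m] m
    by (metis length_Cons less_imp_le Suc_lessD)
  then obtain p where p: "nzpath (tail Q a) (a # p)" "\<And>q. nzpath (tail Q a) (a # q) \<Longrightarrow> length q \<le> length p" by blast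
  have "zero_rel (last (a # p)) b" if b: "b \<in> arcs Q" "head Q (last (a # p)) = tail Q b" for b
  proof (rule ccontr)
    assume nz: "\<not> zero_rel (last (a # p)) b"
    have "wend (tail Q a) (map Fwd (a # p)) = head Q (last (a # p))"
      by (simp add: wend_def last_map)
    moreover have "last (map Fwd (a # p)) = Fwd (last (a # p))" by (simp add: last_map)
    ultimately have "nzpath (tail Q a) (a # p @ [b])"
      using p(1) b nz swalk_append[of "tail Q a" "map Fwd (a # p)" "[Fwd b]"]
      by (simp add: nzpath_def zero_rel_def)
    then show False using p(2)[of "p @ [b]"] by simp
  qed
  then show ?thesis using p(1) unfolding leg_def by (intro exI[of _ p] conjI impI ballI)
qed

section \<open>Modules with two legs\<close>

definition legs :: "'v \<Rightarrow> 'a list \<Rightarrow> 'a list \<Rightarrow> bool" where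
  "legs v r q \<longleftrightarrow> v \<in> verts Q \<and> leg v r \<and> leg v q \<and> (r \<noteq> [] \<longrightarrow> q \<noteq> [] \<longrightarrow> hd r \<noteq> hd q)"

definition starts :: "'a list \<Rightarrow> 'a \<Rightarrow> bool" where
  "starts p a \<longleftrightarrow> p \<noteq> [] \<and> hd p = a"

definition covers :: "'v \<Rightarrow> 'a list \<Rightarrow> 'a list \<Rightarrow> bool" where
  "covers v r q \<longleftrightarrow> (\<forall>a\<in>arcs Q. tail Q a = v \<longrightarrow> starts r a \<or> starts q a)"

text \<open>The string \<open>r\<inverse>q\<close>; if \<open>legs v r q\<close> and \<open>covers v r q\<close> hold, its module is the projective \<open>P(v)\<close>.\<close>

definition LS :: "'v \<Rightarrow> 'a list \<Rightarrow> 'a list \<Rightarrow> 'v \<times> 'a letter list" where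
  "LS v r q = (wend v (map Fwd r), map Inv (rev r) @ map Fwd q)"

lemma legs_sym: "legs v r q \<Longrightarrow> legs v q r"
  by (auto simp: legs_def)

lemma covers_sym: "covers v r q \<Longrightarrow> covers v q r"
  by (auto simp: covers_def)

lemma slen_LS [simp]: "slen (LS v r q) = length r + length q"
  by (simp add: LS_def)

lemma LS_letter_left: "k < length r \<Longrightarrow> snd (LS v r q) ! k = Inv (r ! (length r - Suc k))"
  by (simp add: LS_def nth_append rev_nth)

lemma LS_letter_right: "length r \<le> k \<Longrightarrow> k < length r + length q \<Longrightarrow> snd (LS v r q) ! k = Fwd (q ! (k - length r))"
  by (simp add: LS_def nth_append)

lemma map_Inv_rev: "map Inv (rev r) = map linv (rev (map Fwd r))"
  by (simp add: rev_map)

lemma string_LS_nzpath: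
  assumes "nzpath v r" "nzpath v q" "r \<noteq> [] \<Longrightarrow> q \<noteq> [] \<Longrightarrow> hd r \<noteq> hd q"
  shows "string (LS v r q)"
proof -
  have "r \<noteq> [] \<longrightarrow> q \<noteq> [] \<longrightarrow> letters_ok Q I (last (map Inv (rev r))) (hd (map Fwd q))"
    using assms(3) by (auto simp: last_map hd_map last_rev)
  then show ?thesis
    using assms(1,2) swalk_rev[of v "map Fwd r"]
    unfolding LS_def string_iff nzpath_def swalk_append map_Inv_rev by simp
qed

lemma string_LS: "legs v r q \<Longrightarrow> string (LS v r q)"
  using string_LS_nzpath unfolding legs_def leg_def by blast

lemma rev_string_LS:
  assumes "legs v r q" shows "rev_string (LS v r q) = LS v q r"
proof -
  have "wend (wend v (map Fwd r)) (map Inv (rev r)) = v"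
    using assms swalk_rev[of v "map Fwd r"] unfolding map_Inv_rev legs_def leg_def nzpath_def by blast
  then show ?thesis by (simp add: rev_string_def LS_def rev_map comp_def)
qed

lemma sv_LS_left:
  assumes l: "legs v r q" and k: "k \<le> length r"
  shows "sv (LS v r q) k = pv v r (length r - k)"
proof (cases k)
  case 0
  then show ?thesis by (cases r rule: rev_cases) (auto simp: LS_def pv_def)
next
  case (Suc i)
  have "nzpath v r" using l by (simp add: legs_def leg_def)
  then show ?thesis
    using string_target[OF string_LS[OF l], of i] LS_letter_left[of i r v q] nzpath_nth(2)[of v r "length r - k"] Suc k by simp
qed

lemma sv_LS_right:
  assumes l: "legs v r q" and k: "length r \<le> k" "k \<le> length r + length q"
  shows "sv (LS v r q) k = pv v q (k - length r)"
proof (cases "k = length r")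
  case True
  then show ?thesis using sv_LS_left[OF l, of k] by (simp add: pv_def)
next
  case False
  then obtain i where i: "k = Suc i" "length r \<le> i" using k by (cases k) auto
  then show ?thesis
    using string_target[OF string_LS[OF l], of i] LS_letter_right[of r i q v] k by (simp add: pv_def Suc_diff_le)
qed

lemma sv_LS_mid: "legs v r q \<Longrightarrow> sv (LS v r q) (length r) = v"
  using sv_LS_left[of v r q "length r"] by (simp add: pv_def)

text \<open>The third claim needs \<open>0 < s\<close>: it rests on the relation between
  \<open>b\<close> and the preceding arrow of the leg, while arrows at \<open>x\<close> itself are
  unconstrained.\<close>

lemma leg_elements:
  assumes p: "leg v p" and X: "rep X" and x: "x \<in> space X v" and s: "s \<le> length p"
  shows "fold (act X) (take s p) x \<in> space X (pv v p s)"
    and "s < length p \<Longrightarrow> act X (p ! s) (fold (act X) (take s p) x) = fold (act X) (take (Suc s) p) x"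
    and "0 < s \<Longrightarrow> b \<in> arcs Q \<Longrightarrow> tail Q b = pv v p s \<Longrightarrow> (s < length p \<Longrightarrow> b \<noteq> p ! s) \<Longrightarrow>
       act X b (fold (act X) (take s p) x) = 0"
proof -
  have nz: "nzpath v p" using p by (simp add: leg_def)
  have step: "act X (p ! s) (fold (act X) (take s p) x) = fold (act X) (take (Suc s) p) x" if "s < length p" for s
    using that by (simp add: take_Suc_conv_app_nth)
  have mem: "s \<le> length p \<Longrightarrow> fold (act X) (take s p) x \<in> space X (pv v p s)" for s
  proof (induction s)
    case 0
    then show ?case using x by (simp add: pv_def)
  next
    case (Suc s)
    then have "act X (p ! s) (fold (act X) (take s p) x) \<in> space X (head Q (p ! s))"
      using nzpath_nth[OF nz, of s] act_mem[OF X] by simp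
    then show ?case using step[of s] Suc.prems by (simp add: pv_def)
  qed
  show "fold (act X) (take s p) x \<in> space X (pv v p s)" using mem[OF s] .
  show "s < length p \<Longrightarrow> act X (p ! s) (fold (act X) (take s p) x) = fold (act X) (take (Suc s) p) x" using step .
  assume b: "0 < s" "b \<in> arcs Q" "tail Q b = pv v p s" "s < length p \<Longrightarrow> b \<noteq> p ! s"
  have z: "zero_rel (p ! (s - 1)) b" using leg_next[OF p b(1) s b(2,3,4)] .
  have e: "fold (act X) (take s p) x = act X (p ! (s - 1)) (fold (act X) (take (s - 1) p) x)"
    using step[of "s - 1"] s b(1) by simp
  have n: "p ! (s - 1) \<in> arcs Q" "tail Q (p ! (s - 1)) = pv v p (s - 1)" using nzpath_nth[OF nz, of "s - 1"] s b(1) by simp_all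
  have "fold (act X) (take (s - 1) p) x \<in> space X (tail Q (p ! (s - 1)))" using mem[of "s - 1"] s n by simp
  moreover have "head Q (p ! (s - 1)) = tail Q b" using b by (simp add: pv_def)
  ultimately show "act X b (fold (act X) (take s p) x) = 0"
    unfolding e using act_act[OF X n(1) b(2) _ z] by blast
qed

text \<open>Position \<open>length r\<close> of \<open>LS v r q\<close> is the generator, at the
  vertex \<open>v\<close>. It goes to \<open>x\<close>, and the other positions go to the images of
  \<open>x\<close> down either leg.\<close>

definition leg_family :: "('v, 'a, 'k) rep \<Rightarrow> 'a list \<Rightarrow> 'a list \<Rightarrow> (nat \<Rightarrow> 'k) \<Rightarrow> nat \<Rightarrow> nat \<Rightarrow> 'k" where
  "leg_family X r q x k = (if k \<le> length r then fold (act X) (take (length r - k) r) x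
     else fold (act X) (take (k - length r) q) x)"

text \<open>Below the generator, arrows that leave the legs act as zero by the relations. At the
  generator this is the hypothesis on \<open>x\<close>.\<close>

lemma string_leg_family:
  assumes l: "legs v r q" and X: "rep X" and x: "x \<in> space X v"
    and z: "\<And>a. a \<in> arcs Q \<Longrightarrow> tail Q a = v \<Longrightarrow> \<not> starts r a \<Longrightarrow> \<not> starts q a \<Longrightarrow> act X a x = 0"
  shows "string_family X (LS v r q) (leg_family X r q x)"
proof -
  let ?w = "LS v r q" and ?e = "leg_family X r q x"
  have r: "leg v r" and q: "leg v q" using l by (auto simp: legs_def)
  have eR: "?e k = fold (act X) (take (k - length r) q) x" if "length r \<le> k" for k
    using that by (auto simp: leg_family_def)
  have eL: "?e k = fold (act X) (take (length r - k) r) x" if "k \<le> length r" for k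
    using that by (auto simp: leg_family_def)
  have mem: "?e k \<in> space X (sv ?w k)" if "k \<le> slen ?w" for k
  proof (cases "k \<le> length r")
    case True
    then show ?thesis using eL leg_elements(1)[OF r X x] sv_LS_left[OF l] by simp
  next
    case False
    then show ?thesis using eR leg_elements(1)[OF q X x, of "k - length r"] sv_LS_right[OF l, of k] that by simp
  qed
  have tab: "act X a (?e k) = (if k < slen ?w \<and> snd ?w ! k = Fwd a then ?e (Suc k) else 0) +
       (if 0 < k \<and> snd ?w ! (k - 1) = Inv a then ?e (k - 1) else 0)"
    if k: "k \<le> slen ?w" and a: "a \<in> arcs Q" "tail Q a = sv ?w k" for k a
  proof -
    consider "k < length r" | "k = length r" | "length r < k" by linarith
    then show ?thesis
    proof cases
      case 1
      let ?s = "length r - k"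
      have t: "tail Q a = pv v r ?s" using a sv_LS_left[OF l, of k] 1 by simp
      have n1: "snd ?w ! k = Inv (r ! (?s - 1))" using LS_letter_left[OF 1] by simp
      have n2: "0 < k \<Longrightarrow> snd ?w ! (k - 1) = Inv (r ! ?s)" using LS_letter_left[of "k - 1" r v q] 1 by simp
      show ?thesis
      proof (cases "0 < k \<and> a = r ! ?s")
        case True
        then have "?s < length r" "k - 1 \<le> length r" "length r - (k - 1) = Suc ?s" using 1 by auto
        then have "act X a (?e k) = ?e (k - 1)"
          using leg_elements(2)[OF r X x, of ?s] 1 eL[of k] eL[of "k - 1"] True by simp
        then show ?thesis using True n1 n2 by simp
      next
        case False
        then have "act X a (?e k) = 0"
          using leg_elements(3)[OF r X x, of ?s a] 1 eL[of k] a(1) t by auto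
        then show ?thesis using False n1 n2 by auto
      qed
    next
      case 2
      have t: "tail Q a = v" using a sv_LS_mid[OF l] 2 by simp
      have ek: "?e k = x" using eL[of k] 2 by simp
      have n1: "k < slen ?w \<and> snd ?w ! k = Fwd a \<longleftrightarrow> starts q a"
        using LS_letter_right[of r k q v] 2 by (cases q) (auto simp: starts_def)
      have n2: "0 < k \<and> snd ?w ! (k - 1) = Inv a \<longleftrightarrow> starts r a"
        using LS_letter_left[of "k - 1" r v q] 2 by (cases r) (auto simp: starts_def)
      have e1: "starts q a \<Longrightarrow> ?e (Suc k) = act X a x" using 2 eR[of "Suc k"] by (cases q) (auto simp: starts_def)
      have e2: "starts r a \<Longrightarrow> ?e (k - 1) = act X a x" using 2 eL[of "k - 1"] by (cases r) (auto simp: starts_def)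
      have "\<not> (starts q a \<and> starts r a)" using l unfolding legs_def starts_def by auto
      then show ?thesis unfolding n1 n2 ek using e1 e2 z[OF a(1) t] by auto
    next
      case 3
      let ?s = "k - length r"
      have t: "tail Q a = pv v q ?s" using a sv_LS_right[OF l, of k] 3 k by simp
      have n1: "k < slen ?w \<Longrightarrow> snd ?w ! k = Fwd (q ! ?s)" using LS_letter_right[of r k q v] 3 by simp
      have n2: "snd ?w ! (k - 1) = Fwd (q ! (?s - 1))" using LS_letter_right[of r "k - 1" q v] 3 k by simp
      show ?thesis
      proof (cases "k < slen ?w \<and> a = q ! ?s")
        case True
        then have "act X a (?e k) = ?e (Suc k)"
          using leg_elements(2)[OF q X x, of ?s] 3 eR[of k] eR[of "Suc k"] by (auto simp: Suc_diff_le)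
        then show ?thesis using True n1 n2 by simp
      next
        case False
        then have "act X a (?e k) = 0"
          using leg_elements(3)[OF q X x, of ?s a] 3 k eR[of k] a(1) t by auto
        then show ?thesis using False n1 n2 by auto
      qed
    qed
  qed
  show ?thesis unfolding string_family_def using mem tab by blast
qed

text \<open>The universal property of the module: its homomorphisms are given by the vectors at
  \<open>v\<close> that are killed by all arrows starting no leg. Uniqueness is
  \<open>LS_hom_eqI\<close>.\<close>

lemma LS_hom_exists:
  assumes l: "legs v r q" and X: "rep X" and x: "x \<in> space X v"
    and z: "\<And>a. a \<in> arcs Q \<Longrightarrow> tail Q a = v \<Longrightarrow> \<not> starts r a \<Longrightarrow> \<not> starts q a \<Longrightarrow> act X a x = 0"
  obtains h where "rhom (SM (LS v r q)) X h" "h v (unit_seq (length r)) = x"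
proof
  show "rhom (SM (LS v r q)) X (family_hom (LS v r q) (leg_family X r q x))"
    by (rule hom_family_hom[OF X string_LS[OF l] string_leg_family[OF l X x z]])
  show "family_hom (LS v r q) (leg_family X r q x) v (unit_seq (length r)) = x"
    by (subst family_hom_unit) (simp_all add: leg_family_def)
qed

lemma hom_SM_eqI:
  assumes w: "string w" and f: "rhom (SM w) X f" and g: "rhom (SM w) X g"
    and e: "\<And>k. k \<le> slen w \<Longrightarrow> f (sv w k) (unit_seq k) = g (sv w k) (unit_seq k)"
    and v: "v \<in> verts Q" "x \<in> space (SM w) v"
  shows "f v x = g v x"
  using hom_SM_expand[OF f w v] hom_SM_expand[OF g w v] e by simp

lemma hom_edge:
  assumes w: "string w" and f: "rhom (SM w) X f" and e: "edge (snd w) i (Fwd a) j"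
  shows "f (sv w j) (unit_seq j) = act X a (f (sv w i) (unit_seq i))"
proof -
  note a = string_edge[OF w e]
  have "unit_seq i \<in> space (SM w) (tail Q a)" using a(2) edge_le[OF e] by (intro unit_seq_mem) simp_all
  then show ?thesis using hom_act[OF f a(1)] act_SM_unit[OF w e] a by metis
qed

lemma LS_hom_eqI:
  assumes l: "legs v r q" and f: "rhom (SM (LS v r q)) X f" and g: "rhom (SM (LS v r q)) X g"
    and e: "f v (unit_seq (length r)) = g v (unit_seq (length r))"
    and u: "u \<in> verts Q" "x \<in> space (SM (LS v r q)) u"
  shows "f u x = g u x"
proof (rule hom_SM_eqI[OF string_LS[OF l] f g _ u])
  let ?w = "LS v r q" and ?r = "length r"
  note w = string_LS[OF l]
  have left: "s \<le> ?r \<Longrightarrow> f (sv ?w (?r - s)) (unit_seq (?r - s)) = g (sv ?w (?r - s)) (unit_seq (?r - s))" for s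
  proof (induction s)
    case 0
    then show ?case using e by (simp only: sv_LS_mid[OF l] diff_zero add_0_right)
  next
    case (Suc s)
    have "edge (snd ?w) (?r - s) (Fwd (r ! s)) (?r - Suc s)"
      using Suc.prems LS_letter_left[of "?r - Suc s" r v q] by (auto simp: edge_def LS_def)
    then show ?case using hom_edge[OF w f] hom_edge[OF w g] Suc by (metis Suc_leD)
  qed
  have right: "s \<le> length q \<Longrightarrow> f (sv ?w (?r + s)) (unit_seq (?r + s)) = g (sv ?w (?r + s)) (unit_seq (?r + s))" for s
  proof (induction s)
    case 0
    then show ?case using e by (simp only: sv_LS_mid[OF l] diff_zero add_0_right)
  next
    case (Suc s)
    have "edge (snd ?w) (?r + s) (Fwd (q ! s)) (?r + Suc s)"
      using Suc.prems LS_letter_right[of r "?r + s" q v] by (auto simp: edge_def LS_def)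
    then show ?case using hom_edge[OF w f] hom_edge[OF w g] Suc by (metis Suc_leD)
  qed
  show "f (sv ?w k) (unit_seq k) = g (sv ?w k) (unit_seq k)" if "k \<le> slen ?w" for k
  proof (cases "k \<le> ?r")
    case True
    then show ?thesis using left[of "?r - k"] by simp
  next
    case False
    then show ?thesis using right[of "k - ?r"] that by simp
  qed
qed

section \<open>Indecomposable projectives\<close>

lemma unit_mid_mem: "legs v r q \<Longrightarrow> unit_seq (length r) \<in> space (SM (LS v r q)) v"
  using sv_LS_mid by (intro unit_seq_mem) simp_all

text \<open>With \<open>covers\<close> the universal property imposes no condition on the vector at
  \<open>v\<close>, so any preimage of the image of the generator defines a lift.\<close>

lemma projective_LS:
  assumes l: "legs v r q" and c: "covers v r q" shows "projective_rep Q I (SM (LS v r q))"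
  unfolding projective_rep_def
proof (intro conjI allI impI; (elim conjE)?)
  show "rep (SM (LS v r q))" by (rule rep_SM[OF string_LS[OF l]])
  fix X Y g h assume X: "rep X" and Y: "rep Y" and g: "surj_hom Q X Y g" and h: "rhom (SM (LS v r q)) Y h"
  have v: "v \<in> verts Q" using l by (simp add: legs_def)
  have gh: "rhom X Y g" using g by (simp add: surj_hom_def)
  have "h v (unit_seq (length r)) \<in> space Y v" using hom_mem[OF h v unit_mid_mem[OF l]] .
  then obtain x where x: "x \<in> space X v" "g v x = h v (unit_seq (length r))"
    using g v unfolding surj_hom_def by (metis imageE)
  obtain k where k: "rhom (SM (LS v r q)) X k" "k v (unit_seq (length r)) = x"
    using LS_hom_exists[OF l X x(1)] c unfolding covers_def by metis
  show "\<exists>l. rhom (SM (LS v r q)) X l \<and> (\<forall>u\<in>verts Q. \<forall>x\<in>space (SM (LS v r q)) u. g u (l u x) = h u x)"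
    using LS_hom_eqI[OF l hom_comp[OF k(1) gh] h] x k by blast
qed

lemma covering_legs_exist:
  assumes v: "v \<in> verts Q" shows "\<exists>r q. legs v r q \<and> covers v r q"
proof (cases "\<exists>a\<in>arcs Q. tail Q a = v")
  case False
  then have "legs v [] [] \<and> covers v [] []" using v leg_Nil by (auto simp: legs_def covers_def)
  then show ?thesis by blast
next
  case True
  then obtain a where a: "a \<in> arcs Q" "tail Q a = v" by blast
  obtain p where p: "leg v (a # p)" using leg_exists[OF a(1)] a(2) by blast
  show ?thesis
  proof (cases "\<exists>b\<in>arcs Q. tail Q b = v \<and> b \<noteq> a")
    case False
    then have "legs v [] (a # p) \<and> covers v [] (a # p)" using v p leg_Nil by (auto simp: legs_def covers_def starts_def)
    then show ?thesis by blast
  next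
    case True
    then obtain b where b: "b \<in> arcs Q" "tail Q b = v" "b \<noteq> a" by blast
    obtain p' where p': "leg v (b # p')" using leg_exists[OF b(1)] b(2) by blast
    have "legs v (a # p) (b # p') \<and> covers v (a # p) (b # p')"
      using v p p' b a out2[of _ a b] by (fastforce simp: legs_def covers_def starts_def)
    then show ?thesis by blast
  qed
qed

text \<open>A sum of modules \<open>P(v)\<close> maps onto \<open>P\<close>, with one generator for
  each vector of a basis. Projectivity makes \<open>P\<close> a retract of this sum, and an
  indecomposable retract of a sum is isomorphic to one of the indecomposable terms.\<close>

lemma indec_projective_iso_LS:
  assumes P: "projective_rep Q I P" and ind: "indec P"
  shows "\<exists>v r q. legs v r q \<and> covers v r q \<and> riso P (SM (LS v r q))"
proof -
  have rP: "rep P" using ind by (rule indec_rep)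
  define good where "good = (\<lambda>M. \<exists>v r q. legs v r q \<and> covers v r q \<and> M = SM (LS v r q))"
  have good_rep: "good M \<Longrightarrow> rep M" for M using rep_SM string_LS unfolding good_def by blast
  have good_indec: "good M \<Longrightarrow> indec M" for M using indec_SM string_LS unfolding good_def by blast
  \<comment> \<open>Induction over the vectors still to be reached: each pair \<open>(v, x)\<close>
    adds one \<open>P(v)\<close> whose generator goes to \<open>x\<close>.\<close>
  have cover: "\<exists>Ms h. (\<forall>M\<in>set Ms. good M) \<and> rhom (rep_sum_list Ms) P h \<and>
      (\<forall>(v, x)\<in>set L. x \<in> h v ` space (rep_sum_list Ms) v)"
    if "\<forall>(v, x)\<in>set L. v \<in> verts Q \<and> x \<in> space P v" for L
    using that
  proof (induction L)
    case Nil
    have "rhom (rep_sum_list []) P (\<lambda>v x. 0)" using hom_zero[OF rP] .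
    then show ?case by (metis (no_types, lifting) empty_iff list.set(1))
  next
    case (Cons y L)
    obtain u x where y: "y = (u, x)" by (cases y)
    have u: "u \<in> verts Q" "x \<in> space P u" using Cons.prems y by auto
    obtain Ms h where Ms: "\<forall>M\<in>set Ms. good M" and h: "rhom (rep_sum_list Ms) P h"
      and L: "\<forall>(v, x)\<in>set L. x \<in> h v ` space (rep_sum_list Ms) v"
      using Cons by auto
    obtain r q where l: "legs u r q" "covers u r q" using covering_legs_exist[OF u(1)] by blast
    let ?M = "SM (LS u r q)"
    obtain k where k: "rhom ?M P k" "k u (unit_seq (length r)) = x"
      using LS_hom_exists[OF l(1) rP u(2)] l(2) unfolding covers_def by metis
    have rM: "rep ?M" and rMs: "rep (rep_sum_list Ms)"
      using rep_SM[OF string_LS[OF l(1)]] rep_rep_sum_list Ms good_rep by blast+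
    let ?k = "\<lambda>v z. k v (seq_left z) + h v (seq_right z)"
    have "rhom (rep_sum_list (?M # Ms)) P ?k" using hom_copair[OF rP k(1) h] by simp
    moreover have "\<forall>M\<in>set (?M # Ms). good M" using Ms l unfolding good_def by auto
    moreover have "x' \<in> ?k v ` space (rep_sum_list (?M # Ms)) v" if vx: "(v, x') \<in> set (y # L)" for v x'
    proof (cases "(v, x') = y")
      case True
      have "?k u (seq_pair (unit_seq (length r)) 0) = x" using k(2) hom_0[OF h rMs u(1)] by simp
      moreover have "seq_pair (unit_seq (length r)) 0 \<in> space (rep_sum ?M (rep_sum_list Ms)) u"
        unfolding mem_rep_sum seq_left_pair seq_right_pair using unit_mid_mem[OF l(1)] rep_0[OF rMs u(1)] by blast
      ultimately show ?thesis using True y by (metis (no_types, lifting) Pair_inject image_iff rep_sum_list_simps(2))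
    next
      case False
      then have vL: "(v, x') \<in> set L" using vx by auto
      then have v: "v \<in> verts Q" using Cons.prems by auto
      obtain z where z: "z \<in> space (rep_sum_list Ms) v" "x' = h v z" using L vL by blast
      have "?k v (seq_pair 0 z) = x'" using z hom_0[OF k(1) rM v] by simp
      moreover have "seq_pair 0 z \<in> space (rep_sum ?M (rep_sum_list Ms)) v"
        unfolding mem_rep_sum seq_left_pair seq_right_pair using z rep_0[OF rM v] by blast
      ultimately show ?thesis by (metis (no_types, lifting) image_iff rep_sum_list_simps(2))
    qed
    ultimately show ?case by (intro exI[of _ "?M # Ms"] exI[of _ ?k]) blast
  qed
  have "\<exists>B. finite B \<and> B \<subseteq> space P v \<and> seq.span B = space P v" if "v \<in> verts Q" for v
    using fin_dim_subspace_basis rP that unfolding rep_iff by metis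
  then obtain B where B: "\<And>v. v \<in> verts Q \<Longrightarrow> finite (B v) \<and> B v \<subseteq> space P v \<and> seq.span (B v) = space P v" by metis
  have "finite (SIGMA v:verts Q. B v)" using B by (intro finite_SigmaI) auto
  then obtain L where L: "set L = (SIGMA v:verts Q. B v)" using finite_list by blast
  have "\<forall>(v, x)\<in>set L. v \<in> verts Q \<and> x \<in> space P v" using L B by auto
  then obtain Ms h where Ms: "\<forall>M\<in>set Ms. good M" and h: "rhom (rep_sum_list Ms) P h"
    and hL: "\<forall>(v, x)\<in>set L. x \<in> h v ` space (rep_sum_list Ms) v"
    using cover by blast
  have rMs: "rep (rep_sum_list Ms)" using rep_rep_sum_list Ms good_rep by blast
  have "h v ` space (rep_sum_list Ms) v = space P v" if v: "v \<in> verts Q" for v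
  proof
    show "h v ` space (rep_sum_list Ms) v \<subseteq> space P v" using hom_mem[OF h v] by blast
    have "B v \<subseteq> h v ` space (rep_sum_list Ms) v" using hL L v by auto
    moreover have "seq.subspace (h v ` space (rep_sum_list Ms) v)"
      by (rule linear_map_image_subspace[OF hom_linear[OF h v] rep_subspace[OF rMs v]])
    ultimately show "space P v \<subseteq> h v ` space (rep_sum_list Ms) v" using B[OF v] seq.span_minimal by metis
  qed
  then have "surj_hom Q (rep_sum_list Ms) P h" using h by (simp add: surj_hom_def)
  then obtain s where "rhom P (rep_sum_list Ms) s" "\<forall>v\<in>verts Q. \<forall>x\<in>space P v. h v (s v x) = x"
    using P rMs rP hom_id[of P] unfolding projective_rep_def by meson
  then have "retract P (rep_sum_list Ms)" using h unfolding retract_def by blast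
  then obtain M where M: "M \<in> set Ms" "retract P M"
    using indec_retract_rep_sum_list[OF ind] Ms good_rep by blast
  then have "riso P M" using indec_retract_iso[OF ind good_indec] Ms by blast
  moreover obtain v r q where "legs v r q" "covers v r q" "M = SM (LS v r q)"
    using M(1) Ms unfolding good_def by blast
  ultimately show ?thesis by blast
qed

end

section \<open>Strings with a non-split extension by an indecomposable projective\<close>

context gentle_quiver
begin

text \<open>Copies the \<open>m + 1\<close> positions from \<open>s\<close> on in the source to the
  positions from \<open>d\<close> on in the target, and drops everything else.\<close>

definition interval_hom :: "nat \<Rightarrow> nat \<Rightarrow> nat \<Rightarrow> 'v \<Rightarrow> (nat \<Rightarrow> 'k) \<Rightarrow> nat \<Rightarrow> 'k" where
  "interval_hom s d m = (\<lambda>v x j. if d \<le> j \<and> j \<le> d + m then x (j - d + s) else 0)"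

text \<open>At the borders of the interval arrows lead out of it in \<open>w\<close> and into it in
  \<open>w'\<close>. So it spans a quotient of the source and a submodule of the target, and the map
  is the composite of the two.\<close>

lemma hom_interval_hom:
  assumes w: "string w" and w': "string w'" and le: "s + m \<le> slen w" "d + m \<le> slen w'"
    and letters: "\<And>t. t < m \<Longrightarrow> snd w ! (s + t) = snd w' ! (d + t)"
    and start: "sv w s = sv w' d"
    and s0: "0 < s \<Longrightarrow> \<exists>a. snd w ! (s - 1) = Inv a" and s1: "s + m < slen w \<Longrightarrow> \<exists>a. snd w ! (s + m) = Fwd a"
    and d0: "0 < d \<Longrightarrow> \<exists>a. snd w' ! (d - 1) = Fwd a" and d1: "d + m < slen w' \<Longrightarrow> \<exists>a. snd w' ! (d + m) = Inv a"
  shows "rhom (SM w) (SM w') (interval_hom s d m)"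
proof (rule homI)
  have svt: "t \<le> m \<Longrightarrow> sv w (s + t) = sv w' (d + t)" for t
  proof (induction t)
    case (Suc t)
    then show ?case
      using string_target[OF w, of "s + t"] string_target[OF w', of "d + t"] letters[of t] le by simp
  qed (simp add: start)
  show "interval_hom s d m v x \<in> space (SM w') v" if x: "x \<in> space (SM w) v" for v x
  proof -
    have "j \<le> slen w' \<and> sv w' j = v" if j: "interval_hom s d m v x j \<noteq> 0" for j
    proof -
      have j1: "d \<le> j" "j \<le> d + m" "x (j - d + s) \<noteq> 0" using j by (auto simp: interval_hom_def split: if_splits)
      then have "sv w (s + (j - d)) = v" using x by (metis add.commute mem_SM)
      then show ?thesis using svt[of "j - d"] j1 le by simp
    qed
    then show ?thesis by simp
  qed
  show "interval_hom s d m v (x + y) = interval_hom s d m v x + interval_hom s d m v y" for v x y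
    by (auto simp: interval_hom_def)
  show "interval_hom s d m v (seq_scale c x) = seq_scale c (interval_hom s d m v x)" for v c x
    by (auto simp: interval_hom_def fun_eq_iff)
  fix a x assume "a \<in> arcs Q"
  let ?f = "interval_hom s d m (tail Q a) x"
  have f0: "?f k = 0" if "k < d \<or> d + m < k" for k using that by (auto simp: interval_hom_def)
  have f1: "?f (d + t) = x (s + t)" if "t \<le> m" for t using that by (simp add: interval_hom_def add.commute)
  show "interval_hom s d m (head Q a) (act (SM w) a x) = act (SM w') a ?f"
  proof
    fix j
    let ?i = "j - d + s"
    \<comment> \<open>The two summands of \<open>act_SM\<close> are matched separately. At the
      borders the terms on one side only vanish by \<open>s0\<close> and \<open>d1\<close> here, by
      \<open>d0\<close> and \<open>s1\<close> in the other summand.\<close>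
    have 1: "(if d \<le> j \<and> j \<le> d + m then (if 0 < ?i \<and> ?i \<le> slen w \<and> snd w ! (?i - 1) = Fwd a then x (?i - 1) else 0) else 0)
        = (if 0 < j \<and> j \<le> slen w' \<and> snd w' ! (j - 1) = Fwd a then ?f (j - 1) else 0)" (is "?l = ?r")
    proof -
      consider "j \<le> d" | "d < j" "j \<le> d + m" | "j = Suc (d + m)" | "Suc (d + m) < j" by linarith
      then show ?thesis
      proof cases
        case 1
        then have "?l = 0" using s0 by (cases "j = d") auto
        moreover have "?r = 0" using 1 f0[of "j - 1"] by (cases j) auto
        ultimately show ?thesis by simp
      next
        case 2
        then obtain t where t: "j = Suc (d + t)" "t < m" by (metis Suc_le_eq add_Suc_right le_Suc_ex less_imp_Suc_add nat_add_left_cancel_le)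
        then have "?i = Suc (s + t)" by simp
        then show ?thesis using t letters[OF t(2)] le f1[of t] by (simp add: add.commute)
      next
        case 3
        then show ?thesis using d1 by auto
      next
        case 4
        then have "?f (j - 1) = 0" by (intro f0) linarith
        then show ?thesis using 4 by simp
      qed
    qed
    have 2: "(if d \<le> j \<and> j \<le> d + m then (if ?i < slen w \<and> snd w ! ?i = Inv a then x (Suc ?i) else 0) else 0)
        = (if j < slen w' \<and> snd w' ! j = Inv a then ?f (Suc j) else 0)" (is "?l = ?r")
    proof -
      consider "Suc j < d" | "Suc j = d" | "d \<le> j" "j < d + m" | "j = d + m" | "d + m < j" by linarith
      then show ?thesis
      proof cases
        case 1
        then show ?thesis using f0[of "Suc j"] by auto
      next
        case 2
        then show ?thesis using d0 by auto
      next
        case 3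
        then obtain t where t: "j = d + t" "t < m" by (metis le_Suc_ex nat_add_left_cancel_less)
        then have "?i = s + t" by simp
        then show ?thesis using t letters[OF t(2)] le f1[of "Suc t"] by (simp add: add.commute)
      next
        case 4
        then have "?l = 0" using s1 by (auto simp: add.commute)
        moreover have "?r = 0" using 4 f0[of "Suc j"] by simp
        ultimately show ?thesis by simp
      next
        case 5
        then show ?thesis using f0[of "Suc j"] by auto
      qed
    qed
    show "interval_hom s d m (head Q a) (act (SM w) a x) j = act (SM w') a ?f j"
      unfolding act_SM 1[symmetric] 2[symmetric] unfolding interval_hom_def act_SM by auto
  qed
qed

text \<open>The cut vertex is a sink of \<open>w\<close>. One sum term receives the leg
  \<open>A\<close> and the other the leg \<open>B\<close>, both share the position of
  \<open>v\<close>, and the difference of the two projections to \<open>SM w\<close> cancels exactly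
  there. If a section existed, one of its two parts would give an invertible endomorphism of
  \<open>SM w\<close> although that part only sees one side of the cut; \<open>nt1\<close> and
  \<open>nt2\<close> exclude this.\<close>

lemma cut_extension:
  assumes w: "string (u, w1 @ w2)" and v: "v = wend u w1"
    and w1: "w1 \<noteq> [] \<Longrightarrow> \<exists>c. last w1 = Fwd c" and w2: "w2 \<noteq> [] \<Longrightarrow> \<exists>d. hd w2 = Inv d"
    and l: "legs v B A"
    and okA: "w1 \<noteq> [] \<Longrightarrow> A \<noteq> [] \<Longrightarrow> letters_ok Q I (last w1) (Fwd (hd A))"
    and okB: "w2 \<noteq> [] \<Longrightarrow> B \<noteq> [] \<Longrightarrow> letters_ok Q I (Inv (hd B)) (hd w2)"
    and nt1: "w1 \<noteq> [] \<or> B \<noteq> []" and nt2: "w2 \<noteq> [] \<or> A \<noteq> []"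
  shows "\<exists>E f g. rep E \<and> short_exact Q (SM (LS v B A)) E (SM (u, w1 @ w2)) f g \<and>
     \<not> split_epi Q E (SM (u, w1 @ w2)) g \<and> \<not> indec E"
proof -
  let ?w = "(u, w1 @ w2)" and ?P = "LS v B A"
  let ?E1 = "(u, w1 @ map Fwd A)" and ?E2 = "(wend v (map Fwd B), map Inv (rev B) @ w2)"
  \<comment> \<open>\<open>K\<close> is the position of the cut vertex in \<open>?w\<close> and
    \<open>?E1\<close>, and \<open>b\<close> is its position in \<open>?P\<close> and
    \<open>?E2\<close>.\<close>
  define K b where "K = length w1" and "b = length B"
  have sw: "swalk u w1" "swalk v w2" using w v by (auto simp: string_iff swalk_append)
  have nA: "nzpath v A" and nB: "nzpath v B" using l by (auto simp: legs_def leg_def)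
  have backB: "swalk (wend v (map Fwd B)) (map Inv (rev B))" "wend (wend v (map Fwd B)) (map Inv (rev B)) = v"
    using swalk_rev[of v "map Fwd B"] nB unfolding map_Inv_rev nzpath_def by auto
  have P: "string ?P" by (rule string_LS[OF l])
  have E1: "string ?E1"
    using sw nA okA v by (auto simp: string_iff swalk_append nzpath_def hd_map)
  have E2: "string ?E2"
    using sw backB okB by (auto simp: string_iff swalk_append last_map last_rev)
  have V1: "sv ?E1 j = sv ?w j" if "j \<le> K" for j using that by (simp add: sv_take K_def)
  have V2: "sv ?E1 (K + t) = sv ?P (b + t)" if "t \<le> length A" for t
    using that backB by (simp add: sv_take K_def b_def LS_def v)
  have V3: "sv ?P i = sv ?E2 i" if "i \<le> b" for i using that by (simp add: sv_take b_def LS_def)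
  have V4: "sv ?E2 (b + t) = sv ?w (K + t)" if "t \<le> length w2" for t
    using that backB by (simp add: sv_take K_def b_def v)
  have lastw1: "\<exists>a. (w1 @ xs) ! (K - 1) = Fwd a" if "0 < K" for xs
    using w1 that by (cases w1 rule: rev_cases) (auto simp: K_def nth_append)
  have hdw2: "\<exists>a. (ys @ w2) ! length ys = Inv a" if "w2 \<noteq> []" for ys
    using w2 that by (simp add: nth_append hd_conv_nth)
  have lastB: "\<exists>a. (map Inv (rev B) @ xs) ! (b - 1) = Inv a" if "0 < b" for xs
    using that by (auto simp: nth_append b_def)
  have hdA: "\<exists>a. (ys @ map Fwd A) ! length ys = Fwd a" if "A \<noteq> []" for ys
    using that by (simp add: nth_append)
  let ?f1 = "interval_hom b K (length A)" and ?f2 = "interval_hom 0 0 b"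
  let ?g1 = "interval_hom 0 0 K" and ?g2 = "interval_hom b K (length w2)"
  have f1: "rhom (SM ?P) (SM ?E1) ?f1"
    using V2[of 0] lastB lastw1
    by (intro hom_interval_hom[OF P E1]) (auto simp: K_def b_def LS_def nth_append)
  have f2: "rhom (SM ?P) (SM ?E2) ?f2"
    using V3[of 0] hdA[of "map Inv (rev B)"] hdw2[of "map Inv (rev B)"]
    by (intro hom_interval_hom[OF P E2]) (auto simp: b_def LS_def nth_append)
  have g1: "rhom (SM ?E1) (SM ?w) ?g1"
    using V1[of 0] hdA[of w1] hdw2[of w1]
    by (intro hom_interval_hom[OF E1 w]) (auto simp: K_def nth_append)
  have g2: "rhom (SM ?E2) (SM ?w) ?g2"
    using V4[of 0] lastB lastw1
    by (intro hom_interval_hom[OF E2 w]) (auto simp: K_def b_def nth_append)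
  let ?E = "rep_sum (SM ?E1) (SM ?E2)"
  let ?f = "\<lambda>v x. seq_pair (?f1 v x) (?f2 v x)" and ?g = "\<lambda>v z. ?g1 v (seq_left z) - ?g2 v (seq_right z)"
  have rE1: "rep (SM ?E1)" and rE2: "rep (SM ?E2)" and rw: "rep (SM ?w)" and rP: "rep (SM ?P)"
    using rep_SM E1 E2 w P by auto
  have rE: "rep ?E" using rep_rep_sum[OF rE1 rE2] .
  have f: "rhom (SM ?P) ?E ?f" using hom_pair[OF f1 f2] .
  have g: "rhom ?E (SM ?w) ?g" using hom_minus[OF rw hom_comp[OF hom_left g1] hom_comp[OF hom_right g2]] .
  have ex: "short_exact Q (SM ?P) ?E (SM ?w) ?f ?g"
    unfolding short_exact_def inj_hom_def surj_hom_def
  proof (intro conjI ballI f g)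
    fix t assume "t \<in> verts Q"
    show "inj_on (?f t) (space (SM ?P) t)"
    proof (rule inj_onI)
      fix x y assume x: "x \<in> space (SM ?P) t" "y \<in> space (SM ?P) t" and e: "?f t x = ?f t y"
      show "x = y"
      proof
        fix i
        consider "i \<le> b" | "b < i" "i \<le> b + length A" | "b + length A < i" by linarith
        then show "x i = y i"
        proof cases
          case 1
          have "?f2 t x i = ?f2 t y i" using e unfolding seq_pair_eq_iff by metis
          then show ?thesis using 1 by (simp add: interval_hom_def)
        next
          case 2
          have "?f1 t x (i - b + K) = ?f1 t y (i - b + K)" using e unfolding seq_pair_eq_iff by metis
          moreover have "i - b + K - K + b = i" "K \<le> i - b + K" "i - b + K \<le> K + length A" using 2 by auto
          ultimately show ?thesis unfolding interval_hom_def by metis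
        next
          case 3
          then have "x i = 0" "y i = 0" using x unfolding mem_SM slen_LS b_def by (meson not_le)+
          then show ?thesis by simp
        qed
      qed
    qed
    show "?g t ` space ?E t = space (SM ?w) t"
    proof
      show "?g t ` space ?E t \<subseteq> space (SM ?w) t" using hom_mem[OF g \<open>t \<in> verts Q\<close>] by blast
      show "space (SM ?w) t \<subseteq> ?g t ` space ?E t"
      proof
        fix y assume y: "y \<in> space (SM ?w) t"
        \<comment> \<open>The coordinate at the cut vertex goes to the first term only, and the
          minus sign makes up for the difference in \<open>?g\<close>.\<close>
        let ?y1 = "\<lambda>j. if j \<le> K then y j else 0" and ?y2 = "\<lambda>j. if b < j then - y (j - b + K) else 0"
        have "?y1 \<in> space (SM ?E1) t"
          using y V1 by (auto simp: K_def)
        moreover have "?y2 \<in> space (SM ?E2) t"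
        proof -
          have "j \<le> slen ?E2 \<and> sv ?E2 j = t" if j: "?y2 j \<noteq> 0" for j
          proof -
            have "b < j" "y (j - b + K) \<noteq> 0" using j by (auto split: if_splits)
            moreover from this have "j - b + K \<le> length w1 + length w2" "sv ?w (K + (j - b)) = t"
              using y by (auto simp: add.commute)
            ultimately show ?thesis using V4[of "j - b"] by (simp add: K_def b_def)
          qed
          then show ?thesis by simp
        qed
        moreover have "?g t (seq_pair ?y1 ?y2) = y"
        proof
          fix j
          have "y j = 0" if "K + length w2 < j"
            using y that unfolding mem_SM K_def by (metis length_append not_le snd_conv)
          then show "?g t (seq_pair ?y1 ?y2) j = y j" by (auto simp: interval_hom_def)
        qed
        ultimately show "y \<in> ?g t ` space ?E t"
          by (intro image_eqI[of _ _ "seq_pair ?y1 ?y2"]) (simp_all only: mem_rep_sum seq_left_pair seq_right_pair conj_assoc simp_thms)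
      qed
    qed
    show "?f t ` space (SM ?P) t = {z \<in> space ?E t. ?g t z = 0}"
    proof
      have "?g t (?f t x) = 0" for x by (auto simp: interval_hom_def fun_eq_iff)
      then show "?f t ` space (SM ?P) t \<subseteq> {z \<in> space ?E t. ?g t z = 0}" using hom_mem[OF f \<open>t \<in> verts Q\<close>] by blast
      show "{z \<in> space ?E t. ?g t z = 0} \<subseteq> ?f t ` space (SM ?P) t"
      proof
        fix z assume "z \<in> {z \<in> space ?E t. ?g t z = 0}"
        then obtain z1 z2 where z: "z = seq_pair z1 z2" "z1 \<in> space (SM ?E1) t" "z2 \<in> space (SM ?E2) t"
          and gz: "?g1 t z1 - ?g2 t z2 = 0"
          using that[of "seq_left z" "seq_right z"] by simp
        have gj: "?g1 t z1 j = ?g2 t z2 j" for j using gz by (metis right_minus_eq)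
        have z1: "z1 j = 0" if "j < K" for j using gj[of j] that by (simp add: interval_hom_def)
        have zK: "z1 K = z2 b" using gj[of K] by (simp add: interval_hom_def)
        have z1': "z1 j = 0" if "K + length A < j" for j
          using z(2) that unfolding mem_SM K_def by (metis length_append length_map not_le snd_conv)
        have z2: "z2 j = 0" if "b < j" for j
        proof (cases "j \<le> b + length w2")
          case True
          have "j - b + K - K + b = j" "K \<le> j - b + K" "j - b + K \<le> K + length w2" "\<not> j - b + K \<le> K"
            using that True by auto
          then show ?thesis using gj[of "j - b + K"] unfolding interval_hom_def by (metis add_0)
        next
          case False
          then show ?thesis using z(3) unfolding mem_SM b_def by (metis length_append length_map length_rev snd_conv)
        qed
        \<comment> \<open>In a kernel element both parts vanish away from the legs and agree at the
          cut vertex, so they glue to a vector of \<open>P(v)\<close>.\<close>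
        define x where "x = (\<lambda>i. if i \<le> b then z2 i else z1 (i - b + K))"
        have xm: "x \<in> space (SM ?P) t"
        proof -
          have "i \<le> slen ?P \<and> sv ?P i = t" if i: "x i \<noteq> 0" for i
          proof (cases "i \<le> b")
            case True
            then show ?thesis using i z(3) V3[of i] unfolding x_def mem_SM by (auto simp: b_def)
          next
            case False
            then have "z1 (K + (i - b)) \<noteq> 0" using i unfolding x_def by (simp add: add.commute)
            then have "K + (i - b) \<le> K + length A" "sv ?E1 (K + (i - b)) = t"
              using z(2) z1' by (auto simp: not_less[symmetric])
            then show ?thesis using V2[of "i - b"] False by (auto simp: b_def)
          qed
          then show ?thesis by simp
        qed
        have e1: "?f1 t x = z1"
        proof
          fix j
          show "?f1 t x j = z1 j"
            using z1[of j] z1'[of j] zK unfolding interval_hom_def x_def by (cases "j = K") auto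
        qed
        have e2: "?f2 t x = z2"
        proof
          fix j
          show "?f2 t x j = z2 j" using z2[of j] unfolding interval_hom_def x_def by auto
        qed
        have "z = ?f t x" unfolding z(1) e1 e2 by (rule refl)
        then show "z \<in> ?f t ` space (SM ?P) t" using xm by (rule image_eqI)
      qed
    qed
  qed
  have nsplit: "\<not> split_epi Q ?E (SM ?w) ?g"
  proof
    assume "split_epi Q ?E (SM ?w) ?g"
    then obtain s where s: "rhom (SM ?w) ?E s" and gs: "\<And>v x. v \<in> verts Q \<Longrightarrow> x \<in> space (SM ?w) v \<Longrightarrow> ?g v (s v x) = x"
      unfolding split_epi_def by blast
    let ?s1 = "\<lambda>v x. seq_left (s v x)" and ?s2 = "\<lambda>v x. seq_right (s v x)"
    have s1: "rhom (SM ?w) (SM ?E1) ?s1" and s2: "rhom (SM ?w) (SM ?E2) ?s2"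
      using hom_comp[OF s hom_left] hom_comp[OF s hom_right] .
    let ?h1 = "\<lambda>v x. ?g1 v (?s1 v x)" and ?h2 = "\<lambda>v x. ?g2 v (?s2 v x)"
    have h1: "rhom (SM ?w) (SM ?w) ?h1" and h2: "rhom (SM ?w) (SM ?w) ?h2"
      using hom_comp[OF s1 g1] hom_comp[OF s2 g2] .
    let ?n = "slen ?w"
    \<comment> \<open>Evaluating the section at the first basis vector shows that not both
      composites have zero diagonal.\<close>
    have "coef ?w ?h1 0 0 - coef ?w ?h2 0 0 = 1"
      using fun_cong[OF gs[OF string_sv_verts[OF w, of 0] unit_seq_mem[of 0]], of 0] by (simp add: coef_def)
    then consider "coef ?w ?h1 0 0 \<noteq> 0" | "coef ?w ?h2 0 0 \<noteq> 0" by fastforce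
    then show False
    proof cases
      case 1
      let ?x = "?s1 (sv ?w ?n) (unit_seq ?n)"
      \<comment> \<open>The diagonal is constant, so the entry at the last position is nonzero too,
        although \<open>?g1\<close> produces nothing beyond \<open>K\<close>. Hence
        \<open>w2\<close> is empty, and the first arrow of \<open>A\<close> acts nontrivially on the
        image of a vector that it kills in \<open>SM w\<close>.\<close>
      have c: "coef ?w ?h1 ?n ?n \<noteq> 0" using 1 coef_diag[OF w h1, of ?n] by simp
      have nK: "?n \<le> K"
      proof (rule ccontr)
        assume "\<not> ?n \<le> K"
        then have "coef ?w ?h1 ?n ?n = 0" unfolding coef_def interval_hom_def by simp
        then show False using c by simp
      qed
      then have w2e: "w2 = []" and n: "?n = K" by (auto simp: K_def)
      have xK: "?x K \<noteq> 0" using c n unfolding coef_def interval_hom_def by (simp split: if_splits)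
      obtain a A' where A: "A = a # A'" using nt2 w2e by (cases A) auto
      have e: "edge (snd ?E1) K (Fwd a) (Suc K)" using A by (auto simp: edge_def K_def nth_append)
      have a: "a \<in> arcs Q" "tail Q a = sv ?w ?n" using string_edge(1,2)[OF E1 e] V1[of K] n by auto
      have "\<not> edge (snd ?w) ?n (Fwd a) j" for j
      proof
        assume "edge (snd ?w) ?n (Fwd a) j"
        then have "0 < K" "w1 ! (K - 1) = Inv a" using n w2e by (auto simp: edge_def K_def)
        then show False using lastw1[of "[]"] by auto
      qed
      then have "act (SM ?w) a (unit_seq ?n) = 0" using act_SM_unit_0[OF w] by blast
      then have "act (SM ?E1) a ?x = 0"
        using hom_act[OF s1 a(1), of "unit_seq ?n"] unit_seq_mem[of ?n ?w] a hom_0[OF s1 rw, of "head Q a"]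
        by (metis head_in_verts order_refl)
      then show False using act_SM_edge[OF E1 e, of ?x] xK by (metis zero_fun_apply)
    next
      case 2
      let ?x = "?s2 (sv ?w 0) (unit_seq 0)"
      have K0: "K = 0"
      proof (rule ccontr)
        assume "K \<noteq> 0"
        then have "coef ?w ?h2 0 0 = 0" unfolding coef_def interval_hom_def by simp
        then show False using 2 by simp
      qed
      then have w1e: "w1 = []" by (simp add: K_def)
      have xb: "?x b \<noteq> 0" using 2 K0 unfolding coef_def interval_hom_def by (simp split: if_splits)
      obtain a B' where B: "B = a # B'" using nt1 w1e by (cases B) auto
      have e: "edge (snd ?E2) b (Fwd a) (b - 1)" using B by (auto simp: edge_def b_def nth_append)
      have a: "a \<in> arcs Q" "tail Q a = sv ?w 0" using string_edge(1,2)[OF E2 e] V4[of 0] K0 by auto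
      have "\<not> edge (snd ?w) 0 (Fwd a) j" for j
        using hdw2[of "[]"] w1e by (auto simp: edge_def)
      then have "act (SM ?w) a (unit_seq 0) = 0" using act_SM_unit_0[OF w] by blast
      then have "act (SM ?E2) a ?x = 0"
        using hom_act[OF s2 a(1), of "unit_seq 0"] unit_seq_mem[of 0 ?w] a hom_0[OF s2 rw, of "head Q a"]
        by (metis head_in_verts zero_le)
      then show False using act_SM_edge[OF E2 e, of ?x] xb by (metis zero_fun_apply)
    qed
  qed
  have "\<not> indec ?E"
    using rE1 rE2 iso_refl[of ?E] indec_SM[OF E1] indec_SM[OF E2] unfolding indecomposable_def by blast
  then show ?thesis using rE ex nsplit by blast
qed

section \<open>Good and bad strings\<close>

definition bad :: "'v \<times> 'a letter list \<Rightarrow> bool" where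
  "bad w \<longleftrightarrow> (\<exists>v r q E f g. legs v r q \<and> covers v r q \<and> rep E \<and> short_exact Q (SM (LS v r q)) E (SM w) f g \<and>
     \<not> split_epi Q E (SM w) g \<and> \<not> indec E)"

lemma badI:
  assumes "legs v r q" "covers v r q"
    and "\<exists>E f g. rep E \<and> short_exact Q (SM (LS v r q)) E (SM w) f g \<and> \<not> split_epi Q E (SM w) g \<and> \<not> indec E"
  shows "bad w"
  using assms unfolding bad_def by blast

text \<open>The string \<open>q\<close> belongs to the quotient of \<open>P(v)\<close> by the submodule that \<open>b\<close> generates.\<close>

definition quot_leg :: "'v \<Rightarrow> 'a list \<Rightarrow> 'a \<Rightarrow> bool" where
  "quot_leg v q b \<longleftrightarrow> legs v [] q \<and> b \<in> arcs Q \<and> tail Q b = v \<and> \<not> starts q b \<and>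
     (\<forall>a\<in>arcs Q. tail Q a = v \<longrightarrow> a = b \<or> starts q a)"

text \<open>Either \<open>P(v)\<close> itself or its quotient by the leg through \<open>b\<close>.
  If \<open>b\<close> is the only arrow at \<open>v\<close>, the quotient is the simple module and
  \<open>q\<close> is empty.\<close>

definition good_legs :: "'v \<Rightarrow> 'a list \<Rightarrow> 'a list \<Rightarrow> bool" where
  "good_legs v r q \<longleftrightarrow> legs v r q \<and> (covers v r q \<or> r = [] \<and> (\<exists>b. quot_leg v q b))"

text \<open>Up to isomorphism, because a string and its inverse have isomorphic modules while only
  one of them need have the shape \<open>LS v r q\<close>.\<close>

definition good :: "'v \<times> 'a letter list \<Rightarrow> bool" where
  "good w \<longleftrightarrow> string w \<and> (\<exists>v r q. good_legs v r q \<and> riso (SM w) (SM (LS v r q)))"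

text \<open>The cut is made between \<open>c\<close> and the inverse of \<open>d\<close>. Neither
  \<open>c\<close> nor \<open>d\<close> has a relation with both legs at \<open>v\<close>, and no
  leg has a relation with both \<open>c\<close> and \<open>d\<close>; hence the legs can be assigned
  to the two sides so that no relation occurs.\<close>

lemma bad_if_valley:
  assumes w: "string (u, xs @ Fwd c # Inv d # ys)"
  shows "bad (u, xs @ Fwd c # Inv d # ys)"
proof -
  let ?w1 = "xs @ [Fwd c]" and ?w2 = "Inv d # ys"
  have w': "string (u, ?w1 @ ?w2)" using w by simp
  define v where "v = wend u ?w1"
  have cd: "c \<in> arcs Q" "d \<in> arcs Q" "head Q c = v" "head Q d = v" "c \<noteq> d"
    using w by (auto simp: string_iff swalk_append v_def)
  have "v \<in> verts Q" using cd by auto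
  then obtain r q where l: "legs v r q" and cov: "covers v r q" using covering_legs_exist by blast
  let ?okA = "\<lambda>p. p = [] \<or> \<not> zero_rel c (hd p)" and ?okB = "\<lambda>p. p = [] \<or> \<not> zero_rel d (hd p)"
  have arc: "hd p \<in> arcs Q \<and> tail Q (hd p) = v" if "leg v p" "p \<noteq> []" for p
    using nzpath_nth(1,2)[of v p 0] that by (simp add: leg_def hd_conv_nth pv_def)
  have lr: "leg v r" "leg v q" "r \<noteq> [] \<Longrightarrow> q \<noteq> [] \<Longrightarrow> hd r \<noteq> hd q" using l by (auto simp: legs_def)
  have A: "?okA q \<or> ?okA r" using zero_right[of c "hd r" "hd q"] arc lr cd by metis
  have B: "?okB q \<or> ?okB r" using zero_right[of d "hd r" "hd q"] arc lr cd by metis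
  have AB: "?okA p \<or> ?okB p" if "leg v p" for p using zero_left[of c d "hd p"] arc that cd by metis
  have "?okA q \<and> ?okB r \<or> ?okA r \<and> ?okB q" using A B AB[OF lr(1)] AB[OF lr(2)] by metis
  then obtain A B where AB: "legs v B A" "covers v B A" "?okA A" "?okB B"
    using l cov legs_sym covers_sym by metis
  have "\<exists>E f g. rep E \<and> short_exact Q (SM (LS v B A)) E (SM (u, ?w1 @ ?w2)) f g \<and>
     \<not> split_epi Q E (SM (u, ?w1 @ ?w2)) g \<and> \<not> indec E"
    using AB by (intro cut_extension[OF w' v_def]) (auto simp: zero_rel_def)
  then show ?thesis using badI[OF AB(1,2)] by simp
qed

lemma letters_decomp:
  "(\<exists>xs c d ys. ls = xs @ Fwd c # Inv d # ys) \<or> (\<exists>r q. ls = map Inv r @ map Fwd q)"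
proof (induction ls)
  case Nil
  show ?case by (intro disjI2 exI[of _ "[]"]) simp
next
  case (Cons l ls)
  then show ?case
  proof
    assume "\<exists>xs c d ys. ls = xs @ Fwd c # Inv d # ys"
    then show ?thesis by (metis append_Cons)
  next
    assume "\<exists>r q. ls = map Inv r @ map Fwd q"
    then obtain r q where rq: "ls = map Inv r @ map Fwd q" by blast
    show ?thesis
    proof (cases l)
      case (Inv a)
      then have "l # ls = map Inv (a # r) @ map Fwd q" using rq by simp
      then show ?thesis by blast
    next
      case (Fwd a)
      show ?thesis
      proof (cases r)
        case Nil
        then have "l # ls = map Inv [] @ map Fwd (a # q)" using rq Fwd by simp
        then show ?thesis by blast
      next
        case (Cons d r')
        then have "l # ls = [] @ Fwd a # Inv d # map Inv r' @ map Fwd q" using rq Fwd by simp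
        then show ?thesis by blast
      qed
    qed
  qed
qed

lemma legs_starting:
  assumes "b \<in> arcs Q" "tail Q b = v" obtains A B where "legs v B A" "covers v B A" "starts A b"
proof -
  obtain r q where "legs v r q" "covers v r q" using covering_legs_exist assms tail_in_verts by metis
  then show ?thesis using that assms legs_sym covers_sym unfolding covers_def by metis
qed

text \<open>A string without a valley is \<open>LS v r q\<close> for nonzero paths \<open>r\<close>
  and \<open>q\<close>. If one of them can be prolonged, or if both are empty at a vertex with two
  outgoing arrows, the string is cut at that end or at that vertex. In all other cases the paths are
  legs and at most one leg of \<open>P(v)\<close> is missing.\<close>

lemma good_or_bad:
  assumes w: "string w" shows "good w \<or> bad w"
proof -
  obtain u ls where uls: "w = (u, ls)" by (cases w)
  show ?thesis
  proof (cases "\<exists>xs c d ys. ls = xs @ Fwd c # Inv d # ys")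
    case True
    then show ?thesis using bad_if_valley w uls by blast
  next
    case False
    then obtain r0 q where "ls = map Inv r0 @ map Fwd q" using letters_decomp by blast
    then obtain r where ls: "ls = map Inv (rev r) @ map Fwd q" by (metis rev_rev_ident)
    define v where "v = wend u (map Inv (rev r))"
    have sw: "swalk u (map Inv (rev r))" "nzpath v q" and rq: "r \<noteq> [] \<Longrightarrow> q \<noteq> [] \<Longrightarrow> hd r \<noteq> hd q"
      using w unfolding uls ls string_iff swalk_append
      by (auto simp: v_def nzpath_def last_map hd_map last_rev)
    have "map linv (rev (map Inv (rev r))) = map Fwd r" by (simp add: rev_map)
    then have nr: "nzpath v r" and ur: "u = wend v (map Fwd r)"
      using swalk_rev[OF sw(1)] by (auto simp: v_def nzpath_def)
    have wLS: "w = LS v r q" by (simp add: LS_def uls ls ur[symmetric])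
    have vv: "v \<in> verts Q" using nr swalk_verts by (auto simp: nzpath_def)
    show ?thesis
    proof (cases "leg v q \<and> leg v r")
      case False
      then consider "\<not> leg v q" | "\<not> leg v r" by blast
      then have "bad w"
      proof cases
        case 1
        \<comment> \<open>The cut is at the end of the string. The leg \<open>A\<close> starts with
          \<open>b\<close>, so it prolongs \<open>q\<close>, and being nonempty it prevents a
          splitting.\<close>
        then obtain b where b: "q \<noteq> []" "b \<in> arcs Q" "head Q (last q) = tail Q b" "\<not> zero_rel (last q) b"
          using sw(2) unfolding leg_def by blast
        have we: "wend u ls = tail Q b" using b by (simp add: ls wend_def last_map)
        obtain A B where AB: "legs (tail Q b) B A" "covers (tail Q b) B A" "starts A b" using legs_starting[OF b(2)] by blast
        have "\<exists>E f g. rep E \<and> short_exact Q (SM (LS (tail Q b) B A)) E (SM (u, ls @ [])) f g \<and>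
            \<not> split_epi Q E (SM (u, ls @ [])) g \<and> \<not> indec E"
        proof (rule cut_extension[OF _ _ _ _ AB(1)])
          show "string (u, ls @ [])" using w uls by simp
          show "tail Q b = wend u ls" using we by simp
          show "\<exists>c. last ls = Fwd c" using b(1) by (simp add: ls last_map)
          show "letters_ok Q I (last ls) (Fwd (hd A))" using b AB(3) by (simp add: ls last_map starts_def zero_rel_def)
        qed (use b(1) AB(3) in \<open>auto simp: ls starts_def\<close>)
        then show ?thesis using badI[OF AB(1,2)] by (simp add: uls)
      next
        case 2
        then obtain b where b: "r \<noteq> []" "b \<in> arcs Q" "head Q (last r) = tail Q b" "\<not> zero_rel (last r) b"
          using nr unfolding leg_def by blast
        have we: "u = tail Q b" using b by (simp add: ur wend_def last_map)
        obtain A B where AB: "legs (tail Q b) A B" "covers (tail Q b) A B" "starts A b"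
          using legs_starting[OF b(2)] legs_sym covers_sym by metis
        have hdls: "hd ls = Inv (last r)" using b(1) by (simp add: ls hd_append hd_map hd_rev)
        have "\<exists>E f g. rep E \<and> short_exact Q (SM (LS (tail Q b) A B)) E (SM (u, [] @ ls)) f g \<and>
            \<not> split_epi Q E (SM (u, [] @ ls)) g \<and> \<not> indec E"
        proof (rule cut_extension[OF _ _ _ _ AB(1)])
          show "string (u, [] @ ls)" using w uls by simp
          show "tail Q b = wend u []" using we by simp
          show "\<exists>d. hd ls = Inv d" using hdls by simp
          show "letters_ok Q I (Inv (hd A)) (hd ls)" using b AB(3) hdls by (simp add: starts_def zero_rel_def)
        qed (use b(1) AB(3) in \<open>auto simp: ls starts_def\<close>)
        then show ?thesis using badI[OF AB(1,2)] by (simp add: uls)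
      qed
      then show ?thesis ..
    next
      case True
      then have l: "legs v r q" using rq vv by (simp add: legs_def)
      have one_leg: "good_legs v [] p" if p: "leg v p" "p \<noteq> []" for p
      proof (cases "covers v [] p")
        case True
        then show ?thesis using p vv leg_Nil by (simp add: good_legs_def legs_def)
      next
        case False
        then obtain b where b: "b \<in> arcs Q" "tail Q b = v" "\<not> starts p b" unfolding covers_def by (auto simp: starts_def)
        have hp: "hd p \<in> arcs Q" "tail Q (hd p) = v"
          using nzpath_nth(1,2)[of v p 0] p by (simp_all add: leg_def hd_conv_nth pv_def)
        \<comment> \<open>At most two arrows start at \<open>v\<close>, so besides the leg
          \<open>p\<close> only the leg through one arrow \<open>b\<close> is missing.\<close>
        have "a = b \<or> starts p a" if "a \<in> arcs Q" "tail Q a = v" for a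
          using out2[OF that(1) hp(1) b(1)] that hp b p(2) by (auto simp: starts_def)
        then have "quot_leg v p b" using b p vv leg_Nil by (simp add: quot_leg_def legs_def)
        then show ?thesis using p vv leg_Nil by (auto simp: good_legs_def legs_def)
      qed
      consider "r = []" "q = []" | "r = []" "q \<noteq> []" | "r \<noteq> []" "q = []" | "r \<noteq> []" "q \<noteq> []" by blast
      then show ?thesis
      proof cases
        case 1
        show ?thesis
        proof (cases "\<exists>a\<in>arcs Q. \<exists>b\<in>arcs Q. tail Q a = v \<and> tail Q b = v \<and> a \<noteq> b")
          case True
          obtain B A where AB: "legs v B A" "covers v B A" using covering_legs_exist[OF vv] by blast
          have ne: "A \<noteq> []" "B \<noteq> []" using AB(2) True unfolding covers_def starts_def by metis+
          \<comment> \<open>The simple module at a vertex with two outgoing arrows is cut with both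
            \<open>w1\<close> and \<open>w2\<close> empty; nonsplitting rests on both legs being
            nonempty.\<close>
          have uv: "u = v" using ur 1 by simp
          have "\<exists>E f g. rep E \<and> short_exact Q (SM (LS v B A)) E (SM (u, [] @ [])) f g \<and>
            \<not> split_epi Q E (SM (u, [] @ [])) g \<and> \<not> indec E"
            using w uls ls 1 uv ne by (intro cut_extension[OF _ _ _ _ AB(1)]) auto
          then have "bad w" using badI[OF AB] by (simp add: uls ls 1)
          then show ?thesis ..
        next
          case False
          have "good_legs v [] []"
          proof (cases "\<exists>b\<in>arcs Q. tail Q b = v")
            case True
            then obtain b where "b \<in> arcs Q" "tail Q b = v" by blast
            then have "quot_leg v [] b" using False l 1 by (auto simp: quot_leg_def starts_def)
            then show ?thesis using l 1 by (auto simp: good_legs_def)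
          next
            case False
            then show ?thesis using l 1 by (auto simp: good_legs_def covers_def)
          qed
          then have "good w" using w iso_refl wLS 1 unfolding good_def by blast
          then show ?thesis ..
        qed
      next
        case 2
        then have "good w" using one_leg[of q] l w iso_refl wLS unfolding good_def legs_def by blast
        then show ?thesis ..
      next
        case 3
        \<comment> \<open>\<open>quot_leg\<close> fixes the empty leg to be the first one, so the
          string is reversed.\<close>
        have "riso (SM w) (SM (LS v [] r))"
          using isoI[OF inverse_homs_rev[OF w]] rev_string_LS[OF l] 3 unfolding wLS by simp
        then have "good w" using one_leg[of r] 3 l w unfolding good_def legs_def by blast
        then show ?thesis ..
      next
        case 4
        have h: "hd p \<in> arcs Q \<and> tail Q (hd p) = v" if "leg v p" "p \<noteq> []" for p
          using nzpath_nth(1,2)[of v p 0] that by (simp add: leg_def hd_conv_nth pv_def)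
        have "starts r a \<or> starts q a" if "a \<in> arcs Q" "tail Q a = v" for a
          using out2[of "hd r" "hd q" a] h[of r] h[of q] that l 4 unfolding legs_def starts_def by auto
        then have "good_legs v r q" using l by (simp add: good_legs_def covers_def)
        then have "good w" using w iso_refl wLS unfolding good_def by blast
        then show ?thesis ..
      qed
    qed
  qed
qed

end

section \<open>Extensions between good strings\<close>

context gentle_quiver
begin

lemma string_family_of_hom:
  assumes w: "string w" and X: "rep X" and h: "rhom (SM w) X h"
  shows "string_family X w (\<lambda>k. h (sv w k) (unit_seq k))"
  unfolding string_family_def
proof (intro conjI allI impI ballI)
  fix k assume k: "k \<le> slen w"
  have u: "unit_seq k \<in> space (SM w) (sv w k)" using k by (intro unit_seq_mem) simp_all
  show "h (sv w k) (unit_seq k) \<in> space X (sv w k)" using hom_mem[OF h string_sv_verts[OF w k] u] .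
  fix a assume a: "a \<in> arcs Q" "tail Q a = sv w k"
  have red: "\<not> (k < slen w \<and> snd w ! k = Fwd a \<and> 0 < k \<and> snd w ! (k - 1) = Inv a)"
    using string_reduced[OF w] unfolding reduced_def by (metis Suc_diff_1 linv.simps(2))
  consider "k < slen w" "snd w ! k = Fwd a" | "0 < k" "snd w ! (k - 1) = Inv a"
    | "\<not> (k < slen w \<and> snd w ! k = Fwd a)" "\<not> (0 < k \<and> snd w ! (k - 1) = Inv a)" by blast
  then show "act X a (h (sv w k) (unit_seq k)) =
     (if k < slen w \<and> snd w ! k = Fwd a then h (sv w (Suc k)) (unit_seq (Suc k)) else 0) +
     (if 0 < k \<and> snd w ! (k - 1) = Inv a then h (sv w (k - 1)) (unit_seq (k - 1)) else 0)"
  proof cases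
    case 1
    have "edge (snd w) k (Fwd a) (Suc k)" using 1 by (simp add: edge_def)
    then have "h (sv w (Suc k)) (unit_seq (Suc k)) = act X a (h (sv w k) (unit_seq k))" by (rule hom_edge[OF w h])
    moreover have "\<not> (0 < k \<and> snd w ! (k - 1) = Inv a)" using red 1 by blast
    ultimately show ?thesis using 1 by (simp only: if_True if_False simp_thms add_0_right)
  next
    case 2
    have "edge (snd w) k (Fwd a) (k - 1)" using 2 k by (auto simp: edge_def)
    then have "h (sv w (k - 1)) (unit_seq (k - 1)) = act X a (h (sv w k) (unit_seq k))" by (rule hom_edge[OF w h])
    moreover have "\<not> (k < slen w \<and> snd w ! k = Fwd a)" using red 2 by blast
    ultimately show ?thesis using 2 by (simp only: if_True if_False simp_thms add_0)
  next
    case 3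
    have "\<not> edge (snd w) k (Fwd a) j" for j using 3 by (auto simp: edge_def)
    then have "act (SM w) a (unit_seq k) = 0" using act_SM_unit_0[OF w] by blast
    then have "act X a (h (sv w k) (unit_seq k)) = 0"
      using hom_act[OF h a(1)] u a hom_0[OF h rep_SM[OF w]] by (metis head_in_verts)
    then show ?thesis using 3 by (simp only: if_False add_0)
  qed
qed

text \<open>Builds an automorphism that moves the last basis vector to \<open>y\<close>. If
  \<open>q\<close> is empty, that vector is the generator and \<open>y\<close> is an admissible
  image; otherwise the image of the generator must be chosen so that \<open>q\<close> carries it to
  \<open>y\<close>. The nonzero entry of \<open>y\<close> at the end is a diagonal entry, hence
  bijectivity. The conditions \<open>c1\<close> and \<open>c2\<close> allow the letter
  \<open>Inv b\<close> to follow.\<close>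

lemma leg_end_endo:
  assumes l: "legs v r q" and b: "b \<in> arcs Q" and y: "y \<in> space (SM (LS v r q)) (head Q b)"
    and supp: "\<And>k. y k \<noteq> 0 \<Longrightarrow> k = 0 \<or> k = length r \<or> k = length r + length q"
    and yn: "y (length r + length q) \<noteq> 0"
    and c1: "q = [] \<Longrightarrow> r \<noteq> [] \<Longrightarrow> \<not> zero_rel b (hd r)"
    and c2: "q \<noteq> [] \<Longrightarrow> last q \<noteq> b \<and> y (length r) = 0"
    and c3: "q \<noteq> [] \<Longrightarrow> r \<noteq> [] \<Longrightarrow> y 0 \<noteq> 0 \<Longrightarrow> \<exists>u. r = u @ q"
  shows "\<exists>h. rhom (SM (LS v r q)) (SM (LS v r q)) h \<and> hom_bij (SM (LS v r q)) (SM (LS v r q)) h \<and>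
     h (head Q b) (unit_seq (length r + length q)) = y \<and>
     string (fst (LS v r q), snd (LS v r q) @ [Inv b])"
proof -
  let ?w = "LS v r q" and ?r = "length r" and ?n = "length r + length q"
  have w: "string ?w" by (rule string_LS[OF l])
  have rw: "rep (SM ?w)" by (rule rep_SM[OF w])
  have svn: "sv ?w ?n = head Q b" using y yn by simp
  have nz: "nzpath v r" "nzpath v q" using l by (auto simp: legs_def leg_def)
  have hr: "hd r \<in> arcs Q" "tail Q (hd r) = v" if "r \<noteq> []"
    using nzpath_nth(1,2)[OF nz(1), of 0] that by (simp_all add: hd_conv_nth pv_def)
  have hq: "hd q \<in> arcs Q" "tail Q (hd q) = v" if "q \<noteq> []"
    using nzpath_nth(1,2)[OF nz(2), of 0] that by (simp_all add: hd_conv_nth pv_def)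
  have str: "string (fst ?w, snd ?w @ [Inv b])"
  proof -
    have "letters_ok Q I (last (snd ?w)) (Inv b)" if "snd ?w \<noteq> []"
    proof (cases "q = []")
      case True
      then have "r \<noteq> []" "last (snd ?w) = Inv (hd r)" using that by (auto simp: LS_def last_map last_rev)
      then show ?thesis using c1[OF True] by (simp add: zero_rel_def)
    next
      case False
      then show ?thesis using c2 by (simp add: LS_def last_map)
    qed
    moreover have "swalk (fst ?w) (snd ?w)" using w string_iff[of "fst ?w" "snd ?w"] by simp
    moreover have "wend (fst ?w) (snd ?w) = head Q b" using svn wend_nth[of "fst ?w" "snd ?w"] by simp
    ultimately show ?thesis using b by (auto simp: string_iff swalk_append)
  qed
  have main: "\<exists>h. rhom (SM ?w) (SM ?w) h \<and> h (head Q b) (unit_seq ?n) = y"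
  proof (cases "q = []")
    case True
    have vb: "v = head Q b" using svn sv_LS_mid[OF l] True by simp
    have z: "act (SM ?w) a y = 0" if a: "a \<in> arcs Q" "tail Q a = v" "\<not> starts r a" for a
    proof (rule ext, rule ccontr)
      fix j assume "act (SM ?w) a y j \<noteq> 0 j"
      then obtain i where i: "edge (snd ?w) i (Fwd a) j" using act_SM_no_edge by fastforce
      then have "y i \<noteq> 0" using act_SM_edge[OF w i] \<open>act (SM ?w) a y j \<noteq> 0 j\<close> by simp
      then have "i = 0 \<or> i = ?r" using supp True by auto
      moreover have "k < ?r \<Longrightarrow> snd ?w ! k \<noteq> Fwd a" for k using LS_letter_left[of k r v q] by simp
      ultimately have "i = ?r" "i = Suc j" "snd ?w ! j = Inv a" using i True by (auto simp: edge_def LS_def)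
      then have "starts r a" using LS_letter_left[of j r v q] by (cases r) (auto simp: starts_def)
      then show False using a by simp
    qed
    obtain h where "rhom (SM ?w) (SM ?w) h" "h v (unit_seq ?r) = y"
      using LS_hom_exists[OF l rw y[folded vb]] z by metis
    then show ?thesis using vb True by auto
  next
    case False
    show ?thesis
    proof (cases "y 0 = 0")
      case True
      have "y = seq_scale (y ?n) (unit_seq ?n)"
      proof
        fix k show "y k = seq_scale (y ?n) (unit_seq ?n) k" using supp[of k] True c2 False by auto
      qed
      then show ?thesis using hom_smult[OF rw hom_id, of "y ?n"] by (metis (no_types, lifting))
    next
      case y0: False
      have rne: "r \<noteq> []" using y0 c2 \<open>q \<noteq> []\<close> by auto
      obtain u where u: "r = u @ q" using c3[OF \<open>q \<noteq> []\<close> rne y0] by blast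
      let ?m = "length q"
      \<comment> \<open>Since \<open>r = u @ q\<close>, the left leg returns to \<open>v\<close>
        after \<open>u\<close>, at position \<open>?m\<close>, and continues from there along
        \<open>q\<close>. Adding this vector to the generator makes \<open>q\<close> reach both ends
        at once.\<close>
      define x :: "nat \<Rightarrow> 'k" where "x = seq_scale (y ?n) (unit_seq ?r) + seq_scale (y 0) (unit_seq ?m)"
      have "sv ?w ?m = v"
      proof -
        have "r ! length u = hd q" using u False by (simp add: nth_append hd_conv_nth)
        then have "pv v r (length u) = v"
          using nzpath_nth(2)[OF nz(1), of "length u"] hq False u by simp
        then show ?thesis using sv_LS_left[OF l, of ?m] u by simp
      qed
      then have "unit_seq ?m \<in> space (SM ?w) v" using u by (intro unit_seq_mem) simp_all
      then have xm: "x \<in> space (SM ?w) v"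
        unfolding x_def using unit_mid_mem[OF l] rep_add[OF rw] rep_scale[OF rw] l unfolding legs_def by metis
      have "starts r a \<or> starts q a" if "a \<in> arcs Q" "tail Q a = v" for a
        using out2[of "hd r" "hd q" a] hr[OF rne] hq[OF False] that l rne False unfolding legs_def starts_def by auto
      then obtain h where h: "rhom (SM ?w) (SM ?w) h" "h v (unit_seq ?r) = x"
        using LS_hom_exists[OF l rw xm] by metis
      have hs: "s \<le> ?m \<Longrightarrow> h (sv ?w (?r + s)) (unit_seq (?r + s)) =
          seq_scale (y ?n) (unit_seq (?r + s)) + seq_scale (y 0) (unit_seq (?m - s))" for s
      proof (induction s)
        case 0
        then show ?case using h(2) sv_LS_mid[OF l] unfolding x_def by (metis add_0_right diff_zero)
      next
        case (Suc s)
        let ?a = "q ! s"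
        have e1: "edge (snd ?w) (?r + s) (Fwd ?a) (?r + Suc s)"
          using Suc.prems LS_letter_right[of r "?r + s" q v] by (simp add: edge_def)
        have e2: "edge (snd ?w) (?m - s) (Fwd ?a) (?m - Suc s)"
        proof -
          have "snd ?w ! (?m - Suc s) = Inv (r ! (?r - Suc (?m - Suc s)))"
            using Suc.prems u by (intro LS_letter_left) simp
          moreover have "?r - Suc (?m - Suc s) = length u + s" using Suc.prems u by simp
          ultimately have "snd ?w ! (?m - Suc s) = Inv ?a" using u by (simp add: nth_append)
          then show ?thesis using Suc.prems u by (auto simp: edge_def)
        qed
        note a1 = string_edge[OF w e1] and a2 = string_edge[OF w e2]
        have m1: "unit_seq (?r + s) \<in> space (SM ?w) (tail Q ?a)" using a1 Suc.prems by (intro unit_seq_mem) simp_all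
        have m2: "unit_seq (?m - s) \<in> space (SM ?w) (tail Q ?a)" using a2 Suc.prems by (intro unit_seq_mem) simp_all
        have "h (sv ?w (?r + Suc s)) (unit_seq (?r + Suc s)) = act (SM ?w) ?a (h (sv ?w (?r + s)) (unit_seq (?r + s)))"
          by (rule hom_edge[OF w h(1) e1])
        also have "\<dots> = act (SM ?w) ?a (seq_scale (y ?n) (unit_seq (?r + s)) + seq_scale (y 0) (unit_seq (?m - s)))"
          using Suc.IH Suc.prems by (metis Suc_leD)
        also have "\<dots> = seq_scale (y ?n) (act (SM ?w) ?a (unit_seq (?r + s))) + seq_scale (y 0) (act (SM ?w) ?a (unit_seq (?m - s)))"
          using act_add[OF rw a1(1)] act_scale[OF rw a1(1)] rep_scale[OF rw] m1 m2 a1(1) by (metis tail_in_verts)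
        finally show ?case using act_SM_unit[OF w e1] act_SM_unit[OF w e2] by (simp only:)
      qed
      have "h (sv ?w ?n) (unit_seq ?n) = y"
      proof -
        have "seq_scale (y ?n) (unit_seq ?n) + seq_scale (y 0) (unit_seq 0) = y"
        proof
          fix k show "(seq_scale (y ?n) (unit_seq ?n) + seq_scale (y 0) (unit_seq 0)) k = y k"
            using supp[of k] c2 False rne by auto
        qed
        then show ?thesis using hs[of ?m] by (metis diff_self_eq_0 order_refl)
      qed
      then show ?thesis using h(1) svn by metis
    qed
  qed
  then obtain h where h: "rhom (SM ?w) (SM ?w) h" "h (head Q b) (unit_seq ?n) = y" by blast
  have "coef ?w h ?n ?n \<noteq> 0" unfolding coef_def svn h(2) by (rule yn)
  then have "hom_bij (SM ?w) (SM ?w) h" using endo_bij_if_diag[OF w h(1), of ?n] by simp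
  then show ?thesis using h str by blast
qed

text \<open>By \<open>nonzero_left\<close> a nonzero path is determined backwards by its last arrow,
  as far as it reaches.\<close>

lemma nzpath_same_end:
  "nzpath v p \<Longrightarrow> nzpath v' p' \<Longrightarrow> p \<noteq> [] \<Longrightarrow> p' \<noteq> [] \<Longrightarrow> last p = last p' \<Longrightarrow> (\<exists>u. p = u @ p') \<or> (\<exists>u. p' = u @ p)"
proof (induction p arbitrary: p' rule: rev_induct)
  case (snoc a p)
  then obtain p1 where p': "p' = p1 @ [a]" by (metis append_butlast_last_id last_snoc)
  have nz: "nzpath v p" "nzpath v' p1" using snoc.prems p' by (auto simp: nzpath_def swalk_append)
  show ?case
  proof (cases "p = [] \<or> p1 = []")
    case True
    then show ?thesis using p' by auto
  next
    case False
    then obtain q c q1 c1 where q: "p = q @ [c]" "p1 = q1 @ [c1]" by (metis append_butlast_last_id)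
    have "c = c1"
    proof (rule nonzero_left[of c c1 a])
      show "\<not> zero_rel c a" "\<not> zero_rel c1 a"
        using nzpath_no_zero[of v q c a "[]"] nzpath_no_zero[of v' q1 c1 a "[]"] snoc.prems p' q by auto
    qed (use snoc.prems p' q in \<open>auto simp: nzpath_def swalk_append\<close>)
    then have "(\<exists>u. p = u @ p1) \<or> (\<exists>u. p1 = u @ p)" using snoc.IH[OF nz] False q by simp
    then show ?thesis using p' by auto
  qed
qed simp

lemma string_in_out:
  assumes w: "string w" and i: "edge (snd w) i (Fwd c) k" and j: "edge (snd w) k (Fwd d) j"
  shows "\<not> zero_rel c d"
proof -
  have ok: "letters_ok Q I (snd w ! m) (snd w ! Suc m)" if "Suc m < slen w" for m
    using w that by (simp add: is_string_def)
  show ?thesis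
  proof (cases "k = Suc i")
    case True
    then have i': "snd w ! i = Fwd c" using i by (auto simp: edge_def)
    then have "snd w ! k = Fwd d \<and> k < slen w" using j True by (auto simp: edge_def)
    then show ?thesis using ok[of i] i' True by (simp add: zero_rel_def)
  next
    case False
    then have i': "i = Suc k" "snd w ! k = Inv c" "k < slen w" using i by (auto simp: edge_def)
    then have "k = Suc j \<and> snd w ! j = Inv d" using j by (auto simp: edge_def)
    then show ?thesis using ok[of j] i' by (simp add: zero_rel_def)
  qed
qed

section \<open>Normalising the class of an extension\<close>

lemma LS_edge_left: "s < length r \<Longrightarrow> edge (snd (LS v r q)) (length r - s) (Fwd (r ! s)) (length r - Suc s)"
  using LS_letter_left[of "length r - Suc s" r v q] by (auto simp: edge_def LS_def)

lemma LS_edge_right: "s < length q \<Longrightarrow> edge (snd (LS v r q)) (length r + s) (Fwd (q ! s)) (length r + Suc s)"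
  using LS_letter_right[of r "length r + s" q v] by (simp add: edge_def LS_def)

text \<open>The vector \<open>y\<close> is the last element of a basis that exhibits \<open>M(w)\<close> as a string module \<open>M(w')\<close>
  for which \<open>w'b\<inverse>\<close> is a string.\<close>

definition attachable :: "'v \<times> 'a letter list \<Rightarrow> 'a \<Rightarrow> (nat \<Rightarrow> 'k) \<Rightarrow> bool" where
  "attachable w b y \<longleftrightarrow> (\<exists>w' f f'. string w' \<and> string (fst w', snd w' @ [Inv b]) \<and>
     inverse_homs (SM w') (SM w) f f' \<and> f (head Q b) (unit_seq (slen w')) = y)"

lemma attachable_right:
  assumes "legs v r q" "b \<in> arcs Q" "y \<in> space (SM (LS v r q)) (head Q b)"
    and "\<And>k. y k \<noteq> 0 \<Longrightarrow> k = 0 \<or> k = length r \<or> k = length r + length q"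
    and "y (length r + length q) \<noteq> 0"
    and "q = [] \<Longrightarrow> r \<noteq> [] \<Longrightarrow> \<not> zero_rel b (hd r)"
    and "q \<noteq> [] \<Longrightarrow> last q \<noteq> b \<and> y (length r) = 0"
    and "q \<noteq> [] \<Longrightarrow> r \<noteq> [] \<Longrightarrow> y 0 \<noteq> 0 \<Longrightarrow> \<exists>u. r = u @ q"
  shows "attachable (LS v r q) b y"
proof -
  note w = string_LS[OF assms(1)]
  obtain h where h: "rhom (SM (LS v r q)) (SM (LS v r q)) h" "hom_bij (SM (LS v r q)) (SM (LS v r q)) h"
    "h (head Q b) (unit_seq (slen (LS v r q))) = y" "string (fst (LS v r q), snd (LS v r q) @ [Inv b])"
    using leg_end_endo[OF assms] by auto
  obtain h' where "inverse_homs (SM (LS v r q)) (SM (LS v r q)) h h'" using hom_bij_inverse[OF rep_SM[OF w] h(1,2)] .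
  then show ?thesis using w h(3,4) unfolding attachable_def by blast
qed

text \<open>The mirror image of \<open>attachable_right\<close>, obtained by passing to the inverse
  string and composing with its isomorphism.\<close>

lemma attachable_left:
  assumes l: "legs v r q" and b: "b \<in> arcs Q" and y: "y \<in> space (SM (LS v r q)) (head Q b)"
    and supp: "\<And>k. y k \<noteq> 0 \<Longrightarrow> k = 0 \<or> k = length r \<or> k = length r + length q"
    and y0: "y 0 \<noteq> 0"
    and c1: "r = [] \<Longrightarrow> q \<noteq> [] \<Longrightarrow> \<not> zero_rel b (hd q)"
    and c2: "r \<noteq> [] \<Longrightarrow> last r \<noteq> b \<and> y (length r) = 0"
    and c3: "r \<noteq> [] \<Longrightarrow> q \<noteq> [] \<Longrightarrow> y (length r + length q) \<noteq> 0 \<Longrightarrow> \<exists>u. q = u @ r"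
  shows "attachable (LS v r q) b y"
proof -
  let ?w = "LS v r q" and ?w' = "LS v q r" and ?n = "length r + length q"
  have w: "string ?w" by (rule string_LS[OF l])
  have rv: "rev_string ?w = ?w'" and rv': "rev_string ?w' = ?w" using rev_string_LS l legs_sym by blast+
  define z where "z = rev_hom ?w (head Q b) y"
  have inv: "inverse_homs (SM ?w) (SM ?w') (rev_hom ?w) (rev_hom ?w')" using inverse_homs_rev[OF w] rv by simp
  have hv: "head Q b \<in> verts Q" using b by simp
  have zj: "z j = (if j \<le> ?n then y (?n - j) else 0)" for j unfolding z_def rev_hom_def by simp
  have zm: "z \<in> space (SM ?w') (head Q b)"
    using inv y hv unfolding z_def inverse_homs_def by (blast intro: hom_mem)
  have zy: "rev_hom ?w' (head Q b) z = y" using inv y hv unfolding z_def inverse_homs_def by blast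
  have "attachable ?w' b z"
  proof (rule attachable_right[OF legs_sym[OF l] b zm])
    fix k assume "z k \<noteq> 0"
    then have "k \<le> ?n" "y (?n - k) \<noteq> 0" using zj by (auto split: if_splits)
    then show "k = 0 \<or> k = length q \<or> k = length q + length r" using supp[of "?n - k"] by auto
  next
    show "z (length q + length r) \<noteq> 0" using zj[of ?n] y0 by (simp add: add.commute)
    show "r \<noteq> [] \<Longrightarrow> last r \<noteq> b \<and> z (length q) = 0" using c2 zj[of "length q"] by simp
    show "r \<noteq> [] \<Longrightarrow> q \<noteq> [] \<Longrightarrow> z 0 \<noteq> 0 \<Longrightarrow> \<exists>u. q = u @ r" using c3 zj[of 0] by simp
  qed (rule c1)
  then obtain w1 f f' where f: "string w1" "string (fst w1, snd w1 @ [Inv b])" "inverse_homs (SM w1) (SM ?w') f f'"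
     "f (head Q b) (unit_seq (slen w1)) = z"
    unfolding attachable_def by blast
  have t: "inverse_homs (SM w1) (SM ?w) (\<lambda>v x. rev_hom ?w' v (f v x)) (\<lambda>v x. f' v (rev_hom ?w v x))"
    by (rule inverse_homs_trans[OF f(3) inverse_homs_sym[OF inv]])
  have e: "rev_hom ?w' (head Q b) (f (head Q b) (unit_seq (slen w1))) = y"
    unfolding f(4) by (rule zy)
  show ?thesis
    unfolding attachable_def
    by (rule exI[of _ w1], rule exI[of _ "\<lambda>v x. rev_hom ?w' v (f v x)"],
        rule exI[of _ "\<lambda>v x. f' v (rev_hom ?w v x)"]) (intro conjI f(1,2) t e)
qed

text \<open>Subtracting an image of \<open>b\<close> clears all positions where an edge labelled
  \<open>b\<close> arrives. At a position that remains, any outgoing arrow \<open>d\<close> has no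
  relation with \<open>b\<close>, because of \<open>ann\<close>. An incoming arrow \<open>c\<close>
  would have none with \<open>d\<close> either, so \<open>c = b\<close>, which was cleared. Hence
  only positions without incoming or without outgoing edge remain: the generator and the
  ends.\<close>

lemma LS_class_or_attachable:
  assumes l: "legs v r q" and b: "b \<in> arcs Q" and y: "y \<in> space (SM (LS v r q)) (head Q b)"
    and ann: "\<And>d. d \<in> arcs Q \<Longrightarrow> tail Q d = head Q b \<Longrightarrow> zero_rel b d \<Longrightarrow> act (SM (LS v r q)) d y = 0"
  shows "\<exists>n\<in>space (SM (LS v r q)) (tail Q b).
     y - act (SM (LS v r q)) b n = 0 \<or> attachable (LS v r q) b (y - act (SM (LS v r q)) b n)"
proof -
  let ?w = "LS v r q" and ?r = "length r" and ?n = "length r + length q"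
  have w: "string ?w" by (rule string_LS[OF l])
  have rw: "rep (SM ?w)" by (rule rep_SM[OF w])
  have uniq: "k = k'" if "edge (snd ?w) i (Fwd c) k" "edge (snd ?w) i (Fwd c) k'" for i c k k'
    using edge_unique[OF string_reduced[OF w] that] .
  \<comment> \<open>The vector \<open>n\<close> takes at the source of each edge labelled
    \<open>b\<close> the entry of \<open>y\<close> at its target, so that \<open>act b n\<close>
    agrees with \<open>y\<close> at all these targets. The choice is unique since the walk is
    reduced.\<close>
  define n where "n = (\<lambda>i. if \<exists>k. edge (snd ?w) i (Fwd b) k then y (SOME k. edge (snd ?w) i (Fwd b) k) else 0)"
  have n: "n i = y k" if "edge (snd ?w) i (Fwd b) k" for i k
    using that someI[of "edge (snd ?w) i (Fwd b)" k] uniq unfolding n_def by metis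
  have nm: "n \<in> space (SM ?w) (tail Q b)"
  proof -
    have "i \<le> slen ?w \<and> sv ?w i = tail Q b" if i: "n i \<noteq> 0" for i
    proof -
      obtain k where "edge (snd ?w) i (Fwd b) k" using i unfolding n_def by metis
      then show ?thesis using string_edge[OF w] edge_le by metis
    qed
    then show ?thesis by simp
  qed
  define y' where "y' = y - act (SM ?w) b n"
  have y'm: "y' \<in> space (SM ?w) (head Q b)"
    unfolding y'_def using rep_diff[OF rw head_in_verts[OF b] y act_mem[OF rw b nm]] .
  have y'0: "y' k = 0" if "edge (snd ?w) i (Fwd b) k" for i k
    using act_SM_edge[OF w that, of n] n[OF that] unfolding y'_def by simp
  have y'y: "y' k = y k" if "\<And>i. \<not> edge (snd ?w) i (Fwd b) k" for k
    using act_SM_no_edge[of ?w b k n, OF that] unfolding y'_def by simp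
  have no_b: "\<not> edge (snd ?w) i (Fwd b) k" if "y' k \<noteq> 0" for i k using that y'0 by blast
  have yy: "y k \<noteq> 0" if "y' k \<noteq> 0" for k using y'y no_b that by metis
  have svk: "sv ?w k = head Q b" if "y' k \<noteq> 0" for k using y'm that by simp
  have out: "\<not> zero_rel b d" if k: "y' k \<noteq> 0" and e: "edge (snd ?w) k (Fwd d) j" for k d j
  proof
    assume z: "zero_rel b d"
    have "act (SM ?w) d y j = 0" using ann[of d] z string_edge[OF w e] svk[OF k] by simp
    then show False using act_SM_edge[OF w e, of y] yy[OF k] by simp
  qed
  have inout: False if k: "y' k \<noteq> 0" and e: "edge (snd ?w) i (Fwd c) k" "edge (snd ?w) k (Fwd d) j" for k i c d j
  proof -
    note C = string_edge[OF w e(1)] and D = string_edge[OF w e(2)]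
    have "c = b"
      by (rule nonzero_left[OF C(1) b D(1) _ _ string_in_out[OF w e] out[OF k e(2)]])
        (simp_all only: C(3) D(2) svk[OF k])
    then show False using no_b[OF k] e(1) by blast
  qed
  have supp: "k = 0 \<or> k = ?r \<or> k = ?n" if k: "y' k \<noteq> 0" for k
  proof (rule ccontr)
    assume neg: "\<not> ?thesis"
    have kn: "k \<le> ?n" using y'm k by auto
    show False
    proof (cases "k < ?r")
      case True
      let ?s = "?r - k"
      have "0 < k" using neg by simp
      then have s: "?s < ?r" "0 < ?s" using True by auto
      have "edge (snd ?w) k (Fwd (r ! ?s)) (k - 1)" using LS_edge_left[of ?s r v q] s True by simp
      moreover have "edge (snd ?w) (Suc k) (Fwd (r ! (?s - 1))) k"
        using LS_edge_left[of "?s - 1" r v q] s True by (simp add: Suc_diff_le)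
      ultimately show False using inout[OF k] by blast
    next
      case False
      let ?s = "k - ?r"
      have s: "?s < length q" "0 < ?s" using False neg kn by auto
      have "edge (snd ?w) k (Fwd (q ! ?s)) (Suc k)" using LS_edge_right[of ?s q v r] s False by simp
      moreover have "edge (snd ?w) (k - 1) (Fwd (q ! (?s - 1))) k"
        using LS_edge_right[of "?s - 1" q v r] s False by simp
      ultimately show False using inout[OF k] by blast
    qed
  qed
  have nz: "nzpath v r" "nzpath v q" using l by (auto simp: legs_def leg_def)
  have er0: "edge (snd ?w) ?r (Fwd (hd r)) (?r - 1)" if "r \<noteq> []"
    using LS_edge_left[of 0 r v q] that by (simp add: hd_conv_nth)
  have eq0: "edge (snd ?w) ?r (Fwd (hd q)) (Suc ?r)" if "q \<noteq> []"
    using LS_edge_right[of 0 q v r] that by (simp add: hd_conv_nth)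
  have ern: "edge (snd ?w) 1 (Fwd (last r)) 0" if "r \<noteq> []"
  proof -
    have "?r - (?r - 1) = 1" "?r - Suc (?r - 1) = 0" "?r - 1 < ?r" "r ! (?r - 1) = last r"
      using that by (cases r; simp add: last_conv_nth)+
    then show ?thesis using LS_edge_left[of "?r - 1" r v q] by metis
  qed
  have eqn: "edge (snd ?w) (?n - 1) (Fwd (last q)) ?n" if "q \<noteq> []"
  proof -
    have "?r + (length q - 1) = ?n - 1" "?r + Suc (length q - 1) = ?n" "length q - 1 < length q" "q ! (length q - 1) = last q"
      using that by (cases q; simp add: last_conv_nth)+
    then show ?thesis using LS_edge_right[of "length q - 1" q v r] by metis
  qed
  have "y' = 0 \<or> attachable ?w b y'"
  proof (cases "y' ?r = 0")
    case False
    have zr: "\<not> zero_rel b (hd r)" if "r \<noteq> []" using out[OF False er0[OF that]] .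
    have zq: "\<not> zero_rel b (hd q)" if "q \<noteq> []" using out[OF False eq0[OF that]] .
    \<comment> \<open>Both first arrows would have a nonzero product with \<open>b\<close>, but only
      one arrow can. So the generator is an end of the string.\<close>
    have "r = [] \<or> q = []"
    proof (rule ccontr)
      assume ne: "\<not> ?thesis"
      then have ne': "r \<noteq> []" "q \<noteq> []" by auto
      note R = string_edge(1,2)[OF w er0[OF ne'(1)]] and S = string_edge(1,2)[OF w eq0[OF ne'(2)]]
      have "hd r = hd q"
        by (rule nonzero_right[OF b R(1) S(1) _ _ zr[OF ne'(1)] zq[OF ne'(2)]])
          (simp_all only: R(2) S(2) svk[OF False])
      then show False using l ne by (simp add: legs_def)
    qed
    then show ?thesis
    proof
      assume r: "r = []"
      have "attachable ?w b y'"
        by (rule attachable_left[OF l b y'm]) (use supp False zq r in auto)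
      then show ?thesis ..
    next
      assume q: "q = []"
      have "attachable ?w b y'"
        by (rule attachable_right[OF l b y'm]) (use supp False zr q in auto)
      then show ?thesis ..
    qed
  next
    case True
    have lr: "last r \<noteq> b" "r \<noteq> []" if "y' 0 \<noteq> 0"
    proof -
      show "r \<noteq> []" using that True by auto
      then show "last r \<noteq> b" using no_b[OF that] ern by blast
    qed
    have lq: "last q \<noteq> b" "q \<noteq> []" if "y' ?n \<noteq> 0"
    proof -
      show "q \<noteq> []" using that True by auto
      then show "last q \<noteq> b" using no_b[OF that] eqn by blast
    qed
    consider "y' 0 = 0" "y' ?n = 0" | "y' 0 \<noteq> 0" "y' ?n = 0" | "y' 0 = 0" "y' ?n \<noteq> 0" | "y' 0 \<noteq> 0" "y' ?n \<noteq> 0" by blast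
    then show ?thesis
    proof cases
      case 1
      then have "y' k = 0" for k using supp[of k] True by (cases "y' k = 0") auto
      then have "y' = 0" by (simp add: fun_eq_iff)
      then show ?thesis ..
    next
      case 2
      have "attachable ?w b y'"
        by (rule attachable_left[OF l b y'm]) (use supp True 2 lr in auto)
      then show ?thesis ..
    next
      case 3
      have "attachable ?w b y'"
        by (rule attachable_right[OF l b y'm]) (use supp True 3 lq in auto)
      then show ?thesis ..
    next
      case 4
      \<comment> \<open>Neither last arrow is \<open>b\<close>, and at most two arrows end at
        \<open>head Q b\<close>. Sharing the last arrow, one leg is a suffix of the other.\<close>
      have "last r = last q"
        using in2[of "last r" "last q" b] lr lq 4 string_edge[OF w ern] string_edge[OF w eqn] svk[OF 4(1)] svk[OF 4(2)] b by auto
      then consider u where "r = u @ q" | u where "q = u @ r"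
        using nzpath_same_end[OF nz] lr(2) lq(2) 4 by blast
      then show ?thesis
      proof cases
        case 1
        have "attachable ?w b y'"
          by (rule attachable_right[OF l b y'm]) (use supp True 4 lq 1 in auto)
        then show ?thesis ..
      next
        case 2
        have "attachable ?w b y'"
          by (rule attachable_left[OF l b y'm]) (use supp True 4 lr 2 in auto)
        then show ?thesis ..
      qed
    qed
  qed
  then show ?thesis using nm unfolding y'_def by blast
qed

text \<open>The basis of \<open>SM w\<close> ends in the vector to which \<open>b\<close> sends
  \<open>x0\<close>; it is continued by \<open>x0\<close> and its images along \<open>p\<close>.
  This family belongs to the walk \<open>w\<close>, then \<open>b\<close> inverted, then
  \<open>p\<close>. The resulting map restricts to \<open>f\<close> and induces the identity on the
  quotient, hence is bijective.\<close>

lemma extension_string: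
  assumes w: "string w" and wb: "string (fst w, snd w @ [Inv b])" and ql: "quot_leg i p b"
    and E: "rep E" and f: "inj_hom Q (SM w) E f" and g: "surj_hom Q E (SM (LS i [] p)) g"
    and ex: "\<And>v. v \<in> verts Q \<Longrightarrow> f v ` space (SM w) v = {x \<in> space E v. g v x = 0}"
    and x0: "x0 \<in> space E i" "g i x0 = unit_seq 0" and bx0: "act E b x0 = f (head Q b) (unit_seq (slen w))"
  shows "\<exists>w'. string w' \<and> riso (SM w') E"
proof -
  let ?M = "LS i [] p" and ?n = "slen w"
  let ?w' = "(fst w, snd w @ Inv b # map Fwd p)"
  have l: "legs i [] p" and b: "b \<in> arcs Q" "tail Q b = i" "\<not> starts p b"
    and arcs: "\<And>a. a \<in> arcs Q \<Longrightarrow> tail Q a = i \<Longrightarrow> a = b \<or> starts p a"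
    using ql by (auto simp: quot_leg_def)
  have p: "leg i p" and nzp: "nzpath i p" using l by (auto simp: legs_def leg_def)
  have w': "string ?w'"
  proof -
    have "swalk (fst w) (snd w @ [Inv b])" using wb by (simp add: string_iff)
    moreover have "wend (fst w) (snd w @ [Inv b]) = i" using b by simp
    moreover have "swalk i (map Fwd p)" using nzp by (simp add: nzpath_def)
    moreover have "p \<noteq> [] \<longrightarrow> letters_ok Q I (Inv b) (hd (map Fwd p))" using b(3) by (auto simp: starts_def hd_map)
    ultimately have "swalk (fst w) ((snd w @ [Inv b]) @ map Fwd p)" unfolding swalk_append by auto
    then show ?thesis by (simp add: string_iff)
  qed
  have fh: "rhom (SM w) E f" and gh: "rhom E (SM ?M) g" using f g by (simp_all add: inj_hom_def surj_hom_def)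
  have rw: "rep (SM w)" and rM: "rep (SM ?M)" using rep_SM w string_LS[OF l] by blast+
  have len: "slen ?w' = Suc (?n + length p)" by simp
  have iv: "i \<in> verts Q" using l by (simp add: legs_def)
  have sv1: "sv ?w' k = sv w k" if "k \<le> ?n" for k
    using that sv_take[of k "snd w" "fst w"] sv_take[of k "snd w @ Inv b # map Fwd p" "fst w"] by simp
  have sv2: "sv ?w' (Suc (?n + s)) = pv i p s" if "s \<le> length p" for s
  proof (cases s)
    case 0
    then show ?thesis using string_target[OF w', of ?n] b by (simp add: pv_def)
  next
    case (Suc t)
    then show ?thesis using string_target[OF w', of "Suc (?n + t)"] that by (simp add: pv_def nth_append)
  qed
  have let1: "snd ?w' ! k = snd w ! k" if "k < ?n" for k using that by (simp add: nth_append)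
  have letn: "snd ?w' ! ?n = Inv b" by simp
  have let2: "snd ?w' ! Suc (?n + s) = Fwd (p ! s)" if "s < length p" for s using that by (simp add: nth_append)
  \<comment> \<open>Positions up to \<open>?n\<close> lie in the submodule; position
    \<open>Suc ?n\<close> is the lift \<open>x0\<close> of the generator, and leg indices are
    shifted accordingly.\<close>
  define e where "e = (\<lambda>k. if k \<le> ?n then f (sv w k) (unit_seq k) else fold (act E) (take (k - Suc ?n) p) x0)"
  have e1: "e k = f (sv w k) (unit_seq k)" if "k \<le> ?n" for k using that by (simp add: e_def)
  have e2: "e (Suc (?n + s)) = fold (act E) (take s p) x0" for s by (simp add: e_def)
  note F = string_family_of_hom[OF w E fh, unfolded string_family_def]
  have svn: "sv w ?n = head Q b"
    using wb wend_nth[of "fst w" "snd w"] by (simp add: string_iff swalk_append)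
  have mem: "e k \<in> space E (sv ?w' k)" if k: "k \<le> slen ?w'" for k
  proof (cases "k \<le> ?n")
    case True
    then show ?thesis using F sv1 e1 by simp
  next
    case False
    then obtain s where s: "k = Suc (?n + s)" "s \<le> length p"
      using k that[of "k - Suc ?n"] unfolding len by auto
    then show ?thesis using leg_elements(1)[OF p E x0(1) s(2)] sv2 e2 by simp
  qed
  have fam: "string_family E ?w' e"
    unfolding string_family_def
  proof (intro conjI allI impI ballI)
    fix k assume k: "k \<le> slen ?w'"
    show "e k \<in> space E (sv ?w' k)" by (rule mem[OF k])
    fix a assume a: "a \<in> arcs Q" "tail Q a = sv ?w' k"
    let ?t1 = "if k < slen ?w' \<and> snd ?w' ! k = Fwd a then e (Suc k) else 0"
    let ?t2 = "if 0 < k \<and> snd ?w' ! (k - 1) = Inv a then e (k - 1) else 0"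
    consider "k \<le> ?n" | "k = Suc ?n" | s where "k = Suc (?n + s)" "0 < s" "s \<le> length p"
      using k that(1,2) that(3)[of "k - Suc ?n"] unfolding len by fastforce
    then show "act E a (e k) = ?t1 + ?t2"
    proof cases
      case 1
      have "act E a (e k) = (if k < ?n \<and> snd w ! k = Fwd a then f (sv w (Suc k)) (unit_seq (Suc k)) else 0) +
        (if 0 < k \<and> snd w ! (k - 1) = Inv a then f (sv w (k - 1)) (unit_seq (k - 1)) else 0)"
        using F 1 a sv1[OF 1] unfolding e1[OF 1] by metis
      moreover have "(if k < ?n \<and> snd w ! k = Fwd a then f (sv w (Suc k)) (unit_seq (Suc k)) else 0) = ?t1"
      proof (cases "k = ?n")
        case True
        then show ?thesis using letn by simp
      next
        case False
        then have kn: "k < ?n" using 1 by simp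
        show ?thesis unfolding let1[OF kn] using kn e1[of "Suc k"] by simp
      qed
      moreover have "(if 0 < k \<and> snd w ! (k - 1) = Inv a then f (sv w (k - 1)) (unit_seq (k - 1)) else 0) = ?t2"
      proof (cases "k = 0")
        case False
        then have kn: "k - 1 < ?n" using 1 by simp
        show ?thesis unfolding let1[OF kn] using kn e1[of "k - 1"] by simp
      qed simp
      ultimately show ?thesis by (simp only:)
    next
      case 2
      have ta: "tail Q a = i" using a 2 sv2[of 0] by (simp add: pv_def)
      have ek: "e k = x0" using e2[of 0] 2 by simp
      show ?thesis
      proof (cases "a = b")
        case True
        have "?t1 = 0"
          using b(3) True 2 let2[of 0] by (cases p) (auto simp: starts_def)
        moreover have "?t2 = act E b x0" using True 2 letn e1[of ?n] bx0 svn by simp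
        ultimately show ?thesis using True ek by (simp only: add_0)
      next
        case False
        then have st: "starts p a" using arcs a(1) ta by blast
        then have "?t1 = act E a x0" using 2 let2[of 0] e2[of 1] by (cases p) (auto simp: starts_def)
        moreover have "?t2 = 0" using False 2 letn by simp
        ultimately show ?thesis using ek by (simp only: add_0_right)
      qed
    next
      case 3
      have ta: "tail Q a = pv i p s" using a 3 sv2[of s] by simp
      have t2: "?t2 = 0" using 3 let2[of "s - 1"] by simp
      show ?thesis
      proof (cases "s < length p \<and> a = p ! s")
        case True
        then have "act E a (e k) = e (Suc k)"
          using leg_elements(2)[OF p E x0(1) 3(3)] e2[of s] e2[of "Suc s"] 3(1) by simp
        moreover have "?t1 = e (Suc k)" using True let2[of s] 3(1) by simp
        ultimately show ?thesis using t2 by (simp only: add_0_right)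
      next
        case False
        then have "act E a (e k) = 0"
          using leg_elements(3)[OF p E x0(1) 3(3) 3(2) a(1) ta] e2[of s] 3(1) by auto
        moreover have "?t1 = 0" using False let2[of s] 3(1) by auto
        ultimately show ?thesis using t2 by (simp only: add_0_right)
      qed
    qed
  qed
  let ?h = "family_hom ?w' e"
  have h: "rhom (SM ?w') E ?h" by (rule hom_family_hom[OF E w' fam])
  have rw': "rep (SM ?w')" by (rule rep_SM[OF w'])
  have hf: "?h v x = f v x" if v: "v \<in> verts Q" "x \<in> space (SM w) v" for v x
  proof -
    have x: "x k = 0" if "?n < k" for k using v(2) that unfolding mem_SM by (meson not_le)
    have "?h v x = (\<Sum>k\<in>{..slen ?w'}. seq_scale (x k) (e k))" by (simp only: family_hom_def)
    also have "\<dots> = (\<Sum>k\<in>{..?n}. seq_scale (x k) (e k))"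
      using x by (intro sum.mono_neutral_right) auto
    also have "\<dots> = f v x" unfolding hom_SM_expand[OF fh w v] using e1 by (intro sum.cong) auto
    finally show ?thesis .
  qed
  have gh': "rhom (SM ?w') (SM ?M) (\<lambda>v x. g v (?h v x))" by (rule hom_comp[OF h gh])
  have ge1: "g (sv ?w' k) (e k) = 0" if "k \<le> ?n" for k
  proof -
    have "f (sv w k) (unit_seq k) \<in> f (sv w k) ` space (SM w) (sv w k)"
      using that by (intro imageI unit_seq_mem) simp_all
    then show ?thesis using ex[OF string_sv_verts[OF w that]] e1[OF that] sv1[OF that] by simp
  qed
  have ge2: "s \<le> length p \<Longrightarrow> g (pv i p s) (e (Suc (?n + s))) = unit_seq s" for s
  proof (induction s)
    case 0
    then show ?case using x0(2) e2[of 0] by (simp add: pv_def)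
  next
    case (Suc s)
    let ?a = "p ! s"
    have a: "?a \<in> arcs Q" "tail Q ?a = pv i p s" using nzpath_nth[OF nzp, of s] Suc.prems by simp_all
    have ed: "edge (snd ?M) s (Fwd ?a) (Suc s)" using LS_edge_right[of s p i "[]"] Suc.prems by simp
    have m: "e (Suc (?n + s)) \<in> space E (tail Q ?a)" using leg_elements(1)[OF p E x0(1), of s] Suc.prems a e2 by simp
    have "e (Suc (?n + Suc s)) = act E ?a (e (Suc (?n + s)))"
      unfolding e2 using leg_elements(2)[OF p E x0(1), of s] Suc.prems by (metis Suc_le_lessD less_imp_le)
    then have "g (pv i p (Suc s)) (e (Suc (?n + Suc s))) = act (SM ?M) ?a (g (tail Q ?a) (e (Suc (?n + s))))"
      using hom_act[OF gh a(1) m] by (simp add: pv_def)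
    moreover have "g (tail Q ?a) (e (Suc (?n + s))) = unit_seq s" using Suc a(2) by (metis Suc_leD)
    ultimately show ?case using act_SM_unit[OF string_LS[OF l] ed] by metis
  qed
  \<comment> \<open>Composed with \<open>g\<close>, the map reads off the coordinates beyond
    \<open>?n\<close>.\<close>
  have gh_j: "g v (?h v x) s = x (Suc (?n + s))" if v: "v \<in> verts Q" "x \<in> space (SM ?w') v" and s: "s \<le> length p" for v x s
  proof -
    have gk: "(g (sv ?w' k) (?h (sv ?w' k) (unit_seq k))) s = (if k = Suc (?n + s) then 1 else 0)"
      if k: "k \<le> slen ?w'" for k
    proof (cases "k \<le> ?n")
      case True
      then show ?thesis using ge1[OF True] family_hom_unit[OF k, of e] by simp
    next
      case False
      then obtain t where t: "k = Suc (?n + t)" "t \<le> length p"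
        using k that[of "k - Suc ?n"] unfolding len by auto
      then have "g (sv ?w' k) (?h (sv ?w' k) (unit_seq k)) = unit_seq t"
        using ge2[OF t(2)] sv2[OF t(2)] family_hom_unit[OF k, of e] by simp
      then show ?thesis using t by auto
    qed
    have "g v (?h v x) s = (\<Sum>k\<le>slen ?w'. x k * (g (sv ?w' k) (?h (sv ?w' k) (unit_seq k))) s)"
      using hom_SM_expand[OF gh' w' v] by (simp add: sum_seq_apply)
    also have "\<dots> = (\<Sum>k\<le>slen ?w'. if k = Suc (?n + s) then x k else 0)"
      by (rule sum.cong[OF refl]) (simp only: gk atMost_iff mult_1_right mult_zero_right if_distrib[of "(*) _"])
    also have "\<dots> = x (Suc (?n + s))" using s by simp
    finally show ?thesis .
  qed
  have "bij_betw (?h v) (space (SM ?w') v) (space E v)" if v: "v \<in> verts Q" for v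
    unfolding bij_betw_def
  proof
    have ker: "x = 0" if x: "x \<in> space (SM ?w') v" and hx: "?h v x = 0" for x
    proof -
      have "g v (?h v x) = 0" using hx hom_0[OF gh E v] by simp
      then have up: "x (Suc (?n + s)) = 0" if "s \<le> length p" for s using gh_j[OF v x that] by simp
      have big: "x k = 0" if "?n < k" for k
      proof (cases "k \<le> slen ?w'")
        case True
        then show ?thesis using up[of "k - Suc ?n"] that by simp
      next
        case False
        then show ?thesis using x unfolding mem_SM by blast
      qed
      have xw: "x \<in> space (SM w) v"
        using x big sv1 unfolding mem_SM by (metis not_le)
      have "f v x = f v 0" using hf[OF v xw] hx hom_0[OF fh rw v] by simp
      moreover have "inj_on (f v) (space (SM w) v)" using f v by (simp add: inj_hom_def)
      ultimately show "x = 0" by (intro inj_onD[OF _ _ xw rep_0[OF rw v]])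
    qed
    show "inj_on (?h v) (space (SM ?w') v)"
    proof (rule inj_onI)
      fix x y assume xy: "x \<in> space (SM ?w') v" "y \<in> space (SM ?w') v" "?h v x = ?h v y"
      then have "?h v (x - y) = 0" using hom_diff[OF h rw' v xy(1,2)] by simp
      then show "x = y" using ker[OF rep_diff[OF rw' v xy(1,2)]] by (metis right_minus_eq)
    qed
    show "?h v ` space (SM ?w') v = space E v"
    proof
      show "?h v ` space (SM ?w') v \<subseteq> space E v" using hom_mem[OF h v] by blast
      show "space E v \<subseteq> ?h v ` space (SM ?w') v"
      proof
        fix z assume z: "z \<in> space E v"
        have gz: "g v z \<in> space (SM ?M) v" using hom_mem[OF gh v z] .
        \<comment> \<open>Shifting the coordinates of \<open>g z\<close> behind \<open>?n\<close>
          gives a vector with the same image in the quotient. What is left lies in the kernel of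
          \<open>g\<close>, hence in the image of \<open>SM w\<close>.\<close>
        define x where "x = (\<lambda>k. if ?n < k then g v z (k - Suc ?n) else 0)"
        have xm: "x \<in> space (SM ?w') v"
        proof -
          have "k \<le> slen ?w' \<and> sv ?w' k = v" if k: "x k \<noteq> 0" for k
          proof -
            have nk: "?n < k" "g v z (k - Suc ?n) \<noteq> 0" using k by (auto simp: x_def split: if_splits)
            then have s: "k - Suc ?n \<le> length p" "sv ?M (k - Suc ?n) = v" using gz by auto
            then have "pv i p (k - Suc ?n) = v" using sv_LS_right[OF l, of "k - Suc ?n"] by simp
            then show ?thesis using sv2[OF s(1)] nk(1) s(1) by simp
          qed
          then show ?thesis by simp
        qed
        have "g v (?h v x) = g v z"
        proof
          fix s
          show "g v (?h v x) s = g v z s"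
          proof (cases "s \<le> length p")
            case True
            then show ?thesis using gh_j[OF v xm True] by (simp add: x_def)
          next
            case False
            then have "g v z s = 0" "g v (?h v x) s = 0"
              using gz hom_mem[OF gh' v xm] unfolding mem_SM by auto
            then show ?thesis by simp
          qed
        qed
        then have "g v (z - ?h v x) = 0" using hom_diff[OF gh E v z hom_mem[OF h v xm]] by simp
        then have "z - ?h v x \<in> f v ` space (SM w) v" using ex[OF v] rep_diff[OF E v z hom_mem[OF h v xm]] by simp
        then obtain y where y: "y \<in> space (SM w) v" "z - ?h v x = f v y" by blast
        have ym: "y \<in> space (SM ?w') v" using y(1) sv1 by auto
        have "?h v (x + y) = z" using hom_add[OF h v xm ym] hf[OF v y(1)] y(2) by (metis add_diff_cancel_left' add_diff_eq)
        then show "z \<in> ?h v ` space (SM ?w') v" using rep_add[OF rw' v xm ym] by (metis image_eqI)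
      qed
    qed
  qed
  then have "riso (SM ?w') E" using h unfolding rep_iso_def by blast
  then show ?thesis using w' by blast
qed

section \<open>Split or indecomposable\<close>

lemma projective_split_epi:
  assumes "projective_rep Q I M" "rep E" "surj_hom Q E M g" shows "split_epi Q E M g"
  using assms hom_id[of M] unfolding projective_rep_def split_epi_def by meson

text \<open>The submodule may have any two legs; goodness is required of the quotient, since it
  leaves the action of a single arrow \<open>b\<close> on the lifted generator to be
  understood.\<close>

lemma good_legs_extension:
  assumes l: "legs v r q" and gl: "good_legs i r' p" and E: "rep E"
    and se: "short_exact Q (SM (LS v r q)) E (SM (LS i r' p)) f g"
  shows "split_epi Q E (SM (LS i r' p)) g \<or> indec E"
proof (cases "covers i r' p")
  case True
  then have "projective_rep Q I (SM (LS i r' p))" using gl projective_LS by (simp add: good_legs_def)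
  then show ?thesis using projective_split_epi[OF _ E] se by (simp add: short_exact_def)
next
  case False
  then obtain b where r': "r' = []" and ql: "quot_leg i p b" using gl by (auto simp: good_legs_def)
  let ?N = "LS v r q" and ?M = "LS i [] p"
  have l': "legs i [] p" and b: "b \<in> arcs Q" "tail Q b = i" "\<not> starts p b"
    and arcs: "\<And>a. a \<in> arcs Q \<Longrightarrow> tail Q a = i \<Longrightarrow> a = b \<or> starts p a"
    using ql by (auto simp: quot_leg_def)
  have f: "inj_hom Q (SM ?N) E f" and g: "surj_hom Q E (SM ?M) g"
    and ex: "\<And>v. v \<in> verts Q \<Longrightarrow> f v ` space (SM ?N) v = {x \<in> space E v. g v x = 0}"
    using se r' by (auto simp: short_exact_def)
  have fh: "rhom (SM ?N) E f" and gh: "rhom E (SM ?M) g" using f g by (simp_all add: inj_hom_def surj_hom_def)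
  have rN: "rep (SM ?N)" and rM: "rep (SM ?M)" using rep_SM string_LS l l' by blast+
  have iv: "i \<in> verts Q" "head Q b \<in> verts Q" using b by auto
  have u0: "unit_seq 0 \<in> space (SM ?M) i" using unit_mid_mem[OF l'] by simp
  obtain x where x: "x \<in> space E i" "g i x = unit_seq 0"
    using g iv u0 unfolding surj_hom_def by (metis imageE)
  have bu: "act (SM ?M) b (unit_seq 0) = 0"
  proof (rule act_SM_unit_0[OF string_LS[OF l']])
    fix j show "\<not> edge (snd ?M) 0 (Fwd b) j"
      using b(3) by (cases p) (auto simp: edge_def LS_def starts_def)
  qed
  have xb: "act E b x \<in> space E (head Q b)" using act_mem[OF E b(1)] x b by simp
  have "g (head Q b) (act E b x) = 0" using hom_act[OF gh b(1), of x] x b bu by simp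
  then have "act E b x \<in> f (head Q b) ` space (SM ?N) (head Q b)" using ex[OF iv(2)] xb by simp
  then obtain y where y: "y \<in> space (SM ?N) (head Q b)" "act E b x = f (head Q b) y" by blast
  have finj: "z = 0" if "u \<in> verts Q" "z \<in> space (SM ?N) u" "f u z = 0" for u z
  proof -
    have i: "inj_on (f u) (space (SM ?N) u)" using f that(1) by (simp add: inj_hom_def)
    have e: "f u z = f u 0" by (rule trans[OF that(3) hom_0[OF fh rN that(1), symmetric]])
    show "z = 0" by (rule inj_onD[OF i e that(2) rep_0[OF rN that(1)]])
  qed
  \<comment> \<open>The relation \<open>b d\<close> holds in \<open>E\<close>, and injectivity of
    \<open>f\<close> transfers it to the submodule.\<close>
  have ann: "act (SM ?N) d y = 0" if d: "d \<in> arcs Q" "tail Q d = head Q b" "zero_rel b d" for d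
  proof (rule finj[of "head Q d"])
    have yd: "y \<in> space (SM ?N) (tail Q d)" unfolding d(2) by (rule y(1))
    show "act (SM ?N) d y \<in> space (SM ?N) (head Q d)" by (rule act_mem[OF rN d(1) yd])
    have "f (head Q d) (act (SM ?N) d y) = act E d (act E b x)"
      unfolding y(2) hom_act[OF fh d(1) yd] d(2) by (rule refl)
    then show "f (head Q d) (act (SM ?N) d y) = 0" using act_act[OF E b(1) d(1) _ d(3), of x] x b d by simp
  qed (use d in simp)
  obtain n where n: "n \<in> space (SM ?N) (tail Q b)"
    and alt: "y - act (SM ?N) b n = 0 \<or> attachable ?N b (y - act (SM ?N) b n)"
    using LS_class_or_attachable[OF l b(1) y(1) ann] by blast
  \<comment> \<open>Changing the lift by \<open>n\<close> in the submodule subtracts the image of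
    \<open>n\<close> under \<open>b\<close> from the class \<open>y\<close>.\<close>
  define x0 where "x0 = x - f i n"
  have n': "n \<in> space (SM ?N) i" using n unfolding b(2) .
  have fn: "f i n \<in> space E i" "g i (f i n) = 0"
  proof -
    have "f i n \<in> f i ` space (SM ?N) i" using n' by blast
    then show "f i n \<in> space E i" "g i (f i n) = 0" using ex[OF iv(1)] by auto
  qed
  have x0: "x0 \<in> space E i" "g i x0 = unit_seq 0"
    unfolding x0_def using rep_diff[OF E iv(1) x(1) fn(1)] hom_diff[OF gh E iv(1) x(1) fn(1)] x(2) fn(2)
    by (metis, metis diff_zero)
  have yn: "act (SM ?N) b n \<in> space (SM ?N) (head Q b)" using act_mem[OF rN b(1) n] .
  have bx0: "act E b x0 = f (head Q b) (y - act (SM ?N) b n)"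
  proof -
    have "act E b x0 = act E b x - act E b (f i n)"
      unfolding x0_def using act_diff[OF E b(1), of x "f i n"] x(1) fn(1) b(2) by simp
    also have "act E b (f i n) = f (head Q b) (act (SM ?N) b n)" using hom_act[OF fh b(1) n] b(2) by simp
    finally show ?thesis unfolding y(2) hom_diff[OF fh rN iv(2) y(1) yn] .
  qed
  from alt show ?thesis
  proof
    assume "y - act (SM ?N) b n = 0"
    \<comment> \<open>Now every arrow outside \<open>p\<close> kills \<open>x0\<close>, so by the
      universal property the generator can be sent to it, which gives a section.\<close>
    then have bz: "act E b x0 = 0" using bx0 hom_0[OF fh rN iv(2)] by simp
    have z: "act E a x0 = 0" if "a \<in> arcs Q" "tail Q a = i" "\<not> starts [] a" "\<not> starts p a" for a
      using arcs[OF that(1,2)] that(4) bz by blast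
    have "\<exists>s. rhom (SM ?M) E s \<and> s i (unit_seq (length ([] :: 'a list))) = x0"
    proof (rule LS_hom_exists[OF l' E x0(1)])
      show "act E a x0 = 0" if "a \<in> arcs Q" "tail Q a = i" "\<not> starts [] a" "\<not> starts p a" for a
        by (rule z[OF that])
      show "\<exists>s. rhom (SM ?M) E s \<and> s i (unit_seq (length ([] :: 'a list))) = x0"
        if "rhom (SM ?M) E h" "h i (unit_seq (length ([] :: 'a list))) = x0" for h
        using that by (intro exI[of _ h] conjI)
    qed
    then obtain s where s: "rhom (SM ?M) E s" "s i (unit_seq (length ([] :: 'a list))) = x0" by (elim exE conjE)
    have "g u (s u z) = z" if "u \<in> verts Q" "z \<in> space (SM ?M) u" for u z
      by (rule LS_hom_eqI[OF l' hom_comp[OF s(1) gh] hom_id _ that])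
        (metis list.size(3) s(2) x0(2))
    then have "split_epi Q E (SM ?M) g" using s(1) unfolding split_epi_def by blast
    then show ?thesis using r' by simp
  next
    assume "attachable ?N b (y - act (SM ?N) b n)"
    then obtain w' k k' where w': "string w'" "string (fst w', snd w' @ [Inv b])"
      and k: "inverse_homs (SM w') (SM ?N) k k'" "k (head Q b) (unit_seq (slen w')) = y - act (SM ?N) b n"
      unfolding attachable_def by blast
    have kh: "rhom (SM w') (SM ?N) k" using k by (simp add: inverse_homs_def)
    have kb: "bij_betw (k v) (space (SM w') v) (space (SM ?N) v)" if "v \<in> verts Q" for v
      using inverse_homs_bij[OF k(1) that] .
    \<comment> \<open>Precomposing with the isomorphism \<open>k\<close> presents the same extension
      with \<open>SM w'\<close> as submodule; its last basis vector is the one that \<open>b\<close>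
      reaches from \<open>x0\<close>.\<close>
    let ?f = "\<lambda>v x. f v (k v x)"
    have fk: "inj_hom Q (SM w') E ?f"
      unfolding inj_hom_def
    proof (intro conjI ballI hom_comp[OF kh fh])
      fix v assume v: "v \<in> verts Q"
      have "inj_on (f v) (k v ` space (SM w') v)" using f kb[OF v] v unfolding inj_hom_def bij_betw_def by simp
      then show "inj_on (\<lambda>x. f v (k v x)) (space (SM w') v)"
        using comp_inj_on[of "k v" "space (SM w') v" "f v"] kb[OF v] unfolding bij_betw_def comp_def by blast
    qed
    have exk: "?f v ` space (SM w') v = {x \<in> space E v. g v x = 0}" if v: "v \<in> verts Q" for v
      using ex[OF v] kb[OF v] unfolding bij_betw_def by (metis image_image)
    obtain w'' where w'': "string w''" "riso (SM w'') E"
      using extension_string[OF w' ql E fk g exk x0] bx0 k(2) by metis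
    then show ?thesis using indec_iso[OF indec_SM[OF w''(1)] w''(2) E] by blast
  qed
qed

end

section \<open>The maximal almost rigid module containing the projectives\<close>

context monomial_quiver
begin

lemma iso_sum_comm: "riso (rep_sum A B) (rep_sum B A)"
proof -
  let ?f = "\<lambda>(v :: 'v) z. seq_pair (seq_right z) (seq_left z)"
  have f: "rhom (rep_sum A B) (rep_sum B A) ?f" for A B :: "('v, 'a, 'k) rep"
    using hom_pair[OF hom_right hom_left] .
  show ?thesis
    by (rule isoI[where f = ?f and g = ?f]) (use f in \<open>simp add: inverse_homs_def\<close>)
qed

lemma nonisos_or_double:
  assumes "\<forall>M\<in>set Ms. rep M"
  shows "nonisos Ms \<or> (\<exists>M\<in>set Ms. retract (rep_sum M M) (rep_sum_list Ms))"
  using assms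
proof (induction Ms)
  case (Cons M Ms)
  then have r: "rep M" "rep (rep_sum_list Ms)" "\<forall>M\<in>set Ms. rep M" using rep_rep_sum_list by auto
  have refl: "retract M M" using retract_iso[OF r(1) iso_refl] .
  show ?case
  proof (cases "\<exists>N\<in>set Ms. riso M N")
    case True
    then obtain N where "N \<in> set Ms" "riso M N" by blast
    then have "retract M (rep_sum_list Ms)"
      using retract_trans[OF retract_iso[OF r(1)] retract_rep_sum_list] r(3) by blast
    then have "retract (rep_sum M M) (rep_sum_list (M # Ms))"
      using retract_sum_mono[OF refl] by simp
    then show ?thesis by (meson list.set_intros(1))
  next
    case False
    from Cons.IH[OF r(3)] show ?thesis
    proof
      assume "nonisos Ms"
      then show ?thesis using False by auto
    next
      assume "\<exists>M\<in>set Ms. retract (rep_sum M M) (rep_sum_list Ms)"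
      then obtain N where "N \<in> set Ms" "retract (rep_sum N N) (rep_sum_list Ms)" by blast
      then have "N \<in> set (M # Ms)" "retract (rep_sum N N) (rep_sum_list (M # Ms))"
        using retract_trans[OF _ retract_right[OF r(1)]] by auto
      then show ?thesis by blast
    qed
  qed
qed simp

text \<open>\<open>basic_rep\<close> provides one decomposition without repetition. Any other has
  none either, because a repeated term \<open>M\<close> would make \<open>rep_sum M M\<close> a
  retract.\<close>

lemma basic_rep_nonisos:
  assumes T: "basic_rep Q I T" and Ms: "\<forall>M\<in>set Ms. indec M" and iso: "riso T (rep_sum_list Ms)"
  shows "nonisos Ms"
proof (rule ccontr)
  assume "\<not> nonisos Ms"
  then obtain M where M: "M \<in> set Ms" "retract (rep_sum M M) (rep_sum_list Ms)"
    using nonisos_or_double Ms indec_rep by blast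
  have "rep T" using T by (simp add: basic_rep_def)
  then have "retract (rep_sum M M) T" using retract_trans[OF M(2)] retract_iso' iso by blast
  then show False using basic_rep_no_double[OF T] Ms M(1) by blast
qed

lemma short_exact_iso:
  assumes se: "short_exact Q N E M f g" and N: "inverse_homs N N' b b'" and M: "inverse_homs M M' a a'"
    and rM: "rep M"
  shows "short_exact Q N' E M' (\<lambda>v x. f v (b' v x)) (\<lambda>v x. a v (g v x))"
proof -
  have f: "rhom N E f" "\<And>v. v \<in> verts Q \<Longrightarrow> inj_on (f v) (space N v)"
    and g: "rhom E M g" "\<And>v. v \<in> verts Q \<Longrightarrow> g v ` space E v = space M v"
    and ex: "\<And>v. v \<in> verts Q \<Longrightarrow> f v ` space N v = {x \<in> space E v. g v x = 0}"
    using se by (auto simp: short_exact_def inj_hom_def surj_hom_def)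
  have b: "rhom N' N b'" and a: "rhom M M' a" using N M by (simp_all add: inverse_homs_def)
  have bb: "bij_betw (b' v) (space N' v) (space N v)" and ab: "bij_betw (a v) (space M v) (space M' v)"
    if "v \<in> verts Q" for v
    using inverse_homs_bij[OF inverse_homs_sym[OF N] that] inverse_homs_bij[OF M that] .
  have "inj_on (\<lambda>x. f v (b' v x)) (space N' v)" if v: "v \<in> verts Q" for v
    using comp_inj_on[of "b' v" "space N' v" "f v"] f(2)[OF v] bb[OF v] by (simp add: bij_betw_def comp_def)
  moreover have "(\<lambda>x. a v (g v x)) ` space E v = space M' v" if v: "v \<in> verts Q" for v
    using g(2)[OF v] ab[OF v] unfolding bij_betw_def by (metis image_image)
  moreover have "(\<lambda>x. f v (b' v x)) ` space N' v = {x \<in> space E v. a v (g v x) = 0}" if v: "v \<in> verts Q" for v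
  proof -
    have "a v y = 0 \<longleftrightarrow> y = 0" if y: "y \<in> space M v" for y
    proof
      assume e: "a v y = 0"
      have e': "a v y = a v 0" by (rule trans[OF e hom_0[OF a rM v, symmetric]])
      have "inj_on (a v) (space M v)" using ab[OF v] by (simp add: bij_betw_def)
      then show "y = 0" using e' y rep_0[OF rM v] by (rule inj_onD)
    next
      assume "y = 0"
      then show "a v y = 0" using hom_0[OF a rM v] by (simp only:)
    qed
    then have "{x \<in> space E v. a v (g v x) = 0} = {x \<in> space E v. g v x = 0}"
      using hom_mem[OF g(1) v] by blast
    then show ?thesis using ex[OF v] bb[OF v] unfolding bij_betw_def by (metis image_image)
  qed
  ultimately show ?thesis
    unfolding short_exact_def inj_hom_def surj_hom_def using hom_comp[OF b f(1)] hom_comp[OF g(1) a] by blast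
qed

lemma split_epi_iso:
  assumes s: "split_epi Q E M' (\<lambda>v x. a v (g v x))" and M: "inverse_homs M M' a a'" and g: "rhom E M g"
  shows "split_epi Q E M g"
proof -
  obtain s where s: "rhom M' E s" "\<And>v x. v \<in> verts Q \<Longrightarrow> x \<in> space M' v \<Longrightarrow> a v (g v (s v x)) = x"
    using s unfolding split_epi_def by blast
  have a: "rhom M M' a" and aa: "\<And>v x. v \<in> verts Q \<Longrightarrow> x \<in> space M v \<Longrightarrow> a' v (a v x) = x"
    using M by (auto simp: inverse_homs_def)
  have "g v (s v (a v x)) = x" if v: "v \<in> verts Q" "x \<in> space M v" for v x
  proof -
    have m: "g v (s v (a v x)) \<in> space M v" using hom_mem[OF g v(1) hom_mem[OF s(1) v(1) hom_mem[OF a v]]] .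
    have "a v (g v (s v (a v x))) = a v x" by (rule s(2)[OF v(1) hom_mem[OF a v]])
    then show ?thesis using aa[OF v(1) m] aa[OF v] by metis
  qed
  then show ?thesis unfolding split_epi_def using hom_comp[OF a s(1)] by blast
qed

end

section \<open>The sum of all good modules\<close>

context gentle_quiver
begin

lemma good_string: "good w \<Longrightarrow> string w"
  by (simp add: good_def)

lemma good_LS: "good_legs v r q \<Longrightarrow> good (LS v r q)"
  using string_LS iso_refl unfolding good_def good_legs_def by blast

lemma string_module_sum:
  assumes "\<forall>w\<in>set ws. string w"
  shows "\<forall>M\<in>set (map SM ws). rep M" "\<forall>M\<in>set (map SM ws). indec M" "rep (rep_sum_list (map SM ws))"
proof -
  show r: "\<forall>M\<in>set (map SM ws). rep M" and "\<forall>M\<in>set (map SM ws). indec M"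
    using assms rep_SM indec_SM by auto
  show "rep (rep_sum_list (map SM ws))" using rep_rep_sum_list[OF r] .
qed

lemma indec_summand_iso:
  assumes ws: "\<forall>w\<in>set ws. string w" and T: "rep T" "riso T (rep_sum_list (map SM ws))"
    and M: "indec M" "is_summand Q I M T"
  shows "\<exists>w\<in>set ws. riso M (SM w)"
proof -
  have "retract M T" using M(2) summand_iff_retract[OF T(1)] by blast
  then have "retract M (rep_sum_list (map SM ws))" using retract_trans[OF _ retract_iso[OF T]] by blast
  then obtain N where N: "N \<in> set (map SM ws)" "retract M N"
    using indec_retract_rep_sum_list[OF M(1)] string_module_sum(1)[OF ws] by blast
  then have "riso M N" using indec_retract_iso[OF M(1)] string_module_sum(2)[OF ws] by blast
  then show ?thesis using N(1) by auto
qed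

text \<open>Each indecomposable summand is isomorphic to a listed module, and exact sequences are
  transported along these isomorphisms. The list need not be complete: uniqueness applies the lemma
  to a competitor enlarged by one good module.\<close>

lemma almost_rigid_good:
  assumes ws: "\<forall>w\<in>set ws. good w" and ni: "nonisos (map SM ws)"
    and T: "rep T" "riso T (rep_sum_list (map SM ws))"
  shows "almost_rigid Q I T"
  unfolding almost_rigid_def
proof (intro conjI allI impI; (elim conjE)?)
  have ws': "\<forall>w\<in>set ws. string w" using ws good_string by blast
  show "basic_rep Q I T" unfolding basic_rep_iff using T ni string_module_sum(2)[OF ws'] by blast
  show "\<exists>ws. (\<forall>w\<in>set ws. string w) \<and> riso T (rep_sum_list (map SM ws))" using ws' T by blast
  fix M N E f g
  assume M: "indec M" "is_summand Q I M T" and N: "indec N" "is_summand Q I N T" and E: "rep E"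
    and se: "short_exact Q N E M f g"
  have *: "\<exists>v r q a a'. good_legs v r q \<and> inverse_homs X (SM (LS v r q)) a a'"
    if X: "indec X" "is_summand Q I X T" for X
  proof -
    obtain w where w: "w \<in> set ws" "riso X (SM w)" using indec_summand_iso[OF ws' T X] by blast
    obtain v r q where l: "good_legs v r q" "riso (SM w) (SM (LS v r q))" using ws w(1) unfolding good_def by blast
    then show ?thesis using iso_trans[OF w(2)] iso_iff[OF indec_rep[OF X(1)]] by blast
  qed
  obtain v r q b b' where lN: "good_legs v r q" "inverse_homs N (SM (LS v r q)) b b'" using *[OF N] by blast
  obtain i r' p a a' where lM: "good_legs i r' p" "inverse_homs M (SM (LS i r' p)) a a'" using *[OF M] by blast
  have l: "legs v r q" using lN(1) by (simp add: good_legs_def)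
  have g: "rhom E M g" using se by (simp add: short_exact_def surj_hom_def)
  show "split_epi Q E M g \<or> indec E"
    using good_legs_extension[OF l lM(1) E short_exact_iso[OF se lN(2) lM(2) indec_rep[OF M(1)]]]
      split_epi_iso[OF _ lM(2) g] by blast
qed

lemma finite_representatives:
  assumes "finite S" "\<forall>w\<in>S. string w"
  shows "\<exists>ws. set ws \<subseteq> S \<and> nonisos (map SM ws) \<and> (\<forall>w\<in>S. \<exists>w'\<in>set ws. riso (SM w) (SM w'))"
  using assms
proof (induction S rule: finite_induct)
  case empty
  show ?case by (intro exI[of _ "[]"]) simp
next
  case (insert w S)
  then obtain ws where ws: "set ws \<subseteq> S" "nonisos (map SM ws)" "\<forall>w\<in>S. \<exists>w'\<in>set ws. riso (SM w) (SM w')" by auto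
  show ?case
  proof (cases "\<exists>w'\<in>set ws. riso (SM w) (SM w')")
    case True
    then show ?thesis using ws by (intro exI[of _ ws]) auto
  next
    case False
    then have "nonisos (map SM (w # ws))" using ws(2) by simp
    then show ?thesis using ws iso_refl[of "SM w"] by (intro exI[of _ "w # ws"]) auto
  qed
qed

lemma finite_legs: "finite {(v, r, q). legs v r q}"
proof -
  obtain m where m: "\<And>v p. nzpath v p \<Longrightarrow> length p < m" using nzpath_bounded by blast
  let ?P = "{p. set p \<subseteq> arcs Q \<and> length p \<le> m}"
  have "set p \<subseteq> arcs Q" if "nzpath v p" for v p
    using nzpath_nth(1)[OF that] by (auto simp: in_set_conv_nth)
  then have "{(v, r, q). legs v r q} \<subseteq> verts Q \<times> ?P \<times> ?P"
    using m unfolding legs_def leg_def by (auto simp: less_imp_le)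
  moreover have "finite (verts Q \<times> ?P \<times> ?P)" using finite_lists_length_le[of "arcs Q" m] by simp
  ultimately show ?thesis by (rule finite_subset)
qed

lemma good_representatives:
  "\<exists>ws. (\<forall>w\<in>set ws. good w) \<and> nonisos (map SM ws) \<and> (\<forall>w. good w \<longrightarrow> (\<exists>w'\<in>set ws. riso (SM w) (SM w')))"
proof -
  let ?S = "(\<lambda>(v, r, q). LS v r q) ` {(v, r, q). good_legs v r q}"
  have "{(v, r, q). good_legs v r q} \<subseteq> {(v, r, q). legs v r q}" by (auto simp: good_legs_def)
  then have "finite ?S" using finite_subset[OF _ finite_legs] by blast
  moreover have S: "\<forall>w\<in>?S. good w" using good_LS by auto
  ultimately obtain ws where ws: "set ws \<subseteq> ?S" "nonisos (map SM ws)" "\<forall>w\<in>?S. \<exists>w'\<in>set ws. riso (SM w) (SM w')"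
    using finite_representatives[of ?S] good_string by blast
  have "\<exists>w'\<in>set ws. riso (SM w) (SM w')" if w: "good w" for w
  proof -
    obtain v r q where l: "good_legs v r q" "riso (SM w) (SM (LS v r q))" using w unfolding good_def by blast
    then have "LS v r q \<in> ?S" by force
    then show ?thesis using ws(3) iso_trans[OF l(2)] by blast
  qed
  then show ?thesis using ws S by blast
qed

text \<open>The sequence supplied by \<open>bad\<close> joins two summands of \<open>T\<close>, as
  the modules \<open>P(v)\<close> are among them; it contradicts (M2).\<close>

lemma bad_not_almost_rigid:
  assumes w: "string w" and b: "bad w" and T: "almost_rigid Q I T" and wT: "is_summand Q I (SM w) T"
    and P: "\<And>v r q. legs v r q \<Longrightarrow> covers v r q \<Longrightarrow> is_summand Q I (SM (LS v r q)) T"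
  shows False
proof -
  obtain v r q E f g where l: "legs v r q" "covers v r q" and E: "rep E" "short_exact Q (SM (LS v r q)) E (SM w) f g"
    "\<not> split_epi Q E (SM w) g" "\<not> indec E"
    using b unfolding bad_def by blast
  have "split_epi Q E (SM w) g \<or> indec E"
    using T indec_SM[OF w] indec_SM[OF string_LS[OF l(1)]] wT P[OF l] E(1,2) unfolding almost_rigid_def by blast
  then show False using E by blast
qed

theorem projective_mar:
  "\<exists>T. maximal_almost_rigid Q I T \<and> contains_indec_projectives Q I T \<and>
     (\<forall>T'. maximal_almost_rigid Q I T' \<and> contains_indec_projectives Q I T' \<longrightarrow> riso T' T)"
proof -
  obtain ws where ws: "\<forall>w\<in>set ws. good w" "nonisos (map SM ws)"
    and all: "\<And>w. good w \<Longrightarrow> \<exists>w'\<in>set ws. riso (SM w) (SM w')"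
    using good_representatives by blast
  have str: "\<forall>w\<in>set ws. string w" using ws(1) good_string by blast
  define T where "T = rep_sum_list (map SM ws)"
  have T: "rep T" "riso T (rep_sum_list (map SM ws))" unfolding T_def using string_module_sum(3)[OF str] iso_refl by auto
  have good_retract: "retract (SM w) T" if w: "good w" for w
  proof -
    obtain w' where w': "w' \<in> set ws" "riso (SM w) (SM w')" using all[OF w] by blast
    have "retract (SM w') T" unfolding T_def using retract_rep_sum_list[OF _ string_module_sum(1)[OF str]] w'(1) by simp
    then show ?thesis using retract_trans[OF retract_iso[OF rep_SM[OF good_string[OF w]] w'(2)]] by blast
  qed
  have cov_good: "good (LS v r q)" if "legs v r q" "covers v r q" for v r q
    using that good_LS by (simp add: good_legs_def)
  have "\<not> almost_rigid Q I (rep_sum T (SM w))" if w: "string w" for w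
  proof
    assume ar: "almost_rigid Q I (rep_sum T (SM w))"
    have rw: "rep (SM w)" using rep_SM[OF w] .
    have rs: "rep (rep_sum T (SM w))" using rep_rep_sum[OF T(1) rw] .
    from good_or_bad[OF w] show False
    proof
      \<comment> \<open>This module is already a summand of \<open>T\<close>; a second copy
        contradicts basicness.\<close>
      assume "good w"
      then have "retract (rep_sum (SM w) (SM w)) (rep_sum T (SM w))"
        using retract_sum_mono[OF good_retract retract_iso[OF rw iso_refl]] by blast
      moreover have "basic_rep Q I (rep_sum T (SM w))" using ar by (simp add: almost_rigid_def)
      ultimately show False using basic_rep_no_double indec_SM[OF w] by blast
    next
      assume b: "bad w"
      have "is_summand Q I (SM w) (rep_sum T (SM w))"
        using summand_iff_retract[OF rs] rw retract_right[OF T(1)] by blast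
      moreover have "is_summand Q I (SM (LS v r q)) (rep_sum T (SM w))" if "legs v r q" "covers v r q" for v r q
        using summand_iff_retract[OF rs] rep_SM[OF string_LS[OF that(1)]]
          retract_trans[OF good_retract[OF cov_good[OF that]] retract_left[OF rw]] by blast
      ultimately show False using bad_not_almost_rigid[OF w b ar] by blast
    qed
  qed
  then have mar: "maximal_almost_rigid Q I T"
    unfolding maximal_almost_rigid_def using almost_rigid_good[OF ws T] by blast
  have cont: "contains_indec_projectives Q I T"
    unfolding contains_indec_projectives_def
  proof (intro allI impI, elim conjE)
    fix P assume P: "projective_rep Q I P" "indec P"
    obtain v r q where l: "legs v r q" "covers v r q" "riso P (SM (LS v r q))"
      using indec_projective_iso_LS[OF P] by blast
    have "retract P T"
      using retract_trans[OF retract_iso[OF indec_rep[OF P(2)] l(3)] good_retract[OF cov_good[OF l(1,2)]]] .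
    then show "is_summand Q I P T" using summand_iff_retract[OF T(1)] indec_rep[OF P(2)] by blast
  qed
  have "riso T' T" if T': "maximal_almost_rigid Q I T'" "contains_indec_projectives Q I T'" for T'
  proof -
    have ar: "almost_rigid Q I T'" and max: "\<And>w. string w \<Longrightarrow> \<not> almost_rigid Q I (rep_sum T' (SM w))"
      using T'(1) by (auto simp: maximal_almost_rigid_def)
    have basic: "basic_rep Q I T'" using ar by (simp add: almost_rigid_def)
    then have rT': "rep T'" by (simp add: basic_rep_def)
    obtain us where us: "\<forall>w\<in>set us. string w" "riso T' (rep_sum_list (map SM us))"
      using ar unfolding almost_rigid_def by blast
    note U = string_module_sum[OF us(1)]
    have ni: "nonisos (map SM us)" by (rule basic_rep_nonisos[OF basic U(2) us(2)])
    have good_us: "good w" if w: "w \<in> set us" for w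
    proof (rule ccontr)
      assume "\<not> good w"
      then have b: "bad w" using good_or_bad us(1) w by blast
      have "retract (SM w) T'"
        using retract_trans[OF retract_rep_sum_list[OF _ U(1)] retract_iso'[OF rT' us(2)]] w by simp
      then have "is_summand Q I (SM w) T'" using summand_iff_retract[OF rT'] rep_SM us(1) w by blast
      moreover have "is_summand Q I (SM (LS v r q)) T'" if "legs v r q" "covers v r q" for v r q
        using T'(2) projective_LS[OF that] indec_SM[OF string_LS[OF that(1)]]
        unfolding contains_indec_projectives_def by blast
      ultimately show False using bad_not_almost_rigid[OF _ b ar] us(1) w by blast
    qed
    \<comment> \<open>A good module missing from \<open>T'\<close> could be added without losing
      almost rigidity, against maximality.\<close>
    have "\<exists>w'\<in>set us. riso (SM w) (SM w')" if w: "w \<in> set ws" for w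
    proof (rule ccontr)
      assume no: "\<not> ?thesis"
      have gw: "good w" and sw: "string w" using ws(1) str w by auto
      have rw: "rep (SM w)" using rep_SM[OF sw] .
      have "riso (rep_sum T' (SM w)) (rep_sum (rep_sum_list (map SM us)) (SM w))"
        using iso_sum_cong[OF rT' rw us(2) iso_refl] .
      then have "riso (rep_sum T' (SM w)) (rep_sum_list (map SM (w # us)))"
        using iso_trans[OF _ iso_sum_comm] by simp
      moreover have "nonisos (map SM (w # us))" using ni no by simp
      moreover have "\<forall>w\<in>set (w # us). good w" using gw good_us by simp
      ultimately have "almost_rigid Q I (rep_sum T' (SM w))"
        using almost_rigid_good[of "w # us"] rep_rep_sum[OF rT' rw] by blast
      then show False using max[OF sw] by blast
    qed
    then have "\<forall>N\<in>set (map SM ws). \<exists>M\<in>set (map SM us). riso M N"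
      using iso_sym[OF rep_SM] str by fastforce
    moreover have "\<forall>M\<in>set (map SM us). \<exists>N\<in>set (map SM ws). riso M N" using all good_us by auto
    ultimately have "riso (rep_sum_list (map SM us)) T"
      unfolding T_def by (rule rep_sum_list_iso[OF U(1) string_module_sum(1)[OF str] ni ws(2), rotated])
    then show ?thesis by (rule iso_trans[OF us(2)])
  qed
  then show ?thesis using mar cont by blast
qed

end

section \<open>From gentle algebras to quivers with monomial relations\<close>

context bound_quiver
begin

abbreviation "PA \<equiv> path_algebra Q :: (('v, 'a) qpath \<Rightarrow> 'k) ring"

lemma ring_PA: "ring PA"
  using ring_path_algebra fin_digraph_axioms .

lemma path_elt_carrier: "awalk u p v \<Longrightarrow> path_elt (u, p) \<in> carrier PA"
  by (auto simp: path_algebra_def path_elt_def is_path_def)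

text \<open>Among all ways to cut a path in two, only the cut before the last arrow contributes to
  the product.\<close>

lemma path_elt_snoc:
  assumes "awalk u p (tail Q a)"
  shows "path_elt (u, p @ [a]) = path_elt (u, p) \<otimes>\<^bsub>PA\<^esub> path_elt (tail Q a, [a])"
proof (rule ext, clarify)
  fix w r
  let ?t = "\<lambda>i. (path_elt (u, p) (w, take i r) :: 'k) * path_elt (tail Q a, [a]) (awlast w (take i r), drop i r)"
  have z: "?t i = 0" if "\<not> (w = u \<and> r = p @ [a] \<and> i = length p)" "i \<le> length r" for i
  proof (rule ccontr)
    assume "?t i \<noteq> 0"
    then have "w = u" "take i r = p" "drop i r = [a]" by (auto simp: path_elt_def split: if_splits)
    moreover from this have "r = p @ [a]" by (metis append_take_drop_id)
    moreover have "length (take i r) = i" using that(2) by simp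
    ultimately show False using that(1) by metis
  qed
  have "(path_elt (u, p) \<otimes>\<^bsub>PA\<^esub> path_elt (tail Q a, [a])) (w, r) = (\<Sum>i\<le>length r. ?t i)"
    by (simp add: path_algebra_def)
  also have "\<dots> = (path_elt (u, p @ [a]) :: _ \<Rightarrow> 'k) (w, r)"
  proof (cases "w = u \<and> r = p @ [a]")
    case True
    then have "(\<Sum>i\<le>length r. ?t i) = (\<Sum>i\<in>{length p}. ?t i)"
      using z by (intro sum.mono_neutral_right) auto
    then show ?thesis using True assms by (simp add: path_elt_def awlast_of_awalk)
  next
    case False
    then have "(\<Sum>i\<le>length r. ?t i) = 0" using z by (intro sum.neutral) auto
    then show ?thesis using False by (simp add: path_elt_def)
  qed
  finally show "(path_elt (u, p @ [a]) :: _ \<Rightarrow> 'k) (w, r) = (path_elt (u, p) \<otimes>\<^bsub>PA\<^esub> path_elt (tail Q a, [a])) (w, r)" by simp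
qed

lemma path_elt_power: "awalk u p v \<Longrightarrow> path_elt (u, p) \<in> (arrow_ideal_power Q (length p) :: (_ \<Rightarrow> 'k) set)"
proof (induction p arbitrary: v rule: rev_induct)
  case Nil
  then show ?case using path_elt_carrier by simp
next
  case (snoc a p)
  then have p: "awalk u p (tail Q a)" and a: "a \<in> arcs Q" by (auto simp: awalk_Cons_iff)
  have "path_elt (tail Q a, [a]) \<in> (arrow_ideal Q :: (_ \<Rightarrow> 'k) set)"
  proof -
    have "{path_elt (tail Q a, [a]) | a. a \<in> arcs Q} \<subseteq> carrier PA"
      using path_elt_carrier by (auto simp: awalk_Cons_iff awalk_Nil_iff)
    then show ?thesis unfolding arrow_ideal_def using ring.genideal_self[OF ring_PA] a by blast
  qed
  then have "path_elt (u, p) \<otimes>\<^bsub>PA\<^esub> path_elt (tail Q a, [a]) \<in> (arrow_ideal_power Q (Suc (length p)) :: (_ \<Rightarrow> 'k) set)"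
    using snoc.IH[OF p] unfolding arrow_ideal_power.simps by (intro ideal_prod.prod)
  then show ?case unfolding path_elt_snoc[OF p] by simp
qed

end

context gentle_algebra
begin

text \<open>The elements whose supporting paths all run through a generating relation form an ideal
  \<open>J\<close>. It contains the generators, hence \<open>I\<close>.\<close>

lemma zero_subpath:
  assumes "f \<in> I" "f (u, p) \<noteq> 0"
  shows "\<exists>v xs a b ys. awalk u p v \<and> p = xs @ a # b # ys \<and> path_elt (tail Q a, [a, b]) \<in> I"
proof -
  obtain S where S: "\<And>p. p \<in> S \<Longrightarrow> is_path Q p \<and> length (snd p) = 2" and I: "I = Idl\<^bsub>PA\<^esub> (path_elt ` S)"
    using G4 by auto
  interpret R: ring PA by (rule ring_PA)
  define J where "J = {f \<in> carrier PA. \<forall>u p. f (u, p) \<noteq> 0 \<longrightarrow> (\<exists>xs a b ys. p = xs @ a # b # ys \<and> (tail Q a, [a, b]) \<in> S)}"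
  have S_form: "\<exists>a b. s = (tail Q a, [a, b])" if s: "s \<in> S" for s
  proof -
    obtain a b where ab: "snd s = [a, b]" using S[OF s] by (auto simp: numeral_2_eq_2 length_Suc_conv)
    moreover have "fst s = tail Q a" using S[OF s] ab by (auto simp: is_path_def awalk_Cons_iff)
    ultimately show ?thesis by (metis prod.collapse)
  qed
  have S_carr: "path_elt ` S \<subseteq> carrier PA"
    using S path_elt_carrier by (force simp: is_path_def)
  have mult: "\<exists>q r. p = q @ r \<and> f (u, q) \<noteq> 0 \<and> g (awlast u q, r) \<noteq> 0"
    if nz: "(f \<otimes>\<^bsub>PA\<^esub> g) (u, p) \<noteq> 0" for f g :: "_ \<Rightarrow> 'k" and u p
  proof -
    have "(\<Sum>i\<le>length p. f (u, take i p) * g (awlast u (take i p), drop i p)) \<noteq> 0"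
      using nz by (simp add: path_algebra_def)
    then obtain i where "f (u, take i p) * g (awlast u (take i p), drop i p) \<noteq> 0"
      by (rule sum.not_neutral_contains_not_neutral)
    then show ?thesis by (intro exI[of _ "take i p"] exI[of _ "drop i p"]) auto
  qed
  have "ideal J PA"
  proof (rule idealI[OF ring_PA])
    show "subgroup J (add_monoid PA)"
    proof (rule R.add.subgroupI)
      show "J \<subseteq> carrier PA" unfolding J_def by blast
      have "(\<lambda>_. 0) \<in> J" by (simp add: J_def path_algebra_def)
      then show "J \<noteq> {}" by blast
    next
      fix f assume f: "f \<in> J"
      have neg: "(\<lambda>p. - f p) \<in> carrier PA" using f by (simp add: J_def path_algebra_def)
      have "(\<lambda>p. - f p) \<oplus>\<^bsub>PA\<^esub> f = \<zero>\<^bsub>PA\<^esub>" by (simp add: path_algebra_def)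
      then have "\<ominus>\<^bsub>PA\<^esub> f = (\<lambda>p. - f p)" using R.minus_equality neg f unfolding J_def by blast
      then show "\<ominus>\<^bsub>PA\<^esub> f \<in> J" using f neg unfolding J_def by simp
    next
      fix f g assume fg: "f \<in> J" "g \<in> J"
      then have c: "f \<oplus>\<^bsub>PA\<^esub> g \<in> carrier PA" unfolding J_def by blast
      have "f (u, p) \<noteq> 0 \<or> g (u, p) \<noteq> 0" if "(f \<oplus>\<^bsub>PA\<^esub> g) (u, p) \<noteq> 0" for u p
        using that by (auto simp: path_algebra_def)
      then show "f \<oplus>\<^bsub>PA\<^esub> g \<in> J" using fg c unfolding J_def by blast
    qed
  next
    fix f g assume f: "f \<in> J" and g: "g \<in> carrier PA"
    have "\<exists>xs a b ys. p = xs @ a # b # ys \<and> (tail Q a, [a, b]) \<in> S" if nz: "(g \<otimes>\<^bsub>PA\<^esub> f) (u, p) \<noteq> 0" for u p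
    proof -
      obtain q r where qr: "p = q @ r" "f (awlast u q, r) \<noteq> 0" using mult[OF nz] by blast
      then obtain xs a b ys where "r = xs @ a # b # ys" "(tail Q a, [a, b]) \<in> S" using f unfolding J_def by blast
      then have "p = (q @ xs) @ a # b # ys" "(tail Q a, [a, b]) \<in> S" using qr by auto
      then show ?thesis by blast
    qed
    then show "g \<otimes>\<^bsub>PA\<^esub> f \<in> J" using R.m_closed[OF g] f unfolding J_def by blast
    have "\<exists>xs a b ys. p = xs @ a # b # ys \<and> (tail Q a, [a, b]) \<in> S" if nz: "(f \<otimes>\<^bsub>PA\<^esub> g) (u, p) \<noteq> 0" for u p
    proof -
      obtain q r where qr: "p = q @ r" "f (u, q) \<noteq> 0" using mult[OF nz] by blast
      then obtain xs a b ys where "q = xs @ a # b # ys" "(tail Q a, [a, b]) \<in> S" using f unfolding J_def by blast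
      then have "p = xs @ a # b # (ys @ r)" "(tail Q a, [a, b]) \<in> S" using qr by auto
      then show ?thesis by blast
    qed
    then show "f \<otimes>\<^bsub>PA\<^esub> g \<in> J" using R.m_closed[OF _ g] f unfolding J_def by blast
  qed
  moreover have "path_elt ` S \<subseteq> J"
  proof
    fix f assume f: "f \<in> (path_elt ` S :: (_ \<Rightarrow> 'k) set)"
    then obtain a b where ab: "(tail Q a, [a, b]) \<in> S" "f = path_elt (tail Q a, [a, b])" using S_form by blast
    have "p = [] @ a # b # []" if "f (u, p) \<noteq> 0" for u p
      using that ab(2) by (auto simp: path_elt_def split: if_splits)
    then show "f \<in> J" using f S_carr ab(1) unfolding J_def by blast
  qed
  ultimately have "I \<subseteq> J" unfolding I by (rule R.genideal_minimal)
  then obtain xs a b ys where p: "p = xs @ a # b # ys" "(tail Q a, [a, b]) \<in> S" and f: "f \<in> carrier PA"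
    using assms unfolding J_def by blast
  have "path_elt ` S \<subseteq> I" unfolding I using R.genideal_self[OF S_carr] .
  moreover have "\<exists>v. awalk u p v" using f assms(2) by (fastforce simp: path_algebra_def is_path_def)
  ultimately show ?thesis using p by blast
qed

lemma gentle_quiver: "gentle_quiver Q I"
proof -
  interpret M: monomial_quiver Q I
    by unfold_locales (rule zero_subpath)
  have three: "\<not> card X \<le> 2" if "a \<in> X" "b \<in> X" "c \<in> X" "a \<noteq> b" "a \<noteq> c" "b \<noteq> c" "finite X" for a b c :: 'a and X
    using card_mono[OF that(7), of "{a, b, c}"] that by simp
  show ?thesis
  proof unfold_locales
    fix a b c assume abc: "a \<in> arcs Q" "b \<in> arcs Q" "c \<in> arcs Q" "tail Q a = tail Q c" "tail Q b = tail Q c"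
    show "a = b \<or> a = c \<or> b = c"
    proof (rule ccontr)
      assume "\<not> ?thesis"
      then show False
        using three[of a "out_arcs Q (tail Q c)" b c] abc G1[of "tail Q c"] by (auto simp: out_degree_def)
    qed
  next
    fix a b c assume abc: "a \<in> arcs Q" "b \<in> arcs Q" "c \<in> arcs Q" "head Q a = head Q c" "head Q b = head Q c"
    show "a = b \<or> a = c \<or> b = c"
    proof (rule ccontr)
      assume "\<not> ?thesis"
      then show False
        using three[of a "in_arcs Q (head Q c)" b c] abc G1[of "head Q c"] by (auto simp: in_degree_def)
    qed
  next
    fix a b b' assume "a \<in> arcs Q" "b \<in> arcs Q" "b' \<in> arcs Q" "head Q a = tail Q b" "head Q a = tail Q b'"
      "\<not> M.zero_rel a b" "\<not> M.zero_rel a b'"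
    then show "b = b'" using conjunct1[OF G2[of a]] unfolding Uniq_def M.zero_rel_def by blast
  next
    fix a a' b assume "a \<in> arcs Q" "a' \<in> arcs Q" "b \<in> arcs Q" "head Q a = tail Q b" "head Q a' = tail Q b"
      "\<not> M.zero_rel a b" "\<not> M.zero_rel a' b"
    then show "a = a'" using conjunct2[OF G2[of b]] unfolding Uniq_def M.zero_rel_def by blast
  next
    fix a b b' assume "a \<in> arcs Q" "b \<in> arcs Q" "b' \<in> arcs Q" "head Q a = tail Q b" "head Q a = tail Q b'"
      "M.zero_rel a b" "M.zero_rel a b'"
    then show "b = b'" using conjunct1[OF G3[of a]] unfolding Uniq_def M.zero_rel_def by blast
  next
    fix a a' b assume "a \<in> arcs Q" "a' \<in> arcs Q" "b \<in> arcs Q" "head Q a = tail Q b" "head Q a' = tail Q b"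
      "M.zero_rel a b" "M.zero_rel a' b"
    then show "a = a'" using conjunct2[OF G3[of b]] unfolding Uniq_def M.zero_rel_def by blast
  next
    obtain m where m: "arrow_ideal_power Q m \<subseteq> I" using admissible unfolding admissible_ideal_def by blast
    have "\<exists>xs a b ys. p = xs @ a # b # ys \<and> M.zero_rel a b" if p: "awalk u p v" "m \<le> length p" for u p v
    proof -
      \<comment> \<open>Only the power with exponent \<open>m\<close> is known to lie in
        \<open>I\<close>, so the path is truncated to exactly \<open>m\<close> arrows; a relation in
        this prefix is a relation in the path.\<close>
      have w: "awalk u (take m p) (awlast u (take m p))"
        using p(1) awalk_append_iff[of u "take m p" "drop m p" v] by simp
      have "path_elt (u, take m p) \<in> I" using path_elt_power[OF w] m p(2) by (simp add: min_absorb2 subset_eq)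
      then obtain xs a b ys where "take m p = xs @ a # b # ys" "M.zero_rel a b"
        using zero_subpath[of "path_elt (u, take m p)" u "take m p"] by (auto simp: path_elt_def M.zero_rel_def)
      moreover have "p = take m p @ drop m p" by simp
      ultimately have "p = xs @ a # b # (ys @ drop m p)" "M.zero_rel a b" by auto
      then show ?thesis by blast
    qed
    then show "\<exists>m. \<forall>u p v. awalk u p v \<longrightarrow> m \<le> length p \<longrightarrow> (\<exists>xs a b ys. p = xs @ a # b # ys \<and> M.zero_rel a b)" by blast
  qed
qed

end

section \<open>The opposite quiver\<close>

definition op_quiver :: "('v, 'a) pre_digraph \<Rightarrow> ('v, 'a) pre_digraph" where
  "op_quiver Q = \<lparr>verts = verts Q, arcs = arcs Q, tail = head Q, head = tail Q\<rparr>"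

lemma op_quiver_simps [simp]:
  "verts (op_quiver Q) = verts Q" "arcs (op_quiver Q) = arcs Q"
  "tail (op_quiver Q) = head Q" "head (op_quiver Q) = tail Q"
  by (simp_all add: op_quiver_def)

text \<open>Only the reversed relations of length two, not the ideal that they generate: this is
  what \<open>monomial_quiver\<close> needs.\<close>

definition op_relations ::
    "('v, 'a) pre_digraph \<Rightarrow> (('v, 'a) qpath \<Rightarrow> 'k::field) set \<Rightarrow> (('v, 'a) qpath \<Rightarrow> 'k) set" where
  "op_relations Q I = {path_elt (head Q b, [b, a]) | a b.
     a \<in> arcs Q \<and> b \<in> arcs Q \<and> head Q a = tail Q b \<and> path_elt (tail Q a, [a, b]) \<in> I}"

lemma path_elt_inject: "(path_elt p :: _ \<Rightarrow> 'k::field) = path_elt q \<longleftrightarrow> p = q"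
proof
  assume "(path_elt p :: _ \<Rightarrow> 'k) = path_elt q"
  from fun_cong[OF this, of p] show "p = q" by (simp add: path_elt_def split: if_splits)
qed simp

lemma (in fin_digraph) fin_digraph_op: "fin_digraph (op_quiver G)"
  by unfold_locales auto

lemma (in wf_digraph) awalk_op:
  assumes "wf_digraph (op_quiver G)" "pre_digraph.awalk (op_quiver G) u p v" shows "awalk v (rev p) u"
  using assms(2)
proof (induction p arbitrary: u)
  case Nil
  then show ?case by (auto simp: wf_digraph.awalk_Nil_iff[OF assms(1)] awalk_Nil_iff)
next
  case (Cons a p)
  then have a: "a \<in> arcs G" "u = head G a" "pre_digraph.awalk (op_quiver G) (tail G a) p v"
    by (auto simp: wf_digraph.awalk_Cons_iff[OF assms(1)])
  have "awalk (tail G a) [a] u" using a by (simp add: awalk_Cons_iff awalk_Nil_iff)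
  then show ?case using awalk_appendI[OF Cons.IH[OF a(3)]] by simp
qed

context monomial_quiver
begin

lemma op_relations_iff:
  "path_elt (head Q b, [b, a]) \<in> op_relations Q I \<longleftrightarrow>
     a \<in> arcs Q \<and> b \<in> arcs Q \<and> head Q a = tail Q b \<and> zero_rel a b"
  by (auto simp: op_relations_def path_elt_inject zero_rel_def)

lemma monomial_op: "monomial_quiver (op_quiver Q) (op_relations Q I)"
proof -
  interpret op: fin_digraph "op_quiver Q" by (rule fin_digraph_op)
  show ?thesis
  proof unfold_locales
    fix f u p assume f: "f \<in> op_relations Q I" "f (u, p) \<noteq> 0"
    then obtain a b where ab: "f = path_elt (head Q b, [b, a])" "a \<in> arcs Q" "b \<in> arcs Q" "head Q a = tail Q b"
      unfolding op_relations_def by blast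
    then have p: "p = [] @ b # a # []" "u = head Q b" using f(2) by (auto simp: path_elt_def split: if_splits)
    moreover have "op.awalk u p (tail Q a)" using ab p by (simp add: op.awalk_Cons_iff op.awalk_Nil_iff)
    moreover have "path_elt (tail (op_quiver Q) b, [b, a]) \<in> op_relations Q I" using f ab by simp
    ultimately show "\<exists>v xs a b ys. op.awalk u p v \<and> p = xs @ a # b # ys \<and>
       path_elt (tail (op_quiver Q) a, [a, b]) \<in> op_relations Q I" by blast
  qed
qed

end

text \<open>Reversal exchanges \<open>out2\<close> with \<open>in2\<close> and the left with the
  right conditions on products; \<open>bounded\<close> is its own mirror image.\<close>

lemma (in gentle_quiver) gentle_op: "gentle_quiver (op_quiver Q) (op_relations Q I)"
proof -
  interpret op: monomial_quiver "op_quiver Q" "op_relations Q I" by (rule monomial_op)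
  have z: "op.zero_rel b a \<longleftrightarrow> a \<in> arcs Q \<and> b \<in> arcs Q \<and> head Q a = tail Q b \<and> zero_rel a b" for a b
    using op_relations_iff by (simp add: op.zero_rel_def)
  show ?thesis
  proof unfold_locales
    show "a = b \<or> a = c \<or> b = c"
      if "a \<in> arcs (op_quiver Q)" "b \<in> arcs (op_quiver Q)" "c \<in> arcs (op_quiver Q)"
        "tail (op_quiver Q) a = tail (op_quiver Q) c" "tail (op_quiver Q) b = tail (op_quiver Q) c" for a b c
      using in2[of a b c] that by simp
    show "a = b \<or> a = c \<or> b = c"
      if "a \<in> arcs (op_quiver Q)" "b \<in> arcs (op_quiver Q)" "c \<in> arcs (op_quiver Q)"
        "head (op_quiver Q) a = head (op_quiver Q) c" "head (op_quiver Q) b = head (op_quiver Q) c" for a b c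
      using out2[of a b c] that by simp
  next
    fix a b b' assume "a \<in> arcs (op_quiver Q)" "b \<in> arcs (op_quiver Q)" "b' \<in> arcs (op_quiver Q)"
      "head (op_quiver Q) a = tail (op_quiver Q) b" "head (op_quiver Q) a = tail (op_quiver Q) b'"
    then have ar: "a \<in> arcs Q" "b \<in> arcs Q" "b' \<in> arcs Q" "head Q b = tail Q a" "head Q b' = tail Q a" by simp_all
    show "\<not> op.zero_rel a b \<Longrightarrow> \<not> op.zero_rel a b' \<Longrightarrow> b = b'"
      by (rule nonzero_left[OF ar(2,3,1,4,5)]) (use ar z in blast)+
    show "op.zero_rel a b \<Longrightarrow> op.zero_rel a b' \<Longrightarrow> b = b'"
      by (rule zero_left[OF ar(2,3,1,4,5)]) (use ar z in blast)+
  next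
    fix a a' b assume "a \<in> arcs (op_quiver Q)" "a' \<in> arcs (op_quiver Q)" "b \<in> arcs (op_quiver Q)"
      "head (op_quiver Q) a = tail (op_quiver Q) b" "head (op_quiver Q) a' = tail (op_quiver Q) b"
    then have ar: "a \<in> arcs Q" "a' \<in> arcs Q" "b \<in> arcs Q" "head Q b = tail Q a" "head Q b = tail Q a'" by simp_all
    show "\<not> op.zero_rel a b \<Longrightarrow> \<not> op.zero_rel a' b \<Longrightarrow> a = a'"
      by (rule nonzero_right[OF ar(3,1,2,4,5)]) (use ar z in blast)+
    show "op.zero_rel a b \<Longrightarrow> op.zero_rel a' b \<Longrightarrow> a = a'"
      by (rule zero_right[OF ar(3,1,2,4,5)]) (use ar z in blast)+
  next
    obtain m where m: "\<And>u p v. awalk u p v \<Longrightarrow> m \<le> length p \<Longrightarrow> \<exists>xs a b ys. p = xs @ a # b # ys \<and> zero_rel a b"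
      using bounded by blast
    have "\<exists>xs a b ys. p = xs @ a # b # ys \<and> op.zero_rel a b" if p: "op.awalk u p v" "m \<le> length p" for u p v
    proof -
      have w: "awalk v (rev p) u" by (rule awalk_op[OF op.wf_digraph_axioms p(1)])
      then obtain xs a b ys where r: "rev p = xs @ a # b # ys" "zero_rel a b"
        using m[OF w] p(2) unfolding length_rev by blast
      have "rev (rev p) = rev ys @ b # a # rev xs" unfolding r(1) by simp
      then have "p = rev ys @ b # a # rev xs" by simp
      moreover have "op.zero_rel b a" using r(2) w unfolding z r(1) by (auto simp: awalk_Cons_iff)
      ultimately show ?thesis by blast
    qed
    then show "\<exists>m. \<forall>u p v. op.awalk u p v \<longrightarrow> m \<le> length p \<longrightarrow> (\<exists>xs a b ys. p = xs @ a # b # ys \<and> op.zero_rel a b)"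
      by blast
  qed
qed

section \<open>Duality\<close>

definition functional :: "(nat \<Rightarrow> 'k::field) set \<Rightarrow> ((nat \<Rightarrow> 'k) \<Rightarrow> 'k) \<Rightarrow> bool" where
  "functional V l \<longleftrightarrow> (\<forall>x\<in>V. \<forall>y\<in>V. l (x + y) = l x + l y) \<and> (\<forall>c. \<forall>x\<in>V. l (seq_scale c x) = c * l x)"

text \<open>Each space represents the functionals on the other, and does so uniquely. The form is
  symmetric because duality is applied in both directions.\<close>

definition perfect :: "(nat \<Rightarrow> 'k::field) set \<Rightarrow> (nat \<Rightarrow> 'k) set \<Rightarrow> ((nat \<Rightarrow> 'k) \<Rightarrow> (nat \<Rightarrow> 'k) \<Rightarrow> 'k) \<Rightarrow> bool" where
  "perfect V W b \<longleftrightarrow> (\<forall>p\<in>W. functional V (\<lambda>x. b x p)) \<and> (\<forall>x\<in>V. functional W (b x)) \<and>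
     (\<forall>l. functional V l \<longrightarrow> (\<exists>p\<in>W. \<forall>x\<in>V. b x p = l x)) \<and>
     (\<forall>l. functional W l \<longrightarrow> (\<exists>x\<in>V. \<forall>p\<in>W. b x p = l p)) \<and>
     (\<forall>p\<in>W. \<forall>q\<in>W. (\<forall>x\<in>V. b x p = b x q) \<longrightarrow> p = q) \<and>
     (\<forall>x\<in>V. \<forall>y\<in>V. (\<forall>p\<in>W. b x p = b y p) \<longrightarrow> x = y)"

lemma perfect_sym: "perfect V W b \<Longrightarrow> perfect W V (\<lambda>p x. b x p)"
  unfolding perfect_def by blast

lemma functional_sum:
  assumes l: "functional V l" and V: "seq.subspace V" and m: "\<And>i. i \<in> A \<Longrightarrow> g i \<in> V"
  shows "l (\<Sum>i\<in>A. g i) = (\<Sum>i\<in>A. l (g i))"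
  using m
proof (induction A rule: infinite_finite_induct)
  case (insert x F)
  then have "sum g F \<in> V" using V by (simp add: seq.subspace_sum)
  then have "l (g x + sum g F) = l (g x) + l (sum g F)"
    using l insert.prems unfolding functional_def by blast
  then show ?case using insert by (metis insertCI sum.insert)
next
  case empty
  have "l (seq_scale 0 0) = 0 * l 0" using l V unfolding functional_def by (meson seq.subspace_0)
  then show ?case unfolding sum.empty seq.scale_zero_left mult_zero_left .
next
  case (infinite A)
  have "l (seq_scale 0 0) = 0 * l 0" using l V unfolding functional_def by (meson seq.subspace_0)
  then show ?case unfolding sum.infinite[OF infinite(1)] seq.scale_zero_left mult_zero_left .
qed

lemma functional_0: "functional V l \<Longrightarrow> seq.subspace V \<Longrightarrow> l 0 = 0"
  using functional_sum[of V l "{}" "\<lambda>_. 0"] by simp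

lemma functional_diff:
  assumes l: "functional V l" and V: "seq.subspace V" and "x \<in> V" "y \<in> V"
  shows "l (x - y) = l x - l y"
proof -
  have "l x = l ((x - y) + y)" by simp
  also have "\<dots> = l (x - y) + l y"
    using assms seq.subspace_diff[OF V] unfolding functional_def by blast
  finally show ?thesis by simp
qed

text \<open>In coordinates the pairing is the dot product. General spaces use the coordinates of a
  basis, string modules those given by \<open>unit_seq\<close>.\<close>

lemma perfect_coordinates:
  assumes V: "seq.subspace V" and e: "\<And>i. i \<in> S \<Longrightarrow> e i \<in> V" and S: "finite S"
    and c: "\<And>x. x \<in> V \<Longrightarrow> x = (\<Sum>i\<in>S. seq_scale (c x i) (e i))"
    and ce: "\<And>i j. i \<in> S \<Longrightarrow> c (e i) j = (if j = i then 1 else 0)"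
    and cl: "\<And>x y i. x \<in> V \<Longrightarrow> y \<in> V \<Longrightarrow> i \<in> S \<Longrightarrow> c (x + y) i = c x i + c y i"
      "\<And>a x i. x \<in> V \<Longrightarrow> i \<in> S \<Longrightarrow> c (seq_scale a x) i = a * c x i"
  shows "perfect V {p. \<forall>i. p i \<noteq> 0 \<longrightarrow> i \<in> S} (\<lambda>x p. \<Sum>i\<in>S. c x i * p i)" (is "perfect V ?W ?b")
  unfolding perfect_def
proof (intro conjI ballI allI impI)
  have W: "seq.subspace ?W" using fin_dim_subspace_support[OF S] by (rule fin_dim_subspaceD)
  have be: "?b (e i) p = p i" if "i \<in> S" for i p
  proof -
    have "?b (e i) p = (\<Sum>j\<in>S. if j = i then p j else 0)" by (rule sum.cong) (auto simp: ce[OF that])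
    then show ?thesis using that S by simp
  qed
  have bu: "?b x (unit_seq i) = c x i" if "i \<in> S" for x i
  proof -
    have "?b x (unit_seq i) = (\<Sum>j\<in>S. if j = i then c x j else 0)" by (rule sum.cong) auto
    then show ?thesis using that S by simp
  qed
  show "functional V (\<lambda>x. ?b x p)" for p
    unfolding functional_def by (auto simp: cl algebra_simps sum.distrib sum_distrib_left intro!: sum.cong)
  show "functional ?W (?b x)" for x
    unfolding functional_def by (auto simp: algebra_simps sum.distrib sum_distrib_left intro!: sum.cong)
  show "\<exists>p\<in>?W. \<forall>x\<in>V. ?b x p = l x" if l: "functional V l" for l
  proof (intro bexI ballI)
    let ?p = "\<lambda>i. if i \<in> S then l (e i) else 0"
    show "?p \<in> ?W" by auto
    fix x assume x: "x \<in> V"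
    have "l x = l (\<Sum>i\<in>S. seq_scale (c x i) (e i))" using c[OF x] by simp
    also have "\<dots> = (\<Sum>i\<in>S. l (seq_scale (c x i) (e i)))"
      by (rule functional_sum[OF l V]) (simp add: e V seq.subspace_scale)
    also have "\<dots> = ?b x ?p" using l e unfolding functional_def by (auto intro!: sum.cong)
    finally show "?b x ?p = l x" by simp
  qed
  show "\<exists>x\<in>V. \<forall>p\<in>?W. ?b x p = l p" if l: "functional ?W l" for l
  proof (intro bexI ballI)
    let ?x = "\<Sum>i\<in>S. seq_scale (l (unit_seq i)) (e i)"
    show xV: "?x \<in> V" using e V by (simp add: seq.subspace_sum seq.subspace_scale)
    fix p assume p: "p \<in> ?W"
    have "functional V (\<lambda>x. ?b x p)"
      unfolding functional_def by (auto simp: cl algebra_simps sum.distrib sum_distrib_left intro!: sum.cong)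
    then have "?b ?x p = (\<Sum>i\<in>S. l (unit_seq i) * p i)"
      using functional_sum[of V "\<lambda>x. ?b x p" S "\<lambda>i. seq_scale (l (unit_seq i)) (e i)"] V e be
      unfolding functional_def by (simp add: seq.subspace_scale)
    also have "\<dots> = (\<Sum>i\<in>S. l (seq_scale (p i) (unit_seq i)))"
      using l unfolding functional_def by (auto intro!: sum.cong simp: mult.commute)
    also have "\<dots> = l (\<Sum>i\<in>S. seq_scale (p i) (unit_seq i))"
      by (rule functional_sum[OF l W, symmetric]) auto
    also have "(\<Sum>i\<in>S. seq_scale (p i) (unit_seq i)) = p"
      using seq_expand[OF S, of p] p by simp
    finally show "?b ?x p = l p" .
  qed
  show "p = q" if pq: "p \<in> ?W" "q \<in> ?W" "\<forall>x\<in>V. ?b x p = ?b x q" for p q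
  proof
    fix i show "p i = q i"
    proof (cases "i \<in> S")
      case True
      then show ?thesis using pq(3) e be by metis
    next
      case False
      then have "p i = 0" "q i = 0" using pq by auto
      then show ?thesis by simp
    qed
  qed
  show "x = y" if xy: "x \<in> V" "y \<in> V" "\<forall>p\<in>?W. ?b x p = ?b y p" for x y
  proof -
    have u: "unit_seq i \<in> ?W" if "i \<in> S" for i using that by auto
    have "c x i = c y i" if i: "i \<in> S" for i
      using bspec[OF xy(3) u[OF i]] unfolding bu[OF i] .
    then have "(\<Sum>i\<in>S. seq_scale (c x i) (e i)) = (\<Sum>i\<in>S. seq_scale (c y i) (e i))" by (intro sum.cong) auto
    then show ?thesis using c[OF xy(1)] c[OF xy(2)] by simp
  qed
qed

lemma perfect_exists:
  assumes "fin_dim_subspace V" shows "\<exists>W b. fin_dim_subspace W \<and> perfect V W b"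
proof -
  obtain B where B: "B \<subseteq> V" "finite B" "seq.independent B" "seq.span B = V"
    using fin_dim_subspace_basis[OF assms] .
  obtain e :: "nat \<Rightarrow> _" where e: "bij_betw e {0..<card B} B" using ex_bij_betw_nat_finite[OF B(2)] by blast
  let ?S = "{0..<card B}"
  \<comment> \<open>The value \<open>0\<close> outside the index range matters:
    \<open>perfect_coordinates\<close> evaluates the coordinates of a basis vector at every
    index.\<close>
  define c where "c = (\<lambda>x i. if i \<in> ?S then seq.representation B x (e i) else 0)"
  have eB: "e i \<in> B" if "i \<in> ?S" for i using e that by (auto simp: bij_betw_def)
  have "perfect V {p. \<forall>i. p i \<noteq> 0 \<longrightarrow> i \<in> ?S} (\<lambda>x p. \<Sum>i\<in>?S. c x i * p i)"
  proof (rule perfect_coordinates)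
    show "seq.subspace V" using assms by (rule fin_dim_subspaceD)
    show "e i \<in> V" if "i \<in> ?S" for i using eB[OF that] B(1) by blast
    show "finite ?S" by simp
    show "x = (\<Sum>i\<in>?S. seq_scale (c x i) (e i))" if x: "x \<in> V" for x
    proof -
      have "(\<Sum>b\<in>B. seq_scale (seq.representation B x b) b) = x"
        using seq.sum_representation_eq[OF B(3) _ B(2)] x B(4) by blast
      then have "x = (\<Sum>i\<in>?S. seq_scale (seq.representation B x (e i)) (e i))"
        using sum.reindex_bij_betw[OF e, of "\<lambda>b. seq_scale (seq.representation B x b) b"] by simp
      also have "\<dots> = (\<Sum>i\<in>?S. seq_scale (c x i) (e i))" by (intro sum.cong) (auto simp: c_def)
      finally show ?thesis .
    qed
    show "c (e i) j = (if j = i then 1 else 0)" if i: "i \<in> ?S" for i j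
    proof (cases "j \<in> ?S")
      case True
      have "e j = e i \<longleftrightarrow> j = i" using e i True by (auto simp: bij_betw_def inj_on_def)
      then show ?thesis using seq.representation_basis[OF B(3) eB[OF i]] True by (auto simp: c_def)
    next
      case False
      then show ?thesis using i by (auto simp: c_def)
    qed
    show "c (x + y) i = c x i + c y i" if "x \<in> V" "y \<in> V" "i \<in> ?S" for x y i
      using that seq.representation_add[OF B(3)] B(4) by (simp add: c_def)
    show "c (seq_scale a x) i = a * c x i" if "x \<in> V" "i \<in> ?S" for a x i
      using that seq.representation_scale[OF B(3)] B(4) by (simp add: c_def)
  qed
  moreover have "fin_dim_subspace {p :: nat \<Rightarrow> 'a. \<forall>i. p i \<noteq> 0 \<longrightarrow> i \<in> ?S}" by (rule fin_dim_subspace_support) simp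
  ultimately show ?thesis by blast
qed

text \<open>A symmetric relation between two bound quivers, so that every result can be reused with
  the sides exchanged through \<open>swap\<close>. Forming the opposite relations twice need not
  give back \<open>I\<close>.\<close>

locale dual_quivers = A: monomial_quiver Q I + B: monomial_quiver Q' I'
  for Q :: "('v, 'a) pre_digraph" and I :: "(('v, 'a) qpath \<Rightarrow> 'k::field) set"
    and Q' :: "('v, 'a) pre_digraph" and I' :: "(('v, 'a) qpath \<Rightarrow> 'k::field) set" +
  assumes dual_simps [simp]: "verts Q' = verts Q" "arcs Q' = arcs Q" "tail Q' = head Q" "head Q' = tail Q"
    and dual_zero: "a \<in> arcs Q \<Longrightarrow> b \<in> arcs Q \<Longrightarrow> head Q a = tail Q b \<Longrightarrow> B.zero_rel b a \<longleftrightarrow> A.zero_rel a b"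

lemma dual_quivers_sym: "dual_quivers Q I Q' I' \<Longrightarrow> dual_quivers Q' I' Q I"
  unfolding dual_quivers_def dual_quivers_axioms_def by auto

text \<open>The underlying spaces of representations are spaces of sequences, so \<open>M'\<close> cannot literally be the
  space of functionals on \<open>M\<close>; it is identified with it by a pairing.\<close>

definition dual_pair where
  "dual_pair Q I Q' I' M M' B \<longleftrightarrow> is_rep Q I M \<and> is_rep Q' I' M' \<and>
     (\<forall>v\<in>verts Q. perfect (space M v) (space M' v) (B v)) \<and>
     (\<forall>a\<in>arcs Q. \<forall>x\<in>space M (tail Q a). \<forall>p\<in>space M' (head Q a).
        B (head Q a) (act M a x) p = B (tail Q a) x (act M' a p))"

context dual_quivers
begin

section \<open>Dual representations and transposed homomorphisms\<close>

abbreviation "D \<equiv> dual_pair Q I Q' I'"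
abbreviation "D' \<equiv> dual_pair Q' I' Q I"

lemma dual_pair_sym:
  assumes "D M M' B" shows "D' M' M (\<lambda>v p x. B v x p)"
  unfolding dual_pair_def dual_simps
proof (intro conjI ballI)
  show "perfect (space M' v) (space M v) (\<lambda>p x. B v x p)" if "v \<in> verts Q" for v
    using assms that perfect_sym unfolding dual_pair_def by blast
qed (use assms in \<open>simp_all add: dual_pair_def\<close>)

lemma dual_pair_rep: "D M M' B \<Longrightarrow> A.rep M" "D M M' B \<Longrightarrow> B.rep M'"
  by (simp_all add: dual_pair_def)

lemma dual_pair_perfect: "D M M' B \<Longrightarrow> v \<in> verts Q \<Longrightarrow> perfect (space M v) (space M' v) (B v)"
  by (simp add: dual_pair_def)

lemma dual_pair_act:
  "D M M' B \<Longrightarrow> a \<in> arcs Q \<Longrightarrow> x \<in> space M (tail Q a) \<Longrightarrow> p \<in> space M' (head Q a) \<Longrightarrow>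
     B (head Q a) (act M a x) p = B (tail Q a) x (act M' a p)"
  by (simp add: dual_pair_def)

lemma pair_eqR: "D M M' B \<Longrightarrow> v \<in> verts Q \<Longrightarrow> p \<in> space M' v \<Longrightarrow> q \<in> space M' v \<Longrightarrow>
    (\<And>x. x \<in> space M v \<Longrightarrow> B v x p = B v x q) \<Longrightarrow> p = q"
  using dual_pair_perfect unfolding perfect_def by metis

lemma pair_eqL: "D M M' B \<Longrightarrow> v \<in> verts Q \<Longrightarrow> x \<in> space M v \<Longrightarrow> y \<in> space M v \<Longrightarrow>
    (\<And>p. p \<in> space M' v \<Longrightarrow> B v x p = B v y p) \<Longrightarrow> x = y"
  using dual_pair_perfect unfolding perfect_def by metis

lemma pair_exR:
  assumes "D M M' B" "v \<in> verts Q" "functional (space M v) l"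
  shows "\<exists>p\<in>space M' v. \<forall>x\<in>space M v. B v x p = l x"
  using dual_pair_perfect[OF assms(1,2)] assms(3) unfolding perfect_def by blast

lemma pair_exL:
  assumes "D M M' B" "v \<in> verts Q" "functional (space M' v) l"
  shows "\<exists>x\<in>space M v. \<forall>p\<in>space M' v. B v x p = l p"
  using dual_pair_perfect[OF assms(1,2)] assms(3) unfolding perfect_def by blast

lemma pair_linL: "D M M' B \<Longrightarrow> v \<in> verts Q \<Longrightarrow> p \<in> space M' v \<Longrightarrow> functional (space M v) (\<lambda>x. B v x p)"
  and pair_linR: "D M M' B \<Longrightarrow> v \<in> verts Q \<Longrightarrow> x \<in> space M v \<Longrightarrow> functional (space M' v) (B v x)"
  using dual_pair_perfect unfolding perfect_def by metis+

lemma
  assumes "D M M' B" "v \<in> verts Q"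
  shows pair_addL: "p \<in> space M' v \<Longrightarrow> x \<in> space M v \<Longrightarrow> y \<in> space M v \<Longrightarrow> B v (x + y) p = B v x p + B v y p"
    and pair_scaleL: "p \<in> space M' v \<Longrightarrow> x \<in> space M v \<Longrightarrow> B v (seq_scale c x) p = c * B v x p"
    and pair_addR: "x \<in> space M v \<Longrightarrow> p \<in> space M' v \<Longrightarrow> q \<in> space M' v \<Longrightarrow> B v x (p + q) = B v x p + B v x q"
    and pair_scaleR: "x \<in> space M v \<Longrightarrow> p \<in> space M' v \<Longrightarrow> B v x (seq_scale c p) = c * B v x p"
  using pair_linL[OF assms] pair_linR[OF assms] unfolding functional_def by blast+

lemma pair_0: "D M M' B \<Longrightarrow> v \<in> verts Q \<Longrightarrow> p \<in> space M' v \<Longrightarrow> B v 0 p = 0"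
    "D M M' B \<Longrightarrow> v \<in> verts Q \<Longrightarrow> x \<in> space M v \<Longrightarrow> B v x 0 = 0"
  using functional_0[OF pair_linL A.rep_subspace[OF dual_pair_rep(1)]]
    functional_0[OF pair_linR B.rep_subspace[OF dual_pair_rep(2)]] by auto

text \<open>Arrows act on the dual by transposition: for a fixed \<open>p\<close> the functional
  sending \<open>x\<close> to the pairing of \<open>act M a x\<close> with \<open>p\<close> is
  represented by a vector. That vector is unique, which gives linearity and the reversed
  relations.\<close>

lemma dual_exists:
  assumes M: "A.rep M" shows "\<exists>M' B. D M M' B"
proof -
  have "\<exists>W b. fin_dim_subspace W \<and> perfect (space M v) W b" if "v \<in> verts Q" for v
    using perfect_exists M that unfolding A.rep_iff by blast
  then obtain W b where W: "\<And>v. v \<in> verts Q \<Longrightarrow> fin_dim_subspace (W v)"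
    and b: "\<And>v. v \<in> verts Q \<Longrightarrow> perfect (space M v) (W v) (b v)" by metis
  have t: "tail Q a \<in> verts Q" "head Q a \<in> verts Q" if "a \<in> arcs Q" for a using that by auto
  have lin: "functional (space M v) (\<lambda>x. b v x p)" if "v \<in> verts Q" "p \<in> W v" for v p
    using b[OF that(1)] that(2) unfolding perfect_def by blast
  have linR: "functional (W v) (b v x)" if "v \<in> verts Q" "x \<in> space M v" for v x
    using b[OF that(1)] that(2) unfolding perfect_def by blast
  have sW: "seq.subspace (W v)" if "v \<in> verts Q" for v using fin_dim_subspaceD[OF W[OF that]] .
  have "\<exists>q\<in>W (tail Q a). \<forall>x\<in>space M (tail Q a). b (tail Q a) x q = b (head Q a) (act M a x) p"
    if a: "a \<in> arcs Q" and p: "p \<in> W (head Q a)" for a p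
  proof -
    have "functional (space M (tail Q a)) (\<lambda>x. b (head Q a) (act M a x) p)"
      using lin[OF t(2)[OF a] p] A.act_mem[OF M a] A.act_add[OF M a] A.act_scale[OF M a]
      unfolding functional_def by simp
    then show ?thesis using b[OF t(1)[OF a]] unfolding perfect_def by blast
  qed
  then obtain g where g: "\<And>a p. a \<in> arcs Q \<Longrightarrow> p \<in> W (head Q a) \<Longrightarrow> g a p \<in> W (tail Q a) \<and>
      (\<forall>x\<in>space M (tail Q a). b (tail Q a) x (g a p) = b (head Q a) (act M a x) p)" by metis
  have eq: "p = q" if "v \<in> verts Q" "p \<in> W v" "q \<in> W v" "\<And>x. x \<in> space M v \<Longrightarrow> b v x p = b v x q" for v p q
    using b[OF that(1)] that unfolding perfect_def by blast
  let ?M' = "\<lparr>space = W, act = g\<rparr>"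
  have "B.rep ?M'"
    unfolding B.rep_iff dual_simps
  proof (intro conjI ballI impI)
    show "fin_dim_subspace (space ?M' v)" if "v \<in> verts Q" for v using W[OF that] by simp
    fix a assume a: "a \<in> arcs Q"
    show "linear_map (space ?M' (head Q a)) (space ?M' (tail Q a)) (act ?M' a)"
      unfolding linear_map_def
    proof (intro conjI ballI allI Pi_I)
      fix p assume "p \<in> space ?M' (head Q a)"
      then show "act ?M' a p \<in> space ?M' (tail Q a)" using g[OF a] by simp
    next
      fix p q assume "p \<in> space ?M' (head Q a)" "q \<in> space ?M' (head Q a)"
      then have p: "p \<in> W (head Q a)" "q \<in> W (head Q a)" by simp_all
      then have pq: "p + q \<in> W (head Q a)" using seq.subspace_add[OF sW[OF t(2)[OF a]]] by blast
      have "g a (p + q) = g a p + g a q"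
      proof (rule eq[OF t(1)[OF a]])
        show "g a (p + q) \<in> W (tail Q a)" using g[OF a pq] by blast
        show "g a p + g a q \<in> W (tail Q a)" using g[OF a p(1)] g[OF a p(2)] seq.subspace_add[OF sW[OF t(1)[OF a]]] by blast
        fix x assume x: "x \<in> space M (tail Q a)"
        have "b (tail Q a) x (g a (p + q)) = b (head Q a) (act M a x) p + b (head Q a) (act M a x) q"
          using g[OF a pq] x linR[OF t(2)[OF a] A.act_mem[OF M a x]] p unfolding functional_def by simp
        also have "\<dots> = b (tail Q a) x (g a p + g a q)"
          using g[OF a p(1)] g[OF a p(2)] x linR[OF t(1)[OF a] x] unfolding functional_def by simp
        finally show "b (tail Q a) x (g a (p + q)) = b (tail Q a) x (g a p + g a q)" .
      qed
      then show "act ?M' a (p + q) = act ?M' a p + act ?M' a q" by simp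
    next
      fix c p assume "p \<in> space ?M' (head Q a)"
      then have p: "p \<in> W (head Q a)" by simp
      then have cp: "seq_scale c p \<in> W (head Q a)" using seq.subspace_scale[OF sW[OF t(2)[OF a]]] by blast
      have "g a (seq_scale c p) = seq_scale c (g a p)"
      proof (rule eq[OF t(1)[OF a]])
        show "g a (seq_scale c p) \<in> W (tail Q a)" using g[OF a cp] by blast
        show "seq_scale c (g a p) \<in> W (tail Q a)" using g[OF a p] seq.subspace_scale[OF sW[OF t(1)[OF a]]] by blast
        fix x assume x: "x \<in> space M (tail Q a)"
        have "b (tail Q a) x (g a (seq_scale c p)) = c * b (head Q a) (act M a x) p"
          using g[OF a cp] x linR[OF t(2)[OF a] A.act_mem[OF M a x]] p unfolding functional_def by simp
        also have "\<dots> = b (tail Q a) x (seq_scale c (g a p))"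
          using g[OF a p] x linR[OF t(1)[OF a] x] unfolding functional_def by simp
        finally show "b (tail Q a) x (g a (seq_scale c p)) = b (tail Q a) x (seq_scale c (g a p))" .
      qed
      then show "act ?M' a (seq_scale c p) = seq_scale c (act ?M' a p)" by simp
    qed
  next
    fix b' a p assume b': "b' \<in> arcs Q" "a \<in> arcs Q" "tail Q b' = head Q a" "B.zero_rel b' a"
      and "p \<in> space ?M' (head Q b')"
    then have p: "p \<in> W (head Q b')" by simp
    have z: "A.zero_rel a b'" using dual_zero b' by simp
    have g1: "g b' p \<in> W (head Q a)" using g[OF b'(1) p] b'(3) by simp
    have "g a (g b' p) = 0"
    proof (rule eq[OF t(1)[OF b'(2)]])
      show "g a (g b' p) \<in> W (tail Q a)" using g[OF b'(2) g1] by blast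
      show "0 \<in> W (tail Q a)" using seq.subspace_0[OF sW[OF t(1)[OF b'(2)]]] .
      fix x assume x: "x \<in> space M (tail Q a)"
      have ax: "act M a x \<in> space M (tail Q b')" using A.act_mem[OF M b'(2) x] b'(3) by simp
      have "b (tail Q a) x (g a (g b' p)) = b (tail Q b') (act M a x) (g b' p)" using g[OF b'(2) g1] x b'(3) by simp
      also have "\<dots> = b (head Q b') (act M b' (act M a x)) p" using g[OF b'(1) p] ax by simp
      also have "act M b' (act M a x) = 0" using A.act_act[OF M b'(2,1) _ z x] b'(3) by simp
      also have "b (head Q b') 0 p = 0" using functional_0[OF lin[OF t(2)[OF b'(1)] p] A.rep_subspace[OF M t(2)[OF b'(1)]]] .
      also have "0 = b (tail Q a) x 0" using functional_0[OF linR[OF t(1)[OF b'(2)] x] sW[OF t(1)[OF b'(2)]]] by simp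
      finally show "b (tail Q a) x (g a (g b' p)) = b (tail Q a) x 0" .
    qed
    then show "act ?M' a (act ?M' b' p) = 0" by simp
  qed
  then have "D M ?M' b" unfolding dual_pair_def using M b g by simp
  then show ?thesis by blast
qed

text \<open>The transpose exists since the pairing represents functionals; all its properties follow
  by pairing both sides with an arbitrary \<open>x\<close>.\<close>

lemma adjoint_exists:
  assumes M: "D M M' B" and N: "D N N' C" and h: "A.rhom M N h"
  shows "\<exists>h'. B.rhom N' M' h' \<and> (\<forall>v\<in>verts Q. \<forall>x\<in>space M v. \<forall>p\<in>space N' v. C v (h v x) p = B v x (h' v p))"
proof -
  have "\<exists>q\<in>space M' v. \<forall>x\<in>space M v. B v x q = C v (h v x) p" if v: "v \<in> verts Q" "p \<in> space N' v" for v p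
  proof (rule pair_exR[OF M v(1)])
    show "functional (space M v) (\<lambda>x. C v (h v x) p)"
      using pair_linL[OF N v] A.hom_mem[OF h v(1)] A.hom_add[OF h v(1)] A.hom_scale[OF h v(1)]
      unfolding functional_def by simp
  qed
  then obtain k where k: "\<And>v p. v \<in> verts Q \<Longrightarrow> p \<in> space N' v \<Longrightarrow> k v p \<in> space M' v \<and>
      (\<forall>x\<in>space M v. B v x (k v p) = C v (h v x) p)" by metis
  note rM' = dual_pair_rep(2)[OF M] and rN' = dual_pair_rep(2)[OF N]
  have "B.rhom N' M' k"
  proof (rule B.homI; unfold dual_simps)
    show "k v p \<in> space M' v" if "v \<in> verts Q" "p \<in> space N' v" for v p using k[OF that] by blast
  next
    fix v p q assume v: "v \<in> verts Q" "p \<in> space N' v" "q \<in> space N' v"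
    have vq: "v \<in> verts Q'" using v by simp
    have pq: "p + q \<in> space N' v" by (rule B.rep_add[OF rN' vq v(2,3)])
    show "k v (p + q) = k v p + k v q"
    proof (rule pair_eqR[OF M v(1)])
      show "k v (p + q) \<in> space M' v" using k[OF v(1) pq] by blast
      show "k v p + k v q \<in> space M' v" using k[OF v(1,2)] k[OF v(1,3)] B.rep_add[OF rM' vq] by blast
      fix x assume x: "x \<in> space M v"
      have "B v x (k v (p + q)) = C v (h v x) p + C v (h v x) q"
        using k[OF v(1) pq] x pair_addR[OF N v(1) A.hom_mem[OF h v(1) x] v(2,3)] by simp
      also have "\<dots> = B v x (k v p + k v q)"
        using k[OF v(1,2)] k[OF v(1,3)] x pair_addR[OF M v(1) x] by simp
      finally show "B v x (k v (p + q)) = B v x (k v p + k v q)" .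
    qed
  next
    fix v c p assume v: "v \<in> verts Q" "p \<in> space N' v"
    have vq: "v \<in> verts Q'" using v by simp
    have cp: "seq_scale c p \<in> space N' v" by (rule B.rep_scale[OF rN' vq v(2)])
    show "k v (seq_scale c p) = seq_scale c (k v p)"
    proof (rule pair_eqR[OF M v(1)])
      show "k v (seq_scale c p) \<in> space M' v" using k[OF v(1) cp] by blast
      show "seq_scale c (k v p) \<in> space M' v" using k[OF v] B.rep_scale[OF rM' vq] by blast
      fix x assume x: "x \<in> space M v"
      have "B v x (k v (seq_scale c p)) = c * C v (h v x) p"
        using k[OF v(1) cp] x pair_scaleR[OF N v(1) A.hom_mem[OF h v(1) x] v(2)] by simp
      also have "\<dots> = B v x (seq_scale c (k v p))"
        using k[OF v] x pair_scaleR[OF M v(1) x] by simp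
      finally show "B v x (k v (seq_scale c p)) = B v x (seq_scale c (k v p))" .
    qed
  next
    fix a p assume a: "a \<in> arcs Q" "p \<in> space N' (head Q a)"
    have t: "tail Q a \<in> verts Q" "head Q a \<in> verts Q" using a by auto
    have ap: "act N' a p \<in> space N' (tail Q a)" using B.act_mem[OF rN', of a p] a by simp
    have akp: "act M' a (k (head Q a) p) \<in> space M' (tail Q a)"
      using B.act_mem[OF rM', of a] a k[OF t(2) a(2)] by simp
    show "k (tail Q a) (act N' a p) = act M' a (k (head Q a) p)"
    proof (rule pair_eqR[OF M t(1) _ akp])
      show "k (tail Q a) (act N' a p) \<in> space M' (tail Q a)" using k[OF t(1) ap] by blast
      fix x assume x: "x \<in> space M (tail Q a)"
      note ax = A.act_mem[OF dual_pair_rep(1)[OF M] a(1) x]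
      have "B (tail Q a) x (k (tail Q a) (act N' a p)) = C (tail Q a) (h (tail Q a) x) (act N' a p)"
        using k[OF t(1) ap] x by simp
      also have "\<dots> = C (head Q a) (act N a (h (tail Q a) x)) p"
        using dual_pair_act[OF N a(1) A.hom_mem[OF h t(1) x] a(2)] by simp
      also have "\<dots> = C (head Q a) (h (head Q a) (act M a x)) p" using A.hom_act[OF h a(1) x] by simp
      also have "\<dots> = B (head Q a) (act M a x) (k (head Q a) p)" using k[OF t(2) a(2)] ax by simp
      also have "\<dots> = B (tail Q a) x (act M' a (k (head Q a) p))"
        using dual_pair_act[OF M a(1) x] k[OF t(2) a(2)] by simp
      finally show "B (tail Q a) x (k (tail Q a) (act N' a p)) = B (tail Q a) x (act M' a (k (head Q a) p))" .
    qed
  qed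
  then show ?thesis using k by (intro exI[of _ k]) simp
qed

lemma adjointE:
  assumes "D M M' B" "D N N' C" "A.rhom M N h"
  obtains h' where "B.rhom N' M' h'"
    "\<And>v x p. v \<in> verts Q \<Longrightarrow> x \<in> space M v \<Longrightarrow> p \<in> space N' v \<Longrightarrow> C v (h v x) p = B v x (h' v p)"
  using adjoint_exists[OF assms] by blast

lemmas swap = dual_quivers_sym[OF dual_quivers_axioms]
lemmas adjointE' = dual_quivers.adjointE[OF swap]

lemma hom_memB: "B.rhom M N h \<Longrightarrow> v \<in> verts Q \<Longrightarrow> x \<in> space M v \<Longrightarrow> h v x \<in> space N v"
  using B.hom_mem by simp

text \<open>Transposition exchanges inclusion and projection.\<close>

lemma dual_retract:
  assumes M: "D M M' B" and T: "D T T' C" and r: "A.retract M T" shows "B.retract M' T'"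
proof -
  obtain i p where i: "A.rhom M T i" and p: "A.rhom T M p" and pi: "\<And>v x. v \<in> verts Q \<Longrightarrow> x \<in> space M v \<Longrightarrow> p v (i v x) = x"
    using r unfolding A.retract_def by blast
  obtain i' where i': "B.rhom T' M' i'" "\<And>v x p. v \<in> verts Q \<Longrightarrow> x \<in> space M v \<Longrightarrow> p \<in> space T' v \<Longrightarrow> C v (i v x) p = B v x (i' v p)"
    using adjointE[OF M T i] by metis
  obtain p' where p': "B.rhom M' T' p'" "\<And>v x q. v \<in> verts Q \<Longrightarrow> x \<in> space T v \<Longrightarrow> q \<in> space M' v \<Longrightarrow> B v (p v x) q = C v x (p' v q)"
    using adjointE[OF T M p] by metis
  have "i' v (p' v q) = q" if v: "v \<in> verts Q" "q \<in> space M' v" for v q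
  proof (rule pair_eqR[OF M v(1) _ v(2)])
    have pq: "p' v q \<in> space T' v" using hom_memB[OF p'(1) v] .
    show "i' v (p' v q) \<in> space M' v" using hom_memB[OF i'(1) v(1) pq] .
    fix x assume x: "x \<in> space M v"
    have "B v x (i' v (p' v q)) = C v (i v x) (p' v q)" using i'(2)[OF v(1) x pq] by simp
    also have "\<dots> = B v (p v (i v x)) q" using p'(2)[OF v(1) A.hom_mem[OF i v(1) x] v(2)] by simp
    finally show "B v x (i' v (p' v q)) = B v x q" using pi[OF v(1) x] by simp
  qed
  then show ?thesis unfolding B.retract_def dual_simps using i'(1) p'(1) by blast
qed

lemma dual_iso:
  assumes M: "D M M' B" and N: "D N N' C" and i: "A.riso M N" shows "B.riso M' N'"
proof -
  obtain f g where "A.inverse_homs M N f g" using i A.iso_iff[OF dual_pair_rep(1)[OF M]] by blast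
  then have f: "A.rhom M N f" and g: "A.rhom N M g"
    and gf: "\<And>v x. v \<in> verts Q \<Longrightarrow> x \<in> space M v \<Longrightarrow> g v (f v x) = x"
    and fg: "\<And>v x. v \<in> verts Q \<Longrightarrow> x \<in> space N v \<Longrightarrow> f v (g v x) = x"
    by (auto simp: A.inverse_homs_def)
  obtain f' where f': "B.rhom N' M' f'" "\<And>v x p. v \<in> verts Q \<Longrightarrow> x \<in> space M v \<Longrightarrow> p \<in> space N' v \<Longrightarrow> C v (f v x) p = B v x (f' v p)"
    using adjointE[OF M N f] by metis
  obtain g' where g': "B.rhom M' N' g'" "\<And>v x p. v \<in> verts Q \<Longrightarrow> x \<in> space N v \<Longrightarrow> p \<in> space M' v \<Longrightarrow> B v (g v x) p = C v x (g' v p)"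
    using adjointE[OF N M g] by metis
  have 1: "f' v (g' v q) = q" if v: "v \<in> verts Q" "q \<in> space M' v" for v q
  proof (rule pair_eqR[OF M v(1) _ v(2)])
    have gq: "g' v q \<in> space N' v" using hom_memB[OF g'(1) v] .
    show "f' v (g' v q) \<in> space M' v" using hom_memB[OF f'(1) v(1) gq] .
    fix x assume x: "x \<in> space M v"
    have "B v x (f' v (g' v q)) = C v (f v x) (g' v q)" using f'(2)[OF v(1) x gq] by simp
    also have "\<dots> = B v (g v (f v x)) q" using g'(2)[OF v(1) A.hom_mem[OF f v(1) x] v(2)] by simp
    finally show "B v x (f' v (g' v q)) = B v x q" using gf[OF v(1) x] by simp
  qed
  have 2: "g' v (f' v q) = q" if v: "v \<in> verts Q" "q \<in> space N' v" for v q
  proof (rule pair_eqR[OF N v(1) _ v(2)])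
    have fq: "f' v q \<in> space M' v" using hom_memB[OF f'(1) v] .
    show "g' v (f' v q) \<in> space N' v" using hom_memB[OF g'(1) v(1) fq] .
    fix x assume x: "x \<in> space N v"
    have "C v x (g' v (f' v q)) = B v (g v x) (f' v q)" using g'(2)[OF v(1) x fq] by simp
    also have "\<dots> = C v (f v (g v x)) q" using f'(2)[OF v(1) A.hom_mem[OF g v(1) x] v(2)] by simp
    finally show "C v x (g' v (f' v q)) = C v x q" using fg[OF v(1) x] by simp
  qed
  have "B.inverse_homs M' N' g' f'"
    unfolding B.inverse_homs_def dual_simps using f'(1) g'(1) 1 2 by blast
  then show ?thesis by (rule B.isoI)
qed

text \<open>The transpose of an idempotent is an idempotent of \<open>M\<close>, hence zero or the
  identity, and the pairing carries this back.\<close>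

lemma dual_indec:
  assumes M: "D M M' B" and ind: "A.indec M" shows "B.indec M'"
  unfolding B.indec_iff
proof (intro conjI allI impI)
  note rM = dual_pair_rep(1)[OF M]
  show rM': "B.rep M'" using dual_pair_rep(2)[OF M] .
  obtain v x where v: "v \<in> verts Q" "x \<in> space M v" "x \<noteq> 0" using A.indec_nonzero[OF ind] by blast
  show "\<not> is_zero_rep Q' M'"
  proof
    assume "is_zero_rep Q' M'"
    then have "\<And>p. p \<in> space M' v \<Longrightarrow> p = 0" using v(1) unfolding B.is_zero_rep_iff[OF rM'] dual_simps by blast
    then have "B v x p = B v 0 p" if "p \<in> space M' v" for p
      using that pair_0(2)[OF M v(1,2)] pair_0(2)[OF M v(1) A.rep_0[OF rM v(1)]] by metis
    then have "x = 0" by (rule pair_eqL[OF M v(1,2) A.rep_0[OF rM v(1)]])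
    then show False using v(3) by simp
  qed
  fix e assume e: "B.rhom M' M' e" and ee: "\<forall>v\<in>verts Q'. \<forall>x\<in>space M' v. e v (e v x) = e v x"
  obtain k where k: "A.rhom M M k" "\<And>v p x. v \<in> verts Q' \<Longrightarrow> p \<in> space M' v \<Longrightarrow> x \<in> space M v \<Longrightarrow> B v x (e v p) = B v (k v x) p"
    by (rule adjointE'[OF dual_pair_sym[OF M] dual_pair_sym[OF M] e]) (rule that)
  have k2: "B v (k v x) p = B v x (e v p)" if "v \<in> verts Q" "x \<in> space M v" "p \<in> space M' v" for v x p
    by (rule k(2)[symmetric]) (simp_all only: dual_simps that)
  have "k v (k v x) = k v x" if v: "v \<in> verts Q" "x \<in> space M v" for v x
  proof (rule pair_eqL[OF M v(1)])
    note kx = A.hom_mem[OF k(1) v]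
    show "k v x \<in> space M v" "k v (k v x) \<in> space M v" using kx A.hom_mem[OF k(1) v(1) kx] .
    fix p assume p: "p \<in> space M' v"
    note ep = hom_memB[OF e v(1) p]
    have ee': "e v (e v p) = e v p" using ee v(1) p unfolding dual_simps by blast
    have "B v (k v (k v x)) p = B v (k v x) (e v p)" by (rule k2[OF v(1) kx p])
    also have "\<dots> = B v x (e v (e v p))" by (rule k2[OF v ep])
    also have "\<dots> = B v (k v x) p" unfolding ee' by (rule k2[OF v p, symmetric])
    finally show "B v (k v (k v x)) p = B v (k v x) p" .
  qed
  then consider "\<forall>v\<in>verts Q. \<forall>x\<in>space M v. k v x = 0" | "\<forall>v\<in>verts Q. \<forall>x\<in>space M v. k v x = x"
    using ind k(1) unfolding A.indec_iff by blast
  then show "(\<forall>v\<in>verts Q'. \<forall>x\<in>space M' v. e v x = 0) \<or> (\<forall>v\<in>verts Q'. \<forall>x\<in>space M' v. e v x = x)"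
  proof cases
    case 1
    have "e v p = 0" if v: "v \<in> verts Q" "p \<in> space M' v" for v p
    proof (rule pair_eqR[OF M v(1) hom_memB[OF e v]])
      show "0 \<in> space M' v" using B.rep_0[OF rM'] v(1) by simp
      fix x assume x: "x \<in> space M v"
      have k0: "k v x = 0" using 1 v(1) x by blast
      have "B v x (e v p) = B v (k v x) p" by (rule k2[OF v(1) x v(2), symmetric])
      also have "\<dots> = B v x 0" unfolding k0 by (rule trans[OF pair_0(1)[OF M v] pair_0(2)[OF M v(1) x, symmetric]])
      finally show "B v x (e v p) = B v x 0" .
    qed
    then show ?thesis by simp
  next
    case 2
    have "e v p = p" if v: "v \<in> verts Q" "p \<in> space M' v" for v p
    proof (rule pair_eqR[OF M v(1) hom_memB[OF e v] v(2)])
      fix x assume x: "x \<in> space M v"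
      have k1: "k v x = x" using 2 v(1) x by blast
      show "B v x (e v p) = B v x p" using k2[OF v(1) x v(2)] unfolding k1 by (rule sym)
    qed
    then show ?thesis by simp
  qed
qed

end

lemma perfect_pair:
  assumes p: "perfect V W b" "perfect V' W' b'"
    and s: "seq.subspace V" "seq.subspace W" "seq.subspace V'" "seq.subspace W'"
  shows "perfect {seq_pair x y | x y. x \<in> V \<and> y \<in> V'} {seq_pair x y | x y. x \<in> W \<and> y \<in> W'}
     (\<lambda>z w. b (seq_left z) (seq_left w) + b' (seq_right z) (seq_right w))"
    (is "perfect ?V ?W ?b")
proof -
  have mV: "z \<in> ?V \<longleftrightarrow> seq_left z \<in> V \<and> seq_right z \<in> V'" for z by (auto; metis seq_pair_left_right)
  have mW: "z \<in> ?W \<longleftrightarrow> seq_left z \<in> W \<and> seq_right z \<in> W'" for z by (auto; metis seq_pair_left_right)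
  \<comment> \<open>Proved for arbitrary spaces and pairings, because it is applied once as it
    stands and once with the two sides exchanged.\<close>
  have half: "\<exists>w. seq_left w \<in> W \<and> seq_right w \<in> W' \<and> (\<forall>z. seq_left z \<in> V \<longrightarrow> seq_right z \<in> V' \<longrightarrow>
       b (seq_left z) (seq_left w) + b' (seq_right z) (seq_right w) = l z)"
    if l: "functional {seq_pair x y | x y. x \<in> V \<and> y \<in> V'} l" and ex: "\<And>l. functional V l \<Longrightarrow> \<exists>p\<in>W. \<forall>x\<in>V. b x p = l x"
      "\<And>l. functional V' l \<Longrightarrow> \<exists>p\<in>W'. \<forall>x\<in>V'. b' x p = l x"
      and 0: "0 \<in> V" "0 \<in> V'"
      and mV: "\<And>z. z \<in> {seq_pair x y | x y. x \<in> V \<and> y \<in> V'} \<longleftrightarrow> seq_left z \<in> V \<and> seq_right z \<in> V'"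
    for V V' W W' and b b' :: "(nat \<Rightarrow> 'a) \<Rightarrow> (nat \<Rightarrow> 'a) \<Rightarrow> 'a" and l
  proof -
    let ?V = "{seq_pair x y | x y. x \<in> V \<and> y \<in> V'}"
    have ladd: "l (x + y) = l x + l y" if "x \<in> ?V" "y \<in> ?V" for x y
      by (rule bspec[OF bspec[OF conjunct1[OF l[unfolded functional_def]] that(1)] that(2)])
    have lsc: "l (seq_scale c x) = c * l x" if "x \<in> ?V" for c x
      using spec[OF conjunct2[OF l[unfolded functional_def]]] that by (rule bspec)
    have i1: "seq_pair x 0 \<in> ?V" if "x \<in> V" for x using that 0(2) by blast
    have i2: "seq_pair 0 y \<in> ?V" if "y \<in> V'" for y using that 0(1) by blast
    have e1: "seq_pair (x + y) 0 = seq_pair x 0 + seq_pair y 0" "seq_pair 0 (x + y) = seq_pair 0 x + seq_pair 0 y"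
      "seq_pair (seq_scale c x) 0 = seq_scale c (seq_pair x 0)" "seq_pair 0 (seq_scale c x) = seq_scale c (seq_pair 0 x)"
      for x y :: "nat \<Rightarrow> 'a" and c
      by (auto simp: seq_pair_def fun_eq_iff)
    have f: "functional V (\<lambda>x. l (seq_pair x 0))" "functional V' (\<lambda>y. l (seq_pair 0 y))"
      using ladd[OF i1 i1] lsc[OF i1] ladd[OF i2 i2] lsc[OF i2] by (simp_all only: functional_def e1) auto
    obtain p where p: "p \<in> W" "\<forall>x\<in>V. b x p = l (seq_pair x 0)" using ex(1)[OF f(1)] by (rule bexE)
    obtain q where q: "q \<in> W'" "\<forall>x\<in>V'. b' x q = l (seq_pair 0 x)" using ex(2)[OF f(2)] by (rule bexE)
    have "l (seq_pair (seq_left z) 0) + l (seq_pair 0 (seq_right z)) = l z" if "seq_left z \<in> V" "seq_right z \<in> V'" for z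
    proof -
      have "seq_pair (seq_left z) 0 + seq_pair 0 (seq_right z) = z" by (simp flip: seq_pair_linear(1))
      then show ?thesis using ladd[OF i1[OF that(1)] i2[OF that(2)]] by simp
    qed
    then show ?thesis using p q by (intro exI[of _ "seq_pair p q"]) simp
  qed
  have z: "0 \<in> V" "0 \<in> W" "0 \<in> V'" "0 \<in> W'" using s by (simp_all add: seq.subspace_0)
  have bL: "functional V (\<lambda>x. b x p)" if "p \<in> W" for p using p(1) that unfolding perfect_def by blast
  have bR: "functional W (b x)" if "x \<in> V" for x using p(1) that unfolding perfect_def by blast
  have bL': "functional V' (\<lambda>x. b' x p)" if "p \<in> W'" for p using p(2) that unfolding perfect_def by blast
  have bR': "functional W' (b' x)" if "x \<in> V'" for x using p(2) that unfolding perfect_def by blast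
  have b0: "b 0 p = 0" if "p \<in> W" for p by (rule functional_0[OF bL[OF that] s(1)])
  have b0': "b' 0 p = 0" if "p \<in> W'" for p by (rule functional_0[OF bL'[OF that] s(3)])
  have b0R: "b x 0 = 0" if "x \<in> V" for x by (rule functional_0[OF bR[OF that] s(2)])
  have b0R': "b' x 0 = 0" if "x \<in> V'" for x by (rule functional_0[OF bR'[OF that] s(4)])
  show ?thesis
    unfolding perfect_def
  proof (intro conjI ballI allI impI)
    show "functional ?V (\<lambda>z. ?b z w)" if "w \<in> ?W" for w
      using bL[of "seq_left w"] bL'[of "seq_right w"] that unfolding mW functional_def
      by (auto simp: algebra_simps)
    show "functional ?W (?b z)" if "z \<in> ?V" for z
      using bR[of "seq_left z"] bR'[of "seq_right z"] that unfolding mV functional_def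
      by (auto simp: algebra_simps)
    show "\<exists>w\<in>?W. \<forall>z\<in>?V. ?b z w = l z" if l: "functional ?V l" for l
    proof -
      have "\<exists>w. seq_left w \<in> W \<and> seq_right w \<in> W' \<and> (\<forall>z. seq_left z \<in> V \<longrightarrow> seq_right z \<in> V' \<longrightarrow> ?b z w = l z)"
        by (rule half[OF l _ _ z(1,3) mV]) (use p in \<open>unfold perfect_def, blast\<close>)+
      then show ?thesis unfolding Bex_def Ball_def mV mW by blast
    qed
    show "\<exists>z\<in>?V. \<forall>w\<in>?W. ?b z w = l w" if l: "functional ?W l" for l
    proof -
      have "\<exists>w. seq_left w \<in> V \<and> seq_right w \<in> V' \<and> (\<forall>z. seq_left z \<in> W \<longrightarrow> seq_right z \<in> W' \<longrightarrow> ?b w z = l z)"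
        by (rule half[OF l _ _ z(2,4) mW]) (use p in \<open>unfold perfect_def, blast\<close>)+
      then show ?thesis unfolding Bex_def Ball_def mV mW by blast
    qed
    show "w = w'" if w: "w \<in> ?W" "w' \<in> ?W" "\<forall>z\<in>?V. ?b z w = ?b z w'" for w w'
    proof -
      have "b x (seq_left w) = b x (seq_left w')" if "x \<in> V" for x
        using bspec[OF w(3), of "seq_pair x 0"] that z w(1,2) b0' unfolding mV mW by simp
      then have 1: "seq_left w = seq_left w'" using p(1) w(1,2) unfolding mW perfect_def by blast
      have "b' x (seq_right w) = b' x (seq_right w')" if "x \<in> V'" for x
        using bspec[OF w(3), of "seq_pair 0 x"] that z w(1,2) b0 unfolding mV mW by simp
      then have 2: "seq_right w = seq_right w'" using p(2) w(1,2) unfolding mW perfect_def by blast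
      show ?thesis using 1 2 by (metis seq_pair_left_right)
    qed
    show "w = w'" if w: "w \<in> ?V" "w' \<in> ?V" "\<forall>z\<in>?W. ?b w z = ?b w' z" for w w'
    proof -
      have "b (seq_left w) x = b (seq_left w') x" if "x \<in> W" for x
        using bspec[OF w(3), of "seq_pair x 0"] that z w(1,2) b0R' unfolding mV mW by simp
      then have 1: "seq_left w = seq_left w'" using p(1) w(1,2) unfolding mV perfect_def by blast
      have "b' (seq_right w) x = b' (seq_right w') x" if "x \<in> W'" for x
        using bspec[OF w(3), of "seq_pair 0 x"] that z w(1,2) b0R unfolding mV mW by simp
      then have 2: "seq_right w = seq_right w'" using p(2) w(1,2) unfolding mV perfect_def by blast
      show ?thesis using 1 2 by (metis seq_pair_left_right)
    qed
  qed
qed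

context dual_quivers
begin

lemma dual_sum:
  assumes M: "D M M' B" and N: "D N N' C"
  shows "D (rep_sum M N) (rep_sum M' N') (\<lambda>v z w. B v (seq_left z) (seq_left w) + C v (seq_right z) (seq_right w))"
  unfolding dual_pair_def
proof (intro conjI ballI)
  note r = dual_pair_rep[OF M] dual_pair_rep[OF N]
  show "A.rep (rep_sum M N)" "B.rep (rep_sum M' N')" using A.rep_rep_sum B.rep_rep_sum r by blast+
  fix v assume v: "v \<in> verts Q"
  then have v': "v \<in> verts Q'" by simp
  show "perfect (space (rep_sum M N) v) (space (rep_sum M' N') v)
     (\<lambda>z w. B v (seq_left z) (seq_left w) + C v (seq_right z) (seq_right w))"
    unfolding rep_sum_def rep.simps
    by (rule perfect_pair[OF dual_pair_perfect[OF M v] dual_pair_perfect[OF N v]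
          A.rep_subspace[OF r(1) v] B.rep_subspace[OF r(2) v'] A.rep_subspace[OF r(3) v] B.rep_subspace[OF r(4) v']])
next
  fix a z w assume a: "a \<in> arcs Q" and z: "z \<in> space (rep_sum M N) (tail Q a)"
    and w: "w \<in> space (rep_sum M' N') (head Q a)"
  have m: "seq_left z \<in> space M (tail Q a)" "seq_right z \<in> space N (tail Q a)"
    "seq_left w \<in> space M' (head Q a)" "seq_right w \<in> space N' (head Q a)"
    using z w unfolding A.mem_rep_sum by blast+
  show "B (head Q a) (seq_left (act (rep_sum M N) a z)) (seq_left w) +
      C (head Q a) (seq_right (act (rep_sum M N) a z)) (seq_right w) =
      B (tail Q a) (seq_left z) (seq_left (act (rep_sum M' N') a w)) +
      C (tail Q a) (seq_right z) (seq_right (act (rep_sum M' N') a w))"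
    unfolding A.act_rep_sum seq_left_pair seq_right_pair dual_pair_act[OF M a m(1,3)] dual_pair_act[OF N a m(2,4)]
    by (rule refl)
qed

lemma dual_zero_rep: "D zero_rep zero_rep (\<lambda>_ _ _. 0)"
  unfolding dual_pair_def
proof (intro conjI ballI)
  have "perfect {0 :: nat \<Rightarrow> 'k} {p. \<forall>i. p i \<noteq> 0 \<longrightarrow> i \<in> {}} (\<lambda>x p. \<Sum>i\<in>{}. x i * p i)"
    by (rule perfect_coordinates[where e = unit_seq]) (auto simp: seq.subspace_single_0)
  moreover have "{p :: nat \<Rightarrow> 'k. \<forall>i. p i \<noteq> 0 \<longrightarrow> i \<in> {}} = {0}" by (auto simp: fun_eq_iff)
  ultimately show "perfect (space zero_rep v) (space zero_rep v) (\<lambda>_ _. 0 :: 'k)" for v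
    unfolding zero_rep_def rep.simps by simp
qed (simp_all add: A.rep_zero_rep B.rep_zero_rep)

definition dual_to :: "('v, 'a, 'k) rep \<Rightarrow> ('v, 'a, 'k) rep \<Rightarrow> bool" where
  "dual_to M M' \<longleftrightarrow> (\<exists>B. D M M' B)"

lemma dual_sum_list: "list_all2 dual_to Ms Ms' \<Longrightarrow> dual_to (rep_sum_list Ms) (rep_sum_list Ms')"
proof (induction Ms Ms' rule: list_all2_induct)
  case Nil
  then show ?case using dual_zero_rep by (auto simp: dual_to_def)
next
  case (Cons M Ms M' Ms')
  then show ?case using dual_sum unfolding dual_to_def A.rep_sum_list_simps by blast
qed

text \<open>Not the inverse string: the order of the vertices is kept, and each letter changes
  direction because the arrows of \<open>Q'\<close> run backwards.\<close>

definition dual_string :: "'v \<times> 'a letter list \<Rightarrow> 'v \<times> 'a letter list" where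
  "dual_string w = (fst w, map linv (snd w))"

lemma letters_ok_dual:
  "larrow l \<in> arcs Q \<Longrightarrow> larrow l' \<in> arcs Q \<Longrightarrow> ltarget Q l = lsource Q l' \<Longrightarrow> letters_ok Q I l l' \<Longrightarrow>
     letters_ok Q' I' (linv l) (linv l')"
  using dual_zero by (cases l; cases l') (auto simp: A.zero_rel_def B.zero_rel_def)

lemma letter_dual: "lsource Q' l = ltarget Q l" "ltarget Q' l = lsource Q l"
  by (cases l; simp)+

lemma swalk_dual: "A.swalk u ls \<Longrightarrow> B.swalk u (map linv ls)"
proof (induction ls arbitrary: u)
  case (Cons l ls)
  have "letters_ok Q' I' (linv l) (linv (hd ls))" if "ls \<noteq> []"
    using Cons.prems that by (cases ls) (auto intro!: letters_ok_dual)
  then show ?case using Cons by (cases ls) (auto simp: letter_dual A.lsource_in_verts)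
qed simp

lemma string_dual: "A.string w \<Longrightarrow> B.string (dual_string w)"
  using swalk_dual[of "fst w" "snd w"] A.string_iff[of "fst w" "snd w"] B.string_iff[of "fst w" "map linv (snd w)"]
  by (simp add: dual_string_def)

lemma string_verts_dual: "string_verts Q' (dual_string w) = string_verts Q w"
  by (simp add: string_verts_def dual_string_def letter_dual)

text \<open>In the unit bases the pairing is the dot product, and inverting every letter transposes
  the matrix of every arrow.\<close>

lemma dual_string_module:
  assumes w: "A.string w"
  shows "D (A.SM w) (B.SM (dual_string w)) (\<lambda>v x p. \<Sum>i\<in>{i. i \<le> length (snd w) \<and> string_verts Q w ! i = v}. x i * p i)"
    (is "D ?M ?M' ?b")
  unfolding dual_pair_def
proof (intro conjI ballI)
  let ?n = "length (snd w)"
  let ?S = "\<lambda>v. {i. i \<le> ?n \<and> string_verts Q w ! i = v}"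
  show "A.rep ?M" "B.rep ?M'" using A.rep_SM[OF w] B.rep_SM[OF string_dual[OF w]] .
  have len: "length (snd (dual_string w)) = ?n" by (simp add: dual_string_def)
  have spM: "space ?M v = {x. \<forall>i. x i \<noteq> 0 \<longrightarrow> i \<in> ?S v}" for v by (simp add: string_module_def)
  have spM': "space ?M' v = {x. \<forall>i. x i \<noteq> 0 \<longrightarrow> i \<in> ?S v}" for v
    by (simp add: string_module_def string_verts_dual len)
  have finS: "finite (?S v)" for v by simp
  show "perfect (space ?M v) (space ?M' v) (?b v)" for v
    unfolding spM spM'
  proof (rule perfect_coordinates[where e = unit_seq and c = "\<lambda>x. x"])
    show "seq.subspace {x :: nat \<Rightarrow> 'k. \<forall>i. x i \<noteq> 0 \<longrightarrow> i \<in> ?S v}"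
      using fin_dim_subspaceD[OF fin_dim_subspace_support[OF finS]] .
    show "x = (\<Sum>i\<in>?S v. seq_scale (x i) (unit_seq i))" if "x \<in> {x :: nat \<Rightarrow> 'k. \<forall>i. x i \<noteq> 0 \<longrightarrow> i \<in> ?S v}" for x
      using that by (intro seq_expand[OF finS]) blast
  qed auto
  fix a x p assume a: "a \<in> arcs Q" and x: "x \<in> space ?M (tail Q a)" and p: "p \<in> space ?M' (head Q a)"
  have "?b (head Q a) (act ?M a x) p = (\<Sum>j\<le>?n. act ?M a x j * p j)"
    using p unfolding spM' by (intro sum.mono_neutral_left) auto
  also have "\<dots> = (\<Sum>j\<le>?n. if 0 < j \<and> snd w ! (j - 1) = Fwd a then x (j - 1) * p j else 0) +
      (\<Sum>j\<le>?n. if j < ?n \<and> snd w ! j = Inv a then x (Suc j) * p j else 0)"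
    unfolding sum.distrib[symmetric] by (rule sum.cong) (auto simp: A.act_SM algebra_simps)
  also have "(\<Sum>j\<le>?n. if 0 < j \<and> snd w ! (j - 1) = Fwd a then x (j - 1) * p j else 0) =
      (\<Sum>j<?n. if snd w ! j = Fwd a then x j * p (Suc j) else 0)"
    unfolding sum.atMost_shift diff_Suc_1 by simp
  also have "\<dots> = (\<Sum>j\<le>?n. if j < ?n \<and> snd w ! j = Fwd a then x j * p (Suc j) else 0)"
    unfolding lessThan_Suc_atMost[symmetric] sum.lessThan_Suc by simp
  also have "(\<Sum>j\<le>?n. if j < ?n \<and> snd w ! j = Inv a then x (Suc j) * p j else 0) =
      (\<Sum>j<?n. if snd w ! j = Inv a then x (Suc j) * p j else 0)"
    unfolding lessThan_Suc_atMost[symmetric] sum.lessThan_Suc by simp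
  also have "\<dots> = (\<Sum>j\<le>?n. if 0 < j \<and> snd w ! (j - 1) = Inv a then x j * p (j - 1) else 0)"
    unfolding sum.atMost_shift diff_Suc_1 by simp
  also have "(\<Sum>j\<le>?n. if j < ?n \<and> snd w ! j = Fwd a then x j * p (Suc j) else 0) +
      (\<Sum>j\<le>?n. if 0 < j \<and> snd w ! (j - 1) = Inv a then x j * p (j - 1) else 0) =
      (\<Sum>j\<le>?n. x j * act ?M' a p j)"
    unfolding sum.distrib[symmetric]
  proof (rule sum.cong)
    fix j assume "j \<in> {..?n}"
    then have j: "j \<le> ?n" by simp
    have 1: "0 < j \<and> j \<le> length (snd (dual_string w)) \<and> snd (dual_string w) ! (j - 1) = Fwd a \<longleftrightarrow>
        0 < j \<and> snd w ! (j - 1) = Inv a"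
      using j by (cases j) (auto simp: dual_string_def linv_eq_iff)
    have 2: "j < length (snd (dual_string w)) \<and> snd (dual_string w) ! j = Inv a \<longleftrightarrow> j < ?n \<and> snd w ! j = Fwd a"
      by (auto simp: dual_string_def linv_eq_iff)
    show "(if j < ?n \<and> snd w ! j = Fwd a then x j * p (Suc j) else 0) +
        (if 0 < j \<and> snd w ! (j - 1) = Inv a then x j * p (j - 1) else 0) = x j * act ?M' a p j"
      unfolding B.act_SM 1 2 by (auto simp: algebra_simps)
  qed simp
  also have "\<dots> = ?b (tail Q a) x (act ?M' a p)"
    using x unfolding spM by (intro sum.mono_neutral_right) auto
  finally show "?b (head Q a) (act ?M a x) p = ?b (tail Q a) x (act ?M' a p)" .
qed

subsection \<open>Transfer of exact sequences\<close>

text \<open>If \<open>k x = k y\<close>, the functionals of \<open>x\<close> and \<open>y\<close>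
  agree on the image of \<open>h\<close>, which is everything.\<close>

lemma adjoint_of_surj:
  assumes X: "D X X' BX" and Y: "D Y Y' BY" and h: "surj_hom Q' X' Y' h" and k: "A.rhom Y X k"
    and adj: "\<And>v y p. v \<in> verts Q \<Longrightarrow> y \<in> space Y v \<Longrightarrow> p \<in> space X' v \<Longrightarrow> BX v (k v y) p = BY v y (h v p)"
  shows "inj_hom Q Y X k"
  unfolding inj_hom_def
proof (intro conjI ballI k inj_onI)
  fix v x y assume v: "v \<in> verts Q" and x: "x \<in> space Y v" and y: "y \<in> space Y v" and e: "k v x = k v y"
  show "x = y"
  proof (rule pair_eqL[OF Y v x y])
    fix q assume "q \<in> space Y' v"
    then obtain p where p: "p \<in> space X' v" "q = h v p" using h v unfolding surj_hom_def dual_simps by blast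
    show "BY v x q = BY v y q" unfolding p(2) adj[OF v x p(1), symmetric] adj[OF v y p(1), symmetric] e by (rule refl)
  qed
qed

lemma adjoint_of_inj:
  assumes X: "D X X' BX" and Y: "D Y Y' BY" and h: "inj_hom Q' X' Y' h" and k: "A.rhom Y X k"
    and adj: "\<And>v y p. v \<in> verts Q \<Longrightarrow> y \<in> space Y v \<Longrightarrow> p \<in> space X' v \<Longrightarrow> BX v (k v y) p = BY v y (h v p)"
  shows "surj_hom Q Y X k"
  unfolding surj_hom_def
proof (intro conjI ballI k)
  fix v assume v: "v \<in> verts Q"
  then have v': "v \<in> verts Q'" by simp
  have hh: "B.rhom X' Y' h" and inj: "inj_on (h v) (space X' v)" using h v' by (auto simp: inj_hom_def)
  note sX' = B.rep_subspace[OF dual_pair_rep(2)[OF X] v']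
  show "k v ` space Y v = space X v"
  proof
    show "k v ` space Y v \<subseteq> space X v" using A.hom_mem[OF k v] by blast
    show "space X v \<subseteq> k v ` space Y v"
    proof
      fix x assume x: "x \<in> space X v"
      obtain F where F: "Vector_Spaces.linear seq_scale seq_scale F" "\<And>x. x \<in> space X' v \<Longrightarrow> F x = h v x"
        using linear_map_extend[OF sX' B.hom_linear[OF hh v']] by metis
      have "inj_on F (space X' v)" using inj F(2) by (simp cong: inj_on_cong)
      \<comment> \<open>A linear left inverse of \<open>h\<close> extends the functional of
        \<open>x\<close> from the image of \<open>h\<close> to all of \<open>Y'\<close>; the vector
        representing it is a preimage of \<open>x\<close>.\<close>
      then obtain g where g: "g ` UNIV \<subseteq> space X' v" "Vector_Spaces.linear seq_scale seq_scale g" "\<forall>p\<in>space X' v. g (F p) = p"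
        using seq_pair.linear_exists_left_inverse_on[OF F(1) sX'] by blast
      interpret g: Vector_Spaces.linear seq_scale seq_scale g by fact
      have gm: "g p \<in> space X' v" for p using g(1) by blast
      have "functional (space Y' v) (\<lambda>p. BX v x (g p))"
        unfolding functional_def g.add g.scale using pair_addR[OF X v x gm gm] pair_scaleR[OF X v x gm] by blast
      then obtain y where y: "y \<in> space Y v" "\<forall>p\<in>space Y' v. BY v y p = BX v x (g p)" using pair_exL[OF Y v] by blast
      have "k v y = x"
      proof (rule pair_eqL[OF X v A.hom_mem[OF k v y(1)] x])
        fix p assume p: "p \<in> space X' v"
        have "BX v (k v y) p = BX v x (g (h v p))" using adj[OF v y(1) p] y(2) B.hom_mem[OF hh v' p] by simp
        moreover have "g (h v p) = p" using g(3) F(2)[OF p] p by metis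
        ultimately show "BX v (k v y) p = BX v x p" by (simp only:)
      qed
      then show "x \<in> k v ` space Y v" using y(1) by blast
    qed
  qed
qed

text \<open>Transposition reverses the sequence. For exactness in the middle, an \<open>e\<close>
  killed by \<open>f'\<close> is a functional that vanishes on the image of \<open>f\<close>, hence
  on the kernel of \<open>g\<close>; it factors through \<open>g\<close> and is represented in
  \<open>M\<close>.\<close>

lemma dual_short_exact:
  assumes M: "D M M' BM" and N: "D N N' BN" and E: "D E E' BE" and se: "short_exact Q' N' E' M' f g"
  obtains f' g' where "short_exact Q M E N g' f'"
    "\<And>v e p. v \<in> verts Q \<Longrightarrow> e \<in> space E v \<Longrightarrow> p \<in> space N' v \<Longrightarrow> BN v (f' v e) p = BE v e (f v p)"
proof -
  have f: "inj_hom Q' N' E' f" and g: "surj_hom Q' E' M' g"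
    and ex: "\<And>v. v \<in> verts Q \<Longrightarrow> f v ` space N' v = {x \<in> space E' v. g v x = 0}"
    using se by (auto simp: short_exact_def)
  have fh: "B.rhom N' E' f" and gh: "B.rhom E' M' g" using f g by (simp_all add: inj_hom_def surj_hom_def)
  have "\<exists>f'. A.rhom E N f' \<and> (\<forall>v\<in>verts Q'. \<forall>p\<in>space N' v. \<forall>e\<in>space E v. BE v e (f v p) = BN v (f' v e) p)"
    using dual_quivers.adjoint_exists[OF swap dual_pair_sym[OF N] dual_pair_sym[OF E] fh] .
  then obtain f' where f': "A.rhom E N f'"
    and fa: "\<And>v e p. v \<in> verts Q \<Longrightarrow> e \<in> space E v \<Longrightarrow> p \<in> space N' v \<Longrightarrow> BN v (f' v e) p = BE v e (f v p)"
    unfolding dual_simps by metis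
  have "\<exists>g'. A.rhom M E g' \<and> (\<forall>v\<in>verts Q'. \<forall>p\<in>space E' v. \<forall>m\<in>space M v. BM v m (g v p) = BE v (g' v m) p)"
    using dual_quivers.adjoint_exists[OF swap dual_pair_sym[OF E] dual_pair_sym[OF M] gh] .
  then obtain g' where g': "A.rhom M E g'"
    and ga: "\<And>v m p. v \<in> verts Q \<Longrightarrow> m \<in> space M v \<Longrightarrow> p \<in> space E' v \<Longrightarrow> BE v (g' v m) p = BM v m (g v p)"
    unfolding dual_simps by metis
  have "g' v ` space M v = {e \<in> space E v. f' v e = 0}" if v: "v \<in> verts Q" for v
  proof
    have v': "v \<in> verts Q'" using v by simp
    note rN = dual_pair_rep(1)[OF N] and rE = dual_pair_rep(1)[OF E]
      and rE' = dual_pair_rep(2)[OF E] and rM' = dual_pair_rep(2)[OF M]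
    show "g' v ` space M v \<subseteq> {e \<in> space E v. f' v e = 0}"
    proof
      fix e assume "e \<in> g' v ` space M v"
      then obtain m where m: "m \<in> space M v" "e = g' v m" by blast
      have em: "e \<in> space E v" unfolding m(2) by (rule A.hom_mem[OF g' v m(1)])
      have "f' v e = 0"
      proof (rule pair_eqL[OF N v A.hom_mem[OF f' v em] A.rep_0[OF rN v]])
        fix p assume p: "p \<in> space N' v"
        have fp: "f v p \<in> space E' v" "g v (f v p) = 0" using ex[OF v] p by auto
        have "BN v (f' v e) p = BM v m (g v (f v p))" using fa[OF v em p] ga[OF v m(1) fp(1)] m(2) by simp
        also have "\<dots> = BN v 0 p" unfolding fp(2) by (rule trans[OF pair_0(2)[OF M v m(1)] pair_0(1)[OF N v p, symmetric]])
        finally show "BN v (f' v e) p = BN v 0 p" .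
      qed
      then show "e \<in> {e \<in> space E v. f' v e = 0}" using em by blast
    qed
    show "{e \<in> space E v. f' v e = 0} \<subseteq> g' v ` space M v"
    proof
      fix e assume "e \<in> {e \<in> space E v. f' v e = 0}"
      then have e: "e \<in> space E v" "f' v e = 0" by auto
      have ef: "BE v e (f v p) = 0" if "p \<in> space N' v" for p
        using fa[OF v e(1) that] pair_0(1)[OF N v that] unfolding e(2) by simp
      have same: "BE v e p = BE v e q" if pq: "p \<in> space E' v" "q \<in> space E' v" "g v p = g v q" for p q
      proof -
        have "g v (p - q) = 0" using B.hom_diff[OF gh rE' v' pq(1,2)] pq(3) by simp
        then have "p - q \<in> f v ` space N' v" using ex[OF v] B.rep_diff[OF rE' v' pq(1,2)] by simp
        then obtain r where "r \<in> space N' v" "p - q = f v r" by blast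
        then have "BE v e (p - q) = 0" using ef by simp
        then show ?thesis using functional_diff[OF pair_linR[OF E v e(1)] B.rep_subspace[OF rE' v'] pq(1,2)] by simp
      qed
      have "\<forall>q\<in>space M' v. \<exists>p. p \<in> space E' v \<and> g v p = q" using g v unfolding surj_hom_def dual_simps by (metis imageE)
      \<comment> \<open>An arbitrary choice of preimages under \<open>g\<close>; by
        \<open>same\<close> the value of \<open>e\<close> does not depend on it, and this yields
        linearity.\<close>
      then obtain s where s: "\<And>q. q \<in> space M' v \<Longrightarrow> s q \<in> space E' v \<and> g v (s q) = q" by metis
      have "functional (space M' v) (\<lambda>q. BE v e (s q))"
        unfolding functional_def
      proof (intro conjI ballI allI)
        fix p q assume pq: "p \<in> space M' v" "q \<in> space M' v"
        have sum: "p + q \<in> space M' v" by (rule B.rep_add[OF rM' v' pq])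
        have "BE v e (s (p + q)) = BE v e (s p + s q)"
        proof (rule same)
          show "s (p + q) \<in> space E' v" "s p + s q \<in> space E' v" using s[OF sum] s[OF pq(1)] s[OF pq(2)] B.rep_add[OF rE' v'] by blast+
          show "g v (s (p + q)) = g v (s p + s q)"
            using s[OF sum] s[OF pq(1)] s[OF pq(2)] B.hom_add[OF gh v', of "s p" "s q"] by simp
        qed
        then show "BE v e (s (p + q)) = BE v e (s p) + BE v e (s q)"
          using pair_addR[OF E v e(1)] s[OF pq(1)] s[OF pq(2)] by simp
      next
        fix c q assume q: "q \<in> space M' v"
        have sc: "seq_scale c q \<in> space M' v" by (rule B.rep_scale[OF rM' v' q])
        have "BE v e (s (seq_scale c q)) = BE v e (seq_scale c (s q))"
        proof (rule same)
          show "s (seq_scale c q) \<in> space E' v" "seq_scale c (s q) \<in> space E' v" using s[OF sc] s[OF q] B.rep_scale[OF rE' v'] by blast+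
          show "g v (s (seq_scale c q)) = g v (seq_scale c (s q))"
            using s[OF sc] s[OF q] B.hom_scale[OF gh v', of "s q"] by simp
        qed
        then show "BE v e (s (seq_scale c q)) = c * BE v e (s q)"
          using pair_scaleR[OF E v e(1)] s[OF q] by simp
      qed
      then obtain m where m: "m \<in> space M v" "\<forall>q\<in>space M' v. BM v m q = BE v e (s q)" using pair_exL[OF M v] by blast
      have "g' v m = e"
      proof (rule pair_eqL[OF E v A.hom_mem[OF g' v m(1)] e(1)])
        fix p assume p: "p \<in> space E' v"
        have gp: "g v p \<in> space M' v" by (rule B.hom_mem[OF gh v' p])
        have "BE v (g' v m) p = BE v e (s (g v p))" using ga[OF v m(1) p] m(2) gp by simp
        also have "\<dots> = BE v e p" using s[OF gp] p by (intro same) auto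
        finally show "BE v (g' v m) p = BE v e p" .
      qed
      then show "e \<in> g' v ` space M v" using m(1) by blast
    qed
  qed
  then have "short_exact Q M E N g' f'"
    unfolding short_exact_def using adjoint_of_surj[OF E M g g' ga] adjoint_of_inj[OF N E f f' fa] by blast
  then show ?thesis using that fa by blast
qed

end

context monomial_quiver
begin

text \<open>Duality turns sections into retractions, while almost rigidity speaks of sections. The
  map \<open>1 - f r\<close> kills the image of \<open>f\<close>, so its value at \<open>x\<close>
  depends only on \<open>g x\<close>, and it descends to a section of \<open>g\<close>.\<close>

lemma split_epi_if_retraction:
  assumes se: "short_exact Q N E M f g" and E: "rep E" and M: "rep M" and r: "rhom E N r"
    and rf: "\<And>v x. v \<in> verts Q \<Longrightarrow> x \<in> space N v \<Longrightarrow> r v (f v x) = x"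
  shows "split_epi Q E M g"
proof -
  have fh: "rhom N E f" and gh: "rhom E M g" and gs: "\<And>v. v \<in> verts Q \<Longrightarrow> g v ` space E v = space M v"
    and ex: "\<And>v. v \<in> verts Q \<Longrightarrow> f v ` space N v = {x \<in> space E v. g v x = 0}"
    using se by (auto simp: short_exact_def inj_hom_def surj_hom_def)
  define t where "t = (\<lambda>v x. x - f v (r v x))"
  have t: "rhom E E t" unfolding t_def by (rule hom_minus[OF E hom_id hom_comp[OF r fh]])
  have tf: "t v x = 0" if v: "v \<in> verts Q" "x \<in> space E v" "g v x = 0" for v x
  proof -
    obtain n where "n \<in> space N v" "x = f v n" using ex[OF v(1)] v(2,3) by blast
    then show ?thesis using rf[OF v(1)] by (simp add: t_def)
  qed
  have gt: "g v (t v x) = g v x" if v: "v \<in> verts Q" "x \<in> space E v" for v x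
  proof -
    have m: "f v (r v x) \<in> space E v" "g v (f v (r v x)) = 0" using ex[OF v(1)] hom_mem[OF r v] by auto
    show ?thesis unfolding t_def using hom_diff[OF gh E v(1,2) m(1)] m(2) by simp
  qed
  have same: "t v x = t v y" if v: "v \<in> verts Q" "x \<in> space E v" "y \<in> space E v" "g v x = g v y" for v x y
  proof -
    have "t v (x - y) = 0" using tf[OF v(1) rep_diff[OF E v(1-3)]] hom_diff[OF gh E v(1-3)] v(4) by simp
    then show ?thesis using hom_diff[OF t E v(1-3)] by (metis right_minus_eq)
  qed
  have "\<exists>x. x \<in> space E v \<and> g v x = m" if "v \<in> verts Q" "m \<in> space M v" for v m using gs[OF that(1)] that(2) by (metis imageE)
  then obtain c where c: "\<And>v m. v \<in> verts Q \<Longrightarrow> m \<in> space M v \<Longrightarrow> c v m \<in> space E v \<and> g v (c v m) = m" by metis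
  have "rhom M E (\<lambda>v m. t v (c v m))"
  proof (rule homI)
    show "t v (c v m) \<in> space E v" if "v \<in> verts Q" "m \<in> space M v" for v m using hom_mem[OF t that(1)] c[OF that] by blast
  next
    fix v x y assume v: "v \<in> verts Q" "x \<in> space M v" "y \<in> space M v"
    have s: "x + y \<in> space M v" by (rule rep_add[OF M v])
    have "t v (c v (x + y)) = t v (c v x + c v y)"
    proof (rule same[OF v(1)])
      show "c v (x + y) \<in> space E v" "c v x + c v y \<in> space E v" using c[OF v(1)] v s rep_add[OF E v(1)] by blast+
      show "g v (c v (x + y)) = g v (c v x + c v y)"
        using c[OF v(1) s] c[OF v(1,2)] c[OF v(1,3)] hom_add[OF gh v(1), of "c v x" "c v y"] by simp
    qed
    then show "t v (c v (x + y)) = t v (c v x) + t v (c v y)"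
      using hom_add[OF t v(1), of "c v x" "c v y"] c[OF v(1,2)] c[OF v(1,3)] by simp
  next
    fix v a x assume v: "v \<in> verts Q" "x \<in> space M v"
    have s: "seq_scale a x \<in> space M v" by (rule rep_scale[OF M v])
    have "t v (c v (seq_scale a x)) = t v (seq_scale a (c v x))"
    proof (rule same[OF v(1)])
      show "c v (seq_scale a x) \<in> space E v" "seq_scale a (c v x) \<in> space E v" using c[OF v(1)] v s rep_scale[OF E v(1)] by blast+
      show "g v (c v (seq_scale a x)) = g v (seq_scale a (c v x))"
        using c[OF v(1) s] c[OF v] hom_scale[OF gh v(1), of "c v x"] by simp
    qed
    then show "t v (c v (seq_scale a x)) = seq_scale a (t v (c v x))"
      using hom_scale[OF t v(1), of "c v x"] c[OF v] by simp
  next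
    fix a x assume a: "a \<in> arcs Q" "x \<in> space M (tail Q a)"
    have v: "tail Q a \<in> verts Q" "head Q a \<in> verts Q" using a by auto
    have ax: "act M a x \<in> space M (head Q a)" by (rule act_mem[OF M a])
    note cx = c[OF v(1) a(2)]
    have ac: "act E a (c (tail Q a) x) \<in> space E (head Q a)" using act_mem[OF E a(1)] cx by blast
    have "t (head Q a) (c (head Q a) (act M a x)) = t (head Q a) (act E a (c (tail Q a) x))"
    proof (rule same[OF v(2) _ ac])
      show "c (head Q a) (act M a x) \<in> space E (head Q a)" using c[OF v(2) ax] by blast
      show "g (head Q a) (c (head Q a) (act M a x)) = g (head Q a) (act E a (c (tail Q a) x))"
        using c[OF v(2) ax] hom_act[OF gh a(1), of "c (tail Q a) x"] cx by simp
    qed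
    then show "t (head Q a) (c (head Q a) (act M a x)) = act E a (t (tail Q a) (c (tail Q a) x))"
      using hom_act[OF t a(1), of "c (tail Q a) x"] cx by simp
  qed
  moreover have "g v (t v (c v m)) = m" if "v \<in> verts Q" "m \<in> space M v" for v m
    using gt[OF that(1)] c[OF that] by simp
  ultimately show ?thesis unfolding split_epi_def by blast
qed

end

context dual_quivers
begin

section \<open>Transfer of almost rigid, projective and injective representations\<close>

lemmas dual_exists' = dual_quivers.dual_exists[OF swap]
lemmas dual_retract' = dual_quivers.dual_retract[OF swap]
lemmas dual_iso' = dual_quivers.dual_iso[OF swap]
lemmas dual_indec' = dual_quivers.dual_indec[OF swap]
lemmas dual_pair_sym' = dual_quivers.dual_pair_sym[OF swap]

lemma dual_ex_left:
  assumes "B.rep M'" obtains M B where "D M M' B" "D' M' M (\<lambda>v p x. B v x p)"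
proof -
  obtain M C where C: "D' M' M C" using dual_exists'[OF assms] by blast
  have "D M M' (\<lambda>v p x. C v x p)" by (rule dual_pair_sym'[OF C])
  then show ?thesis using that dual_pair_sym by blast
qed

text \<open>Dual decompositions give basicness and the sum of string modules. The reversed sequence
  exchanges the roles of the two summands, and (M2) ranges over both orders.\<close>

lemma dual_almost_rigid:
  assumes T: "D T T' BT" and ar: "almost_rigid Q I T" shows "almost_rigid Q' I' T'"
  unfolding almost_rigid_def
proof (intro conjI allI impI; (elim conjE)?)
  have basic: "basic_rep Q I T" using ar by (simp add: almost_rigid_def)
  note rT = dual_pair_rep(1)[OF T] and rT' = dual_pair_rep(2)[OF T]
  show "basic_rep Q' I' T'"
  proof -
    obtain Ms where Ms: "\<forall>M\<in>set Ms. A.indec M" "A.nonisos Ms" "A.riso T (rep_sum_list Ms)"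
      using basic unfolding A.basic_rep_iff by blast
    have "\<exists>Ms'. list_all2 dual_to Ms Ms'"
      using Ms(1)
    proof (induction Ms)
      case (Cons M Ms)
      then obtain Ms' where "list_all2 dual_to Ms Ms'" by auto
      moreover obtain M' where "dual_to M M'" using dual_exists A.indec_rep Cons.prems unfolding dual_to_def by (meson list.set_intros(1))
      ultimately have "list_all2 dual_to (M # Ms) (M' # Ms')" by simp
      then show ?case by blast
    next
      case Nil
      show ?case by (intro exI[of _ "[]"]) simp
    qed
    then obtain Ms' where Ms': "list_all2 dual_to Ms Ms'" by blast
    have len: "length Ms' = length Ms" using list_all2_lengthD[OF Ms'] by simp
    have nth: "dual_to (Ms ! i) (Ms' ! i)" if "i < length Ms" for i using list_all2_nthD[OF Ms' that] .
    have ind: "\<forall>M\<in>set Ms'. B.indec M"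
    proof
      fix M' assume "M' \<in> set Ms'"
      then obtain i where i: "i < length Ms" "M' = Ms' ! i" using len by (metis in_set_conv_nth)
      then show "B.indec M'" using nth[OF i(1)] dual_indec Ms(1) unfolding dual_to_def by (metis nth_mem)
    qed
    have "B.nonisos Ms'"
      unfolding sorted_wrt_iff_nth_less
    proof (intro allI impI notI)
      fix i j assume ij: "i < j" "j < length Ms'" and iso: "B.riso (Ms' ! i) (Ms' ! j)"
      obtain C1 C2 where C: "D (Ms ! i) (Ms' ! i) C1" "D (Ms ! j) (Ms' ! j) C2"
        using nth[of i] nth[of j] ij len unfolding dual_to_def by auto
      have "A.riso (Ms ! i) (Ms ! j)" by (rule dual_iso'[OF dual_pair_sym[OF C(1)] dual_pair_sym[OF C(2)] iso])
      then show False using Ms(2) ij len by (simp add: sorted_wrt_iff_nth_less)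
    qed
    moreover obtain C where "D (rep_sum_list Ms) (rep_sum_list Ms') C" using dual_sum_list[OF Ms'] unfolding dual_to_def by blast
    then have "B.riso T' (rep_sum_list Ms')" using dual_iso[OF T _ Ms(3)] by blast
    ultimately show ?thesis unfolding B.basic_rep_iff using rT' ind by blast
  qed
  show "\<exists>ws. (\<forall>w\<in>set ws. B.string w) \<and> B.riso T' (rep_sum_list (map B.SM ws))"
  proof -
    obtain ws where ws: "\<forall>w\<in>set ws. A.string w" "A.riso T (rep_sum_list (map A.SM ws))"
      using ar unfolding almost_rigid_def by blast
    have "list_all2 dual_to (map A.SM ws) (map B.SM (map dual_string ws))"
      using ws(1) dual_string_module unfolding dual_to_def by (induction ws) auto
    then obtain C where "D (rep_sum_list (map A.SM ws)) (rep_sum_list (map B.SM (map dual_string ws))) C"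
      using dual_sum_list unfolding dual_to_def by blast
    then have "B.riso T' (rep_sum_list (map B.SM (map dual_string ws)))" using dual_iso[OF T _ ws(2)] by blast
    moreover have "\<forall>w\<in>set (map dual_string ws). B.string w" using ws(1) string_dual by auto
    ultimately show ?thesis by blast
  qed
  fix M' N' E' f g
  assume iM: "B.indec M'" and sM: "is_summand Q' I' M' T'" and iN: "B.indec N'" and sN: "is_summand Q' I' N' T'"
    and rE: "B.rep E'" and se: "short_exact Q' N' E' M' f g"
  obtain M BM where M: "D M M' BM" "D' M' M (\<lambda>v p x. BM v x p)" using dual_ex_left[OF B.indec_rep[OF iM]] .
  obtain N BN where N: "D N N' BN" "D' N' N (\<lambda>v p x. BN v x p)" using dual_ex_left[OF B.indec_rep[OF iN]] .
  obtain E BE where E: "D E E' BE" "D' E' E (\<lambda>v p x. BE v x p)" using dual_ex_left[OF rE] .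
  have indM: "A.indec M" and indN: "A.indec N" using dual_indec'[OF M(2) iM] dual_indec'[OF N(2) iN] .
  have "B.retract M' T'" "B.retract N' T'" using sM sN B.summand_iff_retract[OF rT'] by blast+
  then have "A.retract M T" "A.retract N T"
    using dual_retract'[OF M(2) dual_pair_sym[OF T]] dual_retract'[OF N(2) dual_pair_sym[OF T]] by blast+
  then have summ: "is_summand Q I M T" "is_summand Q I N T"
    using A.summand_iff_retract[OF rT] A.indec_rep indM indN by blast+
  obtain f' g' where se': "short_exact Q M E N g' f'"
    and adj: "\<And>v e p. v \<in> verts Q \<Longrightarrow> e \<in> space E v \<Longrightarrow> p \<in> space N' v \<Longrightarrow> BN v (f' v e) p = BE v e (f v p)"
    using dual_short_exact[OF M(1) N(1) E(1) se] by metis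
  have "split_epi Q E N f' \<or> A.indec E"
    using ar indM indN summ dual_pair_rep(1)[OF E(1)] se' unfolding almost_rigid_def by blast
  then show "split_epi Q' E' M' g \<or> B.indec E'"
  proof
    assume "split_epi Q E N f'"
    then obtain s where s: "A.rhom N E s" "\<And>v x. v \<in> verts Q \<Longrightarrow> x \<in> space N v \<Longrightarrow> f' v (s v x) = x"
      unfolding split_epi_def by blast
    \<comment> \<open>The transpose of a section of \<open>f'\<close> is a retraction of the
      inclusion \<open>f\<close>.\<close>
    obtain r where r: "B.rhom E' N' r" "\<And>v x p. v \<in> verts Q \<Longrightarrow> x \<in> space N v \<Longrightarrow> p \<in> space E' v \<Longrightarrow> BE v (s v x) p = BN v x (r v p)"
      using adjointE[OF N(1) E(1) s(1)] by metis
    have fh: "B.rhom N' E' f" using se by (simp add: short_exact_def inj_hom_def)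
    have "r v (f v p) = p" if v: "v \<in> verts Q" "p \<in> space N' v" for v p
    proof (rule pair_eqR[OF N(1) v(1) _ v(2)])
      note fp = hom_memB[OF fh v]
      show "r v (f v p) \<in> space N' v" by (rule hom_memB[OF r(1) v(1) fp])
      fix x assume x: "x \<in> space N v"
      have "BN v x (r v (f v p)) = BE v (s v x) (f v p)" by (rule r(2)[OF v(1) x fp, symmetric])
      also have "\<dots> = BN v (f' v (s v x)) p" by (rule adj[OF v(1) A.hom_mem[OF s(1) v(1) x] v(2), symmetric])
      finally show "BN v x (r v (f v p)) = BN v x p" unfolding s(2)[OF v(1) x] .
    qed
    then have "split_epi Q' E' M' g"
      using B.split_epi_if_retraction[OF se rE B.indec_rep[OF iM] r(1)] by simp
    then show ?thesis ..
  next
    assume "A.indec E"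
    then have "B.indec E'" by (rule dual_indec[OF E(1)])
    then show ?thesis ..
  qed
qed

text \<open>The lifting problem over \<open>Q'\<close> transposes to an extension problem over
  \<open>Q\<close>, and the transpose of its solution solves the original one.\<close>

lemma dual_injective:
  assumes J: "D J J' BJ" and inj: "injective_rep Q I J" shows "projective_rep Q' I' J'"
  unfolding projective_rep_def
proof (intro conjI allI impI; (elim conjE)?)
  show "B.rep J'" by (rule dual_pair_rep(2)[OF J])
  fix X' Y' g h assume rX: "B.rep X'" and rY: "B.rep Y'" and g: "surj_hom Q' X' Y' g" and h: "B.rhom J' Y' h"
  obtain X BX where X: "D X X' BX" "D' X' X (\<lambda>v p x. BX v x p)" using dual_ex_left[OF rX] .
  obtain Y BY where Y: "D Y Y' BY" "D' Y' Y (\<lambda>v p x. BY v x p)" using dual_ex_left[OF rY] .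
  have gh: "B.rhom X' Y' g" using g by (simp add: surj_hom_def)
  have "\<exists>k. A.rhom Y X k \<and> (\<forall>v\<in>verts Q'. \<forall>p\<in>space X' v. \<forall>y\<in>space Y v. BY v y (g v p) = BX v (k v y) p)"
    using dual_quivers.adjoint_exists[OF swap X(2) Y(2) gh] .
  then obtain k where k: "A.rhom Y X k"
    and ka: "\<And>v y p. v \<in> verts Q \<Longrightarrow> y \<in> space Y v \<Longrightarrow> p \<in> space X' v \<Longrightarrow> BX v (k v y) p = BY v y (g v p)"
    unfolding dual_simps by metis
  have "\<exists>m. A.rhom Y J m \<and> (\<forall>v\<in>verts Q'. \<forall>p\<in>space J' v. \<forall>y\<in>space Y v. BY v y (h v p) = BJ v (m v y) p)"
    using dual_quivers.adjoint_exists[OF swap dual_pair_sym[OF J] Y(2) h] .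
  then obtain m where m: "A.rhom Y J m"
    and ma: "\<And>v y p. v \<in> verts Q \<Longrightarrow> y \<in> space Y v \<Longrightarrow> p \<in> space J' v \<Longrightarrow> BJ v (m v y) p = BY v y (h v p)"
    unfolding dual_simps by metis
  have "inj_hom Q Y X k" by (rule adjoint_of_surj[OF X(1) Y(1) g k ka])
  then obtain e where e: "A.rhom X J e" "\<And>v y. v \<in> verts Q \<Longrightarrow> y \<in> space Y v \<Longrightarrow> e v (k v y) = m v y"
    using inj m dual_pair_rep(1)[OF X(1)] dual_pair_rep(1)[OF Y(1)] unfolding injective_rep_def by metis
  obtain l where l: "B.rhom J' X' l" "\<And>v x p. v \<in> verts Q \<Longrightarrow> x \<in> space X v \<Longrightarrow> p \<in> space J' v \<Longrightarrow> BJ v (e v x) p = BX v x (l v p)"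
    using adjointE[OF X(1) J e(1)] by metis
  have "g v (l v p) = h v p" if v: "v \<in> verts Q" "p \<in> space J' v" for v p
  proof (rule pair_eqR[OF Y(1) v(1) _ hom_memB[OF h v]])
    note lp = hom_memB[OF l(1) v]
    show "g v (l v p) \<in> space Y' v" by (rule hom_memB[OF gh v(1) lp])
    fix y assume y: "y \<in> space Y v"
    have "BY v y (g v (l v p)) = BX v (k v y) (l v p)" by (rule ka[OF v(1) y lp, symmetric])
    also have "\<dots> = BJ v (e v (k v y)) p" by (rule l(2)[OF v(1) A.hom_mem[OF k v(1) y] v(2), symmetric])
    also have "\<dots> = BY v y (h v p)" unfolding e(2)[OF v(1) y] by (rule ma[OF v(1) y v(2)])
    finally show "BY v y (g v (l v p)) = BY v y (h v p)" .
  qed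
  then show "\<exists>l. B.rhom J' X' l \<and> (\<forall>v\<in>verts Q'. \<forall>x\<in>space J' v. g v (l v x) = h v x)"
    using l(1) unfolding dual_simps by blast
qed

lemma dual_projective:
  assumes P: "D P P' BP" and proj: "projective_rep Q I P" shows "injective_rep Q' I' P'"
  unfolding injective_rep_def
proof (intro conjI allI impI; (elim conjE)?)
  show "B.rep P'" by (rule dual_pair_rep(2)[OF P])
  fix X' Y' g h assume rX: "B.rep X'" and rY: "B.rep Y'" and g: "inj_hom Q' X' Y' g" and h: "B.rhom X' P' h"
  obtain X BX where X: "D X X' BX" "D' X' X (\<lambda>v p x. BX v x p)" using dual_ex_left[OF rX] .
  obtain Y BY where Y: "D Y Y' BY" "D' Y' Y (\<lambda>v p x. BY v x p)" using dual_ex_left[OF rY] .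
  have gh: "B.rhom X' Y' g" using g by (simp add: inj_hom_def)
  have "\<exists>k. A.rhom Y X k \<and> (\<forall>v\<in>verts Q'. \<forall>p\<in>space X' v. \<forall>y\<in>space Y v. BY v y (g v p) = BX v (k v y) p)"
    using dual_quivers.adjoint_exists[OF swap X(2) Y(2) gh] .
  then obtain k where k: "A.rhom Y X k"
    and ka: "\<And>v y p. v \<in> verts Q \<Longrightarrow> y \<in> space Y v \<Longrightarrow> p \<in> space X' v \<Longrightarrow> BX v (k v y) p = BY v y (g v p)"
    unfolding dual_simps by metis
  have "\<exists>m. A.rhom P X m \<and> (\<forall>v\<in>verts Q'. \<forall>p\<in>space X' v. \<forall>y\<in>space P v. BP v y (h v p) = BX v (m v y) p)"
    using dual_quivers.adjoint_exists[OF swap X(2) dual_pair_sym[OF P] h] .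
  then obtain m where m: "A.rhom P X m"
    and ma: "\<And>v y p. v \<in> verts Q \<Longrightarrow> y \<in> space P v \<Longrightarrow> p \<in> space X' v \<Longrightarrow> BX v (m v y) p = BP v y (h v p)"
    unfolding dual_simps by metis
  have "surj_hom Q Y X k" by (rule adjoint_of_inj[OF X(1) Y(1) g k ka])
  then obtain e where e: "A.rhom P Y e" "\<And>v y. v \<in> verts Q \<Longrightarrow> y \<in> space P v \<Longrightarrow> k v (e v y) = m v y"
    using proj m dual_pair_rep(1)[OF X(1)] dual_pair_rep(1)[OF Y(1)] unfolding projective_rep_def by metis
  obtain l where l: "B.rhom Y' P' l" "\<And>v x p. v \<in> verts Q \<Longrightarrow> x \<in> space P v \<Longrightarrow> p \<in> space Y' v \<Longrightarrow> BY v (e v x) p = BP v x (l v p)"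
    using adjointE[OF P Y(1) e(1)] by metis
  have "l v (g v p) = h v p" if v: "v \<in> verts Q" "p \<in> space X' v" for v p
  proof (rule pair_eqR[OF P v(1) _ hom_memB[OF h v]])
    note gp = hom_memB[OF gh v]
    show "l v (g v p) \<in> space P' v" by (rule hom_memB[OF l(1) v(1) gp])
    fix y assume y: "y \<in> space P v"
    have "BP v y (l v (g v p)) = BY v (e v y) (g v p)" by (rule l(2)[OF v(1) y gp, symmetric])
    also have "\<dots> = BX v (k v (e v y)) p" by (rule ka[OF v(1) A.hom_mem[OF e(1) v(1) y] v(2), symmetric])
    also have "\<dots> = BP v y (h v p)" unfolding e(2)[OF v(1) y] by (rule ma[OF v(1) y v(2)])
    finally show "BP v y (l v (g v p)) = BP v y (h v p)" .
  qed
  then show "\<exists>e. B.rhom Y' P' e \<and> (\<forall>v\<in>verts Q'. \<forall>x\<in>space X' v. e v (g v x) = h v x)"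
    using l(1) unfolding dual_simps by blast
qed

lemmas dual_almost_rigid' = dual_quivers.dual_almost_rigid[OF swap]
lemmas dual_injective' = dual_quivers.dual_injective[OF swap]
lemmas dual_projective' = dual_quivers.dual_projective[OF swap]

lemma dual_summand:
  assumes M: "D M M' B" and T: "D T T' C" and s: "is_summand Q I M T" shows "is_summand Q' I' M' T'"
  using dual_retract[OF M T] s A.summand_iff_retract[OF dual_pair_rep(1)[OF T]]
    B.summand_iff_retract[OF dual_pair_rep(2)[OF T]] dual_pair_rep(2)[OF M] by blast

lemma dual_mar:
  assumes T: "D T T' C" and mar: "maximal_almost_rigid Q I T" shows "maximal_almost_rigid Q' I' T'"
  unfolding maximal_almost_rigid_def
proof (intro conjI allI impI notI)
  show "almost_rigid Q' I' T'" using dual_almost_rigid[OF T] mar by (simp add: maximal_almost_rigid_def)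
  fix w assume w: "B.string w" and ar: "almost_rigid Q' I' (rep_sum T' (B.SM w))"
  let ?w = "dual_string w"
  have sw: "A.string ?w" by (rule dual_quivers.string_dual[OF swap w])
  obtain C' where "D (A.SM ?w) (B.SM w) C'"
    using dual_pair_sym'[OF dual_quivers.dual_string_module[OF swap w]] by blast
  then obtain C'' where C'': "D (rep_sum T (A.SM ?w)) (rep_sum T' (B.SM w)) C''" using dual_sum[OF T] by blast
  have "almost_rigid Q I (rep_sum T (A.SM ?w))" by (rule dual_almost_rigid'[OF dual_pair_sym[OF C''] ar])
  then show False using mar sw unfolding maximal_almost_rigid_def by blast
qed

lemma dual_contains_injectives:
  assumes T: "D T T' C" and c: "contains_indec_injectives Q I T" shows "contains_indec_projectives Q' I' T'"
  unfolding contains_indec_projectives_def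
proof (intro allI impI, elim conjE)
  fix P' assume P': "projective_rep Q' I' P'" "B.indec P'"
  obtain P B where P: "D P P' B" "D' P' P (\<lambda>v p x. B v x p)" using dual_ex_left[OF B.indec_rep[OF P'(2)]] .
  have "is_summand Q I P T"
    using c dual_projective'[OF P(2) P'(1)] dual_indec'[OF P(2) P'(2)] unfolding contains_indec_injectives_def by blast
  then show "is_summand Q' I' P' T'" by (rule dual_summand[OF P(1) T])
qed

lemma dual_contains_projectives:
  assumes T: "D T T' C" and c: "contains_indec_projectives Q I T" shows "contains_indec_injectives Q' I' T'"
  unfolding contains_indec_injectives_def
proof (intro allI impI, elim conjE)
  fix J' assume J': "injective_rep Q' I' J'" "B.indec J'"
  obtain J B where J: "D J J' B" "D' J' J (\<lambda>v p x. B v x p)" using dual_ex_left[OF B.indec_rep[OF J'(2)]] .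
  have "is_summand Q I J T"
    using c dual_injective'[OF J(2) J'(1)] dual_indec'[OF J(2) J'(2)] unfolding contains_indec_projectives_def by blast
  then show "is_summand Q' I' J' T'" by (rule dual_summand[OF J(1) T])
qed

text \<open>The module found over \<open>Q'\<close> is dualised. A competitor over \<open>Q\<close>
  is compared with it by dualising the competitor, applying uniqueness over \<open>Q'\<close>, and
  dualising the isomorphism back.\<close>

lemma injective_mar_if_dual:
  assumes "\<exists>T. maximal_almost_rigid Q' I' T \<and> contains_indec_projectives Q' I' T \<and>
     (\<forall>U. maximal_almost_rigid Q' I' U \<and> contains_indec_projectives Q' I' U \<longrightarrow> B.riso U T)"
  shows "\<exists>T. maximal_almost_rigid Q I T \<and> contains_indec_injectives Q I T \<and>
     (\<forall>U. maximal_almost_rigid Q I U \<and> contains_indec_injectives Q I U \<longrightarrow> A.riso U T)"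
proof -
  obtain T' where T': "maximal_almost_rigid Q' I' T'" "contains_indec_projectives Q' I' T'"
    and uniq: "\<And>U. maximal_almost_rigid Q' I' U \<Longrightarrow> contains_indec_projectives Q' I' U \<Longrightarrow> B.riso U T'"
    using assms by blast
  have "B.rep T'" using T'(1) by (simp add: maximal_almost_rigid_def almost_rigid_def basic_rep_def)
  then obtain T C where T: "D T T' C" "D' T' T (\<lambda>v p x. C v x p)" using dual_ex_left by blast
  have "A.riso U T" if U: "maximal_almost_rigid Q I U" "contains_indec_injectives Q I U" for U
  proof -
    have "A.rep U" using U(1) by (simp add: maximal_almost_rigid_def almost_rigid_def basic_rep_def)
    then obtain U' C' where U': "D U U' C'" using dual_exists by blast
    have "B.riso U' T'" by (rule uniq[OF dual_mar[OF U' U(1)] dual_contains_injectives[OF U' U(2)]])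
    then show ?thesis by (rule dual_iso'[OF dual_pair_sym[OF U'] T(2)])
  qed
  then show ?thesis
    using dual_quivers.dual_mar[OF swap T(2) T'(1)] dual_quivers.dual_contains_projectives[OF swap T(2) T'(2)] by blast
qed

end

lemma (in monomial_quiver) dual_quivers_op: "dual_quivers Q I (op_quiver Q) (op_relations Q I)"
proof -
  interpret op: monomial_quiver "op_quiver Q" "op_relations Q I" by (rule monomial_op)
  show ?thesis
    using op_relations_iff by unfold_locales (simp_all add: op.zero_rel_def)
qed

theorem theorem1p1:
  fixes Q :: "('v, 'a) pre_digraph"
    and I :: "(('v, 'a) qpath \<Rightarrow> 'k::alg_closed_field) set"
  assumes "gentle_algebra Q I"
  shows "(\<exists>T. maximal_almost_rigid Q I T \<and> contains_indec_projectives Q I T \<and>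
            (\<forall>T'. maximal_almost_rigid Q I T' \<and> contains_indec_projectives Q I T' \<longrightarrow> rep_iso Q T' T)) \<and>
         (\<exists>T. maximal_almost_rigid Q I T \<and> contains_indec_injectives Q I T \<and>
            (\<forall>T'. maximal_almost_rigid Q I T' \<and> contains_indec_injectives Q I T' \<longrightarrow> rep_iso Q T' T))"
proof
  interpret gentle_quiver Q I using gentle_algebra.gentle_quiver[OF assms] .
  show "\<exists>T. maximal_almost_rigid Q I T \<and> contains_indec_projectives Q I T \<and>
     (\<forall>T'. maximal_almost_rigid Q I T' \<and> contains_indec_projectives Q I T' \<longrightarrow> rep_iso Q T' T)"
    by (rule projective_mar)
  show "\<exists>T. maximal_almost_rigid Q I T \<and> contains_indec_injectives Q I T \<and>
     (\<forall>T'. maximal_almost_rigid Q I T' \<and> contains_indec_injectives Q I T' \<longrightarrow> rep_iso Q T' T)"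
    by (rule dual_quivers.injective_mar_if_dual[OF dual_quivers_op gentle_quiver.projective_mar[OF gentle_op]])
qed

end
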